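(* Let $\mathbb{F}$ be a field of characteristic $0$ and let $R=\mathbb{F}\begin{bmatrix} u & v & w\\ x & y & z\end{bmatrix}$, i.e., $R$ is the ring of polynomials in the six indeterminates $u,v,w,x,y,z$ over $\mathbb{F}$. Let $I$ be the ideal generated by the size two minors of $\begin{bmatrix} u & v & w\\ x & y & z\end{bmatrix}$, let $\mathfrak{m}=(u,v,w,x,y,z)$, and let $$\Delta_1 = vz-wy,\qquad \Delta_2 = wx-uz,\qquad \Delta_3 = uy-vx .$$ Then the identity $$\ln\left(\frac{wy}{vz}\,\frac{uz}{wx}\,\frac{vx}{uy}\right)=\ln(1)=0$$ gives the following identity in the fraction field of the $I$-adic completion of $R$: $$\sum_{m=1}^{\infty}\frac1m\left(\frac{\Delta_1}{vz}\right)^m+\sum_{m=1}^{\infty}\frac1m\left(\frac{\Delta_2}{wx}\right)^m+\sum_{m=1}^{\infty}\frac1m\left(\frac{\Delta_3}{uy}\right)^m=0 .$$ For $t\geq 2$, the $t$-th truncation of this Taylor series yields the generator for $H^3_{\mathfrak{m}}(R/I^t)_0$.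
   Context: $R$ has the standard grading, and $H^3_{\mathfrak{m}}(R/I^t)_0$ is the degree-$0$ component of the third local cohomology module of $R/I^t$ supported at $\mathfrak{m}$; "generator" means generator as an $\mathbb{F}$-vector space. It is computed from the Čech complex $\check{C}^\bullet(\mathbf{x},R/I^t)$ on $\mathbf{x}=u,v,w,x,y,z$, so that $\check{C}^3(\mathbf{x},R/I^t)$ is the direct sum of the localizations $(R/I^t)_{abc}$ over three-element subsets $\{a,b,c\}$ of the variables. Since each $\Delta_i$ lies in $I$, a series such as $\sum_{m\geq 1}\frac1m(\Delta_1/vz)^m$ becomes in a localization of $R/I^t$ the finite sum $\sum_{m=1}^{t-1}\frac1m(\Delta_1/vz)^m$; this is the $t$-th truncation. "Yields" is meant as follows: the identity is the heart of the element, but it has to be adjusted slightly to take the form of an element of $\check{C}^3(\mathbf{x},R/I^t)$. The element $\eta$ used is described, in terms of the $I$-adic completion, by the components $\ln\frac{uy}{vx}$ in $uxy$; $\ln\frac{uy}{vx}$ in $vxy$; $\ln\frac{uz}{wx}+\ln\frac{wy}{vz}$ in $wxy$; $\ln\frac{uz}{wx}$ in $uxz$; $\ln\frac{vz}{wy}+\ln\frac{uy}{vx}$ in $vxz$; $\ln\frac{uz}{wx}$ in $wxz$; $\ln\frac{vx}{uy}+\ln\frac{uz}{wx}$ in $uyz$; $\ln\frac{vz}{wy}$ in $vyz$; $\ln\frac{vz}{wy}$ in $wyz$; and $0$ in every other component.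
   Formalization: A single series such as the sum of (1/m)(Δ₁/vz)^m does not converge to an element of the fraction field of the I-adic completion of R, so the identity is stated in the I-adic completion of that fraction field, where all three series are shown to converge. *)

theory Defs
  imports
    "HOL-Library.Poly_Mapping"
    "HOL-Library.FuncSet"
    "HOL-Algebra.Ideal_Product"
    "HOL-Algebra.QuotRing"
    "HOL-Algebra.Algebraic_Closure_Type"
begin

section \<open>The polynomial ring in six indeterminates\<close>

datatype indet = Ind_u | Ind_v | Ind_w | Ind_x | Ind_y | Ind_z

primrec indet_pos :: "indet \<Rightarrow> nat" where
  "indet_pos Ind_u = 0"
| "indet_pos Ind_v = 1"
| "indet_pos Ind_w = 2"
| "indet_pos Ind_x = 3"
| "indet_pos Ind_y = 4"
| "indet_pos Ind_z = 5"

text \<open>The order \<open>u < v < w < x < y < z\<close> fixes the signs in the Cech complex.\<close>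

instantiation indet :: linorder
begin

definition less_eq_indet :: "indet \<Rightarrow> indet \<Rightarrow> bool"
  where "a \<le> b \<longleftrightarrow> indet_pos a \<le> indet_pos b"

definition less_indet :: "indet \<Rightarrow> indet \<Rightarrow> bool"
  where "a < b \<longleftrightarrow> indet_pos a < indet_pos b"

instance
proof
  fix a b :: indet
  assume "a \<le> b" "b \<le> a"
  then show "a = b"
    by (cases a; cases b) (simp_all add: less_eq_indet_def)
qed (auto simp: less_eq_indet_def less_indet_def)

end

instance indet :: finite
proof
  have "(UNIV :: indet set) \<subseteq> {Ind_u, Ind_v, Ind_w, Ind_x, Ind_y, Ind_z}"
    using indet.exhaust by blast
  then show "finite (UNIV :: indet set)"
    by (rule finite_subset) simp
qed

text \<open>Finitely supported functions on exponent vectors, with the convolution product of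
  \<^theory>\<open>HOL-Library.Poly_Mapping\<close>.\<close>

type_synonym 'k poly6 = "(indet \<Rightarrow>\<^sub>0 nat) \<Rightarrow>\<^sub>0 'k"

definition pvar :: "indet \<Rightarrow> 'k::field_char_0 poly6"
  where "pvar i = Poly_Mapping.single (Poly_Mapping.single i 1) 1"

definition pconst :: "'k::field_char_0 \<Rightarrow> 'k poly6"
  where "pconst c = Poly_Mapping.single 0 c"

definition homogeneous :: "nat \<Rightarrow> 'k::field_char_0 poly6 \<Rightarrow> bool"
  where "homogeneous d p \<longleftrightarrow>
    (\<forall>m\<in>Poly_Mapping.keys p. (\<Sum>i\<in>UNIV. Poly_Mapping.lookup m i) = d)"

definition monomials :: "indet set \<Rightarrow> 'k::field_char_0 poly6 set"
  where "monomials A = {(\<Prod>a\<in>A. pvar a ^ e a) | e :: indet \<Rightarrow> nat. True}"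

definition poly6_ring :: "'k::field_char_0 poly6 ring"
  where "poly6_ring = ring_of_type_algebra"

text \<open>The \<open>n\<close>-th power of an ideal, as a power in the multiplicative monoid of ideals.\<close>

abbreviation ideal_power :: "('a, 'b) ring_scheme \<Rightarrow> 'a set \<Rightarrow> nat \<Rightarrow> 'a set"
  where "ideal_power R I n \<equiv> I [^]\<^bsub>ideals_set R\<^esub> n"


section \<open>Rings of fractions\<close>

definition frac_rel :: "('a, 'b) ring_scheme \<Rightarrow> 'a set \<Rightarrow> (('a \<times> 'a) \<times> ('a \<times> 'a)) set"
  where "frac_rel R S =
    {((r, s), (r', s')). r \<in> carrier R \<and> r' \<in> carrier R \<and> s \<in> S \<and> s' \<in> S \<and>
      (\<exists>q\<in>S. q \<otimes>\<^bsub>R\<^esub> (r \<otimes>\<^bsub>R\<^esub> s') = q \<otimes>\<^bsub>R\<^esub> (r' \<otimes>\<^bsub>R\<^esub> s))}"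

definition frac :: "('a, 'b) ring_scheme \<Rightarrow> 'a set \<Rightarrow> 'a \<Rightarrow> 'a \<Rightarrow> ('a \<times> 'a) set"
  where "frac R S r s = frac_rel R S `` {(r, s)}"

definition localization :: "('a, 'b) ring_scheme \<Rightarrow> 'a set \<Rightarrow> ('a \<times> 'a) set ring"
  where "localization R S =
    \<lparr> carrier = (carrier R \<times> S) // frac_rel R S,
      monoid.mult = (\<lambda>C D. \<Union>(r, s)\<in>C. \<Union>(r', s')\<in>D. frac R S (r \<otimes>\<^bsub>R\<^esub> r') (s \<otimes>\<^bsub>R\<^esub> s')),
      one = frac R S \<one>\<^bsub>R\<^esub> \<one>\<^bsub>R\<^esub>,
      ring.zero = frac R S \<zero>\<^bsub>R\<^esub> \<one>\<^bsub>R\<^esub>,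
      add = (\<lambda>C D. \<Union>(r, s)\<in>C. \<Union>(r', s')\<in>D.
              frac R S ((r \<otimes>\<^bsub>R\<^esub> s') \<oplus>\<^bsub>R\<^esub> (r' \<otimes>\<^bsub>R\<^esub> s)) (s \<otimes>\<^bsub>R\<^esub> s')) \<rparr>"

definition nonzeros :: "('a, 'b) ring_scheme \<Rightarrow> 'a set"
  where "nonzeros D = carrier D - {\<zero>\<^bsub>D\<^esub>}"

definition fraction_field :: "('a, 'b) ring_scheme \<Rightarrow> ('a \<times> 'a) set ring"
  where "fraction_field D = localization D (nonzeros D)"


section \<open>Truncated logarithms\<close>

text \<open>\<open>taylor_trunc A t a\<close> is the \<open>t\<close>-th truncation \<open>a + a\<^sup>2/2 + \<dots> + a\<^sup>t\<^sup>-\<^sup>1/(t-1)\<close> of the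
  Taylor series of \<open>-ln (1 - a)\<close>, and \<open>ln_trunc A t\<close> that of \<open>ln\<close> at \<open>1\<close>. The scalar \<open>1/m\<close> is the
  inverse in \<open>A\<close> of \<open>m \<cdot> 1\<close>.\<close>

definition taylor_trunc :: "('a, 'b) ring_scheme \<Rightarrow> nat \<Rightarrow> 'a \<Rightarrow> 'a"
  where "taylor_trunc A t a =
    (\<Oplus>\<^bsub>A\<^esub>m\<in>{1..<t}. inv\<^bsub>A\<^esub> ([m] \<cdot>\<^bsub>A\<^esub> \<one>\<^bsub>A\<^esub>) \<otimes>\<^bsub>A\<^esub> (a [^]\<^bsub>A\<^esub> m))"

definition ln_trunc :: "('a, 'b) ring_scheme \<Rightarrow> nat \<Rightarrow> 'a \<Rightarrow> 'a"
  where "ln_trunc A t b = \<ominus>\<^bsub>A\<^esub> (taylor_trunc A t (\<one>\<^bsub>A\<^esub> \<ominus>\<^bsub>A\<^esub> b))"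


section \<open>The adic completion and infinite sums in its fraction field\<close>

text \<open>The inverse limit of the rings \<open>R/I\<^sup>n\<close>. The transition map \<open>R/I\<^sup>n\<^sup>+\<^sup>1 \<rightarrow> R/I\<^sup>n\<close> sends a coset to
  the unique coset of \<open>I\<^sup>n\<close> that contains it.\<close>

definition adic_completion :: "('a, 'b) ring_scheme \<Rightarrow> 'a set \<Rightarrow> (nat \<Rightarrow> 'a set) ring"
  where "adic_completion R I =
    \<lparr> carrier = {f. \<forall>n. f n \<in> carrier (R Quot ideal_power R I n) \<and> f (Suc n) \<subseteq> f n},
      monoid.mult = (\<lambda>f g n. f n \<otimes>\<^bsub>R Quot ideal_power R I n\<^esub> g n),
      one = (\<lambda>n. \<one>\<^bsub>R Quot ideal_power R I n\<^esub>),
      ring.zero = (\<lambda>n. \<zero>\<^bsub>R Quot ideal_power R I n\<^esub>),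
      add = (\<lambda>f g n. f n \<oplus>\<^bsub>R Quot ideal_power R I n\<^esub> g n) \<rparr>"

definition to_completion :: "('a, 'b) ring_scheme \<Rightarrow> 'a set \<Rightarrow> 'a \<Rightarrow> nat \<Rightarrow> 'a set"
  where "to_completion R I p = (\<lambda>n. ideal_power R I n +>\<^bsub>R\<^esub> p)"

definition completion_frac ::
    "('a, 'b) ring_scheme \<Rightarrow> 'a set \<Rightarrow> 'a \<Rightarrow> 'a \<Rightarrow> ((nat \<Rightarrow> 'a set) \<times> (nat \<Rightarrow> 'a set)) set"
  where "completion_frac R I p q =
    frac (adic_completion R I) (nonzeros (adic_completion R I))
      (to_completion R I p) (to_completion R I q)"

text \<open>The \<open>k\<close>-th basic neighbourhood of zero for the \<open>I\<close>-adic topology on the fraction field of the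
  completion: the fractions \<open>a/b\<close> for which the \<open>I\<close>-adic order of \<open>a\<close> exceeds that of \<open>b\<close> by at
  least \<open>k\<close>. Here \<open>a\<close> has order at least \<open>n\<close> if its image in \<open>R/I\<^sup>n\<close> is zero.\<close>

definition adic_nhd ::
    "('a, 'b) ring_scheme \<Rightarrow> 'a set \<Rightarrow> nat \<Rightarrow> ((nat \<Rightarrow> 'a set) \<times> (nat \<Rightarrow> 'a set)) set set"
  where "adic_nhd R I k =
    {frac (adic_completion R I) (nonzeros (adic_completion R I)) a b | a b n.
       a \<in> carrier (adic_completion R I) \<and> b \<in> carrier (adic_completion R I) \<and>
       a (n + k) = \<zero>\<^bsub>R Quot ideal_power R I (n + k)\<^esub> \<and>
       b (Suc n) \<noteq> \<zero>\<^bsub>R Quot ideal_power R I (Suc n)\<^esub>}"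

text \<open>The single series \<open>\<Sum> a\<^sup>m/m\<close> below are sums in the sense of this topology; their values lie in
  the completion of the fraction field, i.e. in the ring of Cauchy sequences modulo null
  sequences.\<close>

definition null_seq :: "(nat \<Rightarrow> 'a set) \<Rightarrow> (nat \<Rightarrow> 'a) \<Rightarrow> bool"
  where "null_seq U f \<longleftrightarrow> (\<forall>k. \<exists>N. \<forall>n\<ge>N. f n \<in> U k)"

definition cauchy_seq :: "('a, 'b) ring_scheme \<Rightarrow> (nat \<Rightarrow> 'a set) \<Rightarrow> (nat \<Rightarrow> 'a) \<Rightarrow> bool"
  where "cauchy_seq K U f \<longleftrightarrow>
    (\<forall>n. f n \<in> carrier K) \<and> (\<forall>k. \<exists>N. \<forall>m\<ge>N. \<forall>n\<ge>N. f m \<ominus>\<^bsub>K\<^esub> f n \<in> U k)"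

text \<open>The limit of \<open>f\<close>; it is the empty set, hence no element of the completion, unless \<open>f\<close> is
  Cauchy.\<close>

definition seq_lim ::
    "('a, 'b) ring_scheme \<Rightarrow> (nat \<Rightarrow> 'a set) \<Rightarrow> (nat \<Rightarrow> 'a) \<Rightarrow> (nat \<Rightarrow> 'a) set"
  where "seq_lim K U f =
    {g. cauchy_seq K U f \<and> cauchy_seq K U g \<and> null_seq U (\<lambda>n. f n \<ominus>\<^bsub>K\<^esub> g n)}"

definition seq_completion ::
    "('a, 'b) ring_scheme \<Rightarrow> (nat \<Rightarrow> 'a set) \<Rightarrow> (nat \<Rightarrow> 'a) set ring"
  where "seq_completion K U =
    \<lparr> carrier = {seq_lim K U f | f. cauchy_seq K U f},
      monoid.mult = (\<lambda>C D. \<Union>f\<in>C. \<Union>g\<in>D. seq_lim K U (\<lambda>n. f n \<otimes>\<^bsub>K\<^esub> g n)),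
      one = seq_lim K U (\<lambda>n. \<one>\<^bsub>K\<^esub>),
      ring.zero = seq_lim K U (\<lambda>n. \<zero>\<^bsub>K\<^esub>),
      add = (\<lambda>C D. \<Union>f\<in>C. \<Union>g\<in>D. seq_lim K U (\<lambda>n. f n \<oplus>\<^bsub>K\<^esub> g n)) \<rparr>"

definition taylor_series ::
    "('a, 'b) ring_scheme \<Rightarrow> (nat \<Rightarrow> 'a set) \<Rightarrow> 'a \<Rightarrow> (nat \<Rightarrow> 'a) set"
  where "taylor_series K U a = seq_lim K U (\<lambda>t. taylor_trunc K t a)"

definition adic_ln ::
    "('a, 'b) ring_scheme \<Rightarrow> (nat \<Rightarrow> 'a set) \<Rightarrow> 'a \<Rightarrow> (nat \<Rightarrow> 'a) set"
  where "adic_ln K U b = seq_lim K U (\<lambda>t. ln_trunc K t b)"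


section \<open>The Cech complex and local cohomology\<close>

text \<open>Throughout, \<open>J\<close> is a homogeneous ideal of \<open>poly6_ring\<close>. For a set \<open>A\<close> of indeterminates,
  \<open>cech_loc J A\<close> is the localization of \<open>R/J\<close> at the monomials in \<open>A\<close>, i.e. \<open>(R/J)\<^sub>a\<^sub>b\<^sub>c\<close> if
  \<open>A = {a, b, c}\<close>.\<close>

type_synonym 'k cech_elem = "('k poly6 set \<times> 'k poly6 set) set"

definition residue :: "'k::field_char_0 poly6 set \<Rightarrow> 'k poly6 \<Rightarrow> 'k poly6 set"
  where "residue J p = J +>\<^bsub>poly6_ring\<^esub> p"

definition cech_loc :: "'k::field_char_0 poly6 set \<Rightarrow> indet set \<Rightarrow> 'k cech_elem ring"
  where "cech_loc J A = localization (poly6_ring Quot J) (residue J ` monomials A)"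

definition cech_frac ::
    "'k::field_char_0 poly6 set \<Rightarrow> indet set \<Rightarrow> 'k poly6 \<Rightarrow> 'k poly6 \<Rightarrow> 'k cech_elem"
  where "cech_frac J A p s =
    frac (poly6_ring Quot J) (residue J ` monomials A) (residue J p) (residue J s)"

definition cech_loc_degree ::
    "'k::field_char_0 poly6 set \<Rightarrow> int \<Rightarrow> indet set \<Rightarrow> 'k cech_elem set"
  where "cech_loc_degree J e A =
    {cech_frac J A p s | p s d d'.
       s \<in> monomials A \<and> homogeneous d p \<and> homogeneous d' s \<and> int d = e + int d'}"

text \<open>The localization map \<open>(R/J)\<^sub>A \<rightarrow> (R/J)\<^sub>B\<close> for \<open>A \<subseteq> B\<close>.\<close>

definition cech_restrict ::
    "'k::field_char_0 poly6 set \<Rightarrow> indet set \<Rightarrow> 'k cech_elem \<Rightarrow> 'k cech_elem"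
  where "cech_restrict J B C =
    (\<Union>(r, s)\<in>C. frac (poly6_ring Quot J) (residue J ` monomials B) r s)"

type_synonym 'k cochain = "indet set \<Rightarrow> 'k cech_elem"

definition faces :: "nat \<Rightarrow> indet set set"
  where "faces k = {A. card A = k}"

definition cech :: "'k::field_char_0 poly6 set \<Rightarrow> nat \<Rightarrow> ('k, 'k cochain) module"
  where "cech J k =
    \<lparr> carrier = (\<Pi>\<^sub>E A\<in>faces k. carrier (cech_loc J A)),
      monoid.mult = (\<lambda>f g. \<lambda>A\<in>faces k. f A \<otimes>\<^bsub>cech_loc J A\<^esub> g A),
      one = (\<lambda>A\<in>faces k. \<one>\<^bsub>cech_loc J A\<^esub>),
      ring.zero = (\<lambda>A\<in>faces k. \<zero>\<^bsub>cech_loc J A\<^esub>),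
      add = (\<lambda>f g. \<lambda>A\<in>faces k. f A \<oplus>\<^bsub>cech_loc J A\<^esub> g A),
      module.smult = (\<lambda>c f. \<lambda>A\<in>faces k. cech_frac J A (pconst c) 1 \<otimes>\<^bsub>cech_loc J A\<^esub> f A) \<rparr>"

definition cech_diff ::
    "'k::field_char_0 poly6 set \<Rightarrow> nat \<Rightarrow> 'k cochain \<Rightarrow> 'k cochain"
  where "cech_diff J k f = (\<lambda>B\<in>faces (Suc k). \<Oplus>\<^bsub>cech_loc J B\<^esub>b\<in>B.
    (if even (card {a \<in> B. a < b}) then cech_restrict J B (f (B - {b}))
     else \<ominus>\<^bsub>cech_loc J B\<^esub> cech_restrict J B (f (B - {b}))))"

definition cech_cocycles :: "'k::field_char_0 poly6 set \<Rightarrow> nat \<Rightarrow> 'k cochain set"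
  where "cech_cocycles J k =
    {f \<in> carrier (cech J k). cech_diff J k f = \<zero>\<^bsub>cech J (Suc k)\<^esub>}"

fun cech_boundaries :: "'k::field_char_0 poly6 set \<Rightarrow> nat \<Rightarrow> 'k cochain set" where
  "cech_boundaries J 0 = {\<zero>\<^bsub>cech J 0\<^esub>}"
| "cech_boundaries J (Suc k) = cech_diff J k ` carrier (cech J k)"

definition cech_degree :: "'k::field_char_0 poly6 set \<Rightarrow> nat \<Rightarrow> int \<Rightarrow> 'k cochain set"
  where "cech_degree J k e = (\<Pi>\<^sub>E A\<in>faces k. cech_loc_degree J e A)"

definition cech_class ::
    "'k::field_char_0 poly6 set \<Rightarrow> nat \<Rightarrow> 'k cochain \<Rightarrow> 'k cochain set"
  where "cech_class J k f = cech_boundaries J k +>\<^bsub>cech J k\<^esub> f"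

text \<open>The component of degree \<open>e\<close> of the \<open>k\<close>-th local cohomology module of \<open>R/J\<close> supported at
  \<open>(u, v, w, x, y, z)\<close>, as a vector space over the coefficient field: the cohomology classes, in
  the quotient of all cocycles by all coboundaries, that are represented by a cocycle of degree
  \<open>e\<close>. The fields \<open>mult\<close> and \<open>one\<close> of the record play no role for a module.\<close>

definition local_cohomology ::
    "'k::field_char_0 poly6 set \<Rightarrow> nat \<Rightarrow> int \<Rightarrow> ('k, 'k cochain set) module"
  where "local_cohomology J k e =
    \<lparr> carrier = cech_class J k ` (cech_cocycles J k \<inter> cech_degree J k e),
      monoid.mult = undefined,
      one = undefined,
      ring.zero = cech_boundaries J k,
      add = set_add (cech J k),
      module.smult = (\<lambda>c C. \<Union>f\<in>C. cech_class J k (c \<odot>\<^bsub>cech J k\<^esub> f)) \<rparr>"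


section \<open>The cochains\<close>

text \<open>The fraction \<open>p/q\<close> of two polynomials in \<open>(R/J)\<^sub>A\<close>, where \<open>q\<close> need only be a unit there and
  need not be a monomial in \<open>A\<close>: for instance \<open>vx = uy - \<Delta>\<^sub>3\<close> is a unit in the localization of \<open>R/I\<^sup>t\<close>
  at \<open>u, x, y\<close>, as \<open>\<Delta>\<^sub>3\<close> is nilpotent.\<close>

definition cech_quot ::
    "'k::field_char_0 poly6 set \<Rightarrow> indet set \<Rightarrow> 'k poly6 \<Rightarrow> 'k poly6 \<Rightarrow> 'k cech_elem"
  where "cech_quot J A p q =
    cech_frac J A p 1 \<otimes>\<^bsub>cech_loc J A\<^esub> inv\<^bsub>cech_loc J A\<^esub> (cech_frac J A q 1)"

text \<open>The element \<open>\<eta>\<close>, with each logarithm replaced by its \<open>t\<close>-th truncation; it is used for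
  \<open>J = I\<^sup>t\<close>.\<close>

definition eta :: "'k::field_char_0 poly6 set \<Rightarrow> nat \<Rightarrow> 'k cochain"
  where "eta J t = (\<lambda>A\<in>faces 3.
    let u = pvar Ind_u; v = pvar Ind_v; w = pvar Ind_w;
        x = pvar Ind_x; y = pvar Ind_y; z = pvar Ind_z;
        L = (\<lambda>p q. ln_trunc (cech_loc J A) t (cech_quot J A p q))
    in if A = {Ind_u, Ind_x, Ind_y} then L (u * y) (v * x)
       else if A = {Ind_v, Ind_x, Ind_y} then L (u * y) (v * x)
       else if A = {Ind_w, Ind_x, Ind_y} then L (u * z) (w * x) \<oplus>\<^bsub>cech_loc J A\<^esub> L (w * y) (v * z)
       else if A = {Ind_u, Ind_x, Ind_z} then L (u * z) (w * x)
       else if A = {Ind_v, Ind_x, Ind_z} then L (v * z) (w * y) \<oplus>\<^bsub>cech_loc J A\<^esub> L (u * y) (v * x)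
       else if A = {Ind_w, Ind_x, Ind_z} then L (u * z) (w * x)
       else if A = {Ind_u, Ind_y, Ind_z} then L (v * x) (u * y) \<oplus>\<^bsub>cech_loc J A\<^esub> L (u * z) (w * x)
       else if A = {Ind_v, Ind_y, Ind_z} then L (v * z) (w * y)
       else if A = {Ind_w, Ind_y, Ind_z} then L (v * z) (w * y)
       else \<zero>\<^bsub>cech_loc J A\<^esub>)"

text \<open>The same element in terms of the truncations \<open>T1, T2, T3\<close> of the three series in
  \<open>\<Delta>\<^sub>1/vz, \<Delta>\<^sub>2/wx, \<Delta>\<^sub>3/uy\<close>, which are \<open>ln (vz/wy), ln (wx/uz), ln (uy/vx)\<close>.\<close>

definition taylor_cochain :: "'k::field_char_0 poly6 set \<Rightarrow> nat \<Rightarrow> 'k cochain"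
  where "taylor_cochain J t = (\<lambda>A\<in>faces 3.
    let u = pvar Ind_u; v = pvar Ind_v; w = pvar Ind_w;
        x = pvar Ind_x; y = pvar Ind_y; z = pvar Ind_z;
        T1 = taylor_trunc (cech_loc J A) t (cech_quot J A (v * z - w * y) (v * z));
        T2 = taylor_trunc (cech_loc J A) t (cech_quot J A (w * x - u * z) (w * x));
        T3 = taylor_trunc (cech_loc J A) t (cech_quot J A (u * y - v * x) (u * y))
    in if A = {Ind_u, Ind_x, Ind_y} then T3
       else if A = {Ind_v, Ind_x, Ind_y} then T3
       else if A = {Ind_w, Ind_x, Ind_y} then \<ominus>\<^bsub>cech_loc J A\<^esub> T2 \<oplus>\<^bsub>cech_loc J A\<^esub> \<ominus>\<^bsub>cech_loc J A\<^esub> T1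
       else if A = {Ind_u, Ind_x, Ind_z} then \<ominus>\<^bsub>cech_loc J A\<^esub> T2
       else if A = {Ind_v, Ind_x, Ind_z} then T1 \<oplus>\<^bsub>cech_loc J A\<^esub> T3
       else if A = {Ind_w, Ind_x, Ind_z} then \<ominus>\<^bsub>cech_loc J A\<^esub> T2
       else if A = {Ind_u, Ind_y, Ind_z} then \<ominus>\<^bsub>cech_loc J A\<^esub> T3 \<oplus>\<^bsub>cech_loc J A\<^esub> \<ominus>\<^bsub>cech_loc J A\<^esub> T2
       else if A = {Ind_v, Ind_y, Ind_z} then T1
       else if A = {Ind_w, Ind_y, Ind_z} then T1
       else \<zero>\<^bsub>cech_loc J A\<^esub>)"

end

theory Submission
  imports Defs "HOL-Computational_Algebra.Polynomial"
begin

text \<open>Everything is computed in a ring of Laurent polynomials in the six indeterminates and in three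
  variables \<open>T\<^sub>1, T\<^sub>2, T\<^sub>3\<close> that stand for the minors. The ideal \<open>I\<close> is of linear type: by a
  leading term argument, the kernel of \<open>T\<^sub>i \<mapsto> \<Delta>\<^sub>i\<close> is generated by the regular sequence
  \<open>uT\<^sub>1 + vT\<^sub>2 + wT\<^sub>3, xT\<^sub>1 + yT\<^sub>2 + zT\<^sub>3\<close>. The Koszul resolution of \<open>I\<^sup>t\<close> embeds the third local
  cohomology of \<open>R/I\<^sup>t\<close> into the kernel of this pair on top local cohomology in degree \<open>t - 2\<close>,
  whose part of internal degree \<open>0\<close> has dimension at most one by a weight argument for \<open>sl\<^sub>2\<close>.
  Truncated logarithms of unipotent elements are additive modulo \<open>I\<^sup>t\<close>, so \<open>\<eta>\<close> is a cocycle, and a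
  derivation that annihilates \<open>I\<^sup>2\<close> on the part of multidegree \<open>0\<close> shows that it is not a
  coboundary. For the identity in the completion, the substitution \<open>y \<mapsto> y + vx/u, z \<mapsto> z + wx/u\<close>
  turns \<open>I\<close> into \<open>(y, z)\<close> after inverting \<open>u\<close>; the associated graded ring is thus a domain, the adic
  neighbourhoods are additive groups, and the partial sums of the three series add up to elements of
  \<open>I\<^sup>t\<close>.\<close>

text \<open>The localizations, the forms over them and the cochains all lie in one Laurent ring, so
  restriction maps are inclusions and classes modulo I^t are compared on representatives. Modules of
  forms have Cech cohomology in degree 6 only; the two short exact pieces of the Koszul resolution
  and 0 -> I^t -> R -> R/I^t -> 0 each raise the degree by one, which leads from 3 to 6. This only
  bounds the dimension from above and does not show that \<open>eta\<close> attains the bound; hence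
  the separate derivation, which is blind to I^2 and calls for \<open>t \<ge> 2\<close>.
  Characteristic 0 enters through the scalars 1/m, the integration of formal derivatives and the
  weights of sl2. The completion poses another obstacle: neighbourhoods of zero in its fraction
  field compare the orders of numerator and denominator, and they are closed under addition because
  orders add up in products. The shear shows this only after inverting u, so the powers of I must be
  saturated with respect to u; that follows from the same leading terms as the Koszul
  resolution.\<close>

hide_const (open) Polynomial.degree

section \<open>Laurent polynomials\<close>

lemma poly_mapping_sum_single:
  "p = (\<Sum>e\<in>Poly_Mapping.keys p. Poly_Mapping.single e (Poly_Mapping.lookup p e))"
proof (rule poly_mapping_eqI)
  fix k
  show "Poly_Mapping.lookup p k =
    Poly_Mapping.lookup (\<Sum>e\<in>Poly_Mapping.keys p. Poly_Mapping.single e (Poly_Mapping.lookup p e)) k"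
    by (cases "k \<in> Poly_Mapping.keys p")
      (auto simp: lookup_sum lookup_single when_def in_keys_iff sum.delta)
qed

lemma poly_mapping_span_induct:
  fixes p :: "'a \<Rightarrow>\<^sub>0 'b::comm_monoid_add"
  assumes "P 0"
    and "\<And>e. e \<in> Poly_Mapping.keys p \<Longrightarrow> P (Poly_Mapping.single e (Poly_Mapping.lookup p e))"
    and "\<And>a b. P a \<Longrightarrow> P b \<Longrightarrow> P (a + b)"
  shows "P p"
proof -
  have "P (\<Sum>e\<in>E. Poly_Mapping.single e (Poly_Mapping.lookup p e))"
    if "E \<subseteq> Poly_Mapping.keys p" for E
    using finite_subset[OF that finite_keys] that
    by (induction E) (auto intro: assms)
  from this[OF order_refl] show ?thesis
    by (simp only: flip: poly_mapping_sum_single)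
qed

definition filter_keys :: "'a set \<Rightarrow> ('a \<Rightarrow>\<^sub>0 'b::zero) \<Rightarrow> 'a \<Rightarrow>\<^sub>0 'b"
  where "filter_keys Q p = Poly_Mapping.mapp (\<lambda>e c. if e \<in> Q then c else 0) p"

lemma lookup_filter_keys:
  "Poly_Mapping.lookup (filter_keys Q p) e = (if e \<in> Q then Poly_Mapping.lookup p e else 0)"
  by (auto simp: filter_keys_def lookup_mapp when_def in_keys_iff)

lemma keys_empty_iff: "Poly_Mapping.keys p = {} \<longleftrightarrow> p = 0"
  by (metis keys_zero poly_mapping_eqI lookup_zero in_keys_iff empty_iff)

lemma keys_filter_keys: "Poly_Mapping.keys (filter_keys Q p) = Poly_Mapping.keys p \<inter> Q"
  by (auto simp: in_keys_iff lookup_filter_keys split: if_splits)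

lemma filter_keys_zero [simp]: "filter_keys Q 0 = 0"
  by (auto intro!: poly_mapping_eqI simp: lookup_filter_keys)

lemma filter_keys_add: "filter_keys Q (p + q) = filter_keys Q p + filter_keys Q (q :: 'a \<Rightarrow>\<^sub>0 'b::monoid_add)"
  by (auto intro!: poly_mapping_eqI simp: lookup_filter_keys lookup_add)

lemma filter_keys_uminus: "filter_keys Q (- p) = - filter_keys Q (p :: 'a \<Rightarrow>\<^sub>0 'b::ab_group_add)"
  by (auto intro!: poly_mapping_eqI simp: lookup_filter_keys)

lemma filter_keys_sum:
  "filter_keys Q (\<Sum>i\<in>S. f i) = (\<Sum>i\<in>S. filter_keys Q (f i :: 'a \<Rightarrow>\<^sub>0 'b::comm_monoid_add))"
  by (induction S rule: infinite_finite_induct) (auto simp: filter_keys_add)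

lemma filter_keys_id: "Poly_Mapping.keys p \<subseteq> Q \<Longrightarrow> filter_keys Q p = p"
  by (auto intro!: poly_mapping_eqI simp: lookup_filter_keys in_keys_iff)

lemma filter_keys_eq_0: "Poly_Mapping.keys p \<inter> Q = {} \<Longrightarrow> filter_keys Q p = 0"
  using keys_filter_keys[of Q p] by (metis keys_empty_iff)

lemma filter_keys_split: "p = filter_keys Q p + filter_keys (- Q) (p :: 'a \<Rightarrow>\<^sub>0 'b::monoid_add)"
  by (auto intro!: poly_mapping_eqI simp: lookup_filter_keys lookup_add)

definition key_space :: "'a set \<Rightarrow> ('a \<Rightarrow>\<^sub>0 'b::zero) set"
  where "key_space Q = {p. Poly_Mapping.keys p \<subseteq> Q}"

lemma key_space_zero [simp]: "0 \<in> key_space Q"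
  by (simp add: key_space_def)

lemma key_space_add: "p \<in> key_space Q \<Longrightarrow> q \<in> key_space Q \<Longrightarrow> p + q \<in> key_space Q"
  using keys_add[of p q] by (auto simp: key_space_def)

lemma key_space_uminus: "p \<in> key_space Q \<Longrightarrow> - (p :: 'a \<Rightarrow>\<^sub>0 'b::ab_group_add) \<in> key_space Q"
  by (auto simp: key_space_def in_keys_iff)

lemma key_space_diff:
  "p \<in> key_space Q \<Longrightarrow> q \<in> key_space Q \<Longrightarrow> p - (q :: 'a \<Rightarrow>\<^sub>0 'b::ab_group_add) \<in> key_space Q"
  using key_space_add[of p Q "- q"] key_space_uminus[of q Q] by simp

lemma key_space_sum:
  "(\<And>i. i \<in> S \<Longrightarrow> f i \<in> key_space Q) \<Longrightarrow> (\<Sum>i\<in>S. f i) \<in> key_space Q"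
  by (induction S rule: infinite_finite_induct) (auto intro: key_space_add)

lemma key_space_mult:
  assumes "p \<in> key_space Q" "q \<in> key_space Q'"
    and "\<And>a b. a \<in> Q \<Longrightarrow> b \<in> Q' \<Longrightarrow> a + b \<in> Q''"
  shows "p * q \<in> key_space Q''"
  using keys_mult[of p q] assms unfolding key_space_def by blast

lemma key_space_mono: "p \<in> key_space Q \<Longrightarrow> Q \<subseteq> Q' \<Longrightarrow> p \<in> key_space Q'"
  by (auto simp: key_space_def)

text \<open>The bounds \<open>a\<close> and \<open>b\<close> need not be attained: any other pair of
  exponents has a sum strictly below \<open>a + b\<close>, so a single product of coefficients
  reaches that place.\<close>

lemma lookup_mult_top:
  fixes p q :: "'a::linordered_ab_group_add \<Rightarrow>\<^sub>0 'b::comm_ring_1"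
  assumes "\<And>e. e \<in> Poly_Mapping.keys p \<Longrightarrow> e \<le> a" "\<And>e. e \<in> Poly_Mapping.keys q \<Longrightarrow> e \<le> b"
  shows "Poly_Mapping.lookup (p * q) (a + b) = Poly_Mapping.lookup p a * Poly_Mapping.lookup q b"
proof -
  define p' where "p' = filter_keys (- {a}) p"
  define q' where "q' = filter_keys (- {b}) q"
  have p: "p = Poly_Mapping.single a (Poly_Mapping.lookup p a) + p'"
    by (auto intro!: poly_mapping_eqI simp: lookup_add lookup_single when_def p'_def lookup_filter_keys)
  have q: "q = Poly_Mapping.single b (Poly_Mapping.lookup q b) + q'"
    by (auto intro!: poly_mapping_eqI simp: lookup_add lookup_single when_def q'_def lookup_filter_keys)
  have p'k: "e < a" if "e \<in> Poly_Mapping.keys p'" for e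
    using that assms(1) by (auto simp: p'_def keys_filter_keys order.strict_iff_order)
  have q'k: "e < b" if "e \<in> Poly_Mapping.keys q'" for e
    using that assms(2) by (auto simp: q'_def keys_filter_keys order.strict_iff_order)
  have 1: "Poly_Mapping.lookup (p' * q) (a + b) = 0"
  proof (rule ccontr)
    assume "Poly_Mapping.lookup (p' * q) (a + b) \<noteq> 0"
    then have "a + b \<in> Poly_Mapping.keys (p' * q)"
      by (simp add: in_keys_iff)
    then obtain c d where "c \<in> Poly_Mapping.keys p'" "d \<in> Poly_Mapping.keys q" "a + b = c + d"
      using keys_mult[of p' q] by blast
    then show False
      using add_less_le_mono[OF p'k assms(2)] by force
  qed
  have 2: "Poly_Mapping.lookup (Poly_Mapping.single a (Poly_Mapping.lookup p a) * q') (a + b) = 0"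
  proof (rule ccontr)
    assume "Poly_Mapping.lookup (Poly_Mapping.single a (Poly_Mapping.lookup p a) * q') (a + b) \<noteq> 0"
    then have "a + b \<in> Poly_Mapping.keys (Poly_Mapping.single a (Poly_Mapping.lookup p a) * q')"
      by (simp add: in_keys_iff)
    then obtain d where "d \<in> Poly_Mapping.keys q'" "a + b = a + d"
      using keys_mult[of "Poly_Mapping.single a (Poly_Mapping.lookup p a)" q']
      by (auto split: if_splits)
    then show False
      using q'k by force
  qed
  have "p * q = Poly_Mapping.single (a + b) (Poly_Mapping.lookup p a * Poly_Mapping.lookup q b)
      + Poly_Mapping.single a (Poly_Mapping.lookup p a) * q' + p' * q"
    (is "_ = ?s + ?t + _")
  proof -
    have "p * q = Poly_Mapping.single a (Poly_Mapping.lookup p a) * q + p' * q"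
      using arg_cong[OF p, of "\<lambda>r. r * q"] by (simp only: distrib_right)
    also have "Poly_Mapping.single a (Poly_Mapping.lookup p a) * q = ?s + ?t"
      using arg_cong[OF q, of "\<lambda>r. Poly_Mapping.single a (Poly_Mapping.lookup p a) * r"]
      by (simp only: distrib_left mult_single)
    finally show ?thesis .
  qed
  then show ?thesis
    using 1 2 by (simp add: lookup_add)
qed

lemma keys_mult_le:
  fixes p q :: "'a::linordered_ab_group_add \<Rightarrow>\<^sub>0 'b::comm_ring_1"
  assumes "\<And>e. e \<in> Poly_Mapping.keys p \<Longrightarrow> e \<le> a" "\<And>e. e \<in> Poly_Mapping.keys q \<Longrightarrow> e \<le> b"
    and "e \<in> Poly_Mapping.keys (p * q)"
  shows "e \<le> a + b"
  using keys_mult[of p q] assms by (fastforce intro: add_mono)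

definition graded_part :: "('a \<Rightarrow> int) \<Rightarrow> int \<Rightarrow> ('a \<Rightarrow>\<^sub>0 'b::zero) \<Rightarrow> 'a \<Rightarrow>\<^sub>0 'b"
  where "graded_part \<omega> d = filter_keys {e. \<omega> e = d}"

text \<open>Initial forms multiply: a term of \<open>p\<close> above degree \<open>a\<close> or of
  \<open>q\<close> above degree \<open>b\<close> lands above \<open>a + b\<close>. Over a domain
  this makes orders of vanishing additive.\<close>

lemma graded_part_mult_low:
  fixes p q :: "'a::monoid_add \<Rightarrow>\<^sub>0 'b::comm_ring_1"
  assumes add: "\<And>e e'. \<omega> (e + e') = \<omega> e + \<omega> e'"
    and p: "\<And>e. e \<in> Poly_Mapping.keys p \<Longrightarrow> a \<le> \<omega> e"
    and q: "\<And>e. e \<in> Poly_Mapping.keys q \<Longrightarrow> b \<le> \<omega> e"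
  shows "graded_part \<omega> (a + b) (p * q) = graded_part \<omega> a p * graded_part \<omega> b q"
proof -
  define p0 p1 where "p0 = graded_part \<omega> a p" and "p1 = filter_keys (- {e. \<omega> e = a}) p"
  define q0 q1 where "q0 = graded_part \<omega> b q" and "q1 = filter_keys (- {e. \<omega> e = b}) q"
  have ps: "p = p0 + p1" and qs: "q = q0 + q1"
    unfolding p0_def p1_def q0_def q1_def graded_part_def by (rule filter_keys_split)+
  have p0k: "\<omega> e = a" if "e \<in> Poly_Mapping.keys p0" for e
    using that by (auto simp: p0_def graded_part_def keys_filter_keys)
  have q0k: "\<omega> e = b" if "e \<in> Poly_Mapping.keys q0" for e
    using that by (auto simp: q0_def graded_part_def keys_filter_keys)
  have p1k: "a < \<omega> e" if "e \<in> Poly_Mapping.keys p1" for e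
    using that p[of e] by (auto simp: p1_def keys_filter_keys)
  have q1k: "b < \<omega> e" if "e \<in> Poly_Mapping.keys q1" for e
    using that q[of e] by (auto simp: q1_def keys_filter_keys)
  have 1: "filter_keys {e. \<omega> e = a + b} (p1 * q) = 0"
    using keys_mult[of p1 q] p1k q by (intro filter_keys_eq_0) (fastforce simp: add)
  have 2: "filter_keys {e. \<omega> e = a + b} (p0 * q1) = 0"
    using keys_mult[of p0 q1] p0k q1k by (intro filter_keys_eq_0) (fastforce simp: add)
  have 3: "filter_keys {e. \<omega> e = a + b} (p0 * q0) = p0 * q0"
    using keys_mult[of p0 q0] p0k q0k by (intro filter_keys_id) (fastforce simp: add)
  have "p * q = p0 * q + p1 * q"
    by (metis ps distrib_right)
  also have "p0 * q = p0 * q0 + p0 * q1"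
    by (metis qs distrib_left)
  finally have "p * q = p0 * q0 + p0 * q1 + p1 * q" .
  then show ?thesis
    by (simp add: graded_part_def filter_keys_add 1 2 3 flip: p0_def q0_def)
       (simp add: p0_def q0_def graded_part_def)
qed

text \<open>Lets homogeneous components be taken in an equation with homogeneous coefficients such
  as \<open>l1\<close> and \<open>l2\<close>.\<close>

lemma graded_part_mult_homogeneous:
  fixes p q :: "'a::monoid_add \<Rightarrow>\<^sub>0 'b::comm_ring_1"
  assumes add: "\<And>e e'. \<omega> (e + e') = \<omega> e + \<omega> e'"
    and p: "\<And>e. e \<in> Poly_Mapping.keys p \<Longrightarrow> \<omega> e = a"
  shows "graded_part \<omega> (a + b) (p * q) = p * graded_part \<omega> b q"
proof -
  define q0 q1 where "q0 = graded_part \<omega> b q" and "q1 = filter_keys (- {e. \<omega> e = b}) q"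
  have qs: "q = q0 + q1"
    unfolding q0_def q1_def graded_part_def by (rule filter_keys_split)
  have "filter_keys {e. \<omega> e = a + b} (p * q0) = p * q0"
    using keys_mult[of p q0] p
    by (intro filter_keys_id) (fastforce simp: add q0_def graded_part_def keys_filter_keys)
  moreover have "filter_keys {e. \<omega> e = a + b} (p * q1) = 0"
    using keys_mult[of p q1] p
    by (intro filter_keys_eq_0) (fastforce simp: add q1_def keys_filter_keys)
  ultimately show ?thesis
    by (metis qs distrib_left filter_keys_add add_0_right graded_part_def q0_def)
qed

section \<open>Generators, exponents and monomials of the Laurent ring\<close>

datatype gen = V indet | TA | TB | TC

text \<open>The order makes \<open>x\<close> the most significant and \<open>w\<close> the second most significant generator
  for the lexicographic order on exponents. The leading terms of \<open>\<Delta>\<^sub>1, \<Delta>\<^sub>2, \<Delta>\<^sub>3\<close> are then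
  \<open>-wy, wx, -vx\<close>, and those of \<open>uT\<^sub>1 + vT\<^sub>2 + wT\<^sub>3\<close> and \<open>xT\<^sub>1 + yT\<^sub>2 + zT\<^sub>3\<close> are the coprime
  monomials \<open>wT\<^sub>3\<close> and \<open>xT\<^sub>1\<close>.\<close>

fun gen_pos :: "gen \<Rightarrow> nat" where
  "gen_pos (V Ind_x) = 0"
| "gen_pos (V Ind_w) = 1"
| "gen_pos (V Ind_u) = 2"
| "gen_pos (V Ind_v) = 3"
| "gen_pos (V Ind_y) = 4"
| "gen_pos (V Ind_z) = 5"
| "gen_pos TA = 6"
| "gen_pos TB = 7"
| "gen_pos TC = 8"

lemma gen_pos_inj: "gen_pos a = gen_pos b \<Longrightarrow> a = b"
  by (cases a rule: gen_pos.cases; cases b rule: gen_pos.cases) simp_all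

instantiation gen :: linorder
begin

definition less_eq_gen :: "gen \<Rightarrow> gen \<Rightarrow> bool"
  where "a \<le> b \<longleftrightarrow> gen_pos a \<le> gen_pos b"

definition less_gen :: "gen \<Rightarrow> gen \<Rightarrow> bool"
  where "a < b \<longleftrightarrow> gen_pos a < gen_pos b"

instance
  by standard (auto simp: less_eq_gen_def less_gen_def intro: gen_pos_inj)

end

type_synonym exps = "gen \<Rightarrow>\<^sub>0 int"
type_synonym 'k laur = "(gen \<Rightarrow>\<^sub>0 int) \<Rightarrow>\<^sub>0 'k"

abbreviation lk :: "exps \<Rightarrow> gen \<Rightarrow> int"
  where "lk \<equiv> Poly_Mapping.lookup"

definition ex :: "gen \<Rightarrow> exps"
  where "ex g = Poly_Mapping.single g 1"

definition mn :: "exps \<Rightarrow> 'k::field_char_0 laur"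
  where "mn e = Poly_Mapping.single e 1"

definition sc :: "'k \<Rightarrow> 'k::field_char_0 laur"
  where "sc c = Poly_Mapping.single 0 c"

lemma lk_ex: "lk (ex g) h = (if g = h then 1 else 0)"
  by (simp add: ex_def lookup_single when_def)

lemmas lk_simps = lookup_add lookup_minus lookup_uminus lk_ex lookup_zero

lemma mn_add: "mn (a + b) = mn a * mn b"
  by (simp add: mn_def mult_single)

lemma mn_0 [simp]: "mn 0 = 1"
  by (simp add: mn_def)

lemma mn_uminus [simp]: "mn a * mn (- a) = 1" "mn (- a) * mn a = 1"
  by (simp_all flip: mn_add)

lemma mn_cancel [simp]: "mn a * (mn (- a) * p) = p" "mn (- a) * (mn a * p) = p"
  by (simp_all flip: mult.assoc)

lemma sc_add: "sc (a + b) = sc a + sc b"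
  by (simp add: sc_def single_add)

lemma sc_mult: "sc (a * b) = sc a * sc b"
  by (simp add: sc_def mult_single)

lemma sc_0 [simp]: "sc 0 = 0" and sc_1 [simp]: "sc 1 = 1"
  by (simp_all add: sc_def)

lemma single_eq_sc_mn: "Poly_Mapping.single e c = sc c * mn e"
  by (simp add: sc_def mn_def mult_single)

lemma lookup_sc_mult: "Poly_Mapping.lookup (sc c * p) e = c * Poly_Mapping.lookup p e"
proof -
  have "sc c * p = Poly_Mapping.map ((*) c) p"
    by (simp add: mult_map_scale_conv_mult sc_def)
  then show ?thesis
    by (simp add: Poly_Mapping.map.rep_eq when_def)
qed

lemma keys_mn [simp]: "Poly_Mapping.keys (mn e :: 'k::field_char_0 laur) = {e}"
  by (simp add: mn_def)

lemma lookup_mn_mult: "Poly_Mapping.lookup (mn a * p) e = Poly_Mapping.lookup p (e - a)"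
proof (induction rule: poly_mapping_span_induct[of _ p])
  case (2 e')
  then show ?case
    by (simp add: mn_def mult_single lookup_single when_def) (metis add_diff_cancel_left' diff_add_cancel add.commute)
qed (simp_all add: ring_distribs lookup_add)

text \<open>Linear extension of a map on exponents. The evaluation at the minors, the embedding of
  polynomials, the shear, the detecting functional and the evaluation at ones all have this
  form.\<close>

definition lin :: "('e \<Rightarrow> 'k laur) \<Rightarrow> ('e \<Rightarrow>\<^sub>0 'k) \<Rightarrow> 'k::field_char_0 laur"
  where "lin m p = (\<Sum>e\<in>Poly_Mapping.keys p. sc (Poly_Mapping.lookup p e) * m e)"

lemma lin_0 [simp]: "lin m 0 = 0"
  by (simp add: lin_def)

lemma lin_single [simp]: "lin m (Poly_Mapping.single e c) = sc c * m e"
  by (simp add: lin_def)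

lemma lin_mn [simp]: "lin m (mn e) = m e"
  by (simp add: mn_def)

lemma lin_add: "lin m (p + q) = lin m p + lin m q"
  unfolding lin_def
  by (rule setsum_keys_plus_distrib[where f = "\<lambda>e c. sc c * m e"]) (simp_all add: sc_add algebra_simps)

lemma lin_uminus: "lin m (- p) = - lin m p"
  using lin_add[of m p "- p"] by (simp add: eq_neg_iff_add_eq_0 add.commute)

lemma lin_diff: "lin m (p - q) = lin m p - lin m q"
  using lin_add[of m p "- q"] by (simp add: lin_uminus)

lemma lin_sum: "lin m (\<Sum>i\<in>S. f i) = (\<Sum>i\<in>S. lin m (f i))"
  by (induction S rule: infinite_finite_induct) (auto simp: lin_add)

text \<open>Multiplicativity is asked only on exponents that occur: the substitutions below read
  some exponents through \<open>nat\<close> and are multiplicative only where these are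
  nonnegative.\<close>

lemma lin_mult:
  assumes "\<And>a b. a \<in> Poly_Mapping.keys p \<Longrightarrow> b \<in> Poly_Mapping.keys q \<Longrightarrow> m (a + b) = m a * m b"
  shows "lin m (p * q) = lin m p * lin m q"
proof -
  have "lin m (p * q) = (\<Sum>a\<in>Poly_Mapping.keys p. \<Sum>b\<in>Poly_Mapping.keys q.
     lin m (Poly_Mapping.single a (Poly_Mapping.lookup p a) * Poly_Mapping.single b (Poly_Mapping.lookup q b)))"
    unfolding lin_sum[symmetric] sum_product[symmetric] poly_mapping_sum_single[symmetric] ..
  also have "\<dots> = (\<Sum>a\<in>Poly_Mapping.keys p. \<Sum>b\<in>Poly_Mapping.keys q.
     (sc (Poly_Mapping.lookup p a) * m a) * (sc (Poly_Mapping.lookup q b) * m b))"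
    by (intro sum.cong refl) (simp add: mult_single assms sc_mult algebra_simps)
  also have "\<dots> = lin m p * lin m q"
    by (simp add: lin_def sum_product)
  finally show ?thesis .
qed

lemma lin_cong: "(\<And>e. e \<in> Poly_Mapping.keys p \<Longrightarrow> m e = m' e) \<Longrightarrow> lin m p = lin m' p"
  by (simp add: lin_def)

lemma lin_id: "lin mn p = p"
  using poly_mapping_sum_single[of p, symmetric] by (simp only: lin_def single_eq_sc_mn)

section \<open>The Cech complex of the Laurent model\<close>

definition csgn :: "indet \<Rightarrow> indet set \<Rightarrow> 'a::comm_ring_1"
  where "csgn b B = (-1) ^ card {a \<in> B. a < b}"

text \<open>Restriction maps are inclusions in a common ring and hence invisible. The ring is left
  general so that integer-valued coefficient cochains have the same differential.\<close>

definition cd :: "(indet set \<Rightarrow> 'a::comm_ring_1) \<Rightarrow> indet set \<Rightarrow> 'a"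
  where "cd c B = (\<Sum>b\<in>B. csgn b B * c (B - {b}))"

lemma csgn_insert:
  assumes "i \<notin> A"
  shows "csgn b (insert i A) = (if i < b then - csgn b A else csgn b A)"
proof (cases "i < b")
  case True
  then have "{a \<in> insert i A. a < b} = insert i {a \<in> A. a < b}"
    by auto
  then show ?thesis
    using assms True by (simp add: csgn_def)
next
  case False
  then have "{a \<in> insert i A. a < b} = {a \<in> A. a < b}"
    by auto
  then show ?thesis
    using False by (simp add: csgn_def)
qed

lemma csgn_square [simp]: "csgn b B * csgn b B = 1" "csgn b B * (csgn b B * p) = p"
  by (simp_all add: csgn_def flip: mult.assoc power_mult_distrib)

lemma csgn_cases: "csgn b B = (1 :: 'a::comm_ring_1) \<or> csgn b B = (- 1 :: 'a)"
  unfolding csgn_def by (cases "even (card {a \<in> B. a < b})") simp_all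

lemma csgn_remove:
  assumes "b \<in> E"
  shows "csgn b' (E - {b}) = (if b < b' then - csgn b' E else csgn b' E :: 'a::comm_ring_1)"
  using csgn_insert[of b "E - {b}" b', where 'a = 'a] assms by (auto simp: insert_absorb split: if_splits)

lemma cd_add: "cd (\<lambda>A. c A + c' A) B = cd c B + cd c' B"
  by (simp add: cd_def ring_distribs sum.distrib)

lemma cd_diff: "cd (\<lambda>A. c A - c' A) B = cd c B - cd c' B"
  by (simp add: cd_def ring_distribs sum_subtractf)

lemma cd_mult: "cd (\<lambda>A. p * c A) B = p * cd c B"
  by (simp add: cd_def sum_distrib_left algebra_simps)

lemma cd_cong: "(\<And>b. b \<in> B \<Longrightarrow> c (B - {b}) = c' (B - {b})) \<Longrightarrow> cd c B = cd c' B"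
  by (simp add: cd_def)

text \<open>Deleting two indices in either order gives opposite signs, so the double sum is its own
  negative; in characteristic 0 it is therefore zero.\<close>

lemma cd_cd: "cd (cd c) E = (0 :: 'k::field_char_0 laur)"
proof -
  define t where "t b b' = (if b = b' then 0
    else csgn b E * (csgn b' (E - {b}) * c (E - {b} - {b'})) :: 'k laur)" for b b'
  have anti: "t b b' = - t b' b" if "b \<in> E" "b' \<in> E" for b b'
  proof (cases "b = b'")
    case False
    have "E - {b} - {b'} = E - {b'} - {b}"
      by auto
    with False that show ?thesis
      by (cases b b' rule: linorder_cases) (simp_all add: t_def csgn_remove mult.left_commute)
  qed (simp add: t_def)
  have "cd (cd c) E = (\<Sum>b\<in>E. \<Sum>b'\<in>E. t b b')"
    unfolding cd_def sum_distrib_left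
  proof (rule sum.cong[OF refl])
    fix b assume "b \<in> E"
    then have "(\<Sum>b'\<in>E. t b b') = t b b + (\<Sum>b'\<in>E - {b}. t b b')"
      by (intro sum.remove) simp_all
    also have "\<dots> = (\<Sum>n\<in>E - {b}. csgn b E * (csgn n (E - {b}) * c (E - {b} - {n})))"
      by (simp add: t_def) (intro sum.cong, auto)
    finally show "(\<Sum>n\<in>E - {b}. csgn b E * (csgn n (E - {b}) * c (E - {b} - {n}))) = (\<Sum>b'\<in>E. t b b')" ..
  qed
  moreover have "(\<Sum>b\<in>E. \<Sum>b'\<in>E. t b b') = - (\<Sum>b\<in>E. \<Sum>b'\<in>E. t b b')"
  proof -
    have "(\<Sum>b\<in>E. \<Sum>b'\<in>E. t b b') = (\<Sum>b\<in>E. \<Sum>b'\<in>E. - t b' b)"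
      by (intro sum.cong refl anti)
    also have "\<dots> = - (\<Sum>b\<in>E. \<Sum>b'\<in>E. t b' b)"
      by (simp only: sum_negf)
    also have "(\<Sum>b\<in>E. \<Sum>b'\<in>E. t b' b) = (\<Sum>b\<in>E. \<Sum>b'\<in>E. t b b')"
      by (rule sum.swap)
    finally show ?thesis .
  qed
  ultimately have "cd (cd c) E = - cd (cd c) E"
    by (simp only:)
  then have "cd (cd c) E + cd (cd c) E = 0"
    by (simp only: eq_neg_iff_add_eq_0)
  then have "2 * cd (cd c) E = 0"
    by (simp only: mult_2)
  then show ?thesis
    by (simp only: mult_eq_0_iff) simp
qed

section \<open>Forms in the T variables over the localizations, and exactness of their Cech
  complexes\<close>

definition tdeg :: "exps \<Rightarrow> int"
  where "tdeg e = lk e TA + lk e TB + lk e TC"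

definition EA :: "indet set \<Rightarrow> int \<Rightarrow> exps set"
  where "EA A n = {e. (\<forall>i. i \<notin> A \<longrightarrow> 0 \<le> lk e (V i)) \<and>
    0 \<le> lk e TA \<and> 0 \<le> lk e TB \<and> 0 \<le> lk e TC \<and> tdeg e = n}"

text \<open>The forms of degree \<open>n\<close> in the three variables \<open>T\<^sub>i\<close>, which stand for the minors \<open>\<Delta>\<^sub>i\<close>, over
  the localization of \<open>R\<close> at the indeterminates in \<open>A\<close>. That localization itself is \<open>FT A 0\<close>, and
  \<open>FT A n\<close> is zero for negative \<open>n\<close>.\<close>

definition FT :: "indet set \<Rightarrow> int \<Rightarrow> 'k::field_char_0 laur set"
  where "FT A n = key_space (EA A n)"

lemma EA_add: "e \<in> EA A n \<Longrightarrow> e' \<in> EA A m \<Longrightarrow> e + e' \<in> EA A (n + m)"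
  by (auto simp: EA_def lookup_add tdeg_def)

lemma EA_mono: "A \<subseteq> B \<Longrightarrow> EA A n \<subseteq> EA B n"
  by (auto simp: EA_def)

lemma FT_mult: "p \<in> FT A n \<Longrightarrow> q \<in> FT A m \<Longrightarrow> p * q \<in> FT A (n + m)"
  unfolding FT_def by (erule (1) key_space_mult) (rule EA_add)

lemma FT_mono: "p \<in> FT A n \<Longrightarrow> A \<subseteq> B \<Longrightarrow> p \<in> FT B n"
  unfolding FT_def by (erule key_space_mono) (rule EA_mono)

lemma FT_0 [simp]: "0 \<in> FT A n"
  by (simp add: FT_def)

lemma FT_add: "p \<in> FT A n \<Longrightarrow> q \<in> FT A n \<Longrightarrow> p + q \<in> FT A n"
  unfolding FT_def by (rule key_space_add)

lemma FT_diff: "p \<in> FT A n \<Longrightarrow> q \<in> FT A n \<Longrightarrow> p - q \<in> FT A n"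
  unfolding FT_def by (rule key_space_diff)

lemma FT_uminus: "p \<in> FT A n \<Longrightarrow> - p \<in> FT A n"
  unfolding FT_def by (rule key_space_uminus)

lemma FT_sum: "(\<And>i. i \<in> S \<Longrightarrow> f i \<in> FT A n) \<Longrightarrow> (\<Sum>i\<in>S. f i) \<in> FT A n"
  unfolding FT_def by (rule key_space_sum)

lemma FT_sc_mult: "p \<in> FT A n \<Longrightarrow> sc c * p \<in> FT A n"
  by (auto simp: FT_def key_space_def in_keys_iff lookup_sc_mult)

lemma FT_one [simp]: "1 \<in> FT A 0"
  by (auto simp: FT_def key_space_def EA_def tdeg_def)

lemma FT_csgn_mult: "p \<in> FT A n \<Longrightarrow> csgn b B * (p :: 'k::field_char_0 laur) \<in> FT A n"
  using csgn_cases[of b B, where 'a = "'k laur"]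
  by (elim disjE) (simp_all only: mult_1 mult_minus1 FT_uminus)

lemma FT_cd:
  assumes "\<And>b. b \<in> B \<Longrightarrow> c (B - {b}) \<in> FT (B - {b}) n"
  shows "cd c B \<in> FT B n"
  unfolding cd_def
proof (intro FT_sum FT_csgn_mult)
  fix b assume "b \<in> B"
  then show "c (B - {b}) \<in> FT B n"
    by (rule FT_mono[OF assms]) auto
qed

lemma FT_mn: "e \<in> EA A n \<Longrightarrow> mn e \<in> FT A n"
  by (simp add: FT_def key_space_def)

lemma FT_filter: "p \<in> FT A n \<Longrightarrow> filter_keys Q p \<in> FT A n"
  by (auto simp: FT_def key_space_def keys_filter_keys)

lemma FT_induct:
  assumes "p \<in> FT A n" "P 0" "\<And>e c. e \<in> EA A n \<Longrightarrow> P (sc c * mn e)" "\<And>a b. P a \<Longrightarrow> P b \<Longrightarrow> P (a + b)"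
  shows "P p"
  using assms by (intro poly_mapping_span_induct[of P p])
    (auto simp: FT_def key_space_def single_eq_sc_mn)

text \<open>On the part of a fixed exponent that is nonnegative at \<open>i\<close>, inserting
  \<open>i\<close> into the index set is a contracting homotopy, since inverting \<open>i\<close>
  changes nothing there. The exponents with all entries negative, excluded by the second hypothesis,
  carry the top cohomology.\<close>

lemma cech_exact:
  fixes c :: "indet set \<Rightarrow> 'k::field_char_0 laur"
  assumes c: "\<And>A. card A = Suc k \<Longrightarrow> c A \<in> FT A n"
    and nn: "\<And>A e. card A = Suc k \<Longrightarrow> e \<in> Poly_Mapping.keys (c A) \<Longrightarrow> \<exists>i. 0 \<le> lk e (V i)"
    and closed: "\<And>B. card B = Suc (Suc k) \<Longrightarrow> cd c B = 0"
  obtains h where "\<And>A. card A = k \<Longrightarrow> h A \<in> FT A n" "\<And>A. card A = Suc k \<Longrightarrow> c A = cd h A"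
proof -
  \<comment> \<open>The index depends on the exponent alone, not on the face, so the projections
    \<open>pr\<close> commute with the differential.\<close>
  define sel where "sel e = (SOME i. 0 \<le> lk e (V i))" for e
  define pr :: "indet \<Rightarrow> 'k laur \<Rightarrow> 'k laur"
    where "pr i = filter_keys {e. sel e = i \<and> 0 \<le> lk e (V i)}" for i
  define h where "h A = (\<Sum>i\<in>- A. csgn i (insert i A) * pr i (c (insert i A)))" for A
  have pr_csgn: "pr i (csgn b B * p) = csgn b B * pr i p" for i b B p
    using csgn_cases[of b B, where 'a = "'k laur"]
    by (elim disjE) (simp_all only: mult_1 mult_minus1 pr_def filter_keys_uminus)
  have pr_sumd: "pr i (\<Sum>s\<in>S. f s) = (\<Sum>s\<in>S. pr i (f s))" for i f and S :: "indet set"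
    by (simp add: pr_def filter_keys_sum)
  have pr_sum: "(\<Sum>i\<in>UNIV. pr i (c A)) = c A" if "card A = Suc k" for A
  proof (rule poly_mapping_eqI)
    fix e
    show "Poly_Mapping.lookup (\<Sum>i\<in>UNIV. pr i (c A)) e = Poly_Mapping.lookup (c A) e"
    proof (cases "e \<in> Poly_Mapping.keys (c A)")
      case True
      have *: "0 \<le> lk e (V (sel e))"
        using nn[OF that True] unfolding sel_def by (rule someI_ex)
      have "Poly_Mapping.lookup (pr i (c A)) e = (if i = sel e then Poly_Mapping.lookup (c A) e else 0)" for i
        using * by (auto simp: pr_def lookup_filter_keys)
      then show ?thesis
        by (simp add: lookup_sum)
    next
      case False
      then have 0: "Poly_Mapping.lookup (c A) e = 0"
        by (simp add: in_keys_iff)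
      then have "Poly_Mapping.lookup (pr i (c A)) e = 0" for i
        by (simp add: pr_def lookup_filter_keys)
      then show ?thesis
        using 0 by (simp add: lookup_sum)
    qed
  qed
  \<comment> \<open>Inserting \<open>i\<close> and deleting \<open>b\<close> anticommute; this turns
    closedness on \<open>insert i A\<close> into the homotopy formula.\<close>
  have sign: "csgn b A * csgn i (insert i (A - {b})) = - (csgn i (insert i A) * csgn b (insert i A) :: 'k laur)"
    if "b \<in> A" "i \<notin> A" for b i A
    using that by (auto simp: csgn_insert csgn_remove)
  show ?thesis
  proof
    fix A :: "indet set" assume "card A = k"
    have "pr i (c (insert i A)) \<in> FT A n" if "i \<in> - A" for i
    proof -
      have "c (insert i A) \<in> FT (insert i A) n"
        using that \<open>card A = k\<close> by (intro c) simp
      then have "Poly_Mapping.keys (c (insert i A)) \<subseteq> EA (insert i A) n"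
        by (simp add: FT_def key_space_def)
      moreover have "EA (insert i A) n \<inter> {e. 0 \<le> lk e (V i)} \<subseteq> EA A n"
        by (auto simp: EA_def)
      ultimately show ?thesis
        unfolding FT_def key_space_def pr_def mem_Collect_eq keys_filter_keys by blast
    qed
    then show "h A \<in> FT A n"
      unfolding h_def by (intro FT_sum FT_csgn_mult)
  next
    fix A :: "indet set" assume cA: "card A = Suc k"
    have 1: "pr i (c A) = (\<Sum>b\<in>A. csgn b A * (csgn i (insert i (A - {b})) * pr i (c (insert i (A - {b})))))"
      if i: "i \<notin> A" for i
    proof -
      have "cd c (insert i A) = 0"
        using i cA by (intro closed) simp
      then have "pr i (cd c (insert i A)) = 0"
        by (simp add: pr_def)
      also have "pr i (cd c (insert i A)) = (\<Sum>b\<in>insert i A. csgn b (insert i A) * pr i (c (insert i A - {b})))"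
        by (simp only: cd_def pr_sumd pr_csgn)
      also have "\<dots> = csgn i (insert i A) * pr i (c A) + (\<Sum>b\<in>A. csgn b (insert i A) * pr i (c (insert i A - {b})))"
        using i by simp
      also have "(\<Sum>b\<in>A. csgn b (insert i A) * pr i (c (insert i A - {b})))
          = (\<Sum>b\<in>A. csgn b (insert i A) * pr i (c (insert i (A - {b}))))"
        using i by (intro sum.cong) (auto simp: insert_Diff_if)
      finally have "csgn i (insert i A) * pr i (c A) =
          - (\<Sum>b\<in>A. csgn b (insert i A) * pr i (c (insert i (A - {b}))))"
        by (simp only: eq_neg_iff_add_eq_0)
      then have "csgn i (insert i A) * (csgn i (insert i A) * pr i (c A)) =
          csgn i (insert i A) * - (\<Sum>b\<in>A. csgn b (insert i A) * pr i (c (insert i (A - {b}))))"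
        by (rule arg_cong)
      then have "pr i (c A) =
          csgn i (insert i A) * - (\<Sum>b\<in>A. csgn b (insert i A) * pr i (c (insert i (A - {b}))))"
        by (simp only: csgn_square)
      also have "\<dots> = (\<Sum>b\<in>A. - (csgn i (insert i A) * csgn b (insert i A)) * pr i (c (insert i (A - {b}))))"
        by (simp only: sum_negf sum_distrib_left mult.assoc mult_minus_left mult_minus_right)
      also have "\<dots> = (\<Sum>b\<in>A. csgn b A * csgn i (insert i (A - {b})) * pr i (c (insert i (A - {b}))))"
        by (rule sum.cong[OF refl]) (simp only: sign[OF _ i])
      finally show ?thesis
        by (simp only: mult.assoc)
    qed
    have 2: "h (A - {b}) = csgn b A * pr b (c A)
        + (\<Sum>i\<in>- A. csgn i (insert i (A - {b})) * pr i (c (insert i (A - {b}))))"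
      if "b \<in> A" for b
    proof -
      have "- (A - {b}) = insert b (- A)"
        using that by auto
      then show ?thesis
        using that unfolding h_def by (simp add: insert_absorb)
    qed
    have "cd h A = (\<Sum>b\<in>A. pr b (c A))
        + (\<Sum>b\<in>A. \<Sum>i\<in>- A. csgn b A * (csgn i (insert i (A - {b})) * pr i (c (insert i (A - {b})))))"
      unfolding cd_def by (simp add: 2 ring_distribs sum.distrib sum_distrib_left)
    also have "\<dots> = (\<Sum>b\<in>A. pr b (c A)) + (\<Sum>b\<in>- A. pr b (c A))"
      by (subst sum.swap) (simp add: 1)
    also have "\<dots> = (\<Sum>b\<in>UNIV. pr b (c A))"
      by (metis Compl_partition finite sum.union_disjoint Compl_disjoint)
    finally show "c A = cd h A"
      using pr_sum[OF cA] by simp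
  qed
qed

lemma UNIV_indet: "UNIV = {Ind_u, Ind_v, Ind_w, Ind_x, Ind_y, Ind_z}"
  using indet.exhaust by blast

lemma card_UNIV_indet: "card (UNIV :: indet set) = 6"
  by (simp add: UNIV_indet)

text \<open>A set of at most five indeterminates omits some \<open>i\<close>, and the exponents of
  \<open>FT A n\<close> are nonnegative there.\<close>

lemma cech_exact_low:
  fixes c :: "indet set \<Rightarrow> 'k::field_char_0 laur"
  assumes k: "k < 5" and c: "\<And>A. card A = Suc k \<Longrightarrow> c A \<in> FT A n"
    and closed: "\<And>B. card B = Suc (Suc k) \<Longrightarrow> cd c B = 0"
  obtains h where "\<And>A. card A = k \<Longrightarrow> h A \<in> FT A n" "\<And>A. card A = Suc k \<Longrightarrow> c A = cd h A"
proof -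
  have nn: "\<exists>i. 0 \<le> lk e (V i)" if A: "card A = Suc k" and e: "e \<in> Poly_Mapping.keys (c A)" for A e
  proof -
    have "A \<noteq> UNIV"
      using A k card_UNIV_indet by auto
    then obtain i where "i \<notin> A"
      by auto
    then show ?thesis
      using c[OF A] e by (auto simp: FT_def key_space_def EA_def)
  qed
  show thesis
    by (rule cech_exact[OF c nn closed]) (assumption | erule that)+
qed

section \<open>The relations among the minors\<close>

lemma exps_eqI:
  assumes "\<And>i. lk a (V i) = lk b (V i)" "lk a TA = lk b TA" "lk a TB = lk b TB" "lk a TC = lk b TC"
  shows "a = b"
proof (rule poly_mapping_eqI)
  fix g show "lk a g = lk b g"
    by (cases g) (simp_all add: assms)
qed

abbreviation mv :: "indet \<Rightarrow> 'k::field_char_0 laur"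
  where "mv i \<equiv> mn (ex (V i))"

definition D1 :: "'k::field_char_0 laur"
  where "D1 = mv Ind_v * mv Ind_z - mv Ind_w * mv Ind_y"

definition D2 :: "'k::field_char_0 laur"
  where "D2 = mv Ind_w * mv Ind_x - mv Ind_u * mv Ind_z"

definition D3 :: "'k::field_char_0 laur"
  where "D3 = mv Ind_u * mv Ind_y - mv Ind_v * mv Ind_x"

definition l1 :: "'k::field_char_0 laur"
  where "l1 = mv Ind_u * mn (ex TA) + mv Ind_v * mn (ex TB) + mv Ind_w * mn (ex TC)"

definition l2 :: "'k::field_char_0 laur"
  where "l2 = mv Ind_x * mn (ex TA) + mv Ind_y * mn (ex TB) + mv Ind_z * mn (ex TC)"

definition vpart :: "exps \<Rightarrow> exps"
  where "vpart e = e - (Poly_Mapping.single TA (lk e TA) + Poly_Mapping.single TB (lk e TB)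
    + Poly_Mapping.single TC (lk e TC))"

lemma lk_vpart [simp]: "lk (vpart e) (V i) = lk e (V i)" "lk (vpart e) TA = 0"
  "lk (vpart e) TB = 0" "lk (vpart e) TC = 0"
  by (simp_all add: vpart_def lookup_minus lookup_add lookup_single when_def)

lemma vpart_add: "vpart (a + b) = vpart a + vpart b"
  by (rule exps_eqI) (simp_all add: lookup_add)

definition psim :: "exps \<Rightarrow> 'k::field_char_0 laur"
  where "psim e = mn (vpart e) * D1 ^ nat (lk e TA) * D2 ^ nat (lk e TB) * D3 ^ nat (lk e TC)"

text \<open>The evaluation \<open>T\<^sub>i \<mapsto> \<Delta>\<^sub>i\<close>.\<close>

definition psi :: "'k laur \<Rightarrow> 'k::field_char_0 laur"
  where "psi = lin psim"

lemma psim_add: "e \<in> EA A n \<Longrightarrow> e' \<in> EA B m \<Longrightarrow> psim (e + e') = psim e * psim e'"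
  by (simp add: psim_def EA_def lookup_add vpart_add mn_add nat_add_distrib power_add algebra_simps)

lemma psi_add: "psi (p + q) = psi p + psi q" and psi_diff: "psi (p - q) = psi p - psi q"
  and psi_0 [simp]: "psi 0 = 0" and psi_uminus: "psi (- p) = - psi p"
  by (simp_all add: psi_def lin_add lin_diff lin_uminus)

lemma psi_mult: "p \<in> FT A n \<Longrightarrow> q \<in> FT B m \<Longrightarrow> psi (p * q) = psi p * psi q"
  unfolding psi_def by (rule lin_mult) (auto simp: FT_def key_space_def intro: psim_add)

lemma psi_sc_mn: "psi (sc c * mn e) = sc c * psim e"
  by (simp add: psi_def flip: single_eq_sc_mn)

lemma psi_mn: "psi (mn e) = psim e"
  by (simp add: psi_def)

lemma EA_0_T: "e \<in> EA A 0 \<Longrightarrow> lk e TA = 0 \<and> lk e TB = 0 \<and> lk e TC = 0"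
  by (auto simp: EA_def tdeg_def)

lemma psi_FT0: "p \<in> FT A 0 \<Longrightarrow> psi p = p"
proof -
  assume "p \<in> FT A 0"
  then have "psi p = lin mn p"
    unfolding psi_def FT_def key_space_def
    by (intro lin_cong) (auto simp: psim_def vpart_def dest!: subsetD EA_0_T)
  then show ?thesis
    by (simp add: lin_id)
qed

lemma psi_csgn: "psi (csgn b B * p) = csgn b B * psi p"
  using csgn_cases[of b B, where 'a = "'a laur"]
  by (elim disjE) (simp_all only: mult_1 mult_minus1 psi_uminus)

lemma psi_cd: "psi (cd c B) = cd (\<lambda>A. psi (c A)) B"
  unfolding cd_def psi_csgn[symmetric] by (simp only: psi_def lin_sum)

lemma mn_EA_simps: "ex (V i) \<in> EA A 0" "ex TA \<in> EA A 1" "ex TB \<in> EA A 1" "ex TC \<in> EA A 1"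
  by (simp_all add: EA_def lk_ex tdeg_def)

lemma mv_FT: "mv i \<in> FT A 0"
  by (intro FT_mn mn_EA_simps)

lemma D_FT: "(D1 :: 'k::field_char_0 laur) \<in> FT A 0" "(D2 :: 'k laur) \<in> FT A 0" "(D3 :: 'k laur) \<in> FT A 0"
proof -
  have "(mv i * mv j :: 'k laur) \<in> FT A 0" for i j
    using FT_mult[OF mv_FT[of i A] mv_FT[of j A]] by simp
  then show "(D1 :: 'k laur) \<in> FT A 0" "(D2 :: 'k laur) \<in> FT A 0" "(D3 :: 'k laur) \<in> FT A 0"
    unfolding D1_def D2_def D3_def by (simp_all add: FT_diff)
qed

lemma l_FT: "(l1 :: 'k::field_char_0 laur) \<in> FT A 1" "(l2 :: 'k laur) \<in> FT A 1"
proof -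
  have "(mv i * mn g :: 'k laur) \<in> FT A 1" if "g \<in> EA A 1" for i g
    using FT_mult[OF mv_FT[of i A] FT_mn[OF that]] by simp
  then show "(l1 :: 'k laur) \<in> FT A 1" "(l2 :: 'k laur) \<in> FT A 1"
    unfolding l1_def l2_def by (simp_all add: FT_add mn_EA_simps)
qed

lemma psim_ex: "psim (ex (V i)) = mv i" "psim (ex TA) = D1" "psim (ex TB) = D2" "psim (ex TC) = D3"
proof -
  have "vpart (ex (V i)) = ex (V i)" "vpart (ex TA) = 0" "vpart (ex TB) = 0" "vpart (ex TC) = 0"
    by (auto intro!: exps_eqI simp: lk_ex)
  then show "psim (ex (V i)) = mv i" "psim (ex TA) = D1" "psim (ex TB) = D2" "psim (ex TC) = D3"
    by (simp_all add: psim_def lk_ex)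
qed

text \<open>Both values are determinants with a repeated row, expanded along that row.\<close>

lemma psi_l: "psi (l1 :: 'k::field_char_0 laur) = 0" "psi (l2 :: 'k laur) = 0"
proof -
  have *: "psi (mv i * mn e) = mv i * psi (mn e :: 'k laur)" if "e \<in> EA {} 1" for i e
    using psi_mult[OF mv_FT FT_mn[OF that]] by (simp add: psi_mn psim_ex)
  show "psi (l1 :: 'k laur) = 0" "psi (l2 :: 'k laur) = 0"
    by (simp_all only: l1_def l2_def psi_add * mn_EA_simps psi_mn psim_ex)
      (simp_all add: D1_def D2_def D3_def algebra_simps)
qed

lemma FT_mult0: "p \<in> FT A 0 \<Longrightarrow> q \<in> FT A n \<Longrightarrow> p * q \<in> FT A n"
  using FT_mult[of p A 0 q n] by simp

lemma FT_power: "p \<in> FT A 0 \<Longrightarrow> p ^ n \<in> FT A 0"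
  by (induction n) (simp_all add: FT_mult0)

lemma psim_FT: "e \<in> EA A n \<Longrightarrow> psim e \<in> FT A 0"
proof -
  assume "e \<in> EA A n"
  then have "mn (vpart e) \<in> FT A 0"
    by (intro FT_mn) (simp add: EA_def tdeg_def)
  then show ?thesis
    unfolding psim_def by (intro FT_mult0 FT_power D_FT)
qed

lemma psi_FT: "p \<in> FT A n \<Longrightarrow> psi p \<in> FT A 0"
  by (erule FT_induct) (simp_all add: psi_sc_mn psim_FT FT_sc_mult psi_add FT_add)

subsection \<open>Leading terms\<close>

lemma lex_less: "lk a g < lk b g \<Longrightarrow> (\<And>h. h < g \<Longrightarrow> lk a h = lk b h) \<Longrightarrow> a < b"
  unfolding less_poly_mapping.rep_eq less_fun_def by blast

text \<open>The coefficient \<open>c\<close> may be 0, in which case \<open>a\<close> is merely an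
  upper bound; this keeps products and powers free of side conditions.\<close>

definition lead :: "'k::field_char_0 laur \<Rightarrow> exps \<Rightarrow> 'k \<Rightarrow> bool"
  where "lead p a c \<longleftrightarrow> (\<forall>e\<in>Poly_Mapping.keys p. e \<le> a) \<and> Poly_Mapping.lookup p a = c"

lemma lead_mult: "lead p a c \<Longrightarrow> lead q b d \<Longrightarrow> lead (p * q) (a + b) (c * d)"
  unfolding lead_def using lookup_mult_top[of p a q b] keys_mult_le[of p a q b] by blast

lemma lead_mn: "lead (mn e) e 1"
  by (simp add: lead_def) (simp add: mn_def)

lemma lead_power: "lead p a c \<Longrightarrow> lead (p ^ n) (\<Sum>i<n. a) (c ^ n)"
proof (induction n)
  case 0
  then show ?case
    using lead_mn[of 0] by simp
next
  case (Suc n)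
  then show ?case
    using lead_mult[OF Suc.IH[OF Suc.prems] Suc.prems] by (simp add: power_Suc2 del: power_Suc)
qed

lemma lead_add:
  assumes "lead p a c" and q: "\<And>e. e \<in> Poly_Mapping.keys q \<Longrightarrow> e < a"
  shows "lead (p + q) a c"
proof -
  have "Poly_Mapping.lookup q a = 0"
    using q[of a] by (auto simp: in_keys_iff)
  moreover have "e \<le> a" if "e \<in> Poly_Mapping.keys (p + q)" for e
    using that keys_add[of p q] assms(1) q[of e] by (auto simp: lead_def intro: less_imp_le)
  ultimately show ?thesis
    using assms(1) by (simp add: lead_def lookup_add)
qed

lemma keys_uminus: "Poly_Mapping.keys (- p :: 'k::field_char_0 laur) = Poly_Mapping.keys p"
  by (auto simp: in_keys_iff)

lemma lead_uminus: "lead p a c \<Longrightarrow> lead (- p) a (- c)"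
  by (simp add: lead_def in_keys_iff)

text \<open>In all comparisons of leading terms below, the deciding generator is x or w.\<close>

lemma less_gen_simps:
  "h < V Ind_x \<longleftrightarrow> False" "h < V Ind_w \<longleftrightarrow> h = V Ind_x"
  by (cases h rule: gen_pos.cases; simp add: less_gen_def)+

lemma lead_D:
  "lead (D1 :: 'k::field_char_0 laur) (ex (V Ind_w) + ex (V Ind_y)) (- 1)"
  "lead (D2 :: 'k::field_char_0 laur) (ex (V Ind_w) + ex (V Ind_x)) 1"
  "lead (D3 :: 'k::field_char_0 laur) (ex (V Ind_v) + ex (V Ind_x)) (- 1)"
proof -
  have "ex (V Ind_v) + ex (V Ind_z) < ex (V Ind_w) + ex (V Ind_y)"
    by (rule lex_less[of _ "V Ind_w"]) (auto simp: lk_simps less_gen_simps)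
  then show "lead (D1 :: 'k laur) (ex (V Ind_w) + ex (V Ind_y)) (- 1)"
    unfolding D1_def mn_add[symmetric] diff_conv_add_uminus add.commute[of _ "- _"]
    by (intro lead_add lead_uminus lead_mn) simp
  have "ex (V Ind_u) + ex (V Ind_z) < ex (V Ind_w) + ex (V Ind_x)"
    by (rule lex_less[of _ "V Ind_x"]) (auto simp: lk_simps less_gen_simps)
  then show "lead (D2 :: 'k laur) (ex (V Ind_w) + ex (V Ind_x)) 1"
    unfolding D2_def mn_add[symmetric] diff_conv_add_uminus
    by (intro lead_add lead_mn) (simp add: keys_uminus)
  have "ex (V Ind_u) + ex (V Ind_y) < ex (V Ind_v) + ex (V Ind_x)"
    by (rule lex_less[of _ "V Ind_x"]) (auto simp: lk_simps less_gen_simps)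
  then show "lead (D3 :: 'k laur) (ex (V Ind_v) + ex (V Ind_x)) (- 1)"
    unfolding D3_def mn_add[symmetric] diff_conv_add_uminus add.commute[of _ "- _"]
    by (intro lead_add lead_uminus lead_mn) simp
qed

lemma lead_l:
  "lead (l1 :: 'k::field_char_0 laur) (ex (V Ind_w) + ex TC) 1"
  "lead (l2 :: 'k::field_char_0 laur) (ex (V Ind_x) + ex TA) 1"
proof -
  have 1: "ex (V Ind_u) + ex TA < ex (V Ind_w) + ex TC" "ex (V Ind_v) + ex TB < ex (V Ind_w) + ex TC"
    by (auto intro!: lex_less[of _ "V Ind_w"] simp: lk_simps less_gen_simps)
  have 2: "ex (V Ind_y) + ex TB < ex (V Ind_x) + ex TA" "ex (V Ind_z) + ex TC < ex (V Ind_x) + ex TA"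
    by (auto intro!: lex_less[of _ "V Ind_x"] simp: lk_simps less_gen_simps)
  have "lead (mn (ex (V Ind_w) + ex TC) + mn (ex (V Ind_u) + ex TA) + mn (ex (V Ind_v) + ex TB) :: 'k laur) (ex (V Ind_w) + ex TC) 1"
    by (intro lead_add lead_mn) (simp_all add: 1)
  then show "lead (l1 :: 'k laur) (ex (V Ind_w) + ex TC) 1"
    by (simp only: l1_def mn_add[symmetric] add_ac)
  have "lead (mn (ex (V Ind_x) + ex TA) + mn (ex (V Ind_y) + ex TB) + mn (ex (V Ind_z) + ex TC) :: 'k laur) (ex (V Ind_x) + ex TA) 1"
    by (intro lead_add lead_mn) (simp_all add: 2)
  then show "lead (l2 :: 'k laur) (ex (V Ind_x) + ex TA) 1"
    by (simp only: l2_def mn_add[symmetric] add_ac)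
qed

text \<open>The leading exponent of \<open>psim e\<close>: \<open>TA\<close>, \<open>TB\<close>,
  \<open>TC\<close> contribute those of wy, wx, vx.\<close>

definition lam :: "exps \<Rightarrow> exps"
  where "lam e = vpart e + (\<Sum>i<nat (lk e TA). ex (V Ind_w) + ex (V Ind_y))
    + (\<Sum>i<nat (lk e TB). ex (V Ind_w) + ex (V Ind_x)) + (\<Sum>i<nat (lk e TC). ex (V Ind_v) + ex (V Ind_x))"

lemma lead_psim: "\<exists>c. c \<noteq> 0 \<and> lead (psim e :: 'k::field_char_0 laur) (lam e) c"
proof -
  have "lead (psim e :: 'k laur) (lam e) (1 * (-1) ^ nat (lk e TA) * 1 ^ nat (lk e TB) * (-1) ^ nat (lk e TC))"
    unfolding psim_def lam_def by (intro lead_mult lead_power lead_mn lead_D)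
  then show ?thesis
    by (intro exI conjI) auto
qed

text \<open>The exponents not divisible by the leading monomials \<open>wT\<^sub>3\<close> and \<open>xT\<^sub>1\<close> of the two relations.\<close>

definition RD :: "exps set"
  where "RD = {e. \<not> (1 \<le> lk e (V Ind_w) \<and> 1 \<le> lk e TC) \<and> \<not> (1 \<le> lk e (V Ind_x) \<and> 1 \<le> lk e TA)}"

lemma lk_lam: "e \<in> EA {} n \<Longrightarrow> lk (lam e) (V i) = lk e (V i) +
  (if i = Ind_w then lk e TA + lk e TB else if i = Ind_x then lk e TB + lk e TC
   else if i = Ind_y then lk e TA else if i = Ind_v then lk e TC else 0)"
  by (auto simp: lam_def lookup_add lookup_sum lk_ex EA_def)

text \<open>Write x and w for the exponents of these letters in \<open>e\<close>. As the T degree is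
  \<open>n\<close>, those in \<open>lam e\<close> are n + x - \<open>TA\<close> and n + w -
  \<open>TC\<close>. In a reduced exponent one of x, \<open>TA\<close> and one of w,
  \<open>TC\<close> is 0, so the two differences determine all four numbers, and the rest
  follows.\<close>

lemma lam_inj:
  assumes "e \<in> EA {} n \<inter> RD" "e' \<in> EA {} n \<inter> RD" "lam e = lam e'"
  shows "e = e'"
proof -
  have eq: "lk (lam e) (V i) = lk (lam e') (V i)" for i
    using assms(3) by simp
  have E: "e \<in> EA {} n" "e' \<in> EA {} n"
    using assms by auto
  note eqs = eq[of Ind_u] eq[of Ind_v] eq[of Ind_w] eq[of Ind_x] eq[of Ind_y] eq[of Ind_z]
  have nn: "0 \<le> lk e (V i)" "0 \<le> lk e' (V i)" for i
    using E by (auto simp: EA_def)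
  have T: "lk e TA + lk e TB + lk e TC = lk e' TA + lk e' TB + lk e' TC" "0 \<le> lk e TA" "0 \<le> lk e' TA"
    "0 \<le> lk e TC" "0 \<le> lk e' TC"
    using E by (auto simp: EA_def tdeg_def)
  have R: "lk e (V Ind_w) = 0 \<or> lk e TC = 0" "lk e' (V Ind_w) = 0 \<or> lk e' TC = 0"
    "lk e (V Ind_x) = 0 \<or> lk e TA = 0" "lk e' (V Ind_x) = 0 \<or> lk e' TA = 0"
    using assms(1,2) nn(1)[of Ind_w] nn(2)[of Ind_w] nn(1)[of Ind_x] nn(2)[of Ind_x] T(2-5)
    unfolding RD_def mem_Collect_eq Int_iff by linarith+
  have A: "lk e TA = lk e' TA"
    using eqs(4)[unfolded E[THEN lk_lam]] R(3,4) nn(1)[of Ind_x] nn(2)[of Ind_x] T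
    by (simp split: if_splits) linarith
  have C: "lk e TC = lk e' TC"
    using eqs(3)[unfolded E[THEN lk_lam]] R(1,2) nn(1)[of Ind_w] nn(2)[of Ind_w] T A
    by (simp split: if_splits) linarith
  show ?thesis
  proof (rule exps_eqI)
    fix i show "lk e (V i) = lk e' (V i)"
      using eq[of i] A C T unfolding E[THEN lk_lam] by (auto split: if_splits)
  qed (use A C T in auto)
qed

text \<open>By \<open>lam_inj\<close> the leading terms of the values of distinct reduced monomials
  differ, so the largest one cannot cancel. Besides injectivity of \<open>psi\<close> on reduced
  forms, the surviving exponent itself is used for the saturation.\<close>

lemma psi_top:
  assumes F: "F \<in> key_space (EA {} n \<inter> RD)" and "F \<noteq> (0 :: 'k::field_char_0 laur)"
  obtains e where "e \<in> Poly_Mapping.keys F" "lam e \<in> Poly_Mapping.keys (psi F)"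
proof -
  let ?K = "Poly_Mapping.keys F"
  have K: "finite (lam ` ?K)" "lam ` ?K \<noteq> {}"
    using assms(2) keys_empty_iff[of F] by auto
  have FK: "e \<in> EA {} n \<inter> RD" if "e \<in> ?K" for e
    using F that unfolding key_space_def by blast
  obtain e where e: "e \<in> ?K" "lam e = Max (lam ` ?K)"
    using Max_in[OF K] by auto
  have "Poly_Mapping.lookup (psi F) (lam e) =
    (\<Sum>e'\<in>?K. Poly_Mapping.lookup F e' * Poly_Mapping.lookup (psim e' :: 'k laur) (lam e))"
    by (simp add: psi_def lin_def lookup_sum lookup_sc_mult)
  also have "\<dots> = (\<Sum>e'\<in>{e}. Poly_Mapping.lookup F e' * Poly_Mapping.lookup (psim e' :: 'k laur) (lam e))"
  proof (rule sum.mono_neutral_right)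
    show "\<forall>e'\<in>?K - {e}. Poly_Mapping.lookup F e' * Poly_Mapping.lookup (psim e' :: 'k laur) (lam e) = 0"
    proof
      fix e' assume e': "e' \<in> ?K - {e}"
      have "lam e' \<le> lam e"
        using e e' K by simp
      moreover have "lam e' \<noteq> lam e"
        using lam_inj[OF FK[of e'] FK[of e]] e(1) e' by auto
      ultimately have "lam e' < lam e"
        by simp
      then have "lam e \<notin> Poly_Mapping.keys (psim e' :: 'k laur)"
        using lead_psim[of e', where 'k = 'k] unfolding lead_def by (meson leD)
      then show "Poly_Mapping.lookup F e' * Poly_Mapping.lookup (psim e' :: 'k laur) (lam e) = 0"
        by (simp add: in_keys_iff)
    qed
  qed (use e in auto)
  also have "\<dots> \<noteq> 0"
    using e(1) lead_psim[of e, where 'k = 'k] unfolding lead_def in_keys_iff by force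
  finally show thesis
    using that e(1) by (simp add: in_keys_iff)
qed

lemma exI3: "P a b c \<Longrightarrow> \<exists>x y z. P x y z"
  by blast

lemma EA_diff_ex:
  "e \<in> EA A n \<Longrightarrow> 1 \<le> lk e (V i) \<Longrightarrow> e - ex (V i) \<in> EA A n"
  by (auto simp: EA_def lk_simps tdeg_def)

text \<open>The relations serve as rewrite rules for \<open>w T\<^sub>3\<close> and
  \<open>x T\<^sub>1\<close>. Neither w nor x occurs on the right-hand sides, so the total exponent
  of w and x drops with each step.\<close>

lemma normal_form_mn:
  assumes "e \<in> EA {} n"
  shows "\<exists>F p q. F \<in> key_space (EA {} n \<inter> RD) \<and> p \<in> FT {} (n - 1) \<and> q \<in> FT {} (n - 1) \<and>
    mn e = F + l1 * p + (l2 * q :: 'k::field_char_0 laur)"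
  using assms
proof (induction "nat (lk e (V Ind_w) + lk e (V Ind_x))" arbitrary: e rule: less_induct)
  case less
  have nn: "0 \<le> lk e (V i)" for i
    using less.prems by (simp add: EA_def)
  consider "e \<in> RD" | "1 \<le> lk e (V Ind_w)" "1 \<le> lk e TC" | "1 \<le> lk e (V Ind_x)" "1 \<le> lk e TA"
    by (auto simp: RD_def)
  then show ?case
  proof cases
    case 1
    then have "mn e \<in> key_space (EA {} n \<inter> RD)"
      using less.prems by (simp add: key_space_def)
    then show ?thesis
      by (intro exI3[of _ "mn e" 0 0]) simp
  next
    case 2
    define f where "f = e - ex (V Ind_w) - ex TC"
    have f: "f \<in> EA {} (n - 1)"
      using less.prems 2 by (auto simp: f_def EA_def lk_simps tdeg_def)
    have m: "nat (lk (f + ex (V i) + ex g) (V Ind_w) + lk (f + ex (V i) + ex g) (V Ind_x))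
        < nat (lk e (V Ind_w) + lk e (V Ind_x))"
      if "i \<noteq> Ind_w" "i \<noteq> Ind_x" "g \<in> {TA, TB, TC}" for i g
      using that 2 nn[of Ind_w] nn[of Ind_x] by (auto simp: f_def lk_simps)
    have E: "f + ex (V i) + ex g \<in> EA {} n" if "g \<in> {TA, TB, TC}" for i g
      using f that by (auto simp: EA_def lk_simps tdeg_def)
    obtain Fa pa qa where a: "Fa \<in> key_space (EA {} n \<inter> RD)" "pa \<in> FT {} (n - 1)" "qa \<in> FT {} (n - 1)"
      "mn (f + ex (V Ind_u) + ex TA) = Fa + l1 * pa + (l2 * qa :: 'k laur)"
      using less.hyps[OF m[of Ind_u TA] E[of TA Ind_u]] by auto
    obtain Fb pb qb where b: "Fb \<in> key_space (EA {} n \<inter> RD)" "pb \<in> FT {} (n - 1)" "qb \<in> FT {} (n - 1)"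
      "mn (f + ex (V Ind_v) + ex TB) = Fb + l1 * pb + (l2 * qb :: 'k laur)"
      using less.hyps[OF m[of Ind_v TB] E[of TB Ind_v]] by auto
    have "mn e = mn (f + ex (V Ind_w) + ex TC)"
      by (simp add: f_def)
    also have "\<dots> = l1 * mn f - mn (f + ex (V Ind_u) + ex TA) - (mn (f + ex (V Ind_v) + ex TB) :: 'k laur)"
      by (simp add: l1_def mn_add algebra_simps)
    also have "\<dots> = (- Fa - Fb) + l1 * (mn f - pa - pb) + l2 * (- qa - qb)"
      unfolding a(4) b(4) by (simp add: algebra_simps)
    finally show ?thesis
      using a b f
      by (intro exI3[of _ "- Fa - Fb" "mn f - pa - pb" "- qa - qb"])
        (auto intro!: key_space_diff key_space_uminus FT_diff FT_uminus FT_mn)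
  next
    case 3
    define f where "f = e - ex (V Ind_x) - ex TA"
    have f: "f \<in> EA {} (n - 1)"
      using less.prems 3 by (auto simp: f_def EA_def lk_simps tdeg_def)
    have m: "nat (lk (f + ex (V i) + ex g) (V Ind_w) + lk (f + ex (V i) + ex g) (V Ind_x))
        < nat (lk e (V Ind_w) + lk e (V Ind_x))"
      if "i \<noteq> Ind_w" "i \<noteq> Ind_x" "g \<in> {TA, TB, TC}" for i g
      using that 3 nn[of Ind_w] nn[of Ind_x] by (auto simp: f_def lk_simps)
    have E: "f + ex (V i) + ex g \<in> EA {} n" if "g \<in> {TA, TB, TC}" for i g
      using f that by (auto simp: EA_def lk_simps tdeg_def)
    obtain Fa pa qa where a: "Fa \<in> key_space (EA {} n \<inter> RD)" "pa \<in> FT {} (n - 1)" "qa \<in> FT {} (n - 1)"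
      "mn (f + ex (V Ind_y) + ex TB) = Fa + l1 * pa + (l2 * qa :: 'k laur)"
      using less.hyps[OF m[of Ind_y TB] E[of TB Ind_y]] by auto
    obtain Fb pb qb where b: "Fb \<in> key_space (EA {} n \<inter> RD)" "pb \<in> FT {} (n - 1)" "qb \<in> FT {} (n - 1)"
      "mn (f + ex (V Ind_z) + ex TC) = Fb + l1 * pb + (l2 * qb :: 'k laur)"
      using less.hyps[OF m[of Ind_z TC] E[of TC Ind_z]] by auto
    have "mn e = mn (f + ex (V Ind_x) + ex TA)"
      by (simp add: f_def)
    also have "\<dots> = l2 * mn f - mn (f + ex (V Ind_y) + ex TB) - (mn (f + ex (V Ind_z) + ex TC) :: 'k laur)"
      by (simp add: l2_def mn_add algebra_simps)
    also have "\<dots> = (- Fa - Fb) + l1 * (- pa - pb) + l2 * (mn f - qa - qb)"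
      unfolding a(4) b(4) by (simp add: algebra_simps)
    finally show ?thesis
      using a b f
      by (intro exI3[of _ "- Fa - Fb" "- pa - pb" "mn f - qa - qb"])
        (auto intro!: key_space_diff key_space_uminus FT_diff FT_uminus FT_mn)
  qed
qed

lemma key_space_sc_mult: "p \<in> key_space Q \<Longrightarrow> sc c * p \<in> key_space Q"
  by (auto simp: key_space_def in_keys_iff lookup_sc_mult)

lemma normal_form:
  assumes "G \<in> FT {} n"
  shows "\<exists>F p q. F \<in> key_space (EA {} n \<inter> RD) \<and> p \<in> FT {} (n - 1) \<and> q \<in> FT {} (n - 1) \<and>
    G = F + l1 * p + (l2 * q :: 'k::field_char_0 laur)" (is "?P G")
  using assms
proof (rule FT_induct)
  show "?P 0"
    by (intro exI3[of _ 0 0 0]) simp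
next
  fix e and c :: 'k
  assume "e \<in> EA {} n"
  from normal_form_mn[OF this] obtain F p q where
    *: "F \<in> key_space (EA {} n \<inter> RD)" "p \<in> FT {} (n - 1)" "q \<in> FT {} (n - 1)"
    "mn e = F + l1 * p + (l2 * q :: 'k laur)"
    by blast
  show "?P (sc c * mn e)"
    by (intro exI3[of _ "sc c * F" "sc c * p" "sc c * q"] conjI key_space_sc_mult FT_sc_mult *(1-3))
      (simp only: *(4) ring_distribs mult.left_commute)
next
  fix a b :: "'k laur"
  assume "?P a" "?P b"
  then obtain F p q F' p' q' where
    "F \<in> key_space (EA {} n \<inter> RD)" "p \<in> FT {} (n - 1)" "q \<in> FT {} (n - 1)" "a = F + l1 * p + l2 * q"
    "F' \<in> key_space (EA {} n \<inter> RD)" "p' \<in> FT {} (n - 1)" "q' \<in> FT {} (n - 1)" "b = F' + l1 * p' + l2 * q'"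
    by blast
  then show "?P (a + b)"
    by (intro exI3[of _ "F + F'" "p + p'" "q + q'"])
      (simp add: key_space_add FT_add algebra_simps)
qed

lemma psi_l_mult: "p \<in> FT A n \<Longrightarrow> psi (l1 * p) = 0" "p \<in> FT A n \<Longrightarrow> psi (l2 * p) = 0"
  by (simp_all add: psi_mult[OF l_FT(1)[of A]] psi_mult[OF l_FT(2)[of A]] psi_l)

subsection \<open>Exactness of the Koszul complex of the two relations\<close>

text \<open>Modulo the relations \<open>F\<close> becomes a reduced form with value 0, and such a
  form is 0 by \<open>psi_top\<close>.\<close>

lemma psi_koszul_poly:
  assumes "F \<in> FT {} n" "psi F = 0"
  obtains p q where "p \<in> FT {} (n - 1)" "q \<in> FT {} (n - 1)" "F = l1 * p + l2 * (q :: 'k::field_char_0 laur)"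
proof -
  obtain G p q where G: "G \<in> key_space (EA {} n \<inter> RD)" and pq: "p \<in> FT {} (n - 1)" "q \<in> FT {} (n - 1)"
    and F: "F = G + l1 * p + l2 * q"
    using normal_form[OF assms(1)] by blast
  have "psi G = 0"
    using assms(2) pq unfolding F by (simp only: psi_add psi_l_mult[OF pq(1)] psi_l_mult[OF pq(2)] add_0_right)
  then have "G = 0"
    using psi_top[OF G] by (metis keys_zero empty_iff)
  then show thesis
    using that[OF pq] F by simp
qed

lemma lk_sum_single:
  "lk (\<Sum>i\<in>A. Poly_Mapping.single (V i) (N i)) (V j) = (if j \<in> A then N j else 0)"
  "lk (\<Sum>i\<in>A. Poly_Mapping.single (V i) (N i)) TA = 0"
  "lk (\<Sum>i\<in>A. Poly_Mapping.single (V i) (N i)) TB = 0"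
  "lk (\<Sum>i\<in>A. Poly_Mapping.single (V i) (N i)) TC = 0"
  by (simp_all add: lookup_sum lookup_single when_def)

lemma keys_mn_mult: "Poly_Mapping.keys (mn d * F) = (\<lambda>e. d + e) ` Poly_Mapping.keys F"
proof -
  have "e \<in> (\<lambda>e. d + e) ` Poly_Mapping.keys F" if "e - d \<in> Poly_Mapping.keys F" for e
    using that by (rule rev_image_eqI) simp
  then show ?thesis
    by (auto simp: in_keys_iff lookup_mn_mult)
qed

lemma clear_denominators:
  assumes "F \<in> FT A n"
  obtains d where "d \<in> EA {} 0" "- d \<in> EA A 0" "mn d * F \<in> FT {} n"
proof -
  \<comment> \<open>A crude common bound for the exponents of \<open>i\<close> in absolute
    value.\<close>
  define N where "N i = (\<Sum>e\<in>Poly_Mapping.keys F. \<bar>lk e (V i)\<bar>)" for i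
  define d where "d = (\<Sum>i\<in>A. Poly_Mapping.single (V i) (N i))"
  have N: "\<bar>lk e (V i)\<bar> \<le> N i" if "e \<in> Poly_Mapping.keys F" for e i
    unfolding N_def using that by (intro member_le_sum) auto
  have N0: "0 \<le> N i" for i
    unfolding N_def by (rule sum_nonneg) simp
  have d: "d \<in> EA {} 0" "- d \<in> EA A 0"
    by (auto simp: d_def EA_def tdeg_def lk_sum_single N0)
  have "d + e \<in> EA {} n" if "e \<in> Poly_Mapping.keys F" for e
  proof -
    have "e \<in> EA A n"
      using assms that by (auto simp: FT_def key_space_def)
    moreover have "0 \<le> lk (d + e) (V i)" for i
    proof (cases "i \<in> A")
      case True
      then show ?thesis
        using N[OF that, of i] by (simp add: d_def lookup_add lk_sum_single)
    next
      case False
      then show ?thesis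
        using \<open>e \<in> EA A n\<close> by (simp add: d_def lookup_add lk_sum_single EA_def)
    qed
    ultimately show ?thesis
      by (simp add: EA_def tdeg_def lookup_add) (simp add: d_def lk_sum_single)
  qed
  then have "mn d * F \<in> FT {} n"
    by (auto simp: FT_def key_space_def keys_mn_mult)
  with d that show thesis by blast
qed

lemma FT_unclear: "p \<in> FT {} n \<Longrightarrow> - d \<in> EA A 0 \<Longrightarrow> mn (- d) * p \<in> FT A n"
  by (rule FT_mult0[OF FT_mn]) (auto intro: FT_mono)

lemma psi_mn_mult:
  assumes "d \<in> EA B 0" "F \<in> FT A n"
  shows "psi (mn d * F) = mn d * psi (F :: 'k::field_char_0 laur)"
  using psi_mult[OF FT_mn[OF assms(1)] assms(2)] psi_FT0[OF FT_mn[OF assms(1)], where 'a = 'k] by simp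

lemma psi_koszul:
  assumes "F \<in> FT A n" "psi F = 0"
  obtains p q where "p \<in> FT A (n - 1)" "q \<in> FT A (n - 1)" "F = l1 * p + l2 * (q :: 'k::field_char_0 laur)"
proof -
  obtain d where d: "d \<in> EA {} 0" "- d \<in> EA A 0" "mn d * F \<in> FT {} n"
    using clear_denominators[OF assms(1)] .
  have "psi (mn d * F) = 0"
    by (simp add: psi_mn_mult[OF d(1) assms(1)] assms(2))
  then obtain p q where pq: "p \<in> FT {} (n - 1)" "q \<in> FT {} (n - 1)" "mn d * F = l1 * p + l2 * (q :: 'k laur)"
    using psi_koszul_poly[OF d(3)] by blast
  have "F = mn (- d) * (mn d * F)"
    by simp
  also have "\<dots> = l1 * (mn (- d) * p) + l2 * (mn (- d) * q)"
    unfolding pq(3) by (simp add: algebra_simps)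
  finally show thesis
    using that FT_unclear[OF pq(1) d(2)] FT_unclear[OF pq(2) d(2)] by blast
qed

text \<open>Division by \<open>l2\<close> alone, with leading monomial \<open>x T\<^sub>1\<close>:
  each rewriting lowers the exponent of x.\<close>

lemma divide_l2:
  assumes "p \<in> FT {} n"
  shows "\<exists>r p'. r \<in> FT {} (n - 1) \<and> p' \<in> key_space (EA {} n \<inter> {e. \<not> (1 \<le> lk e (V Ind_x) \<and> 1 \<le> lk e TA)})
    \<and> p = l2 * r + (p' :: 'k::field_char_0 laur)" (is "?P p")
  using assms
proof (rule FT_induct)
  let ?Q = "EA {} n \<inter> {e. \<not> (1 \<le> lk e (V Ind_x) \<and> 1 \<le> lk e TA)}"
  have exI2: "P a b \<Longrightarrow> \<exists>x y. P x y" for P and a b :: "'k laur"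
    by blast
  have P_diff: "?P (a - b)" if "?P a" "?P b" for a b
  proof -
    obtain r p' s q' where "r \<in> FT {} (n - 1)" "p' \<in> key_space ?Q" "a = l2 * r + p'"
      "s \<in> FT {} (n - 1)" "q' \<in> key_space ?Q" "b = l2 * s + q'"
      using \<open>?P a\<close> \<open>?P b\<close> by blast
    then show ?thesis
      by (intro exI2[of _ "r - s" "p' - q'"]) (simp add: FT_diff key_space_diff algebra_simps)
  qed
  show P0: "?P 0"
    by (intro exI2[of _ 0 0]) simp
  show P_add: "?P (a + b)" if "?P a" "?P b" for a b
    using P_diff[OF \<open>?P a\<close> P_diff[OF P0 \<open>?P b\<close>]] by simp
  have mon: "?P (mn e)" if "e \<in> EA {} n" for e
    using that
  proof (induction "nat (lk e (V Ind_x))" arbitrary: e rule: less_induct)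
    case less
    show ?case
    proof (cases "1 \<le> lk e (V Ind_x) \<and> 1 \<le> lk e TA")
      case False
      then have "mn e \<in> key_space ?Q"
        using less.prems by (simp add: key_space_def)
      then show ?thesis
        by (intro exI2[of _ 0 "mn e"]) simp
    next
      case True
      define f where "f = e - ex (V Ind_x) - ex TA"
      have f: "f \<in> EA {} (n - 1)"
        using less.prems True by (auto simp: f_def EA_def lk_simps tdeg_def)
      have m: "nat (lk (f + ex (V i) + ex g) (V Ind_x)) < nat (lk e (V Ind_x))"
        if "i \<noteq> Ind_x" "g \<in> {TA, TB, TC}" for i g
        using that True by (auto simp: f_def lk_simps)
      have E: "f + ex (V i) + ex g \<in> EA {} n" if "g \<in> {TA, TB, TC}" for i g
        using f that by (auto simp: EA_def lk_simps tdeg_def)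
      have "?P (mn (f + ex (V Ind_y) + ex TB))" "?P (mn (f + ex (V Ind_z) + ex TC))"
        by (rule less.hyps[OF m E]; simp)+
      moreover have "?P (l2 * mn f)"
        using f by (intro exI2[of _ "mn f" 0]) (simp add: FT_mn)
      ultimately have "?P (l2 * mn f - mn (f + ex (V Ind_y) + ex TB) - mn (f + ex (V Ind_z) + ex TC))"
        by (intro P_diff)
      moreover have "mn e = l2 * mn f - mn (f + ex (V Ind_y) + ex TB) - (mn (f + ex (V Ind_z) + ex TC) :: 'k laur)"
      proof -
        have "(mn e :: 'k laur) = mn (f + ex (V Ind_x) + ex TA)"
          by (simp add: f_def)
        then show ?thesis
          by (simp add: l2_def mn_add algebra_simps)
      qed
      ultimately show ?thesis
        by simp
    qed
  qed
  show "?P (sc c * mn e)" if e: "e \<in> EA {} n" for e and c :: 'k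
  proof -
    obtain r p' where "r \<in> FT {} (n - 1)" "p' \<in> key_space ?Q" "mn e = l2 * r + (p' :: 'k laur)"
      using mon[OF e] by blast
    then show ?thesis
      by (intro exI2[of _ "sc c * r" "sc c * p'"] conjI FT_sc_mult key_space_sc_mult)
        (simp_all only: ring_distribs mult.left_commute)
  qed
qed

lemma key_space_Max:
  assumes "p \<in> key_space Q" "p \<noteq> 0"
  obtains a c where "a \<in> Q" "c \<noteq> 0" "lead p a (c :: 'k::field_char_0)"
proof -
  have K: "finite (Poly_Mapping.keys p)" "Poly_Mapping.keys p \<noteq> {}"
    using assms(2) keys_empty_iff[of p] by auto
  have "Max (Poly_Mapping.keys p) \<in> Poly_Mapping.keys p"
    using Max_in[OF K] .
  then show thesis
    using that[of "Max (Poly_Mapping.keys p)" "Poly_Mapping.lookup p (Max (Poly_Mapping.keys p))"] assms(1) K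
    by (auto simp: key_space_def lead_def in_keys_iff)
qed

lemma lead_unique:
  assumes "lead p a c" "lead p b d" "c \<noteq> 0" "d \<noteq> 0"
  shows "a = b"
proof -
  have "a \<in> Poly_Mapping.keys p" "b \<in> Poly_Mapping.keys p"
    using assms by (auto simp: lead_def in_keys_iff)
  then show ?thesis
    using assms by (intro order_antisym) (auto simp: lead_def)
qed

text \<open>Regularity of the pair. Modulo \<open>l2\<close> one may assume that no term of
  \<open>p'\<close> is divisible by \<open>x T\<^sub>1\<close>. If \<open>p'\<close> were nonzero,
  comparing leading terms in \<open>l1 * p' = - (l2 * q')\<close> would make
  \<open>x T\<^sub>1\<close> divide the product of \<open>w T\<^sub>3\<close> and the leading
  monomial of \<open>p'\<close>, hence the latter by coprimality.\<close>

lemma koszul_poly: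
  assumes p: "p \<in> FT {} n" and q: "q \<in> FT {} n" and 0: "l1 * p + l2 * q = (0 :: 'k::field_char_0 laur)"
  obtains r where "r \<in> FT {} (n - 1)" "p = l2 * r" "q = - (l1 * r)"
proof -
  obtain r p' where r: "r \<in> FT {} (n - 1)"
    and p': "p' \<in> key_space (EA {} n \<inter> {e. \<not> (1 \<le> lk e (V Ind_x) \<and> 1 \<le> lk e TA)})"
    and pr: "p = l2 * r + p'"
    using divide_l2[OF p] by blast
  define q' where "q' = q + l1 * r"
  have "l1 * r \<in> FT {} n"
    using FT_mult[OF l_FT(1) r] by simp
  with q have q': "q' \<in> FT {} n"
    unfolding q'_def by (rule FT_add)
  have eq: "l1 * p' = - (l2 * q')"
    using 0 unfolding pr q'_def by (simp add: eq_neg_iff_add_eq_0 algebra_simps)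
  have l_nz: "l1 \<noteq> (0 :: 'k laur)" "l2 \<noteq> (0 :: 'k laur)"
    using lead_l[where 'k = 'k] by (auto simp: lead_def)
  have "p' = 0"
  proof (rule ccontr)
    assume "p' \<noteq> 0"
    then have "q' \<noteq> 0"
      using eq l_nz by auto
    obtain a c where a: "a \<in> EA {} n \<inter> {e. \<not> (1 \<le> lk e (V Ind_x) \<and> 1 \<le> lk e TA)}" "c \<noteq> 0" "lead p' a c"
      using key_space_Max[OF p' \<open>p' \<noteq> 0\<close>] .
    obtain b d where b: "b \<in> EA {} n" "d \<noteq> 0" "lead q' b d"
      using key_space_Max[OF q'[unfolded FT_def] \<open>q' \<noteq> 0\<close>] .
    have lead1: "lead (l1 * p') (ex (V Ind_w) + ex TC + a) (1 * c)"
      by (rule lead_mult[OF lead_l(1) a(3)])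
    have lead2: "lead (l1 * p') (ex (V Ind_x) + ex TA + b) (- (1 * d))"
      unfolding eq by (rule lead_uminus[OF lead_mult[OF lead_l(2) b(3)]])
    have ab: "ex (V Ind_w) + ex TC + a = ex (V Ind_x) + ex TA + b"
      by (rule lead_unique[OF lead1 lead2]) (use a(2) b(2) in auto)
    have "lk a (V Ind_x) = 1 + lk b (V Ind_x)" "lk a TA = 1 + lk b TA"
      using arg_cong[OF ab, of "\<lambda>e. lk e (V Ind_x)"] arg_cong[OF ab, of "\<lambda>e. lk e TA"]
      by (simp_all add: lk_simps)
    then show False
      using a(1) b(1) by (simp add: EA_def)
  qed
  moreover from this have "q' = 0"
    using eq l_nz by simp
  ultimately show thesis
    using that[OF r] pr unfolding q'_def by (simp add: eq_neg_iff_add_eq_0)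
qed

lemma koszul:
  assumes p: "p \<in> FT A n" and q: "q \<in> FT A n" and 0: "l1 * p + l2 * q = (0 :: 'k::field_char_0 laur)"
  obtains r where "r \<in> FT A (n - 1)" "p = l2 * r" "q = - (l1 * r)"
proof -
  obtain d1 where d1: "d1 \<in> EA {} 0" "- d1 \<in> EA A 0" "mn d1 * p \<in> FT {} n"
    using clear_denominators[OF p] .
  obtain d2 where d2: "d2 \<in> EA {} 0" "- d2 \<in> EA A 0" "mn d2 * q \<in> FT {} n"
    using clear_denominators[OF q] .
  define d where "d = d1 + d2"
  have d: "- d \<in> EA A 0"
    using EA_add[OF d1(2) d2(2)] by (simp add: d_def)
  have P: "mn d * p \<in> FT {} n"
    using FT_mult0[OF FT_mn[OF d2(1)] d1(3)] by (simp add: d_def mn_add algebra_simps)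
  have Q: "mn d * q \<in> FT {} n"
    using FT_mult0[OF FT_mn[OF d1(1)] d2(3)] by (simp add: d_def mn_add algebra_simps)
  have "l1 * (mn d * p) + l2 * (mn d * q) = mn d * (l1 * p + l2 * q)"
    by (simp add: algebra_simps)
  then have "l1 * (mn d * p) + l2 * (mn d * q) = 0"
    by (simp add: 0)
  then obtain r where r: "r \<in> FT {} (n - 1)" "mn d * p = l2 * r" "mn d * q = - (l1 * r)"
    using koszul_poly[OF P Q] by blast
  have "p = mn (- d) * (mn d * p)" "q = mn (- d) * (mn d * q)"
    by simp_all
  then have "p = l2 * (mn (- d) * r)" "q = - (l1 * (mn (- d) * r))"
    unfolding r(2,3) by (simp_all add: mult.left_commute)
  with that FT_unclear[OF r(1) d] show thesis
    by blast
qed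

text \<open>Powers of the ideal of minors are saturated with respect to \<open>u\<close>: the leading monomials of the
  \<open>\<Delta>\<^sub>i\<close> do not involve \<open>u\<close>, so \<open>u\<close> divides each term of a reduced form whose value it divides.\<close>

lemma u_saturated_reduced:
  assumes "F \<in> key_space (EA {} n \<inter> RD)" "f \<in> FT {} 0" "mv Ind_u * f = psi (F :: 'k::field_char_0 laur)"
  shows "f \<in> psi ` FT {} n"
  using assms
proof (induction "card (Poly_Mapping.keys F)" arbitrary: F f rule: less_induct)
  case less
  show ?case
  proof (cases "F = 0")
    case True
    have "f = mn (- ex (V Ind_u)) * (mv Ind_u * f)"
      by simp
    also have "\<dots> = psi 0"
      unfolding less.prems(3) by (simp add: True)
    finally have "f = psi 0" .
    then show ?thesis
      using FT_0 by (rule image_eqI)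
  next
    case False
    obtain e where e: "e \<in> Poly_Mapping.keys F" "lam e \<in> Poly_Mapping.keys (psi F)"
      using psi_top[OF less.prems(1) False] .
    have eE: "e \<in> EA {} n"
      using less.prems(1) e(1) unfolding key_space_def by blast
    obtain e1 where e1: "e1 \<in> Poly_Mapping.keys f" "lam e = ex (V Ind_u) + e1"
      using e(2) unfolding less.prems(3)[symmetric] keys_mn_mult by blast
    have "0 \<le> lk e1 (V Ind_u)"
      using less.prems(2) e1(1) by (auto simp: FT_def key_space_def EA_def)
    then have "1 \<le> lk (lam e) (V Ind_u)"
      unfolding e1(2) by (simp add: lk_simps)
    then have u: "1 \<le> lk e (V Ind_u)"
      by (simp add: lk_lam[OF eE])
    define c where "c = Poly_Mapping.lookup F e"
    define e' where "e' = e - ex (V Ind_u)"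
    have e': "e' \<in> EA {} n"
      unfolding e'_def using eE u by (rule EA_diff_ex)
    define F1 where "F1 = F - sc c * mn e"
    have F1: "Poly_Mapping.keys F1 = Poly_Mapping.keys F - {e}"
      by (auto simp: F1_def in_keys_iff lookup_minus c_def lookup_single when_def simp flip: single_eq_sc_mn
          split: if_splits)
    have pe: "psim e = mv Ind_u * (psim e' :: 'k laur)"
      using psim_add[OF mn_EA_simps(1)[of Ind_u "{}"] e'] by (simp add: e'_def psim_ex)
    have "f - sc c * psim e' \<in> psi ` FT {} n"
    proof (rule less.hyps)
      show "card (Poly_Mapping.keys F1) < card (Poly_Mapping.keys F)"
        unfolding F1 using e(1) by (intro card_Diff1_less) auto
      show "F1 \<in> key_space (EA {} n \<inter> RD)"
        using less.prems(1) F1 by (auto simp: key_space_def)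
      show "f - sc c * psim e' \<in> FT {} 0"
        using less.prems(2) e' by (intro FT_diff FT_sc_mult psim_FT)
      show "mv Ind_u * (f - sc c * psim e') = psi F1"
        by (simp only: F1_def psi_diff psi_sc_mn pe less.prems(3)[symmetric] right_diff_distrib mult.left_commute)
    qed
    then obtain G where G: "G \<in> FT {} n" "f - sc c * psim e' = psi G"
      by blast
    then have "f = psi (G + sc c * mn e')"
      by (simp only: psi_add psi_sc_mn diff_eq_eq)
    then show ?thesis
      using G(1) e' by (blast intro: FT_add FT_sc_mult FT_mn)
  qed
qed

lemma u_saturated:
  assumes "f \<in> FT {} 0" "mv Ind_u * f \<in> psi ` FT {} n"
  shows "f \<in> psi ` FT {} n"
proof -
  obtain G where G: "G \<in> FT {} n" "mv Ind_u * f = psi G"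
    using assms(2) by blast
  obtain F p q where F: "F \<in> key_space (EA {} n \<inter> RD)" and pq: "p \<in> FT {} (n - 1)" "q \<in> FT {} (n - 1)"
    and GF: "G = F + l1 * p + l2 * q"
    using normal_form[OF G(1)] by blast
  have "psi G = psi F"
    unfolding GF by (simp only: psi_add psi_l_mult[OF pq(1)] psi_l_mult[OF pq(2)] add_0_right)
  then show ?thesis
    using u_saturated_reduced[OF F assms(1)] G(2) by simp
qed

subsection \<open>The kernel on top cohomology\<close>

text \<open>Monomials with all six exponents negative form a basis of the top Cech cohomology;
  \<open>negl\<close> thus says that a coefficient function represents zero there.\<close>

definition allneg :: "exps \<Rightarrow> bool"
  where "allneg e \<longleftrightarrow> (\<forall>i. lk e (V i) < 0)"

definition negl :: "(exps \<Rightarrow> 'k::zero) \<Rightarrow> bool"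
  where "negl f \<longleftrightarrow> (\<forall>e. allneg e \<longrightarrow> f e = 0)"

text \<open>Multiplication by a relation, read on coefficients: by \<open>l1\<close> for u, v, w and
  by \<open>l2\<close> for x, y, z.\<close>

definition raise :: "indet \<Rightarrow> indet \<Rightarrow> indet \<Rightarrow> (exps \<Rightarrow> 'k::field_char_0) \<Rightarrow> exps \<Rightarrow> 'k"
  where "raise a b c f e = f (e - ex (V a) - ex TA) + f (e - ex (V b) - ex TB) + f (e - ex (V c) - ex TC)"

text \<open>The sum of the mixed second derivatives with respect to \<open>a\<close> and
  \<open>TA\<close>, \<open>b\<close> and \<open>TB\<close>, \<open>c\<close> and \<open>TC\<close>,
  read on coefficients.\<close>

definition lower :: "indet \<Rightarrow> indet \<Rightarrow> indet \<Rightarrow> (exps \<Rightarrow> 'k::field_char_0) \<Rightarrow> exps \<Rightarrow> 'k"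
  where "lower a b c f e =
    of_int ((lk e (V a) + 1) * (lk e TA + 1)) * f (e + ex (V a) + ex TA)
    + of_int ((lk e (V b) + 1) * (lk e TB + 1)) * f (e + ex (V b) + ex TB)
    + of_int ((lk e (V c) + 1) * (lk e TC + 1)) * f (e + ex (V c) + ex TC)"

text \<open>The polarization operator a' d/da + b' d/db + c' d/dc, read on coefficients; it moves
  degree from one row of the matrix to the other.\<close>

definition mix :: "indet \<Rightarrow> indet \<Rightarrow> indet \<Rightarrow> indet \<Rightarrow> indet \<Rightarrow> indet \<Rightarrow> (exps \<Rightarrow> 'k::field_char_0) \<Rightarrow> exps \<Rightarrow> 'k"
  where "mix a b c a' b' c' f e =
    of_int (lk e (V a) + 1) * f (e + ex (V a) - ex (V a'))
    + of_int (lk e (V b) + 1) * f (e + ex (V b) - ex (V b'))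
    + of_int (lk e (V c) + 1) * f (e + ex (V c) - ex (V c'))"

definition wt :: "indet \<Rightarrow> indet \<Rightarrow> indet \<Rightarrow> exps \<Rightarrow> int"
  where "wt a b c e = lk e (V a) + lk e (V b) + lk e (V c) + tdeg e + 3"

text \<open>For one pair, the commutator of the mixed derivative with multiplication by a T is a
  d/da + T d/dT + 1, and different pairs commute. The three ones add up to the constant 3 in
  \<open>wt\<close>.\<close>

lemma commutator:
  assumes "distinct [a, b, c]"
  shows "lower a b c (raise a b c f) e - raise a b c (lower a b c f) e = of_int (wt a b c e) * f e"
proof -
  have ne: "a \<noteq> b" "b \<noteq> a" "a \<noteq> c" "c \<noteq> a" "b \<noteq> c" "c \<noteq> b"
    using assms by auto
  show ?thesis
    unfolding lower_def raise_def wt_def tdeg_def by (simp add: lk_simps ne algebra_simps)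
qed

text \<open>The rows share no indeterminate, so only the derivative in T meets a factor T, leaving
  a' d/da for each pair.\<close>

lemma commutator_mix:
  assumes "distinct [a, b, c, a', b', c']"
  shows "lower a b c (raise a' b' c' f) e - raise a' b' c' (lower a b c f) e = mix a b c a' b' c' f e"
proof -
  have ne: "a' \<noteq> a" "a' \<noteq> b" "a' \<noteq> c" "b' \<noteq> a" "b' \<noteq> b" "b' \<noteq> c" "c' \<noteq> a" "c' \<noteq> b" "c' \<noteq> c"
    using assms by auto
  show ?thesis
    unfolding lower_def raise_def mix_def by (simp add: lk_simps ne algebra_simps)
qed

text \<open>The factor \<open>lk e h + 1\<close> vanishes at T exponent -1, so \<open>lower\<close>
  does not leave the nonnegative T exponents; this is why it is recorded as nonzero.\<close>

lemma lower_nonzero: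
  assumes "lower a b c f e \<noteq> 0"
  obtains i h where "(i, h) \<in> {(a, TA), (b, TB), (c, TC)}" "lk e h + 1 \<noteq> 0" "f (e + ex (V i) + ex h) \<noteq> 0"
proof (rule ccontr)
  assume "\<not> thesis"
  with that have *: "lk e h + 1 = 0 \<or> f (e + ex (V i) + ex h) = 0" if "(i, h) \<in> {(a, TA), (b, TB), (c, TC)}" for i h
    using that by blast
  have "of_int ((lk e (V i) + 1) * (lk e h + 1)) * f (e + ex (V i) + ex h) = 0"
    if "(i, h) \<in> {(a, TA), (b, TB), (c, TC)}" for i h
    using *[OF that] by (elim disjE) (simp_all only: mult_zero_left mult_zero_right of_int_0)
  then have "lower a b c f e = 0"
    unfolding lower_def by (simp only: insertI1 insertI2 add_0_left)
  with assms show False ..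
qed

lemma negl_raise: "negl f \<Longrightarrow> negl (raise a b c f)"
proof -
  have "allneg (e - ex (V i) - ex g)" if "allneg e" "g \<in> {TA, TB, TC}" for e i g
    unfolding allneg_def
  proof
    fix j
    have "lk e (V j) < 0"
      using that by (simp add: allneg_def)
    then show "lk (e - ex (V i) - ex g) (V j) < 0"
      using that(2) by (auto simp: lk_simps)
  qed
  then show "negl f \<Longrightarrow> negl (raise a b c f)"
    by (simp add: negl_def raise_def)
qed

text \<open>Differentiation never passes from exponent 0 to exponent -1, so strictly negative
  monomials of the image come only from strictly negative ones.\<close>

lemma negl_lower: "negl f \<Longrightarrow> negl (lower a b c f)"
proof -
  assume f: "negl f"
  have *: "of_int ((lk e (V i) + 1) * m) * f (e + ex (V i) + ex g) = 0" if "allneg e" "g \<in> {TA, TB, TC}" for e i g m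
  proof (cases "lk e (V i) + 1 = 0")
    case False
    have "allneg (e + ex (V i) + ex g)"
      unfolding allneg_def
    proof
      fix j
      have "lk e (V j) < 0" "lk e (V i) < 0"
        using that by (simp_all add: allneg_def)
      then show "lk (e + ex (V i) + ex g) (V j) < 0"
        using that(2) False by (auto simp: lk_simps)
    qed
    then show ?thesis
      using f by (simp add: negl_def)
  qed simp
  show "negl (lower a b c f)"
    unfolding negl_def
  proof (intro allI impI)
    fix e assume e: "allneg e"
    show "lower a b c f e = 0"
      unfolding lower_def by (simp only: *[OF e] insert_iff simp_thms add_0_left)
  qed
qed

lemma negl_mix:
  assumes "distinct [a, b, c, a', b', c']" "negl (raise a' b' c' f)" "negl (lower a b c f)"
  shows "negl (mix a b c a' b' c' f)"
  using negl_lower[OF assms(2), of a b c] negl_raise[OF assms(3), of a' b' c'] commutator_mix[OF assms(1), of f]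
  by (metis negl_def diff_self)

text \<open>\<open>raise\<close> and \<open>lower\<close> generate a copy of \<open>sl\<^sub>2\<close>, acting on Laurent polynomials modulo those with
  no monomial of strictly negative exponents. As the powers of \<open>lower\<close> eventually vanish, no nonzero
  vector of negative weight is annihilated by \<open>raise\<close>.\<close>

lemma raise_negative_weight:
  fixes f :: "exps \<Rightarrow> 'k::field_char_0"
  assumes dist: "distinct [a, b, c]" and f: "negl (raise a b c f)"
    and supp: "\<And>e. f e \<noteq> 0 \<Longrightarrow> 0 \<le> lk e TA \<and> 0 \<le> lk e TB \<and> 0 \<le> lk e TC \<and> tdeg e = n \<and> wt a b c e = w"
    and w: "w < 0"
  shows "negl f"
proof -
  define g where "g k = (lower a b c ^^ k) f" for k
  have g0: "g 0 = f" and gS: "g (Suc k) = lower a b c (g k)" for k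
    by (simp_all add: g_def)
  have gsupp: "0 \<le> lk e TA \<and> 0 \<le> lk e TB \<and> 0 \<le> lk e TC \<and> tdeg e = n - int k \<and> wt a b c e = w - 2 * int k"
    if "g k e \<noteq> 0" for k e
    using that
  proof (induction k arbitrary: e)
    case 0
    then show ?case
      using supp by (simp add: g0)
  next
    case (Suc k)
    have *: "0 \<le> lk e TA \<and> 0 \<le> lk e TB \<and> 0 \<le> lk e TC \<and> tdeg e = n - int (Suc k) \<and> wt a b c e = w - 2 * int (Suc k)"
      if "(i, h) \<in> {(a, TA), (b, TB), (c, TC)}" "lk e h + 1 \<noteq> 0" "g k (e + ex (V i) + ex h) \<noteq> 0" for i h
      using Suc.IH[OF that(3)] that(1,2) dist by (auto simp: lk_simps tdeg_def wt_def)
    obtain i h where "(i, h) \<in> {(a, TA), (b, TB), (c, TC)}" "lk e h + 1 \<noteq> 0" "g k (e + ex (V i) + ex h) \<noteq> 0"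
      using lower_nonzero[OF Suc.prems[unfolded gS]] .
    then show ?case
      by (rule *)
  qed
  \<comment> \<open>The classical sl2 recursion, from moving \<open>raise\<close> past
    \<open>k\<close> copies of \<open>lower\<close> through the weights w, w - 2, w - 4 and so on.
    For \<open>k = 0\<close> the factor \<open>int k\<close> hides the meaningless
    \<open>g (k - 1)\<close>.\<close>
  have rec: "raise a b c (g k) e = - of_int (int k * (w - int k + 1)) * g (k - 1) e" if "allneg e" for k e
    using that
  proof (induction k arbitrary: e)
    case 0
    then show ?case
      using f by (simp add: g0 negl_def)
  next
    case (Suc k)
    have "negl (\<lambda>e. raise a b c (g k) e - (- of_int (int k * (w - int k + 1)) * g (k - 1) e))"
      using Suc.IH by (simp add: negl_def)
    from negl_lower[OF this, of a b c]
    have "lower a b c (raise a b c (g k)) e = - of_int (int k * (w - int k + 1)) * lower a b c (g (k - 1)) e"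
      using Suc.prems unfolding negl_def lower_def by (simp add: algebra_simps)
    also have "\<dots> = - of_int (int k * (w - int k + 1)) * g k e"
      by (cases k) (simp_all add: gS)
    finally have "raise a b c (g (Suc k)) e = - of_int (int k * (w - int k + 1)) * g k e - of_int (wt a b c e) * g k e"
      using commutator[OF dist, of "g k" e] by (simp add: gS algebra_simps)
    also have "of_int (wt a b c e) * g k e = of_int (w - 2 * int k) * g k e"
      using gsupp[of k e] by (cases "g k e = 0") simp_all
    finally show ?case
      by (simp add: algebra_simps)
  qed
  \<comment> \<open>Descending induction: \<open>g (nat n + 1)\<close> is zero because its T degree
    would be negative, and for \<open>w < 0\<close> the factor k (w - k + 1) is nonzero for all
    positive k, so vanishing passes from \<open>g (Suc k)\<close> to \<open>g k\<close>.\<close>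
  have "negl (g k)" if "k \<le> nat n + 1" for k
    using that
  proof (induction rule: inc_induct)
    case base
    have "g (nat n + 1) e = 0" for e
    proof (rule ccontr)
      assume "g (nat n + 1) e \<noteq> 0"
      from gsupp[OF this] show False
        unfolding tdeg_def by (cases "0 \<le> n") auto
    qed
    then show ?case
      by (simp add: negl_def)
  next
    case (step k)
    have "of_int (int (Suc k) * (w - int (Suc k) + 1)) \<noteq> (0 :: 'k)"
      using w unfolding of_int_eq_0_iff by simp
    moreover have "of_int (int (Suc k) * (w - int (Suc k) + 1)) * g k e = 0" if "allneg e" for e
      using rec[OF that, of "Suc k"] negl_raise[OF step.IH, of a b c] that by (simp add: negl_def)
    ultimately show ?case
      unfolding negl_def by (metis mult_eq_0_iff)
  qed
  from this[of 0] show ?thesis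
    by (simp add: g0)
qed

text \<open>In weight 0 the two operators commute on \<open>f\<close>, so \<open>lower\<close> of
  \<open>f\<close> is again annihilated by \<open>raise\<close>; its weight is -2, which
  \<open>raise_negative_weight\<close> excludes.\<close>

lemma lower_zero_weight:
  fixes f :: "exps \<Rightarrow> 'k::field_char_0"
  assumes dist: "distinct [a, b, c]" and f: "negl (raise a b c f)"
    and supp: "\<And>e. f e \<noteq> 0 \<Longrightarrow> 0 \<le> lk e TA \<and> 0 \<le> lk e TB \<and> 0 \<le> lk e TC \<and> tdeg e = n \<and> wt a b c e = 0"
  shows "negl (lower a b c f)"
proof (rule raise_negative_weight[OF dist])
  have "raise a b c (lower a b c f) e = lower a b c (raise a b c f) e" for e
  proof -
    have *: "of_int (wt a b c e) * f e = 0"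
      using supp[of e] by (cases "f e = 0") simp_all
    show ?thesis
      using commutator[OF dist, of f e] unfolding * by (simp only: right_minus_eq)
  qed
  then show "negl (raise a b c (lower a b c f))"
    using negl_lower[OF f, of a b c] by (simp add: negl_def)
  show "0 \<le> lk e TA \<and> 0 \<le> lk e TB \<and> 0 \<le> lk e TC \<and> tdeg e = n - 1 \<and> wt a b c e = - 2"
    if nz: "lower a b c f e \<noteq> 0" for e
  proof -
    have *: "0 \<le> lk e TA \<and> 0 \<le> lk e TB \<and> 0 \<le> lk e TC \<and> tdeg e = n - 1 \<and> wt a b c e = - 2"
      if "(i, h) \<in> {(a, TA), (b, TB), (c, TC)}" "lk e h + 1 \<noteq> 0" "f (e + ex (V i) + ex h) \<noteq> 0" for i h
      using supp[OF that(3)] that(1,2) dist by (auto simp: lk_simps tdeg_def wt_def)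
    obtain i h where "(i, h) \<in> {(a, TA), (b, TB), (c, TC)}" "lk e h + 1 \<noteq> 0" "f (e + ex (V i) + ex h) \<noteq> 0"
      using lower_nonzero[OF nz] .
    then show ?thesis
      by (rule *)
  qed
qed simp

text \<open>Under the pairing of inverse polynomials with polynomials this is the monomial
  \<open>(T\<^sub>1 v z)\<^sup>n\<close>, a term of the \<open>n\<close>-th power of the determinant with rows \<open>T, (u, v, w), (x, y, z)\<close>;
  that power spans the kernel.\<close>

definition e0 :: "int \<Rightarrow> exps"
  where "e0 n = Poly_Mapping.single (V Ind_u) (- 1) + Poly_Mapping.single (V Ind_v) (- 1 - n)
    + Poly_Mapping.single (V Ind_w) (- 1) + Poly_Mapping.single (V Ind_x) (- 1)
    + Poly_Mapping.single (V Ind_y) (- 1) + Poly_Mapping.single (V Ind_z) (- 1 - n)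
    + Poly_Mapping.single TA n"

text \<open>Both rows have weight 0, so in top cohomology \<open>f\<close> is annihilated by both
  \<open>lower\<close> operators and then by both \<open>mix\<close> operators. Each of these is a
  recursion on coefficients, and a suitably extremal exponent in the support has to be
  \<open>e0 n\<close>.\<close>

lemma top_kernel:
  fixes f :: "exps \<Rightarrow> 'k::field_char_0"
  assumes fin: "finite {e. f e \<noteq> 0}"
    and supp: "\<And>e. f e \<noteq> 0 \<Longrightarrow> 0 \<le> lk e TA \<and> 0 \<le> lk e TB \<and> 0 \<le> lk e TC \<and> tdeg e = n"
    and U: "\<And>e. f e \<noteq> 0 \<Longrightarrow> lk e (V Ind_u) + lk e (V Ind_v) + lk e (V Ind_w) = - 3 - n"
    and X: "\<And>e. f e \<noteq> 0 \<Longrightarrow> lk e (V Ind_x) + lk e (V Ind_y) + lk e (V Ind_z) = - 3 - n"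
    and rU: "negl (raise Ind_u Ind_v Ind_w f)" and rX: "negl (raise Ind_x Ind_y Ind_z f)"
    and 0: "f (e0 n) = 0"
  shows "negl f"
proof (rule ccontr)
  assume "\<not> negl f"
  define S where "S = {e. allneg e \<and> f e \<noteq> 0}"
  have S: "finite S" "S \<noteq> {}"
    using fin \<open>\<not> negl f\<close> by (auto simp: S_def negl_def)
  have lU: "negl (lower Ind_u Ind_v Ind_w f)"
    by (rule lower_zero_weight[OF _ rU, where n = n]) (use supp U in \<open>auto simp: wt_def\<close>)
  have lX: "negl (lower Ind_x Ind_y Ind_z f)"
    by (rule lower_zero_weight[OF _ rX, where n = n]) (use supp X in \<open>auto simp: wt_def\<close>)
  have mUX: "negl (mix Ind_u Ind_v Ind_w Ind_x Ind_y Ind_z f)"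
    by (rule negl_mix[OF _ rX lU]) simp
  have mXU: "negl (mix Ind_x Ind_y Ind_z Ind_u Ind_v Ind_w f)"
    by (rule negl_mix[OF _ rU lX]) simp
  define a where "a = Max ((\<lambda>e. lk e TA) ` S)"
  have a_max: "lk e TA \<le> a" if "e \<in> S" for e
    unfolding a_def using S that by simp
  define S' where "S' = {e \<in> S. lk e TA = a}"
  have "a \<in> (\<lambda>e. lk e TA) ` S"
    unfolding a_def using S by (intro Max_in) auto
  then have S': "finite S'" "S' \<noteq> {}"
    using S by (auto simp: S'_def)
  have an: "allneg e \<longleftrightarrow> lk e (V Ind_u) < 0 \<and> lk e (V Ind_v) < 0 \<and> lk e (V Ind_w) < 0 \<and>
      lk e (V Ind_x) < 0 \<and> lk e (V Ind_y) < 0 \<and> lk e (V Ind_z) < 0" for e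
  proof
    assume "lk e (V Ind_u) < 0 \<and> lk e (V Ind_v) < 0 \<and> lk e (V Ind_w) < 0 \<and>
      lk e (V Ind_x) < 0 \<and> lk e (V Ind_y) < 0 \<and> lk e (V Ind_z) < 0"
    then have "lk e (V i) < 0" for i
      by (cases i) auto
    then show "allneg e"
      by (simp add: allneg_def)
  qed (simp add: allneg_def)
  \<comment> \<open>If the exponent of u were below -1, the \<open>raise\<close> equation at
    \<open>e1\<close> would express \<open>f e\<close> through exponents with a larger entry at
    \<open>TA\<close>.\<close>
  have u1: "lk e (V Ind_u) = - 1" if e: "e \<in> S'" for e
  proof (rule ccontr)
    assume "lk e (V Ind_u) \<noteq> - 1"
    with e have e': "allneg e" "lk e (V Ind_u) < - 1" "lk e TA = a" "f e \<noteq> 0"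
      by (auto simp: S'_def S_def an)
    define e1 where "e1 = e + ex (V Ind_u) + ex TA"
    have "allneg e1"
      using e' by (simp add: e1_def an lk_simps)
    then have "raise Ind_u Ind_v Ind_w f e1 = 0"
      using rU by (simp add: negl_def)
    moreover have "f (e1 - ex (V Ind_v) - ex TB) = 0"
      using a_max[of "e1 - ex (V Ind_v) - ex TB"] e' by (auto simp: S_def e1_def an lk_simps)
    moreover have "f (e1 - ex (V Ind_w) - ex TC) = 0"
      using a_max[of "e1 - ex (V Ind_w) - ex TC"] e' by (auto simp: S_def e1_def an lk_simps)
    moreover have "e1 - ex (V Ind_u) - ex TA = e"
      by (simp add: e1_def)
    ultimately show False
      using e' by (simp add: raise_def)
  qed
  have x1: "lk e (V Ind_x) = - 1" if e: "e \<in> S'" for e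
  proof (rule ccontr)
    assume "lk e (V Ind_x) \<noteq> - 1"
    with e have e': "allneg e" "lk e (V Ind_x) < - 1" "lk e TA = a" "f e \<noteq> 0"
      by (auto simp: S'_def S_def an)
    define e1 where "e1 = e + ex (V Ind_x) + ex TA"
    have "allneg e1"
      using e' by (simp add: e1_def an lk_simps)
    then have "raise Ind_x Ind_y Ind_z f e1 = 0"
      using rX by (simp add: negl_def)
    moreover have "f (e1 - ex (V Ind_y) - ex TB) = 0"
      using a_max[of "e1 - ex (V Ind_y) - ex TB"] e' by (auto simp: S_def e1_def an lk_simps)
    moreover have "f (e1 - ex (V Ind_z) - ex TC) = 0"
      using a_max[of "e1 - ex (V Ind_z) - ex TC"] e' by (auto simp: S_def e1_def an lk_simps)
    moreover have "e1 - ex (V Ind_x) - ex TA = e"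
      by (simp add: e1_def)
    ultimately show False
      using e' by (simp add: raise_def)
  qed
  \<comment> \<open>A second extremal choice, least exponent of v: it removes the third term of the
    \<open>mix\<close> equation below, whose exponent of v is \<open>b - 1\<close>.\<close>
  define b where "b = Min ((\<lambda>e. lk e (V Ind_v)) ` S')"
  have b_min: "b \<le> lk e (V Ind_v)" if "e \<in> S'" for e
    unfolding b_def using S' that by simp
  have "b \<in> (\<lambda>e. lk e (V Ind_v)) ` S'"
    unfolding b_def using S' by (intro Min_in) auto
  then obtain e where e: "e \<in> S'" and eb: "lk e (V Ind_v) = b"
    by auto
  have e': "allneg e" "lk e TA = a" "f e \<noteq> 0" "e \<in> S"
    using e by (auto simp: S'_def S_def)
  have y1: "lk e (V Ind_y) = - 1"
  proof (rule ccontr)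
    assume "lk e (V Ind_y) \<noteq> - 1"
    with e' have y: "lk e (V Ind_y) < - 1"
      by (auto simp: an)
    define e1 where "e1 = e + ex (V Ind_y) - ex (V Ind_v)"
    have "allneg e1"
      using e' y by (simp add: e1_def an lk_simps)
    then have "mix Ind_u Ind_v Ind_w Ind_x Ind_y Ind_z f e1 = 0"
      using mUX by (simp add: negl_def)
    moreover have "lk e1 (V Ind_u) + 1 = 0"
      using u1[OF e] by (simp add: e1_def lk_simps)
    moreover have "of_int (lk e1 (V Ind_w) + 1) * f (e1 + ex (V Ind_w) - ex (V Ind_z)) = 0"
    proof (cases "lk e1 (V Ind_w) + 1 = 0")
      case False
      then have "lk e (V Ind_w) < - 1"
        using e' by (simp add: e1_def lk_simps an)
      then have "allneg (e1 + ex (V Ind_w) - ex (V Ind_z))"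
        using e' y by (simp add: e1_def an lk_simps)
      moreover have "lk (e1 + ex (V Ind_w) - ex (V Ind_z)) TA = a" "lk (e1 + ex (V Ind_w) - ex (V Ind_z)) (V Ind_v) < b"
        using e' eb by (simp_all add: e1_def lk_simps)
      ultimately have "f (e1 + ex (V Ind_w) - ex (V Ind_z)) = 0"
        using b_min[of "e1 + ex (V Ind_w) - ex (V Ind_z)"] by (auto simp: S'_def S_def)
      then show ?thesis
        by simp
    qed simp
    moreover have "e1 + ex (V Ind_v) - ex (V Ind_y) = e"
      by (simp add: e1_def)
    ultimately have "of_int (lk e1 (V Ind_v) + 1) * f e = 0"
      by (simp only: mix_def of_int_0 mult_zero_left add_0_left add_0_right)
    moreover have "lk e1 (V Ind_v) + 1 \<noteq> 0"
      using e' by (simp add: e1_def lk_simps an)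
    ultimately show False
      using e' by (metis mult_eq_0_iff of_int_eq_0_iff)
  qed
  \<comment> \<open>Stated for all such exponents, as the argument for \<open>TC\<close> applies it
    to a neighbour of \<open>e\<close>.\<close>
  have w1: "lk e2 (V Ind_w) = - 1" if e2: "e2 \<in> S'" "lk e2 (V Ind_y) = - 1" for e2
  proof (rule ccontr)
    assume w: "lk e2 (V Ind_w) \<noteq> - 1"
    have e2': "allneg e2" "f e2 \<noteq> 0"
      using e2 by (auto simp: S'_def S_def)
    define e1 where "e1 = e2 - ex (V Ind_z) + ex (V Ind_w)"
    have "allneg e1"
      using e2' w by (simp add: e1_def an lk_simps)
    then have "mix Ind_x Ind_y Ind_z Ind_u Ind_v Ind_w f e1 = 0"
      using mXU by (simp add: negl_def)
    moreover have "lk e1 (V Ind_x) + 1 = 0" "lk e1 (V Ind_y) + 1 = 0"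
      using x1[OF e2(1)] e2(2) by (simp_all add: e1_def lk_simps)
    moreover have "e1 + ex (V Ind_z) - ex (V Ind_w) = e2"
      by (simp add: e1_def)
    ultimately have "of_int (lk e1 (V Ind_z) + 1) * f e2 = 0"
      by (simp only: mix_def of_int_0 mult_zero_left add_0_left add_0_right)
    moreover have "lk e1 (V Ind_z) + 1 \<noteq> 0"
      using e2' by (simp add: e1_def lk_simps an)
    ultimately show False
      using e2' by (metis mult_eq_0_iff of_int_eq_0_iff)
  qed
  have C0: "lk e TC = 0"
  proof (rule ccontr)
    assume C: "lk e TC \<noteq> 0"
    define e1 where "e1 = e - ex (V Ind_w) - ex TC"
    have "allneg e1"
      using e' by (simp add: e1_def an lk_simps)
    then have "lower Ind_u Ind_v Ind_w f e1 = 0"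
      using lU by (simp add: negl_def)
    moreover have "lk e1 (V Ind_u) + 1 = 0"
      using u1[OF e] by (simp add: e1_def lk_simps)
    moreover have "of_int ((lk e1 (V Ind_v) + 1) * (lk e1 TB + 1)) * f (e1 + ex (V Ind_v) + ex TB) = 0"
    proof (cases "lk e1 (V Ind_v) + 1 = 0")
      case False
      then have "lk e (V Ind_v) < - 1"
        using e' by (simp add: e1_def lk_simps an)
      then have an2: "allneg (e1 + ex (V Ind_v) + ex TB)"
        using e' by (simp add: e1_def an lk_simps)
      have "lk (e1 + ex (V Ind_v) + ex TB) TA = a" "lk (e1 + ex (V Ind_v) + ex TB) (V Ind_y) = - 1"
        "lk (e1 + ex (V Ind_v) + ex TB) (V Ind_w) \<noteq> - 1"
        using e' y1 by (simp_all add: e1_def lk_simps an)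
      then have "f (e1 + ex (V Ind_v) + ex TB) = 0"
        using w1[of "e1 + ex (V Ind_v) + ex TB"] an2 by (auto simp: S'_def S_def)
      then show ?thesis
        by simp
    qed (simp only: mult_zero_left of_int_0)
    moreover have "e1 + ex (V Ind_w) + ex TC = e"
      by (simp add: e1_def)
    ultimately have "of_int ((lk e1 (V Ind_w) + 1) * (lk e1 TC + 1)) * f e = 0"
      by (simp only: lower_def of_int_0 mult_zero_left add_0_left add_0_right)
    moreover have "(lk e1 (V Ind_w) + 1) * (lk e1 TC + 1) \<noteq> 0"
      using e' C by (simp add: e1_def lk_simps an)
    ultimately show False
      using e' by (metis mult_eq_0_iff of_int_eq_0_iff)
  qed
  have w1e: "lk e (V Ind_w) = - 1"
    using w1[OF e y1] .
  have B0: "lk e TB = 0"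
  proof (rule ccontr)
    assume B: "lk e TB \<noteq> 0"
    define e1 where "e1 = e - ex (V Ind_v) - ex TB"
    have "allneg e1"
      using e' by (simp add: e1_def an lk_simps)
    then have "lower Ind_u Ind_v Ind_w f e1 = 0"
      using lU by (simp add: negl_def)
    moreover have "lk e1 (V Ind_u) + 1 = 0" "lk e1 (V Ind_w) + 1 = 0"
      using u1[OF e] w1e by (simp_all add: e1_def lk_simps)
    moreover have "e1 + ex (V Ind_v) + ex TB = e"
      by (simp add: e1_def)
    ultimately have "of_int ((lk e1 (V Ind_v) + 1) * (lk e1 TB + 1)) * f e = 0"
      by (simp only: lower_def of_int_0 mult_zero_left add_0_left add_0_right)
    moreover have "(lk e1 (V Ind_v) + 1) * (lk e1 TB + 1) \<noteq> 0"
      using e' B by (simp add: e1_def lk_simps an)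
    ultimately show False
      using e' by (metis mult_eq_0_iff of_int_eq_0_iff)
  qed
  \<comment> \<open>The two row degrees and the T degree force the remaining entries, at v, z and
    \<open>TA\<close>.\<close>
  have "e = e0 n"
  proof (rule exps_eqI)
    fix i show "lk e (V i) = lk (e0 n) (V i)"
      using u1[OF e] x1[OF e] y1 w1e U[OF e'(3)] X[OF e'(3)]
      by (cases i) (simp_all add: e0_def lookup_add lookup_single when_def)
  qed (use B0 C0 supp[OF e'(3)] in \<open>simp_all add: e0_def lookup_add lookup_single when_def tdeg_def\<close>)
  with 0 e' show False by simp
qed

section \<open>Classes of cocycles modulo powers of the ideal of minors\<close>

text \<open>The \<open>n\<close>-th power of \<open>I\<close> in the localization at \<open>A\<close>.\<close>

definition IP :: "indet set \<Rightarrow> int \<Rightarrow> 'k::field_char_0 laur set"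
  where "IP A n = psi ` FT A n"

text \<open>The T variables get degree 2, that of the minors, so that \<open>psi\<close> preserves
  degrees.\<close>

definition tot :: "exps \<Rightarrow> int"
  where "tot e = (\<Sum>i\<in>UNIV. lk e (V i)) + 2 * tdeg e"

lemma tot_add: "tot (a + b) = tot a + tot b"
  by (simp add: tot_def tdeg_def lookup_add sum.distrib)

lemma tot_ex: "tot (ex (V i)) = 1" "tot (ex TA) = 2" "tot (ex TB) = 2" "tot (ex TC) = 2"
  by (simp_all add: tot_def lk_ex tdeg_def)

definition homog :: "int \<Rightarrow> 'k::field_char_0 laur \<Rightarrow> bool"
  where "homog d p \<longleftrightarrow> (\<forall>e\<in>Poly_Mapping.keys p. tot e = d)"

lemma homog_mult: "homog d p \<Longrightarrow> homog d' q \<Longrightarrow> homog (d + d') (p * q)"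
  using keys_mult[of p q] by (force simp: homog_def tot_add)

lemma homog_add: "homog d p \<Longrightarrow> homog d q \<Longrightarrow> homog d (p + q)"
  using keys_add[of p q] by (auto simp: homog_def)

lemma homog_uminus: "homog d p \<Longrightarrow> homog d (- p)"
  by (simp add: homog_def keys_uminus)

lemma homog_diff: "homog d p \<Longrightarrow> homog d q \<Longrightarrow> homog d (p - q)"
  using homog_add[of d p "- q"] homog_uminus[of d q] by simp

lemma homog_0 [simp]: "homog d 0"
  by (simp add: homog_def)

lemma homog_sum: "(\<And>i. i \<in> S \<Longrightarrow> homog d (f i)) \<Longrightarrow> homog d (\<Sum>i\<in>S. f i)"
  by (induction S rule: infinite_finite_induct) (auto intro: homog_add)

lemma homog_mn: "homog (tot e) (mn e)"
  by (simp add: homog_def)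

lemma homog_mv: "homog 1 (mv i)"
  using homog_mn[of "ex (V i)"] by (simp add: tot_ex)

lemma homog_1 [simp]: "homog 0 1"
  using homog_mn[of 0] by (simp add: tot_def tdeg_def)

lemma homog_power: "homog d p \<Longrightarrow> homog (int n * d) (p ^ n)"
proof (induction n)
  case (Suc n)
  then show ?case
    using homog_mult[of d p "int n * d" "p ^ n"] by (simp add: algebra_simps)
qed simp

lemma homog_sc_mult: "homog d p \<Longrightarrow> homog d (sc c * p)"
  by (auto simp: homog_def in_keys_iff lookup_sc_mult)

lemma homog_D: "homog 2 (D1 :: 'k::field_char_0 laur)" "homog 2 (D2 :: 'k laur)" "homog 2 (D3 :: 'k laur)"
proof -
  have "homog 2 (mv i * mv j :: 'k laur)" for i j
    using homog_mult[OF homog_mv[of i, where 'a = 'k] homog_mv[of j, where 'a = 'k]] by simp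
  then show "homog 2 (D1 :: 'k laur)" "homog 2 (D2 :: 'k laur)" "homog 2 (D3 :: 'k laur)"
    by (simp_all add: D1_def D2_def D3_def homog_diff)
qed

lemma homog_l: "homog 3 (l1 :: 'k::field_char_0 laur)" "homog 3 (l2 :: 'k laur)"
proof -
  have "homog 3 (mv i * mn (ex g) :: 'k laur)" if "g \<in> {TA, TB, TC}" for i g
    using homog_mult[OF homog_mv[of i, where 'a = 'k] homog_mn[of "ex g", where 'a = 'k]] that by (auto simp: tot_ex)
  then show "homog 3 (l1 :: 'k laur)" "homog 3 (l2 :: 'k laur)"
    by (simp_all add: l1_def l2_def homog_add)
qed

lemma homog_csgn_mult:
  assumes "homog d p"
  shows "homog d (csgn b B * (p :: 'k::field_char_0 laur))"
  using csgn_cases[of b B, where 'a = "'k laur"] assms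
  by (elim disjE) (simp_all only: mult_1 mult_minus1 homog_uminus)

lemma homog_cd: "(\<And>b. b \<in> B \<Longrightarrow> homog d (c (B - {b}))) \<Longrightarrow> homog d (cd c B)"
  unfolding cd_def by (intro homog_sum homog_csgn_mult)

lemma homog_psim:
  assumes "e \<in> EA A n"
  shows "homog (tot e) (psim e :: 'k::field_char_0 laur)"
proof -
  have "tot e = tot (vpart e) + int (nat (lk e TA)) * 2 + int (nat (lk e TB)) * 2 + int (nat (lk e TC)) * 2"
    using assms by (simp add: tot_def tdeg_def EA_def)
  then show ?thesis
    unfolding psim_def by (simp only:) (intro homog_mult homog_power homog_mn homog_D)
qed

lemma graded_part_homog: "homog d p \<Longrightarrow> graded_part tot d p = p"
  unfolding graded_part_def homog_def by (rule filter_keys_id) auto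

lemma graded_part_homog_other: "homog d' p \<Longrightarrow> d \<noteq> d' \<Longrightarrow> graded_part tot d p = 0"
  unfolding graded_part_def homog_def by (rule filter_keys_eq_0) auto

lemma homog_graded_part: "homog d (graded_part tot d p)"
  by (simp add: homog_def graded_part_def keys_filter_keys)

lemma graded_part_add: "graded_part \<omega> d (p + q) = graded_part \<omega> d p + graded_part \<omega> d (q :: 'k::field_char_0 laur)"
  by (simp add: graded_part_def filter_keys_add)

lemma FT_graded_part: "p \<in> FT A n \<Longrightarrow> graded_part \<omega> d p \<in> FT A n"
  unfolding graded_part_def by (rule FT_filter)

lemma psi_graded_part:
  assumes "p \<in> FT A n"
  shows "psi (graded_part tot d p) = graded_part tot d (psi (p :: 'k::field_char_0 laur))"
  using assms
proof (rule FT_induct)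
  fix e and c :: 'k
  assume e: "e \<in> EA A n"
  show "psi (graded_part tot d (sc c * mn e)) = graded_part tot d (psi (sc c * mn e))"
  proof (cases "tot e = d")
    case True
    then show ?thesis
      using homog_mn[of e, where 'a = 'k] homog_psim[OF e, where 'k = 'k]
      by (simp add: psi_sc_mn graded_part_homog homog_sc_mult)
  next
    case False
    then show ?thesis
      using graded_part_homog_other[OF homog_sc_mult[OF homog_mn[of e]], of d c]
        graded_part_homog_other[OF homog_sc_mult[OF homog_psim[OF e]], of d c]
      by (simp add: psi_sc_mn)
  qed
qed (simp_all add: graded_part_add psi_add, simp add: graded_part_def)

lemma graded_part_l_mult:
  "graded_part tot d (l1 * p) = l1 * graded_part tot (d - 3) (p :: 'k::field_char_0 laur)"
  "graded_part tot d (l2 * p) = l2 * graded_part tot (d - 3) p"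
  using graded_part_mult_homogeneous[OF tot_add, of l1 3 "d - 3" p]
    graded_part_mult_homogeneous[OF tot_add, of l2 3 "d - 3" p] homog_l[where 'k = 'k]
  by (simp_all add: homog_def)

text \<open>Up to coboundaries, \<open>zig t a r\<close> says that the iterated connecting homomorphism along
  \<open>0 \<rightarrow> S\<^sup>t\<^sup>-\<^sup>2 \<rightarrow> (S\<^sup>t\<^sup>-\<^sup>1)\<^sup>2 \<rightarrow> S\<^sup>t \<rightarrow> I\<^sup>t \<rightarrow> 0\<close> and \<open>0 \<rightarrow> I\<^sup>t \<rightarrow> R \<rightarrow> R/I\<^sup>t \<rightarrow> 0\<close> sends the class of
  the 3-cochain \<open>a\<close> to that of the 6-cochain \<open>r\<close>, where \<open>S\<^sup>n\<close> denotes the forms of degree \<open>n\<close> in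
  \<open>T\<^sub>1, T\<^sub>2, T\<^sub>3\<close> over \<open>R\<close>.\<close>

definition zig :: "int \<Rightarrow> (indet set \<Rightarrow> 'k laur) \<Rightarrow> 'k::field_char_0 laur \<Rightarrow> bool"
  where "zig t a r \<longleftrightarrow> (\<exists>g p q.
    (\<forall>B. card B = 4 \<longrightarrow> g B \<in> FT B t \<and> psi (g B) = cd a B) \<and>
    (\<forall>C. card C = 5 \<longrightarrow> p C \<in> FT C (t - 1) \<and> q C \<in> FT C (t - 1) \<and> cd g C = l1 * p C + l2 * q C) \<and>
    r \<in> FT UNIV (t - 2) \<and> cd p UNIV = l2 * r \<and> cd q UNIV = - (l1 * r) \<and> homog (- 6) r)"

text \<open>Each obstruction lies in the kernel of the next map and lifts through it. Passing to
  homogeneous parts fixes the degrees at 0 for \<open>g\<close>, -3 for \<open>p\<close> and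
  \<open>q\<close>, and -6 for \<open>r\<close>, as \<open>l1\<close> and \<open>l2\<close> have
  degree 3.\<close>

lemma zig_exists:
  fixes a :: "indet set \<Rightarrow> 'k::field_char_0 laur"
  assumes hom: "\<And>A. card A = 3 \<Longrightarrow> homog 0 (a A)"
    and cyc: "\<And>B. card B = 4 \<Longrightarrow> cd a B \<in> IP B t"
  shows "\<exists>r. zig t a r"
proof -
  have "\<exists>g. card B = 4 \<longrightarrow> g \<in> FT B t \<and> psi g = cd a B \<and> homog 0 g" for B
  proof (cases "card B = 4")
    case True
    then obtain g where g: "g \<in> FT B t" "cd a B = psi g"
      using cyc unfolding IP_def by blast
    have "homog 0 (cd a B)"
      using True by (intro homog_cd hom) simp
    then have "psi (graded_part tot 0 g) = cd a B"
      unfolding psi_graded_part[OF g(1)] g(2) by (rule graded_part_homog)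
    then show ?thesis
      using g(1) by (blast intro: FT_graded_part homog_graded_part)
  qed simp
  then obtain g where g: "\<And>B. card B = 4 \<Longrightarrow> g B \<in> FT B t \<and> psi (g B) = cd a B \<and> homog 0 (g B)"
    by metis
  have "\<exists>pq. card C = 5 \<longrightarrow> fst pq \<in> FT C (t - 1) \<and> snd pq \<in> FT C (t - 1)
      \<and> cd g C = l1 * fst pq + l2 * snd pq \<and> homog (- 3) (fst pq) \<and> homog (- 3) (snd pq)" for C
  proof (cases "card C = 5")
    case True
    have sub: "card (C - {b}) = 4" if "b \<in> C" for b
      using True that by simp
    have "psi (cd g C) = cd (cd a) C"
      unfolding psi_cd using g sub by (intro cd_cong) simp
    then have "psi (cd g C) = 0"
      by (simp only: cd_cd)
    moreover have "cd g C \<in> FT C t"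
      using g sub by (intro FT_cd) simp
    ultimately obtain p q where pq: "p \<in> FT C (t - 1)" "q \<in> FT C (t - 1)" "cd g C = l1 * p + l2 * q"
      using psi_koszul by blast
    have "homog 0 (cd g C)"
      using g sub by (intro homog_cd) simp
    from graded_part_homog[OF this]
    have "cd g C = l1 * graded_part tot (- 3) p + l2 * graded_part tot (- 3) q"
      unfolding pq(3) graded_part_add graded_part_l_mult by simp
    then show ?thesis
      using pq(1,2) by (intro exI[of _ "(graded_part tot (- 3) p, graded_part tot (- 3) q)"])
        (simp add: FT_graded_part homog_graded_part)
  qed simp
  then obtain pq where pq: "\<And>C. card C = 5 \<Longrightarrow> fst (pq C) \<in> FT C (t - 1) \<and> snd (pq C) \<in> FT C (t - 1)
      \<and> cd g C = l1 * fst (pq C) + l2 * snd (pq C) \<and> homog (- 3) (fst (pq C)) \<and> homog (- 3) (snd (pq C))"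
    by metis
  define p where "p C = fst (pq C)" for C
  define q where "q C = snd (pq C)" for C
  have p: "p C \<in> FT C (t - 1)" "q C \<in> FT C (t - 1)" "cd g C = l1 * p C + l2 * q C" "homog (- 3) (p C)" "homog (- 3) (q C)"
    if "card C = 5" for C
    using pq[OF that] by (simp_all add: p_def q_def)
  have sub: "card (UNIV - {b}) = 5" for b :: indet
    using card_UNIV_indet by simp
  have "l1 * cd p UNIV + l2 * cd q UNIV = cd (\<lambda>C. l1 * p C + l2 * q C) UNIV"
    by (simp only: cd_add cd_mult)
  also have "\<dots> = cd (cd g) UNIV"
    using p(3) sub by (intro cd_cong) simp
  finally have "l1 * cd p UNIV + l2 * cd q UNIV = 0"
    by (simp only: cd_cd)
  moreover have "cd p UNIV \<in> FT UNIV (t - 1)" "cd q UNIV \<in> FT UNIV (t - 1)"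
    using p sub by (auto intro!: FT_cd)
  ultimately obtain r where r: "r \<in> FT UNIV (t - 1 - 1)" "cd p UNIV = l2 * r" "cd q UNIV = - (l1 * r)"
    using koszul by blast
  have "homog (- 3) (cd p UNIV)" "homog (- 3) (cd q UNIV)"
    using p sub by (auto intro!: homog_cd)
  from this(1) homog_uminus[OF this(2)] have "homog (- 3) (l2 * r)" "homog (- 3) (l1 * r)"
    unfolding r(2,3) by simp_all
  note gl = this[THEN graded_part_homog]
  have glm: "graded_part tot (- 3) (l1 * r) = l1 * graded_part tot (- 6) r"
    "graded_part tot (- 3) (l2 * r) = l2 * graded_part tot (- 6) r"
    using graded_part_l_mult[of "- 3" r] by (simp_all only:) simp_all
  have P: "cd p UNIV = l2 * graded_part tot (- 6) r" and Q: "cd q UNIV = - (l1 * graded_part tot (- 6) r)"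
    by (simp_all only: r(2,3) gl[unfolded glm])
  have R: "graded_part tot (- 6) r \<in> FT UNIV (t - 2)"
    using FT_graded_part[OF r(1)] by simp
  have "zig t a (graded_part tot (- 6) r)"
    unfolding zig_def
    by (intro exI3[of _ g p q] conjI allI impI) (use g p P Q R homog_graded_part in blast)+
  then show ?thesis
    by blast
qed

lemma zig_diff:
  assumes "zig t a r" "zig t a' r'"
  shows "zig t (\<lambda>A. a A - sc c * a' A) (r - sc c * (r' :: 'k::field_char_0 laur))"
proof -
  obtain g p q where 1: "\<And>B. card B = 4 \<Longrightarrow> g B \<in> FT B t \<and> psi (g B) = cd a B"
    "\<And>C. card C = 5 \<Longrightarrow> p C \<in> FT C (t - 1) \<and> q C \<in> FT C (t - 1) \<and> cd g C = l1 * p C + l2 * q C"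
    "r \<in> FT UNIV (t - 2)" "cd p UNIV = l2 * r" "cd q UNIV = - (l1 * r)" "homog (- 6) r"
    using assms(1) unfolding zig_def by blast
  obtain g' p' q' where 2: "\<And>B. card B = 4 \<Longrightarrow> g' B \<in> FT B t \<and> psi (g' B) = cd a' B"
    "\<And>C. card C = 5 \<Longrightarrow> p' C \<in> FT C (t - 1) \<and> q' C \<in> FT C (t - 1) \<and> cd g' C = l1 * p' C + l2 * q' C"
    "r' \<in> FT UNIV (t - 2)" "cd p' UNIV = l2 * r'" "cd q' UNIV = - (l1 * r')" "homog (- 6) r'"
    using assms(2) unfolding zig_def by blast
  have psi_sc: "psi (sc c * x) = sc c * psi x" for x :: "'k laur"
    by (induction rule: poly_mapping_span_induct[of _ x])
      (simp_all add: ring_distribs psi_add single_eq_sc_mn psi_sc_mn flip: mult.assoc sc_mult)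
  show ?thesis
    unfolding zig_def
  proof (intro exI conjI allI impI)
    show "(\<lambda>B. g B - sc c * g' B) B \<in> FT B t" if "card B = 4" for B
      using 1(1) 2(1) that by (auto intro: FT_diff FT_sc_mult)
    show "psi ((\<lambda>B. g B - sc c * g' B) B) = cd (\<lambda>A. a A - sc c * a' A) B" if "card B = 4" for B
      using 1(1) 2(1) that by (simp add: psi_diff psi_sc cd_diff cd_mult)
    show "(\<lambda>B. p B - sc c * p' B) C \<in> FT C (t - 1)" "(\<lambda>B. q B - sc c * q' B) C \<in> FT C (t - 1)" if "card C = 5" for C
      using 1(2) 2(2) that by (auto intro: FT_diff FT_sc_mult)
    show "cd (\<lambda>B. g B - sc c * g' B) C = l1 * (p C - sc c * p' C) + l2 * (q C - sc c * q' C)" if "card C = 5" for C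
      using 1(2) 2(2) that by (simp add: cd_diff cd_mult algebra_simps)
    show "cd (\<lambda>B. p B - sc c * p' B) UNIV = l2 * (r - sc c * r')"
      "cd (\<lambda>B. q B - sc c * q' B) UNIV = - (l1 * (r - sc c * r'))"
      using 1(4,5) 2(4,5) by (simp_all add: cd_diff cd_mult algebra_simps)
  qed (use 1 2 in \<open>auto intro: FT_diff FT_sc_mult homog_diff homog_sc_mult\<close>)
qed

text \<open>The chase run backwards: \<open>r\<close> is the coboundary of some \<open>s\<close>,
  and below the top degree the complexes of forms are exact, so \<open>p\<close> and
  \<open>q\<close>, then \<open>g\<close>, then \<open>a\<close> can be corrected to coboundaries.
  What is left of \<open>a\<close> are values of \<open>psi\<close> on forms of degree
  \<open>t\<close>.\<close>

lemma zig_boundary: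
  fixes a :: "indet set \<Rightarrow> 'k::field_char_0 laur"
  assumes a: "\<And>A. card A = 3 \<Longrightarrow> a A \<in> FT A 0"
    and "zig t a r" and negl: "negl (Poly_Mapping.lookup r)"
  obtains b where "\<And>A. card A = 2 \<Longrightarrow> b A \<in> FT A 0" "\<And>A. card A = 3 \<Longrightarrow> a A - cd b A \<in> IP A t"
proof -
  obtain g p q where z: "\<And>B. card B = 4 \<Longrightarrow> g B \<in> FT B t \<and> psi (g B) = cd a B"
    "\<And>C. card C = 5 \<Longrightarrow> p C \<in> FT C (t - 1) \<and> q C \<in> FT C (t - 1) \<and> cd g C = l1 * p C + l2 * q C"
    "r \<in> FT UNIV (t - 2)" "cd p UNIV = l2 * r" "cd q UNIV = - (l1 * r)"
    using assms(2) unfolding zig_def by blast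
  have six: "A = UNIV" if "card A = Suc 5" for A :: "indet set"
    using that card_UNIV_indet by (intro card_eq_UNIV_imp_eq_UNIV) auto
  obtain s where s: "\<And>A. card A = 5 \<Longrightarrow> s A \<in> FT A (t - 2)" "\<And>A. card A = Suc 5 \<Longrightarrow> r = cd s A"
  proof (rule cech_exact[of 5 "\<lambda>_. r" "t - 2"])
    show "r \<in> FT A (t - 2)" if "card A = Suc 5" for A
      using six[OF that] z(3) by simp
    show "\<exists>i. 0 \<le> lk e (V i)" if "e \<in> Poly_Mapping.keys r" for e
      using negl that unfolding negl_def allneg_def in_keys_iff by (metis not_less)
    show "cd (\<lambda>_. r) B = 0" if "card B = Suc (Suc 5)" for B :: "indet set"
      using that card_mono[of UNIV B] card_UNIV_indet by simp
  qed (rule that)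
  have rs: "r = cd s UNIV"
    using s(2)[of UNIV] card_UNIV_indet by simp
  have l: "l1 * x \<in> FT A n" "l2 * x \<in> FT A n" if "x \<in> FT A (n - 1)" for x :: "'k laur" and A n
    using FT_mult[OF l_FT(1) that] FT_mult[OF l_FT(2) that] by simp_all
  obtain p' where p': "\<And>A. card A = 4 \<Longrightarrow> p' A \<in> FT A (t - 1)" "\<And>A. card A = Suc 4 \<Longrightarrow> p A - l2 * s A = cd p' A"
  proof (rule cech_exact_low[of 4 "\<lambda>A. p A - l2 * s A" "t - 1"])
    show "p A - l2 * s A \<in> FT A (t - 1)" if "card A = Suc 4" for A
      using z(2) s(1) that by (auto intro!: FT_diff l)
    show "cd (\<lambda>A. p A - l2 * s A) B = 0" if "card B = Suc (Suc 4)" for B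
      using six[of B] that z(4) rs by (simp add: cd_diff cd_mult)
  qed (simp, rule that)
  obtain q' where q': "\<And>A. card A = 4 \<Longrightarrow> q' A \<in> FT A (t - 1)" "\<And>A. card A = Suc 4 \<Longrightarrow> q A + l1 * s A = cd q' A"
  proof (rule cech_exact_low[of 4 "\<lambda>A. q A + l1 * s A" "t - 1"])
    show "q A + l1 * s A \<in> FT A (t - 1)" if "card A = Suc 4" for A
      using z(2) s(1) that by (auto intro!: FT_add l)
    show "cd (\<lambda>A. q A + l1 * s A) B = 0" if "card B = Suc (Suc 4)" for B
      using six[of B] that z(5) rs by (simp add: cd_add cd_mult)
  qed (simp, rule that)
  obtain h where h: "\<And>A. card A = 3 \<Longrightarrow> h A \<in> FT A t" "\<And>A. card A = Suc 3 \<Longrightarrow> g A - (l1 * p' A + l2 * q' A) = cd h A"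
  proof (rule cech_exact_low[of 3 "\<lambda>A. g A - (l1 * p' A + l2 * q' A)" t])
    show "g A - (l1 * p' A + l2 * q' A) \<in> FT A t" if "card A = Suc 3" for A
      using z(1) p'(1) q'(1) that by (auto intro!: FT_diff FT_add l)
    show "cd (\<lambda>A. g A - (l1 * p' A + l2 * q' A)) B = 0" if "card B = Suc (Suc 3)" for B
    proof -
      have B: "card B = 5" "card B = Suc 4"
        using that by simp_all
      have "cd (\<lambda>A. g A - (l1 * p' A + l2 * q' A)) B = cd g B - (l1 * cd p' B + l2 * cd q' B)"
        by (simp only: cd_diff cd_add cd_mult)
      also have "\<dots> = 0"
        using z(2)[OF B(1)] by (simp add: p'(2)[OF B(2), symmetric] q'(2)[OF B(2), symmetric] algebra_simps)
      finally show ?thesis .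
    qed
  qed (simp, rule that)
  obtain b where b: "\<And>A. card A = 2 \<Longrightarrow> b A \<in> FT A 0" "\<And>A. card A = Suc 2 \<Longrightarrow> a A - psi (h A) = cd b A"
  proof (rule cech_exact_low[of 2 "\<lambda>A. a A - psi (h A)" 0])
    show "a A - psi (h A) \<in> FT A 0" if "card A = Suc 2" for A
      using a h(1) that by (auto intro!: FT_diff psi_FT)
    show "cd (\<lambda>A. a A - psi (h A)) B = 0" if "card B = Suc (Suc 2)" for B
    proof -
      have B: "card B = 4" "card B = Suc 3"
        using that by simp_all
      have "psi (g B - (l1 * p' B + l2 * q' B)) = psi (g B)"
        by (simp only: psi_diff psi_add psi_l_mult(1)[OF p'(1)[OF B(1)]] psi_l_mult(2)[OF q'(1)[OF B(1)]] add_0_left diff_0_right)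
      then have "psi (cd h B) = cd a B"
        unfolding h(2)[OF B(2)] using z(1)[OF B(1)] by simp
      then show ?thesis
        by (simp add: cd_diff psi_cd)
    qed
  qed (simp, rule that)
  show thesis
  proof (rule that)
    show "b A \<in> FT A 0" if "card A = 2" for A
      using b(1) that .
    show "a A - cd b A \<in> IP A t" if "card A = 3" for A
    proof -
      have "a A - cd b A = psi (h A)"
        using b(2)[of A] that by (simp add: algebra_simps)
      then show ?thesis
        using h(1)[OF that] unfolding IP_def by blast
    qed
  qed
qed

lemma lookup_l_mult:
  "Poly_Mapping.lookup (l1 * r) = raise Ind_u Ind_v Ind_w (Poly_Mapping.lookup r)"
  "Poly_Mapping.lookup (l2 * r) = raise Ind_x Ind_y Ind_z (Poly_Mapping.lookup r)"
proof -
  have "Poly_Mapping.lookup (mv i * mn g * r) e = Poly_Mapping.lookup r (e - ex (V i) - g)" for i g e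
    by (simp add: lookup_mn_mult mult.assoc)
  then show "Poly_Mapping.lookup (l1 * r) = raise Ind_u Ind_v Ind_w (Poly_Mapping.lookup r)"
    "Poly_Mapping.lookup (l2 * r) = raise Ind_x Ind_y Ind_z (Poly_Mapping.lookup r)"
    by (simp_all add: fun_eq_iff l1_def l2_def raise_def ring_distribs lookup_add)
qed

text \<open>Each summand inverts only five indeterminates and has nonnegative exponents at the
  sixth.\<close>

lemma negl_cd:
  fixes p :: "indet set \<Rightarrow> 'k::field_char_0 laur"
  assumes "\<And>C. card C = 5 \<Longrightarrow> p C \<in> FT C n"
  shows "negl (Poly_Mapping.lookup (cd p UNIV))"
  unfolding negl_def
proof (intro allI impI)
  fix e assume e: "allneg e"
  have "Poly_Mapping.lookup (csgn b UNIV * p (UNIV - {b})) e = 0" for b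
  proof -
    have "csgn b UNIV * p (UNIV - {b}) \<in> FT (UNIV - {b}) n"
      using card_UNIV_indet by (intro FT_csgn_mult assms) simp
    moreover have "\<not> 0 \<le> lk e (V b)"
      using e by (simp add: allneg_def not_le)
    ultimately have "e \<notin> Poly_Mapping.keys (csgn b UNIV * p (UNIV - {b}))"
      by (auto simp: FT_def key_space_def EA_def)
    then show ?thesis
      by (simp add: in_keys_iff)
  qed
  then show "Poly_Mapping.lookup (cd p UNIV) e = 0"
    by (simp add: cd_def lookup_sum)
qed

text \<open>Split \<open>r\<close> by its degree \<open>d\<close> in u, v, w. As \<open>r\<close>
  has total degree -6, the weights for the two rows are d + n + 3 and its negative. If they are
  nonzero, the row of negative weight forces the part to vanish; if they are zero,
  \<open>top_kernel\<close> does.\<close>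

lemma zig_kernel:
  assumes "zig t a r" and 0: "Poly_Mapping.lookup r (e0 (t - 2)) = 0"
  shows "negl (Poly_Mapping.lookup (r :: 'k::field_char_0 laur))"
proof -
  obtain g p q where z:
    "\<And>C. card C = 5 \<Longrightarrow> p C \<in> FT C (t - 1) \<and> q C \<in> FT C (t - 1) \<and> cd g C = l1 * p C + l2 * q C"
    "r \<in> FT UNIV (t - 2)" "cd p UNIV = l2 * r" "cd q UNIV = - (l1 * r)" "homog (- 6) r"
    using assms(1) unfolding zig_def by blast
  define f where "f = Poly_Mapping.lookup r"
  define n where "n = t - 2"
  have "negl (Poly_Mapping.lookup (l2 * r))" "negl (Poly_Mapping.lookup (l1 * r))"
    using negl_cd[of p "t - 1"] negl_cd[of q "t - 1"] z by (simp_all add: negl_def)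
  then have rX: "negl (raise Ind_x Ind_y Ind_z f)" and rU: "negl (raise Ind_u Ind_v Ind_w f)"
    by (simp_all add: lookup_l_mult f_def)
  define dU where "dU e = lk e (V Ind_u) + lk e (V Ind_v) + lk e (V Ind_w)" for e
  define dX where "dX e = lk e (V Ind_x) + lk e (V Ind_y) + lk e (V Ind_z)" for e
  have supp: "0 \<le> lk e TA \<and> 0 \<le> lk e TB \<and> 0 \<le> lk e TC \<and> tdeg e = n" if "f e \<noteq> 0" for e
    using z(2) that by (auto simp: FT_def key_space_def EA_def f_def n_def in_keys_iff dest!: subsetD)
  have deg: "dU e + dX e = - 6 - 2 * n" if "f e \<noteq> 0" for e
  proof -
    have "tot e = - 6"
      using z(5) that by (simp add: homog_def f_def in_keys_iff)
    then show ?thesis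
      using supp[OF that] by (simp add: tot_def UNIV_indet dU_def dX_def)
  qed
  define fd where "fd d e = (if dU e = d then f e else 0)" for d e
  have fd: "f e \<noteq> 0" "dU e = d" if "fd d e \<noteq> 0" for d e
    using that by (simp_all add: fd_def split: if_splits)
  \<comment> \<open>Multiplication by \<open>l1\<close> raises the degree in u, v, w by one and
    \<open>l2\<close> preserves it, so both kernel conditions hold for each part separately.\<close>
  have "raise Ind_u Ind_v Ind_w (fd d) e = (if dU e = d + 1 then raise Ind_u Ind_v Ind_w f e else 0)" for d e
    by (auto simp: raise_def fd_def dU_def lk_simps)
  then have fdU: "negl (raise Ind_u Ind_v Ind_w (fd d))" for d
    using rU by (simp add: negl_def)
  have "raise Ind_x Ind_y Ind_z (fd d) e = (if dU e = d then raise Ind_x Ind_y Ind_z f e else 0)" for d e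
    by (auto simp: raise_def fd_def dU_def lk_simps)
  then have fdX: "negl (raise Ind_x Ind_y Ind_z (fd d))" for d
    using rX by (simp add: negl_def)
  have "negl (fd d)" for d
  proof (cases "d + n + 3" "0 :: int" rule: linorder_cases)
    case less
    show ?thesis
      by (rule raise_negative_weight[OF _ fdU, where n = n and w = "d + n + 3"])
        (use fd supp less in \<open>auto simp: wt_def dU_def\<close>)
  next
    case greater
    show ?thesis
      by (rule raise_negative_weight[OF _ fdX, where n = n and w = "- (d + n + 3)"])
        (use fd supp deg greater in \<open>fastforce simp: wt_def dX_def\<close>)+
  next
    case equal
    show ?thesis
    proof (rule top_kernel[OF _ _ _ _ fdU fdX, where n = n])
      show "finite {e. fd d e \<noteq> 0}"
        by (rule finite_subset[of _ "Poly_Mapping.keys r"]) (auto simp: fd_def f_def in_keys_iff)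
      show "fd d (e0 n) = 0"
        using 0 by (simp add: fd_def f_def n_def)
      show "0 \<le> lk e TA \<and> 0 \<le> lk e TB \<and> 0 \<le> lk e TC \<and> tdeg e = n" if "fd d e \<noteq> 0" for e
        using supp[OF fd(1)[OF that]] .
      show "lk e (V Ind_u) + lk e (V Ind_v) + lk e (V Ind_w) = - 3 - n" if "fd d e \<noteq> 0" for e
        using fd(2)[OF that] equal by (simp add: dU_def)
      show "lk e (V Ind_x) + lk e (V Ind_y) + lk e (V Ind_z) = - 3 - n" if "fd d e \<noteq> 0" for e
        using fd(2)[OF that] deg[OF fd(1)[OF that]] equal by (simp add: dX_def)
    qed
  qed
  then show ?thesis
    unfolding negl_def f_def[symmetric] by (metis fd_def)
qed

text \<open>A form of the statement that the cohomology in question has dimension at most one.\<close>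

lemma cocycle_multiple:
  fixes a h :: "indet set \<Rightarrow> 'k::field_char_0 laur"
  assumes a: "\<And>A. card A = 3 \<Longrightarrow> a A \<in> FT A 0" "\<And>A. card A = 3 \<Longrightarrow> homog 0 (a A)"
      "\<And>B. card B = 4 \<Longrightarrow> cd a B \<in> IP B t"
    and h: "\<And>A. card A = 3 \<Longrightarrow> h A \<in> FT A 0" "\<And>A. card A = 3 \<Longrightarrow> homog 0 (h A)"
      "\<And>B. card B = 4 \<Longrightarrow> cd h B \<in> IP B t"
    and nb: "\<not> (\<exists>b. (\<forall>A. card A = 2 \<longrightarrow> b A \<in> FT A 0) \<and> (\<forall>A. card A = 3 \<longrightarrow> h A - cd b A \<in> IP A t))"
  obtains c b where "\<And>A. card A = 2 \<Longrightarrow> b A \<in> FT A 0"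
    "\<And>A. card A = 3 \<Longrightarrow> a A - sc c * h A - cd b A \<in> IP A t"
proof -
  obtain r where r: "zig t a r"
    using zig_exists[OF a(2,3)] by blast
  obtain s where s: "zig t h s"
    using zig_exists[OF h(2,3)] by blast
  have "Poly_Mapping.lookup s (e0 (t - 2)) \<noteq> 0"
  proof
    assume "Poly_Mapping.lookup s (e0 (t - 2)) = 0"
    then have neg: "negl (Poly_Mapping.lookup s)"
      by (rule zig_kernel[OF s])
    show False
    proof (rule zig_boundary[OF h(1) s neg])
      fix b
      assume b: "\<And>A. card A = 2 \<Longrightarrow> b A \<in> FT A 0" "\<And>A. card A = 3 \<Longrightarrow> h A - cd b A \<in> IP A t"
      show False
        by (rule notE[OF nb], rule exI[of _ b]) (use b in simp)
    qed
  qed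
  \<comment> \<open>Chosen to cancel the coefficient at \<open>e0 (t - 2)\<close>, the only one that
    \<open>zig_kernel\<close> leaves free.\<close>
  moreover define c where "c = Poly_Mapping.lookup r (e0 (t - 2)) / Poly_Mapping.lookup s (e0 (t - 2))"
  ultimately have c: "Poly_Mapping.lookup r (e0 (t - 2)) = c * Poly_Mapping.lookup s (e0 (t - 2))"
    by simp
  have z: "zig t (\<lambda>A. a A - sc c * h A) (r - sc c * s)"
    using r s by (rule zig_diff)
  have n: "negl (Poly_Mapping.lookup (r - sc c * s))"
    by (rule zig_kernel[OF z]) (simp add: lookup_minus lookup_sc_mult c)
  have F: "a A - sc c * h A \<in> FT A 0" if "card A = 3" for A
    using a(1) h(1) that by (intro FT_diff FT_sc_mult)
  show thesis
  proof (rule zig_boundary[OF F z n])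
    fix b
    assume b: "\<And>A. card A = 2 \<Longrightarrow> b A \<in> FT A 0" "\<And>A. card A = 3 \<Longrightarrow> a A - sc c * h A - cd b A \<in> IP A t"
    show thesis
      by (rule that[OF b])
  qed
qed

section \<open>Truncated logarithms of unipotent elements\<close>

text \<open>A truncation of -ln(1 - a); in this convention the product (1 - a)(1 - b) corresponds to
  \<open>a + b - a * b\<close>.\<close>

definition tlog :: "nat \<Rightarrow> 'k::field_char_0 laur \<Rightarrow> 'k laur"
  where "tlog t a = (\<Sum>m\<in>{1..<t}. sc (1 / of_nat m) * a ^ m)"

text \<open>Forms of degree \<open>k\<close> in \<open>a\<close> and \<open>b\<close> over the
  scalars; that degree is what decides membership in a power of I.\<close>

inductive_set form_span :: "'k::field_char_0 laur \<Rightarrow> 'k laur \<Rightarrow> nat \<Rightarrow> 'k laur set"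
  for a b :: "'k laur" and k :: nat where
  zero: "0 \<in> form_span a b k"
| add: "x \<in> form_span a b k \<Longrightarrow> i + j = k \<Longrightarrow> x + sc c * (a ^ i * b ^ j) \<in> form_span a b k"

lemma form_span_add: "x \<in> form_span a b k \<Longrightarrow> y \<in> form_span a b k \<Longrightarrow> x + y \<in> form_span a b k"
  by (rotate_tac 1, induction y rule: form_span.induct)
    (auto simp: add.assoc[symmetric] intro: form_span.intros)

lemma form_span_monom: "i + j = k \<Longrightarrow> sc c * (a ^ i * b ^ j) \<in> form_span a b k"
  using form_span.add[OF form_span.zero, of i j k c a b] by simp

lemma form_span_sc: "x \<in> form_span a b k \<Longrightarrow> sc c * x \<in> form_span a b k"
proof (induction rule: form_span.induct)
  case (add x i j d)
  have "sc c * (x + sc d * (a ^ i * b ^ j)) = sc c * x + sc (c * d) * (a ^ i * b ^ j)"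
    by (simp add: sc_mult algebra_simps)
  then show ?case
    using form_span.add[OF add.IH add.hyps(2)] by simp
qed (simp add: form_span.zero)

lemma form_span_mult_monom:
  "x \<in> form_span a b k \<Longrightarrow> i + j = l \<Longrightarrow> x * (sc c * (a ^ i * b ^ j)) \<in> form_span a b (k + l)"
proof (induction rule: form_span.induct)
  case (add x i' j' d)
  have "(x + sc d * (a ^ i' * b ^ j')) * (sc c * (a ^ i * b ^ j))
      = x * (sc c * (a ^ i * b ^ j)) + sc (d * c) * (a ^ (i' + i) * b ^ (j' + j))"
    by (simp add: sc_mult power_add algebra_simps)
  then show ?case
    using form_span.add[OF add.IH[OF add.prems], of "i' + i" "j' + j" "d * c"] add.hyps(2) add.prems by simp
qed (simp add: form_span.zero)

lemma form_span_mult: "y \<in> form_span a b l \<Longrightarrow> x \<in> form_span a b k \<Longrightarrow> x * y \<in> form_span a b (k + l)"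
proof (induction rule: form_span.induct)
  case (add y i j c)
  have "x * (y + sc c * (a ^ i * b ^ j)) = x * y + x * (sc c * (a ^ i * b ^ j))"
    by (simp add: algebra_simps)
  then show ?case
    using form_span_add[OF add.IH[OF add.prems] form_span_mult_monom[OF add.prems add.hyps(2)]] by simp
qed (simp add: form_span.zero)

lemma form_span_sum: "(\<And>i. i \<in> S \<Longrightarrow> f i \<in> form_span a b k) \<Longrightarrow> (\<Sum>i\<in>S. f i) \<in> form_span a b k"
  by (induction S rule: infinite_finite_induct) (auto intro: form_span_add form_span.zero)

text \<open>Polynomials in an auxiliary variable \<open>s\<close> arising from polynomials in \<open>sa\<close> and \<open>sb\<close>.\<close>

definition form_poly :: "'k::field_char_0 laur \<Rightarrow> 'k laur \<Rightarrow> 'k laur poly set"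
  where "form_poly a b = {p. \<forall>k. coeff p k \<in> form_span a b k}"

lemma form_poly_add: "p \<in> form_poly a b \<Longrightarrow> q \<in> form_poly a b \<Longrightarrow> p + q \<in> form_poly a b"
  by (simp add: form_poly_def form_span_add)

lemma form_poly_sc: "p \<in> form_poly a b \<Longrightarrow> smult (sc c) p \<in> form_poly a b"
  by (simp add: form_poly_def form_span_sc)

lemma form_poly_mult: "p \<in> form_poly a b \<Longrightarrow> q \<in> form_poly a b \<Longrightarrow> p * q \<in> form_poly a b"
proof -
  assume pq: "p \<in> form_poly a b" "q \<in> form_poly a b"
  have "coeff p i * coeff q (k - i) \<in> form_span a b k" if "i \<le> k" for i k
    using pq form_span_mult[of "coeff q (k - i)" a b "k - i" "coeff p i" i] that
    by (simp add: form_poly_def)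
  then show ?thesis
    by (auto simp: form_poly_def coeff_mult intro!: form_span_sum)
qed

lemma form_poly_1: "1 \<in> form_poly a b"
  using form_span_monom[of 0 0 0 1 a b] by (auto simp: form_poly_def coeff_1 form_span.zero)

lemma form_poly_power: "p \<in> form_poly a b \<Longrightarrow> p ^ n \<in> form_poly a b"
  by (induction n) (auto intro: form_poly_mult form_poly_1)

lemma form_poly_0: "0 \<in> form_poly a b"
  by (simp add: form_poly_def form_span.zero)

lemma form_poly_sum: "(\<And>i. i \<in> S \<Longrightarrow> f i \<in> form_poly a b) \<Longrightarrow> (\<Sum>i\<in>S. f i) \<in> form_poly a b"
  by (induction S rule: infinite_finite_induct)
    (auto intro: form_poly_add form_poly_0)

lemma form_poly_linear: "[:0, a:] \<in> form_poly a b" "[:0, b:] \<in> form_poly a b"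
  using form_span_monom[of 1 0 1 1 a b] form_span_monom[of 0 1 1 1 a b]
  by (auto simp: form_poly_def coeff_pCons form_span.zero split: nat.split)

definition log_poly :: "nat \<Rightarrow> 'k::field_char_0 laur poly \<Rightarrow> 'k laur poly"
  where "log_poly t p = (\<Sum>m\<in>{1..<t}. smult (sc (1 / of_nat m)) (p ^ m))"

lemma poly_log_poly: "poly (log_poly t p) x = tlog t (poly p x)"
  by (simp add: log_poly_def tlog_def poly_sum)

lemma pderiv_sum_laur: "pderiv (\<Sum>i\<in>S. f i) = (\<Sum>i\<in>S. pderiv (f i :: 'k::field_char_0 laur poly))"
  by (induction S rule: infinite_finite_induct) (auto simp: pderiv_add)

text \<open>The derivative of the logarithm is \<open>pderiv p\<close> times a geometric sum, which
  \<open>1 - p\<close> telescopes.\<close>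

lemma pderiv_log_poly:
  assumes "1 \<le> t"
  shows "(1 - p) * pderiv (log_poly t p) = pderiv p * (1 - p ^ (t - 1))"
proof -
  have *: "pderiv (smult (sc (1 / of_nat m)) (p ^ m)) = pderiv p * p ^ (m - 1)" if "m \<in> {1..<t}" for m
  proof -
    obtain k where m: "m = Suc k"
      using \<open>m \<in> {1..<t}\<close> by (cases m) auto
    have "sc (1 / of_nat m) * of_nat m = (1 :: 'a laur)"
    proof -
      have "(of_nat m :: 'a laur) = sc (of_nat m)"
        by (simp only: sc_def single_of_nat)
      then show ?thesis
        by (simp add: m del: of_nat_Suc flip: sc_mult)
    qed
    then show ?thesis
      unfolding m by (simp only: pderiv_smult pderiv_power_Suc smult_smult diff_Suc_1 mult_smult_left smult_1_left mult.commute[of "pderiv p"])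
  qed
  have "pderiv (log_poly t p) = (\<Sum>m\<in>{1..<t}. pderiv p * p ^ (m - 1))"
    unfolding log_poly_def pderiv_sum_laur by (intro sum.cong refl *)
  also have "\<dots> = pderiv p * (\<Sum>k<t - 1. p ^ k)"
    unfolding sum_distrib_left using assms
    by (intro sum.reindex_bij_witness[of _ Suc "\<lambda>m. m - 1"]) auto
  finally have "(1 - p) * pderiv (log_poly t p) = pderiv p * ((1 - p) * (\<Sum>k<t - 1. p ^ k))"
    by (simp only: mult.left_commute)
  also have "(1 - p) * (\<Sum>k<t - 1. p ^ k) = 1 - p ^ (t - 1)"
    by (simp only: one_diff_power_eq)
  finally show ?thesis .
qed

text \<open>With \<open>a, b\<close> replaced by \<open>sa, sb\<close>, the derivative of the difference of both sides with
  respect to \<open>s\<close> is divisible by \<open>s\<^sup>t\<^sup>-\<^sup>1\<close>.\<close>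

lemma log_mult_poly:
  fixes a b :: "'k::field_char_0 laur"
  assumes t: "1 \<le> t" and k: "k < t"
  defines "p \<equiv> [:0, a:]" and "q \<equiv> [:0, b:]"
  shows "coeff (log_poly t p + log_poly t q - log_poly t (p + q - p * q)) k = 0"
proof -
  define r where "r = p + q - p * q"
  define f where "f = log_poly t p + log_poly t q - log_poly t r"
  define sv where "sv = ([:0, 1:] :: 'k laur poly)"
  have sv: "sv dvd p" "sv dvd q" "sv dvd r"
    by (simp_all add: sv_def p_def q_def r_def dvd_iff_poly_eq_0[of 0, simplified])
  have Xn: "sv ^ (t - 1) dvd p ^ (t - 1)" "sv ^ (t - 1) dvd q ^ (t - 1)" "sv ^ (t - 1) dvd r ^ (t - 1)"
    using sv by (auto intro: dvd_power_same)
  have r1: "1 - r = (1 - p) * (1 - q)" "1 - r = (1 - q) * (1 - p)"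
    by (simp_all add: r_def algebra_simps)
  have dr: "pderiv r = pderiv p * (1 - q) + pderiv q * (1 - p)"
    by (simp add: r_def pderiv_diff pderiv_add pderiv_mult algebra_simps)
  have "(1 - r) * pderiv f = (1 - q) * ((1 - p) * pderiv (log_poly t p)) + (1 - p) * ((1 - q) * pderiv (log_poly t q))
      - (1 - r) * pderiv (log_poly t r)"
    unfolding f_def pderiv_diff pderiv_add right_diff_distrib[of "1 - r"] distrib_left[of "1 - r"]
    by (simp only: r1 mult.assoc mult.left_commute[of "1 - p" "1 - q"])
  also have "\<dots> = pderiv r * r ^ (t - 1) - (1 - q) * pderiv p * p ^ (t - 1) - (1 - p) * pderiv q * q ^ (t - 1)"
    unfolding pderiv_log_poly[OF t] by (simp add: dr algebra_simps)
  also have "sv ^ (t - 1) dvd \<dots>"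
    using Xn by (intro dvd_diff dvd_mult) auto
  finally have d: "sv ^ (t - 1) dvd (1 - r) * pderiv f" .
  \<comment> \<open>The geometric sum inverts \<open>1 - r\<close> up to \<open>r ^ (t - 1)\<close>,
    which is itself divisible by \<open>sv ^ (t - 1)\<close>.\<close>
  have "pderiv f = (\<Sum>k<t - 1. r ^ k) * ((1 - r) * pderiv f) + r ^ (t - 1) * pderiv f"
  proof -
    have "(\<Sum>k<t - 1. r ^ k) * ((1 - r) * pderiv f) = ((1 - r) * (\<Sum>k<t - 1. r ^ k)) * pderiv f"
      by (simp only: mult_ac)
    also have "\<dots> = (1 - r ^ (t - 1)) * pderiv f"
      by (simp only: one_diff_power_eq)
    finally show ?thesis
      by (simp add: algebra_simps)
  qed
  moreover have "sv ^ (t - 1) dvd (\<Sum>k<t - 1. r ^ k) * ((1 - r) * pderiv f) + r ^ (t - 1) * pderiv f"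
    using d Xn(3) by (intro dvd_add) auto
  ultimately have "sv ^ (t - 1) dvd pderiv f"
    by simp
  moreover have "sv ^ (t - 1) = monom 1 (t - 1)"
    by (simp add: sv_def monom_altdef)
  ultimately have dv: "coeff (pderiv f) j = 0" if "j < t - 1" for j
    using that by (auto simp: monom_1_dvd_iff' dvd_def coeff_monom_mult)
  have "coeff f k = 0"
  proof (cases k)
    case 0
    have z: "tlog t 0 = (0 :: 'k laur)"
      by (simp add: tlog_def power_0_left)
    have "poly f 0 = 0"
      by (simp add: f_def poly_log_poly p_def q_def r_def z)
    then show ?thesis
      using 0 by (simp add: poly_0_coeff_0)
  next
    case (Suc j)
    then have "coeff (pderiv f) j = 0"
      using k dv by simp
    then have "of_nat (Suc j) * coeff f (Suc j) = 0"
      by (simp only: coeff_pderiv)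
    then show ?thesis
      using Suc by (simp only: mult_eq_0_iff of_nat_eq_0_iff) simp
  qed
  then show ?thesis
    by (simp add: f_def r_def)
qed

text \<open>Set s = 1 in \<open>log_mult_poly\<close>: the coefficients below degree
  \<open>t\<close> vanish, and the others are forms of degree at least \<open>t\<close> in
  \<open>a\<close> and \<open>b\<close>, hence in \<open>N\<close>. The application takes for
  \<open>N\<close> the localized power I^t.\<close>

lemma log_mult:
  fixes a b :: "'k::field_char_0 laur"
  assumes t: "1 \<le> t"
    and N0: "0 \<in> N" and Nadd: "\<And>x y. x \<in> N \<Longrightarrow> y \<in> N \<Longrightarrow> x + y \<in> N"
    and Nmon: "\<And>c i j. t \<le> i + j \<Longrightarrow> sc c * (a ^ i * b ^ j) \<in> N"
  shows "tlog t a + tlog t b - tlog t (a + b - a * b) \<in> N"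
proof -
  define p q where "p = [:0, a:]" and "q = [:0, b:]"
  define f where "f = log_poly t p + log_poly t q - log_poly t (p + q - p * q)"
  have lin: "p \<in> form_poly a b" "q \<in> form_poly a b"
    unfolding p_def q_def by (rule form_poly_linear)+
  have minus: "x - y \<in> form_poly a b" if "x \<in> form_poly a b" "y \<in> form_poly a b" for x y
  proof -
    have "sc (- 1) = (- 1 :: 'k laur)"
      by (simp add: sc_def single_uminus)
    then have "x - y = x + smult (sc (- 1)) y"
      by simp
    then show ?thesis
      using form_poly_add[OF that(1) form_poly_sc[OF that(2)], of "- 1"] by (simp only:)
  qed
  have lp: "log_poly t x \<in> form_poly a b" if "x \<in> form_poly a b" for x
    unfolding log_poly_def using that by (intro form_poly_sum form_poly_sc form_poly_power)
  have f: "f \<in> form_poly a b"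
    unfolding f_def by (intro minus form_poly_add form_poly_mult lp lin)
  have spanN: "x \<in> N" if "x \<in> form_span a b k" "t \<le> k" for x k
    using that(1)
  proof (induction rule: form_span.induct)
    case (add x i j c)
    show ?case
      by (rule Nadd[OF add.IH Nmon]) (use add.hyps(2) that(2) in simp)
  qed (rule N0)
  have "coeff f k \<in> N" for k
  proof (cases "k < t")
    case True
    then show ?thesis
      using log_mult_poly[OF t True, of a b] N0 by (simp add: f_def p_def q_def)
  next
    case False
    then show ?thesis
      using f spanN[of "coeff f k" k] by (simp add: form_poly_def)
  qed
  then have "(\<Sum>k\<le>n. coeff f k) \<in> N" for n
    by (induction n) (auto intro: Nadd)
  then have "poly f 1 \<in> N"
    by (simp add: poly_altdef)
  then show ?thesis
    by (simp add: f_def poly_log_poly p_def q_def mult.commute)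
qed

section \<open>The class \<open>\<eta>\<close>\<close>

lemma IP_0 [simp]: "0 \<in> IP A n"
  unfolding IP_def using psi_0 FT_0 by (metis imageI)

lemma IP_add: "x \<in> IP A n \<Longrightarrow> y \<in> IP A n \<Longrightarrow> x + y \<in> IP A n"
  unfolding IP_def by (auto simp flip: psi_add intro: FT_add)

lemma IP_diff: "x \<in> IP A n \<Longrightarrow> y \<in> IP A n \<Longrightarrow> x - y \<in> IP A n"
  unfolding IP_def by (auto simp flip: psi_diff intro: FT_diff)

lemma IP_uminus: "x \<in> IP A n \<Longrightarrow> - x \<in> IP A n"
  using IP_diff[of 0 A n x] by simp

lemma IP_sum: "(\<And>i. i \<in> S \<Longrightarrow> f i \<in> IP A n) \<Longrightarrow> (\<Sum>i\<in>S. f i) \<in> IP A n"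
  by (induction S rule: infinite_finite_induct) (auto intro: IP_add)

lemma IP_mult:
  assumes "x \<in> IP A n" "y \<in> IP A m"
  shows "x * y \<in> IP A (n + m)"
proof -
  obtain p q where "p \<in> FT A n" "x = psi p" "q \<in> FT A m" "y = psi q"
    using assms unfolding IP_def by blast
  then show ?thesis
    unfolding IP_def by (intro image_eqI[of _ _ "p * q"]) (simp_all add: psi_mult FT_mult)
qed

lemma IP_zero: "IP A 0 = FT A 0"
  unfolding IP_def using psi_FT0 by (force intro: psi_FT rev_image_eqI)

lemma IP_mult_FT: "x \<in> FT A 0 \<Longrightarrow> y \<in> IP A n \<Longrightarrow> x * y \<in> IP A n"
  using IP_mult[of x A 0 y n] by (simp add: IP_zero)

lemma IP_mult_FT2: "y \<in> IP A n \<Longrightarrow> x \<in> FT A 0 \<Longrightarrow> y * x \<in> IP A n"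
  using IP_mult_FT[of x A y n] by (simp add: mult.commute)

lemma sc_FT: "sc c \<in> FT A 0"
  using FT_sc_mult[OF FT_one, of c A] by simp

lemma IP_sc: "x \<in> IP A n \<Longrightarrow> sc c * x \<in> IP A n"
  by (rule IP_mult_FT[OF sc_FT])

lemma IP_subset: "x \<in> IP A n \<Longrightarrow> x \<in> FT A 0"
  unfolding IP_def using psi_FT by blast

lemma IP_mono: "x \<in> IP A n \<Longrightarrow> A \<subseteq> B \<Longrightarrow> x \<in> IP B n"
  unfolding IP_def using FT_mono by blast

lemma IP_power: "x \<in> IP A 1 \<Longrightarrow> x ^ k \<in> IP A (int k)"
  by (induction k) (auto simp: IP_zero dest: IP_mult)

lemma EA_Suc_cases:
  assumes "e \<in> EA A (n + 1)" "0 \<le> n"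
  obtains g where "g \<in> {TA, TB, TC}" "e - ex g \<in> EA A n"
proof -
  have "1 \<le> lk e TA \<or> 1 \<le> lk e TB \<or> 1 \<le> lk e TC"
    using assms unfolding EA_def tdeg_def mem_Collect_eq by linarith
  then show thesis
  proof (elim disjE)
    assume "1 \<le> lk e TA" then show thesis
      using assms(1) by (intro that[of TA]) (auto simp: EA_def tdeg_def lk_simps)
  next
    assume "1 \<le> lk e TB" then show thesis
      using assms(1) by (intro that[of TB]) (auto simp: EA_def tdeg_def lk_simps)
  next
    assume "1 \<le> lk e TC" then show thesis
      using assms(1) by (intro that[of TC]) (auto simp: EA_def tdeg_def lk_simps)
  qed
qed

lemma ex_T_EA: "g \<in> {TA, TB, TC} \<Longrightarrow> ex g \<in> EA A 1"
  using mn_EA_simps by auto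

lemma psim_split:
  assumes "g \<in> {TA, TB, TC}" "e - ex g \<in> EA A n"
  shows "psim e = psim (e - ex g) * (psim (ex g) :: 'k::field_char_0 laur)"
  using psim_add[OF assms(2) ex_T_EA[OF assms(1)]] by simp

lemma psim_T_FT: "g \<in> {TA, TB, TC} \<Longrightarrow> psim (ex g) \<in> FT A 0"
  by (auto simp: psim_ex D_FT)

lemma psim_IP: "e \<in> EA A n \<Longrightarrow> psim e \<in> IP A n"
  unfolding IP_def using psi_mn FT_mn by (metis imageI)

text \<open>Every term of a form of positive T degree contains a T variable, whose minor can be
  absorbed into the coefficient.\<close>

lemma IP_Suc:
  assumes "x \<in> IP A (n + 1)" "0 \<le> n"
  shows "x \<in> IP A n"
proof -
  obtain F where F: "F \<in> FT A (n + 1)" "x = psi F"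
    using assms(1) by (auto simp: IP_def)
  from F(1) have "psi F \<in> IP A n"
  proof (rule FT_induct)
    fix e and c :: 'a
    assume "e \<in> EA A (n + 1)"
    then obtain g where g: "g \<in> {TA, TB, TC}" "e - ex g \<in> EA A n"
      using assms(2) EA_Suc_cases by blast
    show "psi (sc c * mn e) \<in> IP A n"
      unfolding psi_sc_mn psim_split[OF g] by (intro IP_sc IP_mult_FT2 psim_IP psim_T_FT g)
  qed (simp_all add: psi_add IP_add)
  with F(2) show ?thesis by simp
qed

lemma IP_antimono:
  assumes "x \<in> IP A m" "0 \<le> n" "n \<le> m"
  shows "x \<in> IP A n"
proof -
  have "x \<in> IP A (n + int k) \<Longrightarrow> x \<in> IP A n" for k
  proof (induction k)
    case (Suc k)
    then show ?case
      using IP_Suc[of x A "n + int k"] assms(2) by (simp add: algebra_simps)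
  qed simp
  from this[of "nat (m - n)"] show ?thesis
    using assms by simp
qed

lemma IP_power_ge: "x \<in> IP A 1 \<Longrightarrow> t \<le> k \<Longrightarrow> x ^ k \<in> IP A (int t)"
  using IP_antimono[OF IP_power[of x A k], of "int t"] by simp

lemma D_IP: "(D1 :: 'k::field_char_0 laur) \<in> IP A 1" "(D2 :: 'k laur) \<in> IP A 1" "(D3 :: 'k laur) \<in> IP A 1"
  using psim_IP[OF mn_EA_simps(2), where 'a = 'k] psim_IP[OF mn_EA_simps(3), where 'a = 'k]
    psim_IP[OF mn_EA_simps(4), where 'a = 'k] by (simp_all add: psim_ex)

subsection \<open>Logarithms in the localizations\<close>

text \<open>Equality in the localization of R/I^t at \<open>A\<close>, on representatives.
  Membership in the localization is part of it, so that congruences can be multiplied.\<close>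

definition eqm :: "nat \<Rightarrow> indet set \<Rightarrow> 'k::field_char_0 laur \<Rightarrow> 'k laur \<Rightarrow> bool"
  where "eqm t A x y \<longleftrightarrow> x \<in> FT A 0 \<and> y \<in> FT A 0 \<and> x - y \<in> IP A (int t)"

lemma eqm_refl: "x \<in> FT A 0 \<Longrightarrow> eqm t A x x"
  by (simp add: eqm_def)

lemma eqm_sym: "eqm t A x y \<Longrightarrow> eqm t A y x"
  unfolding eqm_def using IP_uminus[of "x - y" A "int t"] by simp

lemma eqm_trans: "eqm t A x y \<Longrightarrow> eqm t A y z \<Longrightarrow> eqm t A x z"
  unfolding eqm_def using IP_add[of "x - y" A "int t" "y - z"] by simp

lemma eqm_add: "eqm t A x y \<Longrightarrow> eqm t A x' y' \<Longrightarrow> eqm t A (x + x') (y + y')"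
  unfolding eqm_def using IP_add[of "x - y" A "int t" "x' - y'"] by (simp add: FT_add algebra_simps)

lemma eqm_uminus: "eqm t A x y \<Longrightarrow> eqm t A (- x) (- y)"
  unfolding eqm_def using IP_uminus[of "x - y" A "int t"] by (simp add: FT_uminus)

lemma eqm_diff: "eqm t A x y \<Longrightarrow> eqm t A x' y' \<Longrightarrow> eqm t A (x - x') (y - y')"
  using eqm_add[of t A x y "- x'" "- y'"] eqm_uminus[of t A x' y'] by simp

lemma eqm_mult:
  assumes "eqm t A x y" "eqm t A x' y'"
  shows "eqm t A (x * x') (y * y')"
proof -
  have "x * x' - y * y' = x * (x' - y') + (x - y) * y'"
    by (simp add: algebra_simps)
  then show ?thesis
    using assms unfolding eqm_def by (simp add: FT_mult0 IP_add IP_mult_FT IP_mult_FT2)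
qed

lemma eqm_power: "eqm t A x y \<Longrightarrow> eqm t A (x ^ n) (y ^ n)"
  by (induction n) (auto intro: eqm_mult eqm_refl)

lemma eqm_sum: "(\<And>i. i \<in> S \<Longrightarrow> eqm t A (f i) (g i)) \<Longrightarrow> eqm t A (\<Sum>i\<in>S. f i) (\<Sum>i\<in>S. g i)"
  by (induction S rule: infinite_finite_induct) (auto intro: eqm_add eqm_refl)

lemma eqm_mono: "eqm t A x y \<Longrightarrow> A \<subseteq> B \<Longrightarrow> eqm t B x y"
  unfolding eqm_def using IP_mono FT_mono by blast

lemma eqm_tlog: "eqm t A x y \<Longrightarrow> eqm t A (tlog t x) (tlog t y)"
  unfolding tlog_def by (intro eqm_sum eqm_mult eqm_power eqm_refl sc_FT)

lemma tlog_0 [simp]: "tlog t 0 = 0"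
  by (simp add: tlog_def power_0_left)

lemma tlog_FT: "x \<in> FT A 0 \<Longrightarrow> tlog t x \<in> FT A 0"
  unfolding tlog_def by (intro FT_sum FT_sc_mult FT_power)

lemma eqm_log_mult:
  assumes "1 \<le> t" "a \<in> IP A 1" "b \<in> IP A 1"
  shows "eqm t A (tlog t a + tlog t b) (tlog t (a + b - a * b))"
proof -
  have "sc c * (a ^ i * b ^ j) \<in> IP A (int t)" if "t \<le> i + j" for c i j
    using IP_antimono[OF IP_mult[OF IP_power[OF assms(2), of i] IP_power[OF assms(3), of j]], of "int t"] that
    by (intro IP_sc) simp
  then have "tlog t a + tlog t b - tlog t (a + b - a * b) \<in> IP A (int t)"
    by (intro log_mult[OF assms(1)] IP_0 IP_add)
  then show ?thesis
    unfolding eqm_def by (intro conjI FT_add FT_diff FT_mult0 tlog_FT IP_subset[OF assms(2)] IP_subset[OF assms(3)])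
qed

lemma eqm_log_inverse:
  assumes "1 \<le> t" "a \<in> IP A 1" "b \<in> IP A 1" "eqm t A ((1 - a) * (1 - b)) 1"
  shows "eqm t A (tlog t a) (- tlog t b)"
proof -
  have "eqm t A (1 - (1 - a) * (1 - b)) (1 - 1)"
    by (intro eqm_diff assms(4) eqm_refl) simp
  then have "eqm t A (tlog t (a + b - a * b)) (tlog t 0)"
    by (intro eqm_tlog) (simp add: algebra_simps)
  then have "eqm t A (tlog t a + tlog t b) 0"
    using eqm_trans[OF eqm_log_mult[OF assms(1-3)]] by simp
  then have "eqm t A (tlog t a + tlog t b - tlog t b) (0 - tlog t b)"
    by (intro eqm_diff eqm_refl tlog_FT IP_subset[OF assms(3)])
  then show ?thesis
    by simp
qed

section \<open>Inverses modulo I^t and logarithms of quotients of monomials\<close>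

definition is_inv :: "nat \<Rightarrow> indet set \<Rightarrow> 'k::field_char_0 laur \<Rightarrow> 'k laur \<Rightarrow> bool"
  where "is_inv t A x s \<longleftrightarrow> eqm t A (x * s) 1 \<and> x \<in> FT A 0 \<and> s \<in> FT A 0"

lemma is_inv_unique:
  assumes "is_inv t A x s" "is_inv t A x s'"
  shows "eqm t A s s'"
proof -
  have "eqm t A (s * (x * s')) (s * 1)" "eqm t A (s' * (x * s)) (s' * 1)"
    using assms unfolding is_inv_def by (auto intro!: eqm_mult eqm_refl simp del: mult_1_right)
  moreover have "s * (x * s') = s' * (x * s)"
    by (simp only: mult_ac)
  ultimately show ?thesis
    using eqm_trans eqm_sym by (metis mult_1_right)
qed

definition quad :: "indet \<Rightarrow> indet \<Rightarrow> 'k::field_char_0 laur"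
  where "quad i j = mv i * mv j"

text \<open>An inverse of ij modulo I^t when ij - kl is a minor. If i or j is not inverted, then ij
  = kl (1 - d) with d = (kl - ij)/kl in I, and the geometric series in d may stop before
  \<open>t\<close>.\<close>

definition qinv :: "nat \<Rightarrow> indet set \<Rightarrow> indet \<Rightarrow> indet \<Rightarrow> indet \<Rightarrow> indet \<Rightarrow> 'k::field_char_0 laur"
  where "qinv t A i j k l = (if i \<in> A \<and> j \<in> A then mn (- (ex (V i) + ex (V j)))
    else mn (- (ex (V k) + ex (V l))) * (\<Sum>m<t. (- (quad i j - quad k l) * mn (- (ex (V k) + ex (V l)))) ^ m))"

text \<open>One of the two terms of a minor is inverted on \<open>A\<close>. Modulo I^t the other is
  then a unit too, so the logarithm of their quotient makes sense.\<close>

definition gd :: "indet set \<Rightarrow> indet \<Rightarrow> indet \<Rightarrow> indet \<Rightarrow> indet \<Rightarrow> bool"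
  where "gd A i j k l \<longleftrightarrow> (i \<in> A \<and> j \<in> A) \<or> (k \<in> A \<and> l \<in> A)"

lemma quad_FT: "quad i j \<in> FT A 0"
  unfolding quad_def by (intro FT_mult0 mv_FT)

lemma quad_mn: "quad i j = mn (ex (V i) + ex (V j))"
  by (simp add: quad_def mn_add)

lemma mn_neg_FT: "i \<in> A \<Longrightarrow> j \<in> A \<Longrightarrow> mn (- (ex (V i) + ex (V j))) \<in> FT A 0"
  by (intro FT_mn) (auto simp: EA_def lk_simps tdeg_def)

lemma is_inv_qinv:
  assumes D: "(quad i j - quad k l :: 'k::field_char_0 laur) \<in> IP A 1" and "gd A i j k l"
  shows "is_inv t A (quad i j) (qinv t A i j k l :: 'k laur)"
proof (cases "i \<in> A \<and> j \<in> A")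
  case True
  then have "qinv t A i j k l = (mn (- (ex (V i) + ex (V j))) :: 'k laur)"
    by (simp only: qinv_def if_True simp_thms)
  moreover have "quad i j * mn (- (ex (V i) + ex (V j))) = (1 :: 'k laur)"
    by (simp only: quad_mn mn_uminus)
  ultimately show ?thesis
    using mn_neg_FT[of i A j, where 'a = 'k] quad_FT[of i j A, where 'a = 'k] True
    by (simp only: is_inv_def eqm_refl FT_one simp_thms)
next
  case False
  with assms(2) have kl: "k \<in> A" "l \<in> A"
    by (auto simp: gd_def)
  define q where "q = (mn (- (ex (V k) + ex (V l))) :: 'k laur)"
  define d where "d = - (quad i j - quad k l) * q"
  have q: "q \<in> FT A 0" "quad k l * q = 1"
    using mn_neg_FT[OF kl] by (simp_all only: q_def quad_mn mn_uminus)
  have d: "d \<in> IP A 1"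
    unfolding d_def by (intro IP_mult_FT2 IP_uminus D q)
  have s: "qinv t A i j k l = (q :: 'k laur) * (\<Sum>m<t. d ^ m)"
    by (simp only: qinv_def q_def d_def if_not_P[OF False])
  have dF: "(\<Sum>m<t. d ^ m) \<in> FT A 0"
    by (intro FT_sum FT_power IP_subset[OF d])
  have "quad i j * q = 1 - d"
    using q(2) by (simp add: d_def algebra_simps)
  then have "quad i j * qinv t A i j k l = (1 - d :: 'k laur) * (\<Sum>m<t. d ^ m)"
    by (simp only: s flip: mult.assoc)
  also have "\<dots> = 1 - d ^ t"
    by (simp only: one_diff_power_eq)
  finally have "eqm t A (quad i j * qinv t A i j k l) (1 :: 'k laur)"
    using IP_power_ge[OF d, of t t] IP_uminus[of "d ^ t" A "int t"] IP_subset[of "d ^ t" A "int t"]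
    by (simp add: eqm_def FT_diff)
  then show ?thesis
    unfolding is_inv_def s using q dF by (simp add: quad_FT FT_mult0)
qed

text \<open>The truncated logarithm of ij/kl, expanded as -ln(1 - (ij - kl)/ij).\<close>

definition tay :: "nat \<Rightarrow> indet set \<Rightarrow> indet \<Rightarrow> indet \<Rightarrow> indet \<Rightarrow> indet \<Rightarrow> 'k::field_char_0 laur"
  where "tay t A i j k l = tlog t ((quad i j - quad k l) * qinv t A i j k l)"

lemma quad_diff_homog: "homog 2 (quad i j - quad k l :: 'k::field_char_0 laur)"
proof -
  have "homog 2 (quad i j :: 'k laur)" for i j
    using homog_mn[of "ex (V i) + ex (V j)", where 'a = 'k] by (simp add: quad_mn tot_add tot_ex)
  then show ?thesis
    by (intro homog_diff)
qed

lemma homog_tlog: "homog 0 x \<Longrightarrow> homog 0 (tlog t x)"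
  unfolding tlog_def using homog_power[of 0 x] by (intro homog_sum homog_sc_mult) simp

lemma homog_tay: "homog 0 (tay t A i j k l :: 'k::field_char_0 laur)"
proof -
  have tot_neg: "tot (- (ex (V i) + ex (V j))) = - 2" for i j
    using tot_add[of "- (ex (V i) + ex (V j))" "ex (V i) + ex (V j)"] tot_add[of "ex (V i)" "ex (V j)"]
    by (simp add: tot_ex) (simp add: tot_def tdeg_def)
  have m: "homog (- 2) (mn (- (ex (V i) + ex (V j))) :: 'k laur)" for i j
    using homog_mn[of "- (ex (V i) + ex (V j))", where 'a = 'k] by (simp only: tot_neg)
  have "homog (2 + - 2) (- (quad i j - quad k l) * mn (- (ex (V k) + ex (V l))) :: 'k laur)"
    by (intro homog_mult homog_uminus quad_diff_homog m)
  from homog_power[OF this] have "homog 0 (\<Sum>m<t. (- (quad i j - quad k l) * mn (- (ex (V k) + ex (V l))) :: 'k laur) ^ m)"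
    by (intro homog_sum) simp
  then have "homog (- 2 + 0) (mn (- (ex (V k) + ex (V l)))
      * (\<Sum>m<t. (- (quad i j - quad k l) * mn (- (ex (V k) + ex (V l))) :: 'k laur) ^ m))"
    by (intro homog_mult m)
  with m have "homog (- 2) (qinv t A i j k l :: 'k laur)"
    by (simp add: qinv_def)
  from homog_mult[OF quad_diff_homog this] show ?thesis
    unfolding tay_def by (intro homog_tlog) simp
qed

lemma tay_FT:
  assumes "(quad i j - quad k l :: 'k::field_char_0 laur) \<in> IP A 1" "gd A i j k l"
  shows "(tay t A i j k l :: 'k laur) \<in> FT A 0" "(quad i j - quad k l :: 'k laur) * qinv t A i j k l \<in> IP A 1"
proof -
  show *: "(quad i j - quad k l :: 'k laur) * qinv t A i j k l \<in> IP A 1"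
    using is_inv_qinv[OF assms, of t] assms(1) unfolding is_inv_def by (blast intro: IP_mult_FT2)
  show "(tay t A i j k l :: 'k laur) \<in> FT A 0"
    unfolding tay_def by (intro tlog_FT IP_subset[OF *])
qed

text \<open>The formula for \<open>qinv\<close> depends on the face, but inverses are unique modulo
  I^t; logarithms from different faces thus become comparable on a larger one.\<close>

lemma tay_restrict:
  assumes "(quad i j - quad k l :: 'k::field_char_0 laur) \<in> IP A 1" "gd A i j k l" "A \<subseteq> B"
  shows "eqm t B (tay t A i j k l) (tay t B i j k l :: 'k laur)"
proof -
  have gB: "gd B i j k l" and DB: "(quad i j - quad k l :: 'k laur) \<in> IP B 1"
    using assms by (auto simp: gd_def intro: IP_mono)
  have "is_inv t B (quad i j) (qinv t A i j k l :: 'k laur)"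
    using is_inv_qinv[OF assms(1,2), of t] assms(3) unfolding is_inv_def by (blast intro: eqm_mono FT_mono)
  from is_inv_unique[OF this is_inv_qinv[OF DB gB]] show ?thesis
    unfolding tay_def by (intro eqm_tlog eqm_mult eqm_refl IP_subset[OF DB])
qed

text \<open>Modulo I^t each 1 - a is kl/ij, so the equation between products says that (1 - a)(1 -
  a')(1 - a'') = 1; additivity of truncated logarithms does the rest.\<close>

lemma tay_sum:
  assumes D: "(quad i j - quad k l :: 'k::field_char_0 laur) \<in> IP A 1" "(quad i' j' - quad k' l' :: 'k laur) \<in> IP A 1"
      "(quad i'' j'' - quad k'' l'' :: 'k laur) \<in> IP A 1"
    and g: "gd A i j k l" "gd A i' j' k' l'" "gd A i'' j'' k'' l''"
    and eq: "quad i j * quad i' j' * quad i'' j'' = (quad k l * quad k' l' * quad k'' l'' :: 'k laur)"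
    and t: "1 \<le> t"
  shows "eqm t A (tay t A i j k l + tay t A i' j' k' l' + tay t A i'' j'' k'' l'') (0 :: 'k laur)"
proof -
  define s where "s = (qinv t A i j k l :: 'k laur)"
  define s' where "s' = (qinv t A i' j' k' l' :: 'k laur)"
  define s'' where "s'' = (qinv t A i'' j'' k'' l'' :: 'k laur)"
  define a where "a = (quad i j - quad k l) * s"
  define a' where "a' = (quad i' j' - quad k' l') * s'"
  define a'' where "a'' = (quad i'' j'' - quad k'' l'') * s''"
  have inv: "is_inv t A (quad i j) s" "is_inv t A (quad i' j') s'" "is_inv t A (quad i'' j'') s''"
    unfolding s_def s'_def s''_def by (intro is_inv_qinv D g)+
  have aI: "a \<in> IP A 1" "a' \<in> IP A 1" "a'' \<in> IP A 1"
    unfolding a_def a'_def a''_def s_def s'_def s''_def by (intro tay_FT D g)+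
  define c where "c = a + a' - a * a'"
  have cI: "c \<in> IP A 1"
    unfolding c_def using aI by (intro IP_diff IP_add IP_mult_FT IP_subset[OF aI(1)])
  have 1: "eqm t A (1 - ((quad i j - quad k l) * s)) (quad k l * s)"
    if "is_inv t A (quad i j) s" for i j k l and s :: "'k laur"
  proof -
    have "eqm t A (1 - quad i j * s + quad k l * s) (1 - 1 + quad k l * s)"
      using that unfolding is_inv_def by (intro eqm_add eqm_diff eqm_refl FT_one FT_mult0 quad_FT) auto
    then show ?thesis
      by (simp add: algebra_simps)
  qed
  have "eqm t A ((1 - a) * (1 - a') * (1 - a'')) ((quad k l * s) * (quad k' l' * s') * (quad k'' l'' * s''))"
    unfolding a_def a'_def a''_def by (intro eqm_mult 1 inv)
  also have "(quad k l * s) * (quad k' l' * s') * (quad k'' l'' * s'')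
      = (quad k l * quad k' l' * quad k'' l'') * (s * s' * s'')"
    by (simp only: mult_ac)
  also have "\<dots> = (quad i j * s) * (quad i' j' * s') * (quad i'' j'' * s'')"
    unfolding eq[symmetric] by (simp only: mult_ac)
  finally have "eqm t A ((1 - a) * (1 - a') * (1 - a'')) ((quad i j * s) * (quad i' j' * s') * (quad i'' j'' * s''))" .
  moreover have "eqm t A ((quad i j * s) * (quad i' j' * s') * (quad i'' j'' * s'')) (1 * 1 * 1)"
    using inv unfolding is_inv_def by (intro eqm_mult) auto
  moreover have "(1 - a) * (1 - a') = 1 - c"
    by (simp add: c_def algebra_simps)
  ultimately have "eqm t A ((1 - c) * (1 - a'')) 1"
    using eqm_trans by simp
  then have "eqm t A (tlog t c) (- tlog t a'')"
    by (intro eqm_log_inverse[OF t cI aI(3)])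
  with eqm_log_mult[OF t aI(1,2)] have "eqm t A (tlog t a + tlog t a') (- tlog t a'')"
    unfolding c_def by (rule eqm_trans)
  then have "eqm t A (tlog t a + tlog t a' + tlog t a'') (- tlog t a'' + tlog t a'')"
    by (intro eqm_add eqm_refl tlog_FT IP_subset[OF aI(3)])
  then show ?thesis
    by (simp add: tay_def a_def a'_def a''_def s_def s'_def s''_def)
qed

text \<open>Two expansions of ln(ij/kl), in powers of 1 - ij/kl on the left and of 1 - kl/ij on the
  right. They agree modulo I^t because inversion changes the sign of the logarithm.\<close>

lemma tay_swap:
  assumes D: "(quad i j - quad k l :: 'k::field_char_0 laur) \<in> IP A 1" and g: "gd A i j k l" and t: "1 \<le> t"
    and s: "is_inv t A (quad k l) s"
  shows "eqm t A (- tlog t (1 - quad i j * s)) (tay t A i j k l :: 'k laur)"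
proof -
  define r where "r = (qinv t A i j k l :: 'k laur)"
  have r: "is_inv t A (quad i j) r"
    unfolding r_def by (rule is_inv_qinv[OF D g])
  have "eqm t A (1 - quad i j * s) (quad k l * s - quad i j * s)"
    using s quad_FT unfolding is_inv_def by (intro eqm_diff eqm_refl FT_mult0 eqm_sym[of t A "quad k l * s" 1]) auto
  then have *: "eqm t A (tlog t (1 - quad i j * s)) (tlog t (- (quad i j - quad k l) * s))"
    by (intro eqm_tlog) (simp add: algebra_simps)
  have a: "(quad i j - quad k l) * r \<in> IP A 1" "- (quad i j - quad k l) * s \<in> IP A 1"
    using D r s unfolding is_inv_def by (auto intro: IP_mult_FT2 IP_uminus simp del: minus_diff_eq)
  have "eqm t A ((1 - (quad i j - quad k l) * r) * (1 - - (quad i j - quad k l) * s)) 1"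
  proof -
    have "eqm t A ((1 - quad i j * r + quad k l * r) * (1 - quad k l * s + quad i j * s))
        ((1 - 1 + quad k l * r) * (1 - 1 + quad i j * s))"
      using r s unfolding is_inv_def by (intro eqm_mult eqm_add eqm_diff eqm_refl FT_one FT_mult0 quad_FT) auto
    moreover have "(1 - 1 + quad k l * r) * (1 - 1 + quad i j * s) = (quad i j * r) * (quad k l * s)"
      by (simp add: algebra_simps)
    moreover have "eqm t A ((quad i j * r) * (quad k l * s)) (1 * 1)"
      using r s unfolding is_inv_def by (intro eqm_mult) auto
    ultimately show ?thesis
      using eqm_trans by (simp add: algebra_simps)
  qed
  from eqm_log_inverse[OF t a this] have "eqm t A (tay t A i j k l) (- tlog t (- (quad i j - quad k l) * s))"
    by (simp add: tay_def r_def)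
  with eqm_uminus[OF *] show ?thesis
    using eqm_trans eqm_sym by blast
qed

subsection \<open>The cochain and its coboundary\<close>

text \<open>\<open>cf1\<close>, \<open>cf2\<close>, \<open>cf3\<close> are the coefficients of
  ln(vz/wy), ln(wx/uz), ln(uy/vx) in the components of \<open>eta\<close>. On sets of three
  elements, containing a triple means being equal to it.\<close>

definition cf1 :: "indet set \<Rightarrow> int"
  where "cf1 A = (if Ind_w \<in> A \<and> Ind_x \<in> A \<and> Ind_y \<in> A then - 1
    else if (Ind_v \<in> A \<and> Ind_x \<in> A \<and> Ind_z \<in> A) \<or> (Ind_v \<in> A \<and> Ind_y \<in> A \<and> Ind_z \<in> A)
      \<or> (Ind_w \<in> A \<and> Ind_y \<in> A \<and> Ind_z \<in> A) then 1 else 0)"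

definition cf2 :: "indet set \<Rightarrow> int"
  where "cf2 A = (if (Ind_w \<in> A \<and> Ind_x \<in> A \<and> Ind_y \<in> A) \<or> (Ind_u \<in> A \<and> Ind_x \<in> A \<and> Ind_z \<in> A)
    \<or> (Ind_w \<in> A \<and> Ind_x \<in> A \<and> Ind_z \<in> A) \<or> (Ind_u \<in> A \<and> Ind_y \<in> A \<and> Ind_z \<in> A) then - 1 else 0)"

definition cf3 :: "indet set \<Rightarrow> int"
  where "cf3 A = (if Ind_u \<in> A \<and> Ind_y \<in> A \<and> Ind_z \<in> A then - 1
    else if (Ind_u \<in> A \<and> Ind_x \<in> A \<and> Ind_y \<in> A) \<or> (Ind_v \<in> A \<and> Ind_x \<in> A \<and> Ind_y \<in> A)
      \<or> (Ind_v \<in> A \<and> Ind_x \<in> A \<and> Ind_z \<in> A) then 1 else 0)"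

definition tay1 :: "nat \<Rightarrow> indet set \<Rightarrow> 'k::field_char_0 laur"
  where "tay1 t A = tay t A Ind_v Ind_z Ind_w Ind_y"

definition tay2 :: "nat \<Rightarrow> indet set \<Rightarrow> 'k::field_char_0 laur"
  where "tay2 t A = tay t A Ind_w Ind_x Ind_u Ind_z"

definition tay3 :: "nat \<Rightarrow> indet set \<Rightarrow> 'k::field_char_0 laur"
  where "tay3 t A = tay t A Ind_u Ind_y Ind_v Ind_x"

definition etaL :: "nat \<Rightarrow> indet set \<Rightarrow> 'k::field_char_0 laur"
  where "etaL t A = of_int (cf1 A) * tay1 t A + of_int (cf2 A) * tay2 t A + of_int (cf3 A) * tay3 t A"

abbreviation "gd1 A \<equiv> gd A Ind_v Ind_z Ind_w Ind_y"
abbreviation "gd2 A \<equiv> gd A Ind_w Ind_x Ind_u Ind_z"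
abbreviation "gd3 A \<equiv> gd A Ind_u Ind_y Ind_v Ind_x"

lemma cf_gd: "cf1 A \<noteq> 0 \<Longrightarrow> gd1 A" "cf2 A \<noteq> 0 \<Longrightarrow> gd2 A" "cf3 A \<noteq> 0 \<Longrightarrow> gd3 A"
  by (auto simp: cf1_def cf2_def cf3_def gd_def split: if_splits)

lemma D_quad: "quad Ind_v Ind_z - quad Ind_w Ind_y = D1" "quad Ind_w Ind_x - quad Ind_u Ind_z = D2"
  "quad Ind_u Ind_y - quad Ind_v Ind_x = D3"
  by (simp_all add: quad_def D1_def D2_def D3_def)

lemma indet_set_eq_iff: "A = B \<longleftrightarrow> (Ind_u \<in> A \<longleftrightarrow> Ind_u \<in> B) \<and> (Ind_v \<in> A \<longleftrightarrow> Ind_v \<in> B) \<and>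
  (Ind_w \<in> A \<longleftrightarrow> Ind_w \<in> B) \<and> (Ind_x \<in> A \<longleftrightarrow> Ind_x \<in> B) \<and> (Ind_y \<in> A \<longleftrightarrow> Ind_y \<in> B) \<and> (Ind_z \<in> A \<longleftrightarrow> Ind_z \<in> B)"
proof -
  have "(\<forall>i. P i) \<longleftrightarrow> P Ind_u \<and> P Ind_v \<and> P Ind_w \<and> P Ind_x \<and> P Ind_y \<and> P Ind_z" for P
  proof
    assume *: "P Ind_u \<and> P Ind_v \<and> P Ind_w \<and> P Ind_x \<and> P Ind_y \<and> P Ind_z"
    show "\<forall>i. P i"
    proof
      fix i show "P i"
        using * by (cases i) auto
    qed
  qed simp
  then show ?thesis
    unfolding set_eq_iff .
qed

lemma card_indet_set: "card A = of_bool (Ind_u \<in> A) + of_bool (Ind_v \<in> A) + of_bool (Ind_w \<in> A)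
  + of_bool (Ind_x \<in> A) + of_bool (Ind_y \<in> A) + of_bool (Ind_z \<in> A)"
proof -
  have "card A = (\<Sum>i\<in>UNIV. of_bool (i \<in> A))"
    by simp
  then show ?thesis
    by (simp add: UNIV_indet del: sum_of_bool_eq)
qed

lemma card_4_cases:
  assumes "card B = 4"
  shows "B \<in> {{Ind_u, Ind_v, Ind_w, Ind_x}, {Ind_u, Ind_v, Ind_w, Ind_y}, {Ind_u, Ind_v, Ind_w, Ind_z},
    {Ind_u, Ind_v, Ind_x, Ind_y}, {Ind_u, Ind_v, Ind_x, Ind_z}, {Ind_u, Ind_v, Ind_y, Ind_z},
    {Ind_u, Ind_w, Ind_x, Ind_y}, {Ind_u, Ind_w, Ind_x, Ind_z}, {Ind_u, Ind_w, Ind_y, Ind_z},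
    {Ind_u, Ind_x, Ind_y, Ind_z}, {Ind_v, Ind_w, Ind_x, Ind_y}, {Ind_v, Ind_w, Ind_x, Ind_z},
    {Ind_v, Ind_w, Ind_y, Ind_z}, {Ind_v, Ind_x, Ind_y, Ind_z}, {Ind_w, Ind_x, Ind_y, Ind_z}}"
  using assms unfolding card_indet_set
  by (cases "Ind_u \<in> B"; cases "Ind_v \<in> B"; cases "Ind_w \<in> B"; cases "Ind_x \<in> B"; cases "Ind_y \<in> B"; cases "Ind_z \<in> B")
    (simp_all only: of_bool_eq, simp_all add: indet_set_eq_iff[of B])

lemma csgn_empty: "csgn b {} = 1"
  by (simp add: csgn_def)

text \<open>The reason why \<open>eta\<close> is a cocycle: the three coefficient cochains have the
  same coboundary, so that of \<open>eta\<close> is a multiple of the sum of the three logarithms,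
  and all of these exist wherever the multiple is nonzero.\<close>

lemma cf_cd:
  assumes "card B = 4"
  shows "cd cf2 B = cd cf1 B \<and> cd cf3 B = cd cf1 B \<and> (cd cf1 B \<noteq> 0 \<longrightarrow> gd1 B \<and> gd2 B \<and> gd3 B)"
  using card_4_cases[OF assms] unfolding insert_iff empty_iff
  by (elim disjE FalseE; simp only:;
      simp add: cd_def csgn_insert csgn_empty less_indet_def gd_def cf1_def cf2_def cf3_def)

text \<open>The congruence is asked for nonzero \<open>c\<close> only: a logarithm with coefficient
  0 on a face need not lie in the localization there.\<close>

lemma eqm_of_int:
  assumes "c \<noteq> 0 \<Longrightarrow> eqm t A x (y :: 'k::field_char_0 laur)"
  shows "eqm t A (of_int c * x) (of_int c * y)"
proof (cases "c = 0")
  case False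
  have "(of_int c :: 'k laur) = sc (of_int c)"
    by (simp only: sc_def single_of_int)
  then show ?thesis
    using assms[OF False] by (simp add: eqm_mult eqm_refl sc_FT)
qed (simp add: eqm_refl)

lemma csgn_of_int: "csgn b B = of_int (csgn b B)"
  by (simp add: csgn_def)

lemma etaL_FT: "etaL t A \<in> FT A 0"
proof -
  have "of_int c * x \<in> FT A 0" if "c \<noteq> 0 \<Longrightarrow> x \<in> FT A 0" for c and x :: "'a laur"
    using eqm_of_int[of c t A x x] that eqm_refl by (auto simp: eqm_def)
  then show ?thesis
    unfolding etaL_def tay1_def tay2_def tay3_def
    by (intro FT_add) (simp_all add: tay_FT D_quad D_IP cf_gd)
qed

lemma homog_etaL: "homog 0 (etaL t A :: 'k::field_char_0 laur)"
proof -
  have "homog 0 (of_int c * x)" if "homog 0 x" for c and x :: "'k laur"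
  proof -
    have "(of_int c :: 'k laur) = sc (of_int c)"
      by (simp only: sc_def single_of_int)
    then show ?thesis
      using homog_sc_mult[OF that] by simp
  qed
  then show ?thesis
    unfolding etaL_def tay1_def tay2_def tay3_def by (intro homog_add) (simp_all add: homog_tay)
qed

lemma etaL_cocycle:
  assumes t: "1 \<le> t" and B: "card B = 4"
  shows "cd (etaL t) B \<in> IP B (int t)"
proof -
  have R: "eqm t B (of_int (cf1 A) * tay1 t A) (of_int (cf1 A) * tay1 t B)"
    "eqm t B (of_int (cf2 A) * tay2 t A) (of_int (cf2 A) * tay2 t B)"
    "eqm t B (of_int (cf3 A) * tay3 t A) (of_int (cf3 A) * tay3 t B :: 'a laur)" if "A \<subseteq> B" for A
    unfolding tay1_def tay2_def tay3_def
    by (intro eqm_of_int tay_restrict that cf_gd; simp add: D_quad D_IP)+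
  have "eqm t B (csgn b B * etaL t (B - {b}))
      (of_int (csgn b B) * (of_int (cf1 (B - {b})) * tay1 t B + of_int (cf2 (B - {b})) * tay2 t B
        + of_int (cf3 (B - {b})) * tay3 t B :: 'a laur))" for b
    unfolding etaL_def csgn_of_int[of b B, where 'a = "'a laur"] by (intro eqm_of_int eqm_add R Diff_subset)
  then have "eqm t B (cd (etaL t) B)
      (\<Sum>b\<in>B. of_int (csgn b B) * (of_int (cf1 (B - {b})) * tay1 t B + of_int (cf2 (B - {b})) * tay2 t B
        + of_int (cf3 (B - {b})) * tay3 t B :: 'a laur))"
    unfolding cd_def by (intro eqm_sum)
  also have "(\<Sum>b\<in>B. of_int (csgn b B) * (of_int (cf1 (B - {b})) * tay1 t B + of_int (cf2 (B - {b})) * tay2 t B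
        + of_int (cf3 (B - {b})) * tay3 t B :: 'a laur))
      = of_int (cd cf1 B) * tay1 t B + of_int (cd cf2 B) * tay2 t B + of_int (cd cf3 B) * tay3 t B"
    by (simp add: cd_def sum_distrib_right sum.distrib ring_distribs mult.assoc)
  also have "\<dots> = of_int (cd cf1 B) * (tay1 t B + tay2 t B + tay3 t B)"
    using cf_cd[OF B] by (simp add: ring_distribs)
  finally have *: "eqm t B (cd (etaL t) B) (of_int (cd cf1 B) * (tay1 t B + tay2 t B + tay3 t B :: 'a laur))" .
  have "eqm t B (of_int (cd cf1 B) * (tay1 t B + tay2 t B + tay3 t B :: 'a laur)) (of_int (cd cf1 B) * 0)"
  proof (rule eqm_of_int)
    assume "cd cf1 B \<noteq> 0"
    then have "gd1 B" "gd2 B" "gd3 B"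
      using cf_cd[OF B] by auto
    then show "eqm t B (tay1 t B + tay2 t B + tay3 t B :: 'a laur) 0"
      unfolding tay1_def tay2_def tay3_def
      by (intro tay_sum t) (simp_all add: D_quad D_IP, simp add: quad_def mult_ac)
  qed
  with * have "eqm t B (cd (etaL t) B :: 'a laur) (of_int (cd cf1 B) * 0)"
    by (rule eqm_trans)
  then show ?thesis
    by (simp add: eqm_def)
qed

subsection \<open>A functional that detects \<open>\<eta>\<close>\<close>

text \<open>The terms whose row sums and column sums vanish form the part of multidegree \<open>0\<close>; on this
  part \<open>detect\<close> is the derivation \<open>u\<partial>/\<partial>u\<close> followed by evaluation at the matrix of ones, and
  thus it annihilates \<open>I\<^sup>2\<close>.\<close>

definition bal :: "exps \<Rightarrow> bool"
  where "bal e \<longleftrightarrow> lk e (V Ind_u) + lk e (V Ind_v) + lk e (V Ind_w) = 0 \<and>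
    lk e (V Ind_x) + lk e (V Ind_y) + lk e (V Ind_z) = 0 \<and>
    lk e (V Ind_u) + lk e (V Ind_x) = 0 \<and> lk e (V Ind_v) + lk e (V Ind_y) = 0 \<and> lk e (V Ind_w) + lk e (V Ind_z) = 0"

definition detect :: "'k::field_char_0 laur \<Rightarrow> 'k laur"
  where "detect = lin (\<lambda>e. if bal e then of_int (lk e (V Ind_u)) else 0)"

lemma detect_add: "detect (x + y) = detect x + detect y" and detect_diff: "detect (x - y) = detect x - detect y"
  and detect_0 [simp]: "detect 0 = 0"
  by (simp_all add: detect_def lin_add lin_diff)

lemma detect_sc_mn: "detect (sc c * mn e) = sc c * (if bal e then of_int (lk e (V Ind_u)) else 0)"
  by (simp add: detect_def flip: single_eq_sc_mn)

text \<open>The two terms of a minor have equal row and column sums, so \<open>bal\<close> is the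
  same for all four products; the exponent of u is additive, and its second difference over them
  vanishes.\<close>

lemma detect_two_minors:
  assumes "g \<in> {TA, TB, TC}" "h \<in> {TA, TB, TC}"
  shows "detect (sc c * (mn f * psim (ex g) * psim (ex h) :: 'k::field_char_0 laur)) = 0"
proof -
  \<comment> \<open>\<open>P\<close> and \<open>Q\<close> give the exponents of the positive and the
    negative term of each minor.\<close>
  define P where "P g = (if g = TA then ex (V Ind_v) + ex (V Ind_z) else if g = TB then ex (V Ind_w) + ex (V Ind_x)
    else ex (V Ind_u) + ex (V Ind_y))" for g
  define Q where "Q g = (if g = TA then ex (V Ind_w) + ex (V Ind_y) else if g = TB then ex (V Ind_u) + ex (V Ind_z)
    else ex (V Ind_v) + ex (V Ind_x))" for g
  have D: "psim (ex g) = mn (P g) - (mn (Q g) :: 'k laur)" if "g \<in> {TA, TB, TC}" for g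
    using that by (auto simp: psim_ex P_def Q_def D1_def D2_def D3_def mn_add)
  have balQ: "bal (e + Q g) = bal (e + P g)" if "g \<in> {TA, TB, TC}" for e g
    using that by (auto simp: bal_def P_def Q_def lk_simps)
  have "sc c * (mn f * psim (ex g) * psim (ex h)) = sc c * mn (f + P h + P g) - sc c * mn (f + Q h + P g)
      - (sc c * mn (f + P h + Q g) - sc c * (mn (f + Q h + Q g) :: 'k laur))"
    unfolding D[OF assms(1)] D[OF assms(2)] by (simp add: mn_add algebra_simps)
  then have "detect (sc c * (mn f * psim (ex g) * psim (ex h) :: 'k laur)) =
      detect (sc c * mn (f + P h + P g)) - detect (sc c * mn (f + Q h + P g))
      - (detect (sc c * mn (f + P h + Q g)) - detect (sc c * (mn (f + Q h + Q g) :: 'k laur)))"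
    by (simp only: detect_diff)
  also have "\<dots> = 0"
  proof -
    have b1: "bal (f + Q h + P g) = bal (f + P h + P g)"
      using balQ[OF assms(2), of "f + P g"] by (simp only: add_ac)
    have b2: "bal (f + P h + Q g) = bal (f + P h + P g)"
      by (rule balQ[OF assms(1)])
    have b3: "bal (f + Q h + Q g) = bal (f + P h + P g)"
      using balQ[OF assms(1), of "f + Q h"] b1 by simp
    show ?thesis
      unfolding detect_sc_mn b1 b2 b3 by (simp add: lookup_add ring_distribs)
  qed
  finally show ?thesis .
qed

lemma detect_IP:
  assumes "x \<in> IP A n" "2 \<le> n"
  shows "detect (x :: 'k::field_char_0 laur) = 0"
proof -
  have "x \<in> IP A 2"
    using IP_antimono[OF assms(1)] assms(2) by simp
  then obtain F where F: "F \<in> FT A 2" "x = psi F"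
    by (auto simp: IP_def)
  from F(1) have "detect (psi F) = 0"
  proof (rule FT_induct)
    fix e and c :: 'k
    assume "e \<in> EA A 2"
    then have "e \<in> EA A (1 + 1)"
      by simp
    then obtain g where g: "g \<in> {TA, TB, TC}" "e - ex g \<in> EA A 1"
      using EA_Suc_cases[of e A 1] by auto
    have "e - ex g \<in> EA A (0 + 1)"
      using g by simp
    then obtain h where h: "h \<in> {TA, TB, TC}" "e - ex g - ex h \<in> EA A 0"
      using EA_Suc_cases[of "e - ex g" A 0] by auto
    have "psim (e - ex g - ex h) = (mn (e - ex g - ex h) :: 'k laur)"
      using psi_FT0[OF FT_mn[OF h(2)], where 'a = 'k] by (simp add: psi_mn)
    then have "psim e = mn (e - ex g - ex h) * psim (ex h) * (psim (ex g) :: 'k laur)"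
      by (simp only: psim_split[OF g] psim_split[OF h])
    then show "detect (psi (sc c * mn e)) = 0"
      unfolding psi_sc_mn using detect_two_minors[OF h(1) g(1)] by simp
  qed (simp_all add: psi_add detect_add)
  with F(2) show ?thesis by simp
qed

text \<open>For these pairs, nonnegativity outside \<open>A\<close> and vanishing row and column
  sums force the exponent of u to be 0. The pair uy is absent: it admits vx/uy.\<close>

lemma detect_FT:
  assumes "x \<in> FT A 0" and A: "A \<in> {{Ind_x, Ind_y}, {Ind_u, Ind_x}, {Ind_v, Ind_y}, {Ind_u, Ind_v}}"
  shows "detect (x :: 'k::field_char_0 laur) = 0"
  using assms(1)
proof (rule FT_induct)
  fix e and c :: 'k
  assume e: "e \<in> EA A 0"
  have nn: "0 \<le> lk e (V i)" if "i \<notin> A" for i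
    using e that by (simp add: EA_def)
  have "lk e (V Ind_u) = 0" if "bal e"
    using that A nn[of Ind_u] nn[of Ind_v] nn[of Ind_w] nn[of Ind_x] nn[of Ind_y] nn[of Ind_z]
    unfolding bal_def by auto
  then show "detect (sc c * mn e) = 0"
    by (simp add: detect_sc_mn)
qed (simp_all add: detect_add)

text \<open>The faces uxy and uvy share the edge uy, which enters both coboundaries with the same
  sign, and \<open>detect\<close> vanishes on the other four edges involved. A coboundary thus has
  equal values on the two faces, but \<open>eta\<close> gives 1 on the first and 0 on the
  second.\<close>

lemma etaL_not_boundary:
  assumes t: "2 \<le> t"
  shows "\<not> (\<exists>b. (\<forall>A. card A = 2 \<longrightarrow> b A \<in> FT A 0) \<and>
    (\<forall>A. card A = 3 \<longrightarrow> etaL t A - cd b A \<in> IP A (int t)))"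
proof
  assume "\<exists>b. (\<forall>A. card A = 2 \<longrightarrow> b A \<in> FT A 0) \<and> (\<forall>A. card A = 3 \<longrightarrow> etaL t A - (cd b A :: 'a laur) \<in> IP A (int t))"
  then obtain b where b: "\<And>A. card A = 2 \<Longrightarrow> b A \<in> FT A 0"
    and eq: "\<And>A. card A = 3 \<Longrightarrow> etaL t A - (cd b A :: 'a laur) \<in> IP A (int t)"
    by blast
  have d: "detect (etaL t A) = detect (cd b A)" if "card A = 3" for A
    using detect_IP[OF eq[OF that]] t by (simp add: detect_diff)
  have b0: "detect (b A) = 0" if "A \<in> {{Ind_x, Ind_y}, {Ind_u, Ind_x}, {Ind_v, Ind_y}, {Ind_u, Ind_v}}" for A
    by (rule detect_FT[OF b that]) (use that in auto)
  define A1 A2 where "A1 = {Ind_u, Ind_x, Ind_y}" and "A2 = {Ind_u, Ind_v, Ind_y}"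
  have c: "card A1 = 3" "card A2 = 3"
    by (simp_all add: A1_def A2_def)
  have "cd b A1 = b {Ind_x, Ind_y} - b {Ind_u, Ind_y} + b {Ind_u, Ind_x}"
    by (simp add: cd_def A1_def csgn_insert csgn_empty insert_Diff_if less_indet_def)
  then have 1: "detect (etaL t A1) = - detect (b {Ind_u, Ind_y})"
    using d[OF c(1)] b0[of "{Ind_x, Ind_y}"] b0[of "{Ind_u, Ind_x}"] by (simp add: detect_add detect_diff)
  have "cd b A2 = b {Ind_v, Ind_y} - b {Ind_u, Ind_y} + b {Ind_u, Ind_v}"
    by (simp add: cd_def A2_def csgn_insert csgn_empty insert_Diff_if less_indet_def)
  then have 2: "detect (etaL t A2) = - detect (b {Ind_u, Ind_y})"
    using d[OF c(2)] b0[of "{Ind_v, Ind_y}"] b0[of "{Ind_u, Ind_v}"] by (simp add: detect_add detect_diff)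
  have "etaL t A2 = (0 :: 'a laur)"
    by (simp add: etaL_def A2_def cf1_def cf2_def cf3_def)
  with 1 2 have "detect (etaL t A1 :: 'a laur) = 0"
    by simp
  moreover have "etaL t A1 = (tay3 t A1 :: 'a laur)"
    by (simp add: etaL_def A1_def cf1_def cf2_def cf3_def)
  moreover have "detect (tay3 t A1 :: 'a laur) = 1"
  proof -
    \<comment> \<open>On this face uy is inverted, so x is exactly 1 - vx/uy; the second term has
      exponent -1 at u, whence \<open>detect x = 1\<close>.\<close>
    define x where "x = (D3 * qinv t A1 Ind_u Ind_y Ind_v Ind_x :: 'a laur)"
    define k where "k = ex (V Ind_v) + ex (V Ind_x) - ex (V Ind_u) - ex (V Ind_y)"
    have "qinv t A1 Ind_u Ind_y Ind_v Ind_x = (mn (- (ex (V Ind_u) + ex (V Ind_y))) :: 'a laur)"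
      by (simp only: qinv_def A1_def insert_iff simp_thms if_True)
    then have "x = mn (ex (V Ind_u) + ex (V Ind_y) + - (ex (V Ind_u) + ex (V Ind_y)))
        - mn (ex (V Ind_v) + ex (V Ind_x) + - (ex (V Ind_u) + ex (V Ind_y)))"
      by (simp only: x_def D3_def mn_add left_diff_distrib)
    then have x: "x = sc 1 * mn 0 - sc 1 * mn k"
      by (simp add: k_def algebra_simps)
    have "x \<in> IP A1 1"
      unfolding x_def D_quad[symmetric] by (intro tay_FT) (simp_all add: D_quad D_IP gd_def A1_def)
    have "detect x = 1"
      unfolding x detect_diff detect_sc_mn by (simp add: bal_def k_def lk_simps)
    have s1: "sc (1 / of_nat 1) * x ^ 1 = x"
      by simp
    have "tlog t x = sc (1 / of_nat 1) * x ^ 1 + (\<Sum>m\<in>{1..<t} - {1}. sc (1 / of_nat m) * x ^ m)"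
      unfolding tlog_def using t by (intro sum.remove) auto
    \<comment> \<open>All terms beyond the first lie in I^2, which \<open>detect\<close>
      annihilates.\<close>
    moreover have "(\<Sum>m\<in>{1..<t} - {1}. sc (1 / of_nat m) * x ^ m) \<in> IP A1 2"
    proof (intro IP_sum IP_sc)
      fix m assume "m \<in> {1..<t} - {1}"
      then show "x ^ m \<in> IP A1 2"
        using IP_power_ge[OF \<open>x \<in> IP A1 1\<close>, of 2 m] by simp
    qed
    ultimately have "detect (tlog t x) = 1"
      using detect_IP[of _ A1 2] \<open>detect x = 1\<close> unfolding s1 by (simp add: detect_add)
    then show ?thesis
      by (simp add: tay3_def tay_def x_def D_quad)
  qed
  ultimately show False
    by simp
qed

section \<open>Rings of fractions\<close>

text \<open>Zero divisors in \<open>S\<close> are allowed. The instances are R/I^t with the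
  monomials in \<open>A\<close> and the adic completion with its nonzero elements.\<close>

locale frac_ring = cring R for R (structure) +
  fixes S :: "'a set"
  assumes S_sub: "S \<subseteq> carrier R" and S_one: "\<one> \<in> S"
    and S_mult: "s \<in> S \<Longrightarrow> s' \<in> S \<Longrightarrow> s \<otimes> s' \<in> S"
begin

lemma S_carr [simp]: "s \<in> S \<Longrightarrow> s \<in> carrier R"
  using S_sub by blast

lemma frac_rel_iff: "((r, s), (r', s')) \<in> frac_rel R S \<longleftrightarrow> r \<in> carrier R \<and> r' \<in> carrier R \<and> s \<in> S \<and> s' \<in> S \<and>
    (\<exists>q\<in>S. q \<otimes> (r \<otimes> s') = q \<otimes> (r' \<otimes> s))"
  by (simp add: frac_rel_def)

lemma frac_rel_trans:
  assumes "((r, s), (r', s')) \<in> frac_rel R S" "((r', s'), (r'', s'')) \<in> frac_rel R S"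
  shows "((r, s), (r'', s'')) \<in> frac_rel R S"
proof -
  obtain q where q: "q \<in> S" "q \<otimes> (r \<otimes> s') = q \<otimes> (r' \<otimes> s)"
    and 1: "r \<in> carrier R" "r' \<in> carrier R" "s \<in> S" "s' \<in> S"
    using assms(1) unfolding frac_rel_iff by blast
  obtain q' where q': "q' \<in> S" "q' \<otimes> (r' \<otimes> s'') = q' \<otimes> (r'' \<otimes> s')"
    and 2: "r'' \<in> carrier R" "s'' \<in> S"
    using assms(2) unfolding frac_rel_iff by blast
  note c = 1 2 q(1) q'(1)
  have "(q \<otimes> q' \<otimes> s') \<otimes> (r \<otimes> s'') = (q' \<otimes> s'') \<otimes> (q \<otimes> (r \<otimes> s'))"
    using c by (simp add: m_ac)
  also have "\<dots> = (q \<otimes> s) \<otimes> (q' \<otimes> (r' \<otimes> s''))"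
    unfolding q(2) using c by (simp add: m_ac)
  also have "\<dots> = (q \<otimes> q' \<otimes> s') \<otimes> (r'' \<otimes> s)"
    unfolding q'(2) using c by (simp add: m_ac)
  finally have "(q \<otimes> q' \<otimes> s') \<otimes> (r \<otimes> s'') = (q \<otimes> q' \<otimes> s') \<otimes> (r'' \<otimes> s)" .
  moreover have "q \<otimes> q' \<otimes> s' \<in> S"
    using c by (intro S_mult)
  ultimately show ?thesis
    using c unfolding frac_rel_iff by blast
qed

lemma frac_rel_equiv: "equiv (carrier R \<times> S) (frac_rel R S)"
proof (rule equivI)
  show "frac_rel R S \<subseteq> (carrier R \<times> S) \<times> (carrier R \<times> S)"
    by (auto simp: frac_rel_def)
  show "refl_on (carrier R \<times> S) (frac_rel R S)"
    using S_one by (auto simp: refl_on_def frac_rel_def)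
  show "sym (frac_rel R S)"
    by (auto simp: sym_def frac_rel_def dest: sym)
  show "trans (frac_rel R S)"
    unfolding trans_def using frac_rel_trans by fast
qed

lemma frac_eq_rel:
  "r \<in> carrier R \<Longrightarrow> s \<in> S \<Longrightarrow> r' \<in> carrier R \<Longrightarrow> s' \<in> S \<Longrightarrow>
    frac R S r s = frac R S r' s' \<longleftrightarrow> ((r, s), (r', s')) \<in> frac_rel R S"
  unfolding frac_def by (rule eq_equiv_class_iff[OF frac_rel_equiv]) auto

lemma frac_eq:
  "r \<in> carrier R \<Longrightarrow> s \<in> S \<Longrightarrow> r' \<in> carrier R \<Longrightarrow> s' \<in> S \<Longrightarrow>
    frac R S r s = frac R S r' s' \<longleftrightarrow> (\<exists>q\<in>S. q \<otimes> (r \<otimes> s') = q \<otimes> (r' \<otimes> s))"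
  by (simp add: frac_eq_rel frac_rel_iff)

lemma frac_eqI:
  "r \<in> carrier R \<Longrightarrow> s \<in> S \<Longrightarrow> r' \<in> carrier R \<Longrightarrow> s' \<in> S \<Longrightarrow> r \<otimes> s' = r' \<otimes> s \<Longrightarrow>
    frac R S r s = frac R S r' s'"
  using S_one by (auto simp: frac_eq)

lemma mem_frac: "(a, b) \<in> frac R S r s \<longleftrightarrow> ((r, s), (a, b)) \<in> frac_rel R S"
  by (simp add: frac_def)

lemma frac_self: "r \<in> carrier R \<Longrightarrow> s \<in> S \<Longrightarrow> (r, s) \<in> frac R S r s"
  using S_one by (auto simp: mem_frac frac_rel_iff)

lemma mem_fracD:
  assumes "(a, b) \<in> frac R S r s"
  shows "a \<in> carrier R" "b \<in> S" "r \<in> carrier R" "s \<in> S" "\<exists>q\<in>S. q \<otimes> (r \<otimes> b) = q \<otimes> (a \<otimes> s)"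
  using assms by (simp_all add: mem_frac frac_rel_iff)

lemma localization_carrier: "carrier (localization R S) = {frac R S r s | r s. r \<in> carrier R \<and> s \<in> S}"
  by (auto simp: localization_def quotient_def frac_def)

text \<open>The operations of \<open>localization\<close> are unions over all pairs of
  representatives; well-definedness collapses such a union to a single value.\<close>

lemma UN2_const:
  assumes "\<And>a b c d. (a, b) \<in> C \<Longrightarrow> (c, d) \<in> D \<Longrightarrow> f a b c d = E" "(a, b) \<in> C" "(c, d) \<in> D"
  shows "(\<Union>(r, s)\<in>C. \<Union>(r', s')\<in>D. f r s r' s') = E"
  using assms by fastforce

lemma localization_mult:
  assumes "r \<in> carrier R" "s \<in> S" "r' \<in> carrier R" "s' \<in> S"
  shows "frac R S r s \<otimes>\<^bsub>localization R S\<^esub> frac R S r' s' = frac R S (r \<otimes> r') (s \<otimes> s')"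
proof -
  have "frac R S (a \<otimes> a') (b \<otimes> b') = frac R S (r \<otimes> r') (s \<otimes> s')"
    if m: "(a, b) \<in> frac R S r s" "(a', b') \<in> frac R S r' s'" for a b a' b'
  proof -
    note d = mem_fracD[OF m(1)] mem_fracD[OF m(2)]
    obtain q where q: "q \<in> S" "q \<otimes> (r \<otimes> b) = q \<otimes> (a \<otimes> s)"
      using d(5) by blast
    obtain q' where q': "q' \<in> S" "q' \<otimes> (r' \<otimes> b') = q' \<otimes> (a' \<otimes> s')"
      using d(10) by blast
    note c = d(1-4) d(6-9) q(1) q'(1)
    have "(q \<otimes> q') \<otimes> ((a \<otimes> a') \<otimes> (s \<otimes> s')) = (q \<otimes> (a \<otimes> s)) \<otimes> (q' \<otimes> (a' \<otimes> s'))"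
      using c by (simp add: m_ac)
    also have "\<dots> = (q \<otimes> q') \<otimes> ((r \<otimes> r') \<otimes> (b \<otimes> b'))"
      unfolding q(2)[symmetric] q'(2)[symmetric] using c by (simp add: m_ac)
    finally show ?thesis
      using c S_mult[OF q(1) q'(1)] by (subst frac_eq) (auto intro: S_mult)
  qed
  then show ?thesis
    unfolding localization_def monoid.select_convs
    by (rule UN2_const[OF _ frac_self[OF assms(1,2)] frac_self[OF assms(3,4)]])
qed

lemma localization_add:
  assumes "r \<in> carrier R" "s \<in> S" "r' \<in> carrier R" "s' \<in> S"
  shows "frac R S r s \<oplus>\<^bsub>localization R S\<^esub> frac R S r' s' = frac R S ((r \<otimes> s') \<oplus> (r' \<otimes> s)) (s \<otimes> s')"
proof -
  have "frac R S ((a \<otimes> b') \<oplus> (a' \<otimes> b)) (b \<otimes> b') = frac R S ((r \<otimes> s') \<oplus> (r' \<otimes> s)) (s \<otimes> s')"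
    if m: "(a, b) \<in> frac R S r s" "(a', b') \<in> frac R S r' s'" for a b a' b'
  proof -
    note d = mem_fracD[OF m(1)] mem_fracD[OF m(2)]
    obtain q where q: "q \<in> S" "q \<otimes> (r \<otimes> b) = q \<otimes> (a \<otimes> s)"
      using d(5) by blast
    obtain q' where q': "q' \<in> S" "q' \<otimes> (r' \<otimes> b') = q' \<otimes> (a' \<otimes> s')"
      using d(10) by blast
    note c = d(1-4) d(6-9) q(1) q'(1)
    have "(q \<otimes> q') \<otimes> (((a \<otimes> b') \<oplus> (a' \<otimes> b)) \<otimes> (s \<otimes> s'))
        = (q' \<otimes> (b' \<otimes> s')) \<otimes> (q \<otimes> (a \<otimes> s)) \<oplus> (q \<otimes> (b \<otimes> s)) \<otimes> (q' \<otimes> (a' \<otimes> s'))"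
      using c by (simp add: m_ac l_distr r_distr)
    also have "\<dots> = (q \<otimes> q') \<otimes> (((r \<otimes> s') \<oplus> (r' \<otimes> s)) \<otimes> (b \<otimes> b'))"
      unfolding q(2)[symmetric] q'(2)[symmetric] using c by (simp add: m_ac l_distr r_distr)
    finally show ?thesis
      using c S_mult[OF q(1) q'(1)] by (subst frac_eq) (auto intro: S_mult)
  qed
  then show ?thesis
    unfolding localization_def ring_record_simps
    by (rule UN2_const[OF _ frac_self[OF assms(1,2)] frac_self[OF assms(3,4)]])
qed

lemma localization_one: "\<one>\<^bsub>localization R S\<^esub> = frac R S \<one> \<one>"
  by (simp add: localization_def)

lemma localization_zero: "\<zero>\<^bsub>localization R S\<^esub> = frac R S \<zero> \<one>"
  by (simp add: localization_def)

lemma frac_carrier: "r \<in> carrier R \<Longrightarrow> s \<in> S \<Longrightarrow> frac R S r s \<in> carrier (localization R S)"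
  by (auto simp: localization_carrier)

lemma frac_zero: "s \<in> S \<Longrightarrow> frac R S \<zero> s = frac R S \<zero> \<one>"
  by (rule frac_eqI) (simp_all add: S_one)

lemma localization_cring: "cring (localization R S)"
proof (rule cringI)
  let ?L = "localization R S"
  show "abelian_group ?L"
  proof (rule abelian_groupI)
    fix x y assume "x \<in> carrier ?L" "y \<in> carrier ?L"
    then obtain r s r' s' where c: "r \<in> carrier R" "s \<in> S" "x = frac R S r s" "r' \<in> carrier R" "s' \<in> S" "y = frac R S r' s'"
      unfolding localization_carrier by blast
    then show "x \<oplus>\<^bsub>?L\<^esub> y \<in> carrier ?L" "x \<oplus>\<^bsub>?L\<^esub> y = y \<oplus>\<^bsub>?L\<^esub> x"
      by (simp_all add: localization_add frac_carrier S_mult m_comm a_comm)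
  next
    fix x y z assume "x \<in> carrier ?L" "y \<in> carrier ?L" "z \<in> carrier ?L"
    then obtain r s r' s' r'' s'' where "r \<in> carrier R" "s \<in> S" "x = frac R S r s" "r' \<in> carrier R" "s' \<in> S" "y = frac R S r' s'"
      "r'' \<in> carrier R" "s'' \<in> S" "z = frac R S r'' s''"
      unfolding localization_carrier by blast
    then show "(x \<oplus>\<^bsub>?L\<^esub> y) \<oplus>\<^bsub>?L\<^esub> z = x \<oplus>\<^bsub>?L\<^esub> (y \<oplus>\<^bsub>?L\<^esub> z)"
      by (simp add: localization_add S_mult l_distr r_distr m_ac a_ac)
  next
    show "\<zero>\<^bsub>?L\<^esub> \<in> carrier ?L"
      by (simp add: localization_zero frac_carrier S_one)
  next
    fix x assume "x \<in> carrier ?L"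
    then obtain r s where c: "r \<in> carrier R" "s \<in> S" "x = frac R S r s"
      unfolding localization_carrier by blast
    then show "\<zero>\<^bsub>?L\<^esub> \<oplus>\<^bsub>?L\<^esub> x = x"
      by (simp add: localization_zero localization_add S_one)
    have "frac R S (\<ominus> r) s \<oplus>\<^bsub>?L\<^esub> x = \<zero>\<^bsub>?L\<^esub>"
      using c by (simp add: localization_add localization_zero S_mult frac_zero l_neg l_minus)
    then show "\<exists>y\<in>carrier ?L. y \<oplus>\<^bsub>?L\<^esub> x = \<zero>\<^bsub>?L\<^esub>"
      using c by (blast intro: frac_carrier a_inv_closed)
  qed
  show "comm_monoid ?L"
  proof (rule comm_monoidI)
    fix x y assume "x \<in> carrier ?L" "y \<in> carrier ?L"
    then obtain r s r' s' where c: "r \<in> carrier R" "s \<in> S" "x = frac R S r s" "r' \<in> carrier R" "s' \<in> S" "y = frac R S r' s'"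
      unfolding localization_carrier by blast
    then show "x \<otimes>\<^bsub>?L\<^esub> y \<in> carrier ?L" "x \<otimes>\<^bsub>?L\<^esub> y = y \<otimes>\<^bsub>?L\<^esub> x"
      by (simp_all add: localization_mult frac_carrier S_mult m_comm)
  next
    fix x y z assume "x \<in> carrier ?L" "y \<in> carrier ?L" "z \<in> carrier ?L"
    then obtain r s r' s' r'' s'' where "r \<in> carrier R" "s \<in> S" "x = frac R S r s" "r' \<in> carrier R" "s' \<in> S" "y = frac R S r' s'"
      "r'' \<in> carrier R" "s'' \<in> S" "z = frac R S r'' s''"
      unfolding localization_carrier by blast
    then show "(x \<otimes>\<^bsub>?L\<^esub> y) \<otimes>\<^bsub>?L\<^esub> z = x \<otimes>\<^bsub>?L\<^esub> (y \<otimes>\<^bsub>?L\<^esub> z)"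
      by (simp add: localization_mult S_mult m_ac)
  next
    show "\<one>\<^bsub>?L\<^esub> \<in> carrier ?L"
      by (simp add: localization_one frac_carrier S_one)
  next
    fix x assume "x \<in> carrier ?L"
    then obtain r s where c: "r \<in> carrier R" "s \<in> S" "x = frac R S r s"
      unfolding localization_carrier by blast
    then show "\<one>\<^bsub>?L\<^esub> \<otimes>\<^bsub>?L\<^esub> x = x"
      by (simp add: localization_one localization_mult S_one)
  qed
  fix x y z assume "x \<in> carrier ?L" "y \<in> carrier ?L" "z \<in> carrier ?L"
  then obtain r s r' s' r'' s'' where c: "r \<in> carrier R" "s \<in> S" "x = frac R S r s" "r' \<in> carrier R" "s' \<in> S" "y = frac R S r' s'"
    "r'' \<in> carrier R" "s'' \<in> S" "z = frac R S r'' s''"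
    unfolding localization_carrier by blast
  show "(x \<oplus>\<^bsub>?L\<^esub> y) \<otimes>\<^bsub>?L\<^esub> z = x \<otimes>\<^bsub>?L\<^esub> z \<oplus>\<^bsub>?L\<^esub> y \<otimes>\<^bsub>?L\<^esub> z"
    using c by (simp add: localization_mult localization_add S_mult) (rule frac_eqI; simp add: S_mult l_distr r_distr m_ac)
qed

end

section \<open>Polynomials as Laurent polynomials\<close>

definition emb_exp :: "(indet \<Rightarrow>\<^sub>0 nat) \<Rightarrow> exps"
  where "emb_exp m = (\<Sum>i\<in>UNIV. Poly_Mapping.single (V i) (int (Poly_Mapping.lookup m i)))"

lemma lk_emb_exp [simp]: "lk (emb_exp m) (V i) = int (Poly_Mapping.lookup m i)"
  "lk (emb_exp m) TA = 0" "lk (emb_exp m) TB = 0" "lk (emb_exp m) TC = 0"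
  by (simp_all add: emb_exp_def lk_sum_single)

lemma emb_exp_add: "emb_exp (m + n) = emb_exp m + emb_exp n"
  by (rule exps_eqI) (simp_all add: lookup_add)

lemma emb_exp_EA: "emb_exp m \<in> EA {} 0"
  by (simp add: EA_def tdeg_def)

lemma tot_emb_exp: "tot (emb_exp m) = int (\<Sum>i\<in>UNIV. Poly_Mapping.lookup m i)"
  by (simp add: tot_def tdeg_def)

definition emb :: "'k::field_char_0 poly6 \<Rightarrow> 'k laur"
  where "emb = lin (\<lambda>m. mn (emb_exp m))"

lemma emb_add: "emb (p + q) = emb p + emb q" and emb_diff: "emb (p - q) = emb p - emb q"
  and emb_0 [simp]: "emb 0 = 0" and emb_uminus: "emb (- p) = - emb p"
  by (simp_all add: emb_def lin_add lin_diff lin_uminus)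

lemma emb_mult: "emb (p * q) = emb p * emb q"
  unfolding emb_def by (rule lin_mult) (simp add: emb_exp_add mn_add)

lemma emb_single: "emb (Poly_Mapping.single m c) = sc c * mn (emb_exp m)"
  by (simp add: emb_def)

lemma emb_exp_0 [simp]: "emb_exp 0 = 0"
  by (rule exps_eqI) simp_all

lemma emb_1 [simp]: "emb 1 = 1"
  using emb_single[of 0 1] by simp

lemma emb_pconst: "emb (pconst c) = sc c"
  by (simp add: pconst_def emb_single)

lemma emb_pvar: "emb (pvar i) = mv i"
proof -
  have "emb_exp (Poly_Mapping.single i 1) = ex (V i)"
    by (rule exps_eqI) (auto simp: lk_ex lookup_single when_def)
  then show ?thesis
    by (simp add: pvar_def emb_single)
qed

lemma emb_power: "emb (p ^ n) = emb p ^ n"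
  by (induction n) (simp_all add: emb_mult)

lemma emb_prod: "emb (\<Prod>a\<in>S. f a) = (\<Prod>a\<in>S. emb (f a))"
  by (induction S rule: infinite_finite_induct) (simp_all add: emb_mult)

lemma lookup_emb: "Poly_Mapping.lookup (emb p) (emb_exp m) = Poly_Mapping.lookup p m"
proof -
  have inj: "emb_exp m = emb_exp m' \<longleftrightarrow> m = m'" for m m'
    by (metis lk_emb_exp(1) poly_mapping_eqI of_nat_eq_iff)
  show ?thesis
    by (induction rule: poly_mapping_span_induct[of _ p])
      (simp_all add: emb_add lookup_add emb_single lookup_sc_mult inj lookup_single mn_def when_def)
qed

lemma emb_inj: "emb p = emb q \<longleftrightarrow> p = q"
  by (metis lookup_emb poly_mapping_eqI)

lemma emb_FT: "emb p \<in> FT {} 0"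
  by (induction rule: poly_mapping_span_induct[of _ p])
    (simp_all add: emb_add FT_add emb_single FT_sc_mult FT_mn emb_exp_EA)

lemma emb_exp_surj:
  assumes "e \<in> EA {} 0"
  obtains m where "e = emb_exp m"
proof -
  define m :: "indet \<Rightarrow>\<^sub>0 nat" where "m = (\<Sum>i\<in>UNIV. Poly_Mapping.single i (nat (lk e (V i))))"
  have "Poly_Mapping.lookup m i = nat (lk e (V i))" for i
    by (simp add: m_def lookup_sum lookup_single when_def)
  then have "e = emb_exp m"
    using assms EA_0_T[OF assms] by (intro exps_eqI) (simp_all add: EA_def)
  then show thesis
    by (rule that)
qed

lemma emb_surj: "x \<in> FT {} 0 \<Longrightarrow> \<exists>p. x = emb p"
proof (erule FT_induct)
  show "\<exists>p. 0 = emb p"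
    by (rule exI[of _ 0]) simp
  show "\<exists>p. sc c * mn e = emb p" if e: "e \<in> EA {} 0" for e and c :: 'a
    using emb_exp_surj[OF e] emb_single by metis
  show "\<exists>p. a + b = emb p" if "\<exists>p. a = emb p" "\<exists>p. b = emb p" for a b
    using that by (metis emb_add)
qed

lemma keys_emb: "Poly_Mapping.keys (emb p) = emb_exp ` Poly_Mapping.keys p"
proof
  show "emb_exp ` Poly_Mapping.keys p \<subseteq> Poly_Mapping.keys (emb p)"
    by (auto simp: in_keys_iff lookup_emb)
  show "Poly_Mapping.keys (emb p) \<subseteq> emb_exp ` Poly_Mapping.keys p"
  proof
    fix e assume e: "e \<in> Poly_Mapping.keys (emb p)"
    then have "e \<in> EA {} 0"
      using emb_FT[of p] by (auto simp: FT_def key_space_def)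
    then obtain m where "e = emb_exp m"
      by (rule emb_exp_surj)
    then show "e \<in> emb_exp ` Poly_Mapping.keys p"
      using e by (auto simp: in_keys_iff lookup_emb)
  qed
qed

lemma homog_emb: "homog (int d) (emb p) \<longleftrightarrow> homogeneous d p"
  by (auto simp: homog_def homogeneous_def keys_emb tot_emb_exp simp flip: of_nat_sum)

subsection \<open>Powers of the ideal of minors\<close>

lemma poly6_ring_simps [simp]:
  "carrier poly6_ring = UNIV" "p \<otimes>\<^bsub>poly6_ring\<^esub> q = p * q" "p \<oplus>\<^bsub>poly6_ring\<^esub> q = p + q"
  "\<one>\<^bsub>poly6_ring\<^esub> = 1" "\<zero>\<^bsub>poly6_ring\<^esub> = 0"
  by (simp_all add: poly6_ring_def ring_of_type_algebra_def)

lemma poly6_cring: "cring (poly6_ring :: 'k::field_char_0 poly6 ring)"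
  unfolding poly6_ring_def by (rule cring_from_type_algebra)

lemma poly6_ring: "ring (poly6_ring :: 'k::field_char_0 poly6 ring)"
  using poly6_cring by (rule cring.axioms(1))

definition mI :: "'k::field_char_0 poly6 set"
  where "mI = Idl\<^bsub>poly6_ring\<^esub> {pvar Ind_v * pvar Ind_z - pvar Ind_w * pvar Ind_y,
    pvar Ind_w * pvar Ind_x - pvar Ind_u * pvar Ind_z, pvar Ind_u * pvar Ind_y - pvar Ind_v * pvar Ind_x}"

definition mJ :: "nat \<Rightarrow> 'k::field_char_0 poly6 set"
  where "mJ n = ideal_power poly6_ring mI n"

text \<open>The power I^n seen from the Laurent ring. Its equality with \<open>mJ n\<close> ties
  \<open>IP\<close> to powers in the monoid of ideals.\<close>

definition mW :: "nat \<Rightarrow> 'k::field_char_0 poly6 set"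
  where "mW n = {p. emb p \<in> IP {} (int n)}"

lemma poly6_minus: "\<ominus>\<^bsub>poly6_ring\<^esub> p = - (p :: 'k::field_char_0 poly6)"
proof -
  interpret cring "poly6_ring :: 'k poly6 ring"
    by (rule poly6_cring)
  show ?thesis
    by (rule minus_equality) simp_all
qed

lemma idealI_poly6:
  assumes "(0 :: 'k::field_char_0 poly6) \<in> W" "\<And>p q. p \<in> W \<Longrightarrow> q \<in> W \<Longrightarrow> p + q \<in> W"
    "\<And>p q. p \<in> W \<Longrightarrow> q * p \<in> W"
  shows "ideal W poly6_ring"
proof (rule idealI[OF poly6_ring])
  have um: "- p \<in> W" if "p \<in> W" for p
    using assms(3)[OF that, of "- 1"] by simp
  show "subgroup W (add_monoid poly6_ring)"
  proof
    fix x assume "x \<in> W"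
    then show "inv\<^bsub>add_monoid poly6_ring\<^esub> x \<in> W"
      using um poly6_minus[of x] by (simp add: a_inv_def)
  qed (use assms in auto)
qed (use assms(3) in \<open>auto simp: mult.commute\<close>)

lemma mW_ideal: "ideal (mW n :: 'k::field_char_0 poly6 set) poly6_ring"
  by (rule idealI_poly6) (auto simp: mW_def emb_add emb_mult IP_add intro: IP_mult_FT emb_FT)

lemma emb_minors:
  "emb (pvar Ind_v * pvar Ind_z - pvar Ind_w * pvar Ind_y) = D1"
  "emb (pvar Ind_w * pvar Ind_x - pvar Ind_u * pvar Ind_z) = D2"
  "emb (pvar Ind_u * pvar Ind_y - pvar Ind_v * pvar Ind_x) = D3"
  by (simp_all add: emb_diff emb_mult emb_pvar D1_def D2_def D3_def)

lemma mI_ideal: "ideal (mI :: 'k::field_char_0 poly6 set) poly6_ring"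
  unfolding mI_def using ring.genideal_ideal[OF poly6_ring] by simp

lemma mI_minors: "g \<in> {TA, TB, TC} \<Longrightarrow> \<exists>d\<in>mI. psim (ex g) = emb (d :: 'k::field_char_0 poly6)"
proof -
  have "{pvar Ind_v * pvar Ind_z - pvar Ind_w * pvar Ind_y,
    pvar Ind_w * pvar Ind_x - pvar Ind_u * pvar Ind_z, pvar Ind_u * pvar Ind_y - pvar Ind_v * pvar Ind_x} \<subseteq> (mI :: 'k poly6 set)"
    unfolding mI_def by (rule ring.genideal_self[OF poly6_ring]) simp
  then show "g \<in> {TA, TB, TC} \<Longrightarrow> \<exists>d\<in>mI. psim (ex g) = emb (d :: 'k poly6)"
    by (auto simp: psim_ex simp flip: emb_minors)
qed

lemma ideal_add: "ideal J poly6_ring \<Longrightarrow> p \<in> J \<Longrightarrow> q \<in> J \<Longrightarrow> p + q \<in> J"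
  using additive_subgroup.a_closed[OF ideal.axioms(1), of J poly6_ring p q] by simp

lemma ideal_0: "ideal J poly6_ring \<Longrightarrow> 0 \<in> J"
  using additive_subgroup.zero_closed[OF ideal.axioms(1), of J poly6_ring] by simp

lemma ideal_mult: "ideal J poly6_ring \<Longrightarrow> p \<in> J \<Longrightarrow> q * p \<in> J"
  using ideal.I_l_closed[of J poly6_ring p q] by simp

text \<open>One minor is split off each term of a form. With \<open>K\<close> arbitrary, this serves
  both the generation of I by the minors and the product of I^n with I.\<close>

lemma mW_Suc:
  assumes "p \<in> mW (Suc n)" and K: "ideal K poly6_ring"
    and step: "\<And>q d. q \<in> mW n \<Longrightarrow> d \<in> mI \<Longrightarrow> q * d \<in> K"
  shows "p \<in> (K :: 'k::field_char_0 poly6 set)"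
proof -
  obtain F where F: "F \<in> FT {} (int n + 1)" "emb p = psi F"
    using assms(1) by (auto simp: mW_def IP_def add.commute)
  from F(1) have "\<exists>q\<in>K. psi F = emb q"
  proof (rule FT_induct)
    show "\<exists>q\<in>K. psi 0 = emb q"
      using ideal_0[OF K] by (intro bexI[of _ 0]) simp_all
    show "\<exists>q\<in>K. psi (a + b) = emb q" if "\<exists>q\<in>K. psi a = emb q" "\<exists>q\<in>K. psi b = emb q" for a b
      using that ideal_add[OF K] by (metis psi_add emb_add)
    fix e and c :: 'k
    assume e: "e \<in> EA {} (int n + 1)"
    obtain g where g: "g \<in> {TA, TB, TC}" "e - ex g \<in> EA {} (int n)"
      using EA_Suc_cases[OF e] by auto
    obtain d where d: "d \<in> mI" "psim (ex g) = emb (d :: 'k poly6)"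
      using mI_minors[OF g(1)] by blast
    have "sc c * psim (e - ex g) \<in> (IP {} (int n) :: 'k laur set)"
      by (intro IP_sc psim_IP g(2))
    moreover from this obtain q where q: "sc c * psim (e - ex g) = emb q"
      using emb_surj IP_subset by blast
    ultimately have "q \<in> mW n"
      by (simp add: mW_def)
    then have "q * d \<in> K"
      using d(1) by (rule step)
    moreover have "psi (sc c * mn e) = emb (q * d)"
      by (simp only: psi_sc_mn psim_split[OF g] emb_mult q[symmetric] d(2)[symmetric] mult.assoc)
    ultimately show "\<exists>q\<in>K. psi (sc c * mn e) = emb q"
      by blast
  qed
  then show ?thesis
    using F(2) emb_inj by metis
qed

lemma mI_mW: "mI = (mW 1 :: 'k::field_char_0 poly6 set)"
proof
  show "mI \<subseteq> (mW 1 :: 'k poly6 set)"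
    unfolding mI_def
    by (rule ring.genideal_minimal[OF poly6_ring mW_ideal]) (auto simp: mW_def emb_minors D_IP)
  show "mW 1 \<subseteq> (mI :: 'k poly6 set)"
    using mW_Suc[of _ 0 mI] mI_ideal ideal_mult[OF mI_ideal] by auto
qed

lemma mJ_mW: "mJ n = (mW n :: 'k::field_char_0 poly6 set)"
proof (induction n)
  case 0
  show ?case
    by (auto simp: mJ_def ideals_set_def mW_def IP_zero emb_FT)
next
  case (Suc n)
  have "mJ (Suc n) = ideal_prod poly6_ring (mW n) (mW 1 :: 'k poly6 set)"
  proof -
    have "a \<otimes>\<^bsub>ideals_set poly6_ring\<^esub> b = ideal_prod poly6_ring a b" for a b :: "'k poly6 set"
      by (simp add: ideals_set_def)
    then have "mJ (Suc n) = ideal_prod poly6_ring (mJ n) (mI :: 'k poly6 set)"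
      by (simp add: mJ_def)
    then show ?thesis
      by (simp only: Suc mI_mW)
  qed
  also have "\<dots> = mW (Suc n)"
  proof
    show "ideal_prod poly6_ring (mW n) (mW 1 :: 'k poly6 set) \<subseteq> mW (Suc n)"
    proof
      fix p :: "'k poly6" assume "p \<in> ideal_prod poly6_ring (mW n) (mW 1)"
      then show "p \<in> mW (Suc n)"
      proof (induction rule: ideal_prod.induct)
        case (prod i j)
        then show ?case
          using IP_mult[of "emb i" "{}" "int n" "emb j" 1] by (simp add: mW_def emb_mult add.commute)
      next
        case (sum s1 s2)
        then show ?case
          using ideal_add[OF mW_ideal] by simp
      qed
    qed
    have "ideal (ideal_prod poly6_ring (mW n) (mW 1 :: 'k poly6 set)) poly6_ring"
      by (rule ring.ideal_prod_is_ideal[OF poly6_ring mW_ideal mW_ideal])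
    moreover have "q * d \<in> ideal_prod poly6_ring (mW n) (mW 1 :: 'k poly6 set)" if "q \<in> mW n" "d \<in> mI" for q d
      using ideal_prod.prod[of q "mW n" d "mW 1" poly6_ring] that by (simp add: mI_mW)
    ultimately show "mW (Suc n) \<subseteq> ideal_prod poly6_ring (mW n) (mW 1 :: 'k poly6 set)"
      using mW_Suc by blast
  qed
  finally show ?case .
qed

lemma mJ_iff: "p \<in> mJ n \<longleftrightarrow> emb p \<in> IP {} (int n)"
  by (simp add: mJ_mW mW_def)

lemma mJ_ideal: "ideal (mJ n :: 'k::field_char_0 poly6 set) poly6_ring"
  using mW_ideal by (simp add: mJ_mW)

section \<open>The residue rings and their localizations\<close>

lemma mem_residue: "q \<in> residue J p \<longleftrightarrow> q - p \<in> J"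
  by (auto simp: residue_def a_r_coset_def' intro: bexI[of _ "q - p"])

lemma residue_eq:
  assumes "ideal J poly6_ring"
  shows "residue J p = residue J q \<longleftrightarrow> p - (q :: 'k::field_char_0 poly6) \<in> J"
proof
  assume "residue J p = residue J q"
  moreover have "p \<in> residue J p"
    using ideal_0[OF assms] by (simp add: mem_residue)
  ultimately show "p - q \<in> J"
    by (simp add: mem_residue)
next
  assume pq: "p - q \<in> J"
  have "r - p \<in> J \<longleftrightarrow> r - q \<in> J" for r
    using ideal_add[OF assms _ pq, of "r - p"] ideal_add[OF assms _ ideal_mult[OF assms pq, of "- 1"], of "r - q"]
    by (auto simp: algebra_simps)
  then show "residue J p = residue J q"
    by (auto simp: mem_residue)
qed

lemma quot_carrier: "carrier (poly6_ring Quot J) = range (residue J)"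
  by (auto simp: FactRing_def A_RCOSETS_def' residue_def)

lemma quot_one: "\<one>\<^bsub>poly6_ring Quot J\<^esub> = residue J 1"
  by (simp add: FactRing_def residue_def)

lemma quot_zero:
  assumes "ideal J poly6_ring"
  shows "\<zero>\<^bsub>poly6_ring Quot J\<^esub> = residue J 0"
  by (auto simp: FactRing_def mem_residue)

lemma quot_mult:
  assumes "ideal J poly6_ring"
  shows "residue J p \<otimes>\<^bsub>poly6_ring Quot J\<^esub> residue J q = residue J (p * q)"
  using ideal.rcoset_mult_add[OF assms, of p q] by (simp add: FactRing_def residue_def)

lemma quot_add:
  assumes "ideal J poly6_ring"
  shows "residue J p \<oplus>\<^bsub>poly6_ring Quot J\<^esub> residue J q = residue J (p + q)"
proof -
  have "abelian_subgroup J poly6_ring"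
    using assms poly6_ring by (intro abelian_subgroupI3 ideal.axioms(1) ring.is_abelian_group)
  from abelian_subgroup.a_rcos_sum[OF this, of p q] show ?thesis
    by (simp add: FactRing_def residue_def)
qed

lemma quot_cring: "ideal J poly6_ring \<Longrightarrow> cring (poly6_ring Quot J)"
  by (rule ideal.quotient_is_cring[OF _ poly6_cring])

text \<open>Exponents of the monomials in \<open>A\<close>, singled out as polynomials that are
  units of the localization.\<close>

definition MA :: "indet set \<Rightarrow> exps set"
  where "MA A = {d. d \<in> EA {} 0 \<and> - d \<in> EA A 0}"

lemma emb_monomials: "emb ` monomials A = (mn ` MA A :: 'k::field_char_0 laur set)"
proof
  have p: "(\<Prod>a\<in>A. mv a ^ e a) = (mn (\<Sum>a\<in>A. Poly_Mapping.single (V a) (int (e a))) :: 'k laur)" for e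
  proof -
    have "mv a ^ k = (mn (Poly_Mapping.single (V a) (int k)) :: 'k laur)" for a k
      by (induction k) (simp_all add: ex_def flip: mn_add single_add)
    then show ?thesis
      by (induction A rule: infinite_finite_induct) (simp_all add: mn_add)
  qed
  show "emb ` monomials A \<subseteq> (mn ` MA A :: 'k laur set)"
  proof
    fix x :: "'k laur" assume "x \<in> emb ` monomials A"
    then obtain e where "x = emb (\<Prod>a\<in>A. pvar a ^ e a)"
      by (auto simp: monomials_def)
    then have "x = mn (\<Sum>a\<in>A. Poly_Mapping.single (V a) (int (e a)))"
      by (simp add: emb_prod emb_power emb_pvar p)
    moreover have "(\<Sum>a\<in>A. Poly_Mapping.single (V a) (int (e a))) \<in> MA A"
      by (auto simp: MA_def EA_def tdeg_def lk_sum_single)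
    ultimately show "x \<in> mn ` MA A"
      by blast
  qed
  show "mn ` MA A \<subseteq> (emb ` monomials A :: 'k laur set)"
  proof
    fix x :: "'k laur" assume "x \<in> mn ` MA A"
    then obtain d where d: "d \<in> EA {} 0" "- d \<in> EA A 0" "x = mn d"
      by (auto simp: MA_def)
    have 0: "lk d (V i) = 0" if "i \<notin> A" for i
    proof -
      have "0 \<le> lk d (V i)" "0 \<le> lk (- d) (V i)"
        using d(1,2) that by (simp_all add: EA_def)
      then show ?thesis
        by simp
    qed
    have "d = (\<Sum>a\<in>A. Poly_Mapping.single (V a) (int (nat (lk d (V a)))))"
      using d(1) EA_0_T[OF d(1)] 0 by (intro exps_eqI) (auto simp: lk_sum_single EA_def)
    then have "x = emb (\<Prod>a\<in>A. pvar a ^ nat (lk d (V a)))"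
      by (simp add: d(3) emb_prod emb_power emb_pvar p)
    then show "x \<in> emb ` monomials A"
      by (auto simp: monomials_def)
  qed
qed

lemma monomials_one: "1 \<in> monomials A"
  unfolding monomials_def by (auto intro: exI[of _ "\<lambda>_. 0"])

lemma monomials_mult: "s \<in> monomials A \<Longrightarrow> s' \<in> monomials A \<Longrightarrow> s * s' \<in> monomials A"
proof -
  assume "s \<in> monomials A" "s' \<in> monomials A"
  then obtain e e' where "s = (\<Prod>a\<in>A. pvar a ^ e a)" "s' = (\<Prod>a\<in>A. pvar a ^ e' a)"
    by (auto simp: monomials_def)
  then have "s * s' = (\<Prod>a\<in>A. pvar a ^ (e a + e' a))"
    by (simp add: prod.distrib power_add)
  then show ?thesis
    unfolding monomials_def by (intro CollectI exI[of _ "\<lambda>a. e a + e' a"]) simp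
qed

lemma monomials_mono: "A \<subseteq> B \<Longrightarrow> monomials A \<subseteq> (monomials B :: 'k::field_char_0 poly6 set)"
proof -
  assume "A \<subseteq> B"
  then have "MA A \<subseteq> MA B"
    by (auto simp: MA_def EA_def)
  then have "emb ` monomials A \<subseteq> (emb ` monomials B :: 'k laur set)"
    unfolding emb_monomials by blast
  then have sub: "emb p \<in> emb ` monomials B" if "p \<in> monomials A" for p :: "'k poly6"
    using that by blast
  show ?thesis
  proof
    fix p :: "'k poly6" assume "p \<in> monomials A"
    from sub[OF this] obtain q :: "'k poly6" where "emb p = emb q" "q \<in> monomials B"
      by (rule imageE)
    then show "p \<in> monomials B"
      by (simp add: emb_inj)
  qed
qed

lemma cech_frac_ring: "frac_ring (poly6_ring Quot (mJ t)) (residue (mJ t) ` monomials A)"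
proof -
  interpret cring "poly6_ring Quot (mJ t)"
    by (rule quot_cring[OF mJ_ideal])
  show ?thesis
    by unfold_locales
      (auto simp: quot_carrier quot_one quot_mult[OF mJ_ideal] intro: monomials_one monomials_mult)
qed

text \<open>Turns membership in a localized power of I into membership after multiplication by a
  monomial, the shape in which equality of fractions is defined.\<close>

lemma IP_clear:
  "x \<in> FT A 0 \<Longrightarrow> x \<in> IP A n \<longleftrightarrow> (\<exists>d\<in>MA A. mn d * x \<in> (IP {} n :: 'k::field_char_0 laur set))"
proof
  assume "x \<in> IP A n"
  then obtain F where F: "F \<in> FT A n" "x = psi F"
    by (auto simp: IP_def)
  obtain d where d: "d \<in> EA {} 0" "- d \<in> EA A 0" "mn d * F \<in> FT {} n"
    using clear_denominators[OF F(1)] .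
  have "mn d * x = psi (mn d * F)"
    by (simp add: F(2) psi_mn_mult[OF d(1) F(1)])
  then show "\<exists>d\<in>MA A. mn d * x \<in> IP {} n"
    using d unfolding MA_def IP_def by blast
next
  assume "\<exists>d\<in>MA A. mn d * x \<in> IP {} n"
  then obtain d where d: "- d \<in> EA A 0" "mn d * x \<in> IP {} n"
    by (auto simp: MA_def)
  have "mn (- d) * (mn d * x) \<in> IP A n"
    by (intro IP_mult_FT FT_mn d(1) IP_mono[OF d(2)]) simp
  then show "x \<in> IP A n"
    by simp
qed

subsection \<open>Homomorphisms from rings of Laurent polynomials\<close>

text \<open>The instances are the maps to the localizations of R/I^t and to the fraction field of
  the completion, so truncated series are transported once for both. The equations are oriented to
  collect a term under a single \<open>\<phi>\<close>.\<close>

locale laur_hom = cring L for L (structure) +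
  fixes A :: "indet set" and \<phi> :: "'k::field_char_0 laur \<Rightarrow> 'a"
  assumes hom_carrier: "a \<in> FT A 0 \<Longrightarrow> \<phi> a \<in> carrier L"
    and hom_add: "a \<in> FT A 0 \<Longrightarrow> b \<in> FT A 0 \<Longrightarrow> \<phi> a \<oplus> \<phi> b = \<phi> (a + b)"
    and hom_mult: "a \<in> FT A 0 \<Longrightarrow> b \<in> FT A 0 \<Longrightarrow> \<phi> a \<otimes> \<phi> b = \<phi> (a * b)"
    and hom_one: "\<one> = \<phi> 1"
begin

lemma hom_zero: "\<zero> = \<phi> 0"
proof -
  have "\<phi> 0 \<oplus> \<phi> 0 = \<phi> 0"
    using hom_add[of 0 0] by simp
  then show ?thesis
    using hom_carrier[of 0] by (metis FT_0 add.l_cancel_one' zero_closed)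
qed

lemma hom_uminus: "a \<in> FT A 0 \<Longrightarrow> \<ominus> \<phi> a = \<phi> (- a)"
  by (rule minus_equality) (simp_all add: FT_uminus hom_add hom_zero hom_carrier)

lemma hom_minus: "a \<in> FT A 0 \<Longrightarrow> b \<in> FT A 0 \<Longrightarrow> \<phi> a \<ominus> \<phi> b = \<phi> (a - b)"
  by (simp add: a_minus_def hom_uminus hom_add FT_uminus)

lemma hom_finsum:
  assumes "finite S" "\<And>i. i \<in> S \<Longrightarrow> f i \<in> FT A 0"
  shows "(\<Oplus>i\<in>S. \<phi> (f i)) = \<phi> (\<Sum>i\<in>S. f i)"
  using assms
proof (induction S)
  case empty
  then show ?case
    by (simp add: hom_zero)
next
  case (insert i S)
  then have "(\<Oplus>i\<in>insert i S. \<phi> (f i)) = \<phi> (f i) \<oplus> (\<Oplus>i\<in>S. \<phi> (f i))"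
    by (intro finsum_insert) (auto simp: hom_carrier)
  then show ?case
    using insert by (simp add: hom_add FT_sum)
qed

lemma hom_pow: "a \<in> FT A 0 \<Longrightarrow> \<phi> a [^] (n :: nat) = \<phi> (a ^ n)"
  by (induction n) (simp_all add: hom_one hom_mult FT_power mult.commute)

lemma hom_inv:
  assumes "x \<in> FT A 0" "s \<in> FT A 0" "\<phi> (x * s) = \<phi> 1"
  shows "inv \<phi> x = \<phi> s"
  by (rule comm_inv_char) (simp_all add: hom_mult hom_carrier hom_one assms)

lemma of_nat_FT: "(of_nat m :: 'k laur) \<in> FT A 0"
  using sc_FT[of "of_nat m :: 'k" A] by (simp add: sc_def)

lemma hom_add_pow: "[m] \<cdot> \<one> = \<phi> (of_nat m)"
  by (induction m) (simp_all add: hom_zero[symmetric] hom_one hom_add of_nat_FT add.commute del: one_closed)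

lemma taylor_trunc_hom:
  assumes "a \<in> FT A 0"
  shows "taylor_trunc L n (\<phi> a) = \<phi> (tlog n a)"
proof -
  have "inv ([m] \<cdot> \<one>) \<otimes> (\<phi> a [^] m) = \<phi> (sc (1 / of_nat m) * a ^ m)" if m: "m \<in> {1..<n}" for m
  proof -
    have "(of_nat m :: 'k laur) = sc (of_nat m)"
      by (simp add: sc_def)
    then have "of_nat m * sc (1 / of_nat m) = (1 :: 'k laur)"
      using m by (simp flip: sc_mult)
    then have "inv (\<phi> (of_nat m)) = \<phi> (sc (1 / of_nat m))"
      by (intro hom_inv of_nat_FT sc_FT) simp
    then show ?thesis
      by (simp add: hom_add_pow hom_pow assms hom_mult sc_FT FT_power)
  qed
  then have "taylor_trunc L n (\<phi> a) = (\<Oplus>m\<in>{1..<n}. \<phi> (sc (1 / of_nat m) * a ^ m))"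
    unfolding taylor_trunc_def
    by (intro finsum_cong) (auto simp: simp_implies_def hom_carrier FT_sc_mult FT_power assms)
  also have "\<dots> = \<phi> (tlog n a)"
    unfolding tlog_def by (rule hom_finsum) (auto intro: FT_sc_mult FT_power assms)
  finally show ?thesis .
qed

lemma ln_trunc_hom:
  assumes "b \<in> FT A 0"
  shows "ln_trunc L n (\<phi> b) = \<phi> (- tlog n (1 - b))"
  by (simp add: ln_trunc_def hom_one hom_minus assms taylor_trunc_hom FT_diff hom_uminus tlog_FT)

end

text \<open>The class in \<open>(R/I\<^sup>t)\<^sub>A\<close> of a Laurent polynomial with denominators in \<open>A\<close>.\<close>

definition lf :: "nat \<Rightarrow> indet set \<Rightarrow> 'k::field_char_0 laur \<Rightarrow> 'k cech_elem"
  where "lf t A a = (SOME c. \<exists>p s. s \<in> monomials A \<and> emb p = a * emb s \<and> c = cech_frac (mJ t) A p s)"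

lemma monomials_emb: "s \<in> monomials A \<Longrightarrow> \<exists>d\<in>MA A. emb s = (mn d :: 'k::field_char_0 laur)"
  using emb_monomials[of A, where 'k = 'k] by blast

lemma MA_monomial:
  assumes "d \<in> MA A"
  shows "\<exists>s\<in>monomials A. emb s = (mn d :: 'k::field_char_0 laur)"
proof -
  have "(mn d :: 'k laur) \<in> emb ` monomials A"
    unfolding emb_monomials using assms by (rule imageI)
  then obtain s where "mn d = emb s" "s \<in> (monomials A :: 'k poly6 set)"
    by (rule imageE)
  then show ?thesis
    by (intro bexI[of _ s]) simp_all
qed

lemma laur_fraction:
  assumes "a \<in> FT A 0"
  obtains p s where "s \<in> monomials A" "emb p = a * (emb s :: 'k::field_char_0 laur)"
proof -
  obtain d where d: "d \<in> EA {} 0" "- d \<in> EA A 0" "mn d * a \<in> FT {} 0"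
    using clear_denominators[OF assms] .
  then obtain s :: "'k poly6" where s: "s \<in> monomials A" "emb s = (mn d :: 'k laur)"
    using MA_monomial[of d A, where 'k = 'k] unfolding MA_def by blast
  obtain p where "mn d * a = emb p"
    using emb_surj[OF d(3)] by blast
  then show thesis
    using that[OF s(1), of p] s(2) by (simp add: mult.commute)
qed

text \<open>The multiplier allowed by \<open>frac_rel\<close> is the monomial of
  \<open>IP_clear\<close>, and the denominators can be cancelled since they are units of
  \<open>FT A 0\<close>.\<close>

lemma cech_frac_eq:
  assumes "s \<in> monomials A" "s' \<in> monomials A" "emb p = a * emb s" "emb p' = a' * (emb s' :: 'k::field_char_0 laur)"
    and a: "a \<in> FT A 0" "a' \<in> FT A 0"
  shows "cech_frac (mJ t) A p s = cech_frac (mJ t) A p' s' \<longleftrightarrow> eqm t A a a'"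
proof -
  interpret frac_ring "poly6_ring Quot (mJ t :: 'k poly6 set)" "residue (mJ t) ` monomials A"
    by (rule cech_frac_ring)
  obtain d d' where d: "d \<in> MA A" "emb s = (mn d :: 'k laur)" "d' \<in> MA A" "emb s' = (mn d' :: 'k laur)"
    using monomials_emb[OF assms(1)] monomials_emb[OF assms(2)] by blast
  have dE: "d \<in> EA {} 0" "d' \<in> EA {} 0" "- d \<in> EA A 0" "- d' \<in> EA A 0"
    using d(1,3) by (auto simp: MA_def)
  have mF: "mn d \<in> FT A 0" "mn d' \<in> (FT A 0 :: 'k laur set)"
    using dE by (auto intro: FT_mono[OF FT_mn])
  have "cech_frac (mJ t) A p s = cech_frac (mJ t) A p' s' \<longleftrightarrow>
    (\<exists>q\<in>monomials A. q * (p * s') - q * (p' * s) \<in> mJ t)"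
    unfolding cech_frac_def
    by (subst frac_eq) (use assms(1,2) in \<open>auto simp: quot_carrier quot_mult[OF mJ_ideal] residue_eq[OF mJ_ideal]\<close>)
  also have "\<dots> \<longleftrightarrow> (\<exists>q\<in>monomials A. emb q * ((a - a') * (mn d * mn d')) \<in> IP {} (int t))"
    by (simp add: mJ_iff emb_diff emb_mult assms(3,4) d(2,4) algebra_simps)
  also have "\<dots> \<longleftrightarrow> (\<exists>f\<in>MA A. mn f * ((a - a') * (mn d * mn d')) \<in> IP {} (int t))"
    using monomials_emb[where 'k = 'k] MA_monomial[where 'k = 'k] by metis
  also have "\<dots> \<longleftrightarrow> (a - a') * (mn d * mn d') \<in> IP A (int t)"
    by (rule IP_clear[symmetric]) (intro FT_mult0 FT_diff a mF)
  also have "\<dots> \<longleftrightarrow> a - a' \<in> IP A (int t)"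
  proof
    assume "(a - a') * (mn d * mn d') \<in> IP A (int t)"
    then have "(mn (- d) * mn (- d')) * ((a - a') * (mn d * mn d')) \<in> IP A (int t)"
      by (rule IP_mult_FT[OF FT_mult0[OF FT_mn[OF dE(3)] FT_mn[OF dE(4)]]])
    moreover have "(mn (- d) * mn (- d')) * ((a - a') * (mn d * mn d')) = (a - a') * ((mn d * mn (- d)) * (mn d' * mn (- d')))"
      by (simp only: mult_ac)
    ultimately show "a - a' \<in> IP A (int t)"
      by simp
  next
    assume "a - a' \<in> IP A (int t)"
    then show "(a - a') * (mn d * mn d') \<in> IP A (int t)"
      by (intro IP_mult_FT2 FT_mult0 mF)
  qed
  finally show ?thesis
    using a by (simp add: eqm_def)
qed

lemma lf_eq_frac:
  assumes "s \<in> monomials A" "emb p = a * (emb s :: 'k::field_char_0 laur)" "a \<in> FT A 0"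
  shows "lf t A a = cech_frac (mJ t) A p s"
proof -
  let ?P = "\<lambda>c. \<exists>p s. s \<in> monomials A \<and> emb p = a * emb s \<and> c = cech_frac (mJ t) A p s"
  have "?P (lf t A a)"
    unfolding lf_def by (rule someI[of ?P "cech_frac (mJ t) A p s"]) (use assms in blast)
  then obtain p' s' where "s' \<in> monomials A" "emb p' = a * emb s'" "lf t A a = cech_frac (mJ t) A p' s'"
    by blast
  then show ?thesis
    using cech_frac_eq[of s' A s p' a p a t] assms eqm_refl by metis
qed

lemma lf_eq_iff:
  assumes "a \<in> FT A 0" "b \<in> FT A 0"
  shows "lf t A a = lf t A b \<longleftrightarrow> eqm t A a (b :: 'k::field_char_0 laur)"
proof -
  obtain p s where 1: "s \<in> monomials A" "emb p = a * (emb s :: 'k laur)"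
    using laur_fraction[OF assms(1)] .
  obtain q r where 2: "r \<in> monomials A" "emb q = b * (emb r :: 'k laur)"
    using laur_fraction[OF assms(2)] .
  show ?thesis
    using lf_eq_frac[OF 1 assms(1)] lf_eq_frac[OF 2 assms(2)] cech_frac_eq[OF 1(1) 2(1) 1(2) 2(2) assms] by simp
qed

lemma lf_cong: "eqm t A a b \<Longrightarrow> lf t A a = lf t A b"
  using lf_eq_iff[of a A b t] by (simp add: eqm_def)

lemma cech_frac_lf:
  assumes "s \<in> monomials A"
  shows "\<exists>a\<in>FT A 0. cech_frac (mJ t) A p s = lf t A a \<and> emb p = a * (emb s :: 'k::field_char_0 laur)"
proof -
  obtain d where d: "d \<in> MA A" "emb s = (mn d :: 'k laur)"
    using monomials_emb[OF assms] by blast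
  have a: "emb p * mn (- d) \<in> FT A 0"
    using d(1) by (intro FT_mult0 FT_mono[OF emb_FT] FT_mn) (auto simp: MA_def)
  have e: "emb p = emb p * mn (- d) * (emb s :: 'k laur)"
    unfolding d(2) by (simp add: mult.assoc)
  show ?thesis
    using lf_eq_frac[OF assms e a, of t] a e by (intro bexI[of _ "emb p * mn (- d)"]) simp_all
qed

lemma cech_loc_cring: "cring (cech_loc (mJ t) A)"
  unfolding cech_loc_def by (rule frac_ring.localization_cring[OF cech_frac_ring])

lemma cech_loc_carrier: "carrier (cech_loc (mJ t) A) = lf t A ` (FT A 0 :: 'k::field_char_0 laur set)"
proof -
  interpret frac_ring "poly6_ring Quot (mJ t :: 'k poly6 set)" "residue (mJ t) ` monomials A"
    by (rule cech_frac_ring)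
  have "carrier (cech_loc (mJ t) A) = {cech_frac (mJ t) A p s | p s. s \<in> (monomials A :: 'k poly6 set)}"
    by (auto simp: cech_loc_def localization_carrier cech_frac_def quot_carrier)
  also have "\<dots> = lf t A ` (FT A 0 :: 'k laur set)"
  proof
    show "{cech_frac (mJ t) A p s | p s. s \<in> (monomials A :: 'k poly6 set)} \<subseteq> lf t A ` FT A 0"
      using cech_frac_lf by blast
    show "lf t A ` FT A 0 \<subseteq> {cech_frac (mJ t) A p s | p s. s \<in> (monomials A :: 'k poly6 set)}"
    proof
      fix c :: "'k cech_elem" assume "c \<in> lf t A ` FT A 0"
      then obtain a :: "'k laur" where a: "a \<in> FT A 0" "c = lf t A a"
        by blast
      obtain p s where s: "s \<in> monomials A" "emb p = a * (emb s :: 'k laur)"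
        using laur_fraction[OF a(1)] .
      then show "c \<in> {cech_frac (mJ t) A p s | p s. s \<in> (monomials A :: 'k poly6 set)}"
        unfolding a(2) lf_eq_frac[OF s a(1)] by blast
    qed
  qed
  finally show ?thesis .
qed

lemma lf_carrier: "a \<in> FT A 0 \<Longrightarrow> lf t A a \<in> carrier (cech_loc (mJ t) A)"
  by (auto simp: cech_loc_carrier)

lemma lf_mult:
  assumes "a \<in> FT A 0" "b \<in> FT A 0"
  shows "lf t A a \<otimes>\<^bsub>cech_loc (mJ t) A\<^esub> lf t A b = lf t A (a * (b :: 'k::field_char_0 laur))"
proof -
  interpret frac_ring "poly6_ring Quot (mJ t :: 'k poly6 set)" "residue (mJ t) ` monomials A"
    by (rule cech_frac_ring)
  obtain p s where 1: "s \<in> monomials A" "emb p = a * (emb s :: 'k laur)"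
    using laur_fraction[OF assms(1)] .
  obtain q r where 2: "r \<in> monomials A" "emb q = b * (emb r :: 'k laur)"
    using laur_fraction[OF assms(2)] .
  have "emb (p * q) = a * b * (emb (s * r) :: 'k laur)"
    by (simp add: emb_mult 1 2 mult_ac)
  from lf_eq_frac[OF monomials_mult[OF 1(1) 2(1)] this FT_mult0[OF assms], of t]
  show ?thesis
    unfolding lf_eq_frac[OF 1 assms(1), of t] lf_eq_frac[OF 2 assms(2), of t]
    using localization_mult[of "residue (mJ t) p" "residue (mJ t) s" "residue (mJ t) q" "residue (mJ t) r"] 1(1) 2(1)
    by (simp add: cech_loc_def cech_frac_def quot_carrier quot_mult[OF mJ_ideal])
qed

lemma lf_add:
  assumes "a \<in> FT A 0" "b \<in> FT A 0"
  shows "lf t A a \<oplus>\<^bsub>cech_loc (mJ t) A\<^esub> lf t A b = lf t A (a + (b :: 'k::field_char_0 laur))"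
proof -
  interpret frac_ring "poly6_ring Quot (mJ t :: 'k poly6 set)" "residue (mJ t) ` monomials A"
    by (rule cech_frac_ring)
  obtain p s where 1: "s \<in> monomials A" "emb p = a * (emb s :: 'k laur)"
    using laur_fraction[OF assms(1)] .
  obtain q r where 2: "r \<in> monomials A" "emb q = b * (emb r :: 'k laur)"
    using laur_fraction[OF assms(2)] .
  have "emb (p * r + q * s) = (a + b) * (emb (s * r) :: 'k laur)"
    by (simp add: emb_mult emb_add 1 2 algebra_simps)
  from lf_eq_frac[OF monomials_mult[OF 1(1) 2(1)] this FT_add[OF assms], of t]
  show ?thesis
    unfolding lf_eq_frac[OF 1 assms(1), of t] lf_eq_frac[OF 2 assms(2), of t]
    using localization_add[of "residue (mJ t) p" "residue (mJ t) s" "residue (mJ t) q" "residue (mJ t) r"] 1(1) 2(1)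
    by (simp add: cech_loc_def cech_frac_def quot_carrier quot_mult[OF mJ_ideal] quot_add[OF mJ_ideal])
qed

lemma emb_FT': "emb p \<in> FT A 0"
  by (rule FT_mono[OF emb_FT]) simp

lemma lf_poly: "cech_frac (mJ t) A p 1 = lf t A (emb (p :: 'k::field_char_0 poly6))"
  using lf_eq_frac[OF monomials_one[where 'a = 'k], of p "emb p" A t] emb_FT'[of p A] by simp

lemma lf_one: "\<one>\<^bsub>cech_loc (mJ t) A\<^esub> = lf t A (1 :: 'k::field_char_0 laur)"
proof -
  interpret frac_ring "poly6_ring Quot (mJ t :: 'k poly6 set)" "residue (mJ t) ` monomials A"
    by (rule cech_frac_ring)
  show ?thesis
    using localization_one lf_poly[of t A "1 :: 'k poly6"]
    by (simp add: cech_loc_def cech_frac_def quot_one)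
qed

lemma lf_hom: "laur_hom (cech_loc (mJ t) A) A (lf t A)"
  by (intro laur_hom.intro laur_hom_axioms.intro cech_loc_cring lf_carrier lf_add lf_mult lf_one)

lemmas lf_zero = laur_hom.hom_zero[OF lf_hom]
  and lf_uminus = laur_hom.hom_uminus[OF lf_hom]
  and lf_finsum = laur_hom.hom_finsum[OF lf_hom]
  and taylor_trunc_lf = laur_hom.taylor_trunc_hom[OF lf_hom]
  and ln_trunc_lf = laur_hom.ln_trunc_hom[OF lf_hom]

lemma lf_inv:
  assumes "is_inv t A x s"
  shows "inv\<^bsub>cech_loc (mJ t) A\<^esub> lf t A x = lf t A s"
  by (rule laur_hom.hom_inv[OF lf_hom]) (use assms in \<open>simp_all add: is_inv_def lf_eq_iff FT_mult0\<close>)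

lemma cech_quot_lf:
  assumes "is_inv t A (emb q) s"
  shows "cech_quot (mJ t) A p q = lf t A (emb p * s)"
  using assms by (simp add: cech_quot_def lf_poly lf_inv[OF assms] lf_mult is_inv_def emb_FT')

text \<open>\<open>cech_restrict\<close> is a union over representatives; all of them give the same
  fraction over \<open>B\<close>, because multipliers over \<open>A\<close> are multipliers over
  \<open>B\<close>.\<close>

lemma restrict_lf:
  assumes "a \<in> FT A 0" "A \<subseteq> B"
  shows "cech_restrict (mJ t) B (lf t A a) = lf t B (a :: 'k::field_char_0 laur)"
proof -
  interpret A: frac_ring "poly6_ring Quot (mJ t :: 'k poly6 set)" "residue (mJ t) ` monomials A"
    by (rule cech_frac_ring)
  interpret B: frac_ring "poly6_ring Quot (mJ t :: 'k poly6 set)" "residue (mJ t) ` monomials B"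
    by (rule cech_frac_ring)
  obtain p s where ps: "s \<in> monomials A" "emb p = a * (emb s :: 'k laur)"
    using laur_fraction[OF assms(1)] .
  have S: "residue (mJ t) ` monomials A \<subseteq> (residue (mJ t) ` monomials B :: 'k poly6 set set)"
    using monomials_mono[OF assms(2)] by blast
  have B: "lf t B a = cech_frac (mJ t) B p s"
    using lf_eq_frac[of s B p a t] ps monomials_mono[OF assms(2)] FT_mono[OF assms] by blast
  have *: "frac (poly6_ring Quot (mJ t)) (residue (mJ t) ` monomials B) r r' = lf t B a"
    if "(r, r') \<in> lf t A a" for r r'
  proof -
    have m: "(r, r') \<in> frac (poly6_ring Quot (mJ t)) (residue (mJ t) ` monomials A) (residue (mJ t) p) (residue (mJ t) s)"
      using that lf_eq_frac[OF ps assms(1), of t] by (simp add: cech_frac_def)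
    note d = A.mem_fracD[OF m]
    have "\<exists>q\<in>residue (mJ t) ` monomials B. q \<otimes>\<^bsub>poly6_ring Quot (mJ t)\<^esub> (residue (mJ t) p \<otimes>\<^bsub>poly6_ring Quot (mJ t)\<^esub> r')
        = q \<otimes>\<^bsub>poly6_ring Quot (mJ t)\<^esub> (r \<otimes>\<^bsub>poly6_ring Quot (mJ t)\<^esub> residue (mJ t) s)"
      using d(5) S by (meson subsetD)
    then have "frac (poly6_ring Quot (mJ t)) (residue (mJ t) ` monomials B) (residue (mJ t) p) (residue (mJ t) s)
        = frac (poly6_ring Quot (mJ t)) (residue (mJ t) ` monomials B) r r'"
      unfolding B.frac_eq[OF d(3) subsetD[OF S d(4)] d(1) subsetD[OF S d(2)]] .
    then show ?thesis
      unfolding B cech_frac_def by simp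
  qed
  have "(residue (mJ t) p, residue (mJ t) s) \<in> lf t A a"
    unfolding lf_eq_frac[OF ps assms(1), of t] cech_frac_def
    by (rule A.frac_self) (use ps in \<open>auto simp: quot_carrier\<close>)
  with * show ?thesis
    unfolding cech_restrict_def by fastforce
qed

lemma lf_degree:
  "cech_loc_degree (mJ t) 0 A = lf t A ` {a \<in> FT A 0. homog 0 (a :: 'k::field_char_0 laur)}"
proof (intro equalityI subsetI)
  fix c :: "'k cech_elem"
  assume "c \<in> cech_loc_degree (mJ t) 0 A"
  then obtain p s d where c: "c = cech_frac (mJ t) A p s" "s \<in> monomials A" "homogeneous d p" "homogeneous d s"
    by (auto simp: cech_loc_degree_def)
  obtain f where f: "f \<in> MA A" "emb s = (mn f :: 'k laur)"
    using monomials_emb[OF c(2)] by blast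
  obtain a :: "'k laur" where a: "a \<in> FT A 0" "c = lf t A a" "emb p = a * emb s"
    using cech_frac_lf[OF c(2)] c(1) by blast
  have a': "a = emb p * mn (- f)"
    unfolding a(3) f(2) by (simp add: mult.assoc)
  have "homog (int d) (mn f :: 'k laur)"
    using c(4) by (simp add: homog_emb f(2)[symmetric])
  then have "tot f = int d"
    by (simp add: homog_def)
  moreover have "tot (- f) = - tot f"
    using tot_add[of f "- f"] by (simp add: tot_def tdeg_def)
  ultimately have "homog (int d + - int d) a"
    unfolding a' using c(3) homog_mn[of "- f", where 'a = 'k] by (intro homog_mult) (simp_all add: homog_emb)
  then show "c \<in> lf t A ` {a \<in> FT A 0. homog 0 a}"
    using a by simp
next
  fix c :: "'k cech_elem"
  assume "c \<in> lf t A ` {a \<in> FT A 0. homog 0 a}"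
  then obtain a :: "'k laur" where a: "a \<in> FT A 0" "homog 0 a" "c = lf t A a"
    by blast
  obtain p s where ps: "s \<in> monomials A" "emb p = a * (emb s :: 'k laur)"
    using laur_fraction[OF a(1)] .
  obtain f where f: "f \<in> MA A" "emb s = (mn f :: 'k laur)"
    using monomials_emb[OF ps(1)] by blast
  obtain m where m: "f = emb_exp m"
    using emb_exp_surj f(1) by (auto simp: MA_def)
  define d where "d = (\<Sum>i\<in>UNIV. Poly_Mapping.lookup m i)"
  have s: "homog (int d) (emb s)"
    using homog_mn[of f, where 'a = 'k] by (simp add: f(2)) (simp add: m tot_emb_exp d_def)
  then have "homog (0 + int d) (emb p)"
    unfolding ps(2) by (intro homog_mult a(2))
  with s have "homogeneous d p" "homogeneous d s"
    by (simp_all add: homog_emb)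
  then show "c \<in> cech_loc_degree (mJ t) 0 A"
    unfolding a(3) lf_eq_frac[OF ps a(1)] cech_loc_degree_def using ps(1) by force
qed

section \<open>Local cohomology\<close>

definition lfc :: "nat \<Rightarrow> nat \<Rightarrow> (indet set \<Rightarrow> 'k::field_char_0 laur) \<Rightarrow> 'k cochain"
  where "lfc t k x = (\<lambda>A\<in>faces k. lf t A (x A))"

text \<open>Total functions whose values on sets of other sizes are free; \<open>lfc\<close>
  discards those values.\<close>

definition LC :: "nat \<Rightarrow> (indet set \<Rightarrow> 'k::field_char_0 laur) set"
  where "LC k = {x. \<forall>A. card A = k \<longrightarrow> x A \<in> FT A 0}"

lemma LC_D: "x \<in> LC k \<Longrightarrow> card A = k \<Longrightarrow> x A \<in> FT A 0"
  by (simp add: LC_def)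

lemma LC_add: "x \<in> LC k \<Longrightarrow> y \<in> LC k \<Longrightarrow> (\<lambda>A. x A + y A) \<in> LC k"
  by (simp add: LC_def FT_add)

lemma LC_sc: "x \<in> LC k \<Longrightarrow> (\<lambda>A. sc c * x A) \<in> LC k"
  by (simp add: LC_def FT_sc_mult)

lemma LC_0: "(\<lambda>A. 0) \<in> LC k"
  by (simp add: LC_def)

lemma LC_cd: "x \<in> LC k \<Longrightarrow> cd x \<in> LC (Suc k)"
  by (auto simp: LC_def intro!: FT_cd)

lemma faces_iff: "A \<in> faces k \<longleftrightarrow> card A = k"
  by (simp add: faces_def)

lemma lfc_eq_iff:
  assumes "x \<in> LC k" "y \<in> LC k"
  shows "lfc t k x = lfc t k y \<longleftrightarrow> (\<forall>A. card A = k \<longrightarrow> eqm t A (x A) (y A))"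
proof -
  have "lfc t k x = lfc t k y \<longleftrightarrow> (\<forall>A. card A = k \<longrightarrow> lf t A (x A) = lf t A (y A))"
    by (auto simp: lfc_def restrict_def fun_eq_iff faces_iff)
  also have "\<dots> \<longleftrightarrow> (\<forall>A. card A = k \<longrightarrow> eqm t A (x A) (y A))"
    using assms by (auto simp: LC_def lf_eq_iff)
  finally show ?thesis .
qed

lemma cech_carrier: "carrier (cech (mJ t) k) = lfc t k ` (LC k :: (indet set \<Rightarrow> 'k::field_char_0 laur) set)"
proof (intro equalityI subsetI)
  fix f :: "'k cochain"
  assume f: "f \<in> carrier (cech (mJ t) k)"
  then have "\<forall>A. \<exists>x. card A = k \<longrightarrow> x \<in> FT A 0 \<and> f A = lf t A (x :: 'k laur)"
    by (auto simp: cech_def PiE_def Pi_def faces_iff cech_loc_carrier)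
  then obtain x where x: "\<And>A. card A = k \<Longrightarrow> x A \<in> FT A 0 \<and> f A = lf t A (x A :: 'k laur)"
    by metis
  have "f = lfc t k x"
  proof
    fix A show "f A = lfc t k x A"
      using f x[of A] by (auto simp: cech_def lfc_def faces_iff PiE_def extensional_def)
  qed
  then show "f \<in> lfc t k ` LC k"
    using x by (auto simp: LC_def)
next
  fix f :: "'k cochain"
  assume "f \<in> lfc t k ` LC k"
  then show "f \<in> carrier (cech (mJ t) k)"
    by (auto simp: cech_def lfc_def LC_def faces_iff cech_loc_carrier)
qed

lemma lfc_add:
  "x \<in> LC k \<Longrightarrow> y \<in> LC k \<Longrightarrow> lfc t k x \<oplus>\<^bsub>cech (mJ t) k\<^esub> lfc t k y = lfc t k (\<lambda>A. x A + y A)"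
  by (auto simp: cech_def lfc_def LC_def faces_iff lf_add intro!: restrict_ext)

lemma lfc_smult:
  assumes "x \<in> LC k"
  shows "c \<odot>\<^bsub>cech (mJ t) k\<^esub> lfc t k x = lfc t k (\<lambda>A. sc c * x A)"
  using assms by (auto simp: cech_def lfc_def LC_def faces_iff lf_poly emb_pconst lf_mult sc_FT intro!: restrict_ext)

lemma lfc_zero: "\<zero>\<^bsub>cech (mJ t) k\<^esub> = lfc t k (\<lambda>A. 0)"
  by (auto simp: cech_def lfc_def lf_zero)

lemma lfc_diff:
  fixes x :: "indet set \<Rightarrow> 'k::field_char_0 laur"
  assumes "x \<in> LC k"
  shows "cech_diff (mJ t) k (lfc t k x) = lfc t (Suc k) (cd x)"
  unfolding cech_diff_def lfc_def[of t "Suc k"]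
proof (rule restrict_ext)
  fix B :: "indet set" assume "B \<in> faces (Suc k)"
  then have B: "card B = Suc k"
    by (simp add: faces_iff)
  interpret cring "cech_loc (mJ t :: 'k poly6 set) B"
    by (rule cech_loc_cring)
  have x: "x (B - {b}) \<in> FT B 0" "x (B - {b}) \<in> FT (B - {b}) 0" if "b \<in> B" for b
    using LC_D[OF assms, of "B - {b}"] B that by (auto intro: FT_mono)
  have "(if even (card {a \<in> B. a < b}) then cech_restrict (mJ t) B (lfc t k x (B - {b}))
      else \<ominus>\<^bsub>cech_loc (mJ t) B\<^esub> cech_restrict (mJ t) B (lfc t k x (B - {b})))
      = lf t B (csgn b B * x (B - {b}))" if "b \<in> B" for b
  proof -
    have "lfc t k x (B - {b}) = lf t (B - {b}) (x (B - {b}))"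
      using B that by (simp add: lfc_def faces_iff)
    then show ?thesis
      using x[OF that] by (simp add: restrict_lf lf_uminus csgn_def)
  qed
  then have "(\<Oplus>\<^bsub>cech_loc (mJ t) B\<^esub>b\<in>B. (if even (card {a \<in> B. a < b}) then cech_restrict (mJ t) B (lfc t k x (B - {b}))
      else \<ominus>\<^bsub>cech_loc (mJ t) B\<^esub> cech_restrict (mJ t) B (lfc t k x (B - {b}))))
      = (\<Oplus>\<^bsub>cech_loc (mJ t) B\<^esub>b\<in>B. lf t B (csgn b B * x (B - {b})))"
    by (intro finsum_cong) (auto simp: simp_implies_def intro!: lf_carrier FT_csgn_mult x)
  also have "\<dots> = lf t B (cd x B)"
    unfolding cd_def by (rule lf_finsum) (auto intro: FT_csgn_mult x)
  finally show "(\<Oplus>\<^bsub>cech_loc (mJ t) B\<^esub>b\<in>B. (if even (card {a \<in> B. a < b}) then cech_restrict (mJ t) B (lfc t k x (B - {b}))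
      else \<ominus>\<^bsub>cech_loc (mJ t) B\<^esub> cech_restrict (mJ t) B (lfc t k x (B - {b})))) = lf t B (cd x B)" .
qed

lemma lfc_cocycle:
  fixes x :: "indet set \<Rightarrow> 'k::field_char_0 laur"
  assumes "x \<in> LC 3"
  shows "lfc t 3 x \<in> cech_cocycles (mJ t) 3 \<longleftrightarrow> (\<forall>B. card B = 4 \<longrightarrow> cd x B \<in> IP B (int t))"
proof -
  have c: "lfc t 3 x \<in> carrier (cech (mJ t) 3)"
    using assms by (auto simp: cech_carrier)
  have d: "cd x \<in> LC (Suc 3)"
    by (rule LC_cd[OF assms])
  have "lfc t 3 x \<in> cech_cocycles (mJ t) 3 \<longleftrightarrow> lfc t (Suc 3) (cd x) = lfc t (Suc 3) (\<lambda>A. 0)"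
    using c by (simp add: cech_cocycles_def lfc_diff[OF assms] lfc_zero)
  also have "\<dots> \<longleftrightarrow> (\<forall>B. card B = 4 \<longrightarrow> cd x B \<in> IP B (int t))"
    unfolding lfc_eq_iff[OF d LC_0] using d by (auto simp: eqm_def LC_def)
  finally show ?thesis .
qed

lemma boundaries_lfc:
  "cech_boundaries (mJ t) 3 = {lfc t 3 (cd b) | b. b \<in> (LC 2 :: (indet set \<Rightarrow> 'k::field_char_0 laur) set)}"
proof -
  have 3: "(3::nat) = Suc 2"
    by simp
  show ?thesis
    unfolding 3 cech_boundaries.simps cech_carrier by (auto simp: lfc_diff image_iff)
qed

lemma class_lfc:
  assumes "x \<in> LC 3"
  shows "cech_class (mJ t) 3 (lfc t 3 x) = {lfc t 3 (\<lambda>A. cd b A + x A) | b. b \<in> (LC 2 :: (indet set \<Rightarrow> 'k::field_char_0 laur) set)}"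
proof -
  have cdb: "cd b \<in> LC 3" if "b \<in> (LC 2 :: (indet set \<Rightarrow> 'k laur) set)" for b
    using LC_cd[OF that] by (simp add: numeral_3_eq_3 numeral_2_eq_2)
  have "cech_class (mJ t) 3 (lfc t 3 x) = {f \<oplus>\<^bsub>cech (mJ t) 3\<^esub> lfc t 3 x | f. f \<in> cech_boundaries (mJ t) 3}"
    by (auto simp: cech_class_def a_r_coset_def')
  also have "\<dots> = {lfc t 3 (cd b) \<oplus>\<^bsub>cech (mJ t) 3\<^esub> lfc t 3 x | b. b \<in> LC 2}"
    unfolding boundaries_lfc by blast
  also have "\<dots> = {lfc t 3 (\<lambda>A. cd b A + x A) | b. b \<in> LC 2}"
    using lfc_add[OF cdb assms] by (intro Collect_cong ex_cong1) auto
  finally show ?thesis .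
qed

lemma class_lfc_cong:
  fixes x y :: "indet set \<Rightarrow> 'k::field_char_0 laur"
  assumes x: "x \<in> LC 3" and y: "y \<in> LC 3" and b: "b \<in> LC 2"
    and eq: "\<And>A. card A = 3 \<Longrightarrow> eqm t A (x A) (cd b A + y A)"
  shows "cech_class (mJ t) 3 (lfc t 3 x) = cech_class (mJ t) 3 (lfc t 3 y)"
proof -
  have cdb: "cd b \<in> LC 3" if "b \<in> (LC 2 :: (indet set \<Rightarrow> 'k laur) set)" for b
    using LC_cd[OF that] by (simp add: numeral_3_eq_3 numeral_2_eq_2)
  have e: "lfc t 3 (\<lambda>A. cd b' A + x A) = lfc t 3 (\<lambda>A. cd (\<lambda>A. b' A + b A) A + y A)" if b': "b' \<in> LC 2" for b'
  proof -
    have "eqm t A (cd b' A + x A) (cd b' A + (cd b A + y A))" if "card A = 3" for A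
      using eq[OF that] LC_D[OF cdb[OF b'] that] by (intro eqm_add eqm_refl)
    then show ?thesis
      using x y b b' by (subst lfc_eq_iff) (auto intro!: LC_add cdb simp: cd_add add.assoc)
  qed
  have e2: "lfc t 3 (\<lambda>A. cd b' A + y A) = lfc t 3 (\<lambda>A. cd (\<lambda>A. b' A + sc (- 1) * b A) A + x A)" if b': "b' \<in> LC 2" for b'
  proof -
    have m: "sc (- 1) = (- 1 :: 'k laur)"
      by (simp add: sc_def single_uminus)
    from e[OF LC_add[OF b' LC_sc[OF b]], of "- 1"] show ?thesis
      unfolding m by simp
  qed
  show ?thesis
    unfolding class_lfc[OF x] class_lfc[OF y]
  proof (intro equalityI subsetI)
    fix f assume "f \<in> {lfc t 3 (\<lambda>A. cd b A + x A) | b. b \<in> LC 2}"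
    then obtain b' where "b' \<in> LC 2" "f = lfc t 3 (\<lambda>A. cd b' A + x A)"
      by blast
    then show "f \<in> {lfc t 3 (\<lambda>A. cd b A + y A) | b. b \<in> LC 2}"
      using e LC_add[OF _ b] by blast
  next
    fix f assume "f \<in> {lfc t 3 (\<lambda>A. cd b A + y A) | b. b \<in> LC 2}"
    then obtain b' where "b' \<in> LC 2" "f = lfc t 3 (\<lambda>A. cd b' A + y A)"
      by blast
    then show "f \<in> {lfc t 3 (\<lambda>A. cd b A + x A) | b. b \<in> LC 2}"
      using e2 LC_add[OF _ LC_sc[OF b]] by blast
  qed
qed

subsection \<open>Evaluation of the two cochains\<close>

lemma emb_pvar_mult: "emb (pvar i * pvar j) = quad i j"
  by (simp add: emb_mult emb_pvar quad_def)

lemma gd_swap: "gd A i j k l = gd A k l i j"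
  by (auto simp: gd_def)

lemma taylor_quot:
  assumes D: "(quad i j - quad k l :: 'k::field_char_0 laur) \<in> IP A 1" and g: "gd A i j k l"
  shows "taylor_trunc (cech_loc (mJ t) A) t (cech_quot (mJ t) A (pvar i * pvar j - pvar k * pvar l) (pvar i * pvar j))
    = lf t A (tay t A i j k l :: 'k laur)"
proof -
  have "is_inv t A (emb (pvar i * pvar j)) (qinv t A i j k l :: 'k laur)"
    unfolding emb_pvar_mult by (rule is_inv_qinv[OF D g])
  from cech_quot_lf[OF this] show ?thesis
    using taylor_trunc_lf[OF IP_subset[OF tay_FT(2)[OF D g]]]
    by (simp add: emb_diff emb_pvar_mult tay_def)
qed

text \<open>Modulo I^t one has 1 - ij/kl = (kl - ij)/kl, so both sides use powers of the same
  element.\<close>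

lemma ln_quot:
  assumes D: "(quad k l - quad i j :: 'k::field_char_0 laur) \<in> IP A 1" and g: "gd A k l i j"
  shows "ln_trunc (cech_loc (mJ t) A) t (cech_quot (mJ t) A (pvar i * pvar j) (pvar k * pvar l))
    = lf t A (- tay t A k l i j :: 'k laur)"
proof -
  define s where "s = (qinv t A k l i j :: 'k laur)"
  have s: "is_inv t A (quad k l) s"
    unfolding s_def by (rule is_inv_qinv[OF D g])
  have "eqm t A (1 - quad i j * s) (quad k l * s - quad i j * s)"
    using s quad_FT unfolding is_inv_def by (intro eqm_diff eqm_refl FT_mult0 eqm_sym[of t A "quad k l * s" 1]) auto
  then have "eqm t A (- tlog t (1 - quad i j * s)) (- tlog t ((quad k l - quad i j) * s))"
    by (intro eqm_uminus eqm_tlog) (simp add: algebra_simps)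
  from lf_cong[OF this] show ?thesis
    using cech_quot_lf[of t A "pvar k * pvar l" s "pvar i * pvar j"] s
    by (simp add: emb_pvar_mult ln_trunc_lf FT_mult0 quad_FT is_inv_def tay_def s_def)
qed

text \<open>The logarithm expands in 1 - ij/kl but \<open>tay\<close> in 1 - kl/ij, hence the use of
  \<open>tay_swap\<close>. The truncations agree because both stop at the power of I that is divided
  out.\<close>

lemma ln_quot_swap:
  assumes D: "(quad i j - quad k l :: 'k::field_char_0 laur) \<in> IP A 1" and g: "gd A i j k l" and t: "1 \<le> t"
  shows "ln_trunc (cech_loc (mJ t) A) t (cech_quot (mJ t) A (pvar i * pvar j) (pvar k * pvar l))
    = lf t A (tay t A i j k l :: 'k laur)"
proof -
  define s where "s = (qinv t A k l i j :: 'k laur)"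
  have D': "(quad k l - quad i j :: 'k laur) \<in> IP A 1"
    using IP_uminus[OF D] by simp
  have s: "is_inv t A (quad k l) s"
    unfolding s_def by (rule is_inv_qinv[OF D']) (use g in \<open>simp add: gd_swap\<close>)
  from lf_cong[OF tay_swap[OF D g t s]] show ?thesis
    using cech_quot_lf[of t A "pvar k * pvar l" s "pvar i * pvar j"] s
    by (simp add: emb_pvar_mult ln_trunc_lf FT_mult0 quad_FT is_inv_def)
qed

lemma D_IP_quad:
  "(quad Ind_v Ind_z - quad Ind_w Ind_y :: 'k::field_char_0 laur) \<in> IP A 1"
  "(quad Ind_w Ind_x - quad Ind_u Ind_z :: 'k laur) \<in> IP A 1"
  "(quad Ind_u Ind_y - quad Ind_v Ind_x :: 'k laur) \<in> IP A 1"
  by (simp_all add: D_quad D_IP)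

lemma tay_FTs:
  "gd1 A \<Longrightarrow> tay1 t A \<in> (FT A 0 :: 'k::field_char_0 laur set)"
  "gd2 A \<Longrightarrow> tay2 t A \<in> (FT A 0 :: 'k laur set)"
  "gd3 A \<Longrightarrow> tay3 t A \<in> (FT A 0 :: 'k laur set)"
  unfolding tay1_def tay2_def tay3_def by (rule tay_FT D_IP_quad; assumption?)+

definition nine :: "indet set set"
  where "nine = {{Ind_u, Ind_x, Ind_y}, {Ind_v, Ind_x, Ind_y}, {Ind_w, Ind_x, Ind_y}, {Ind_u, Ind_x, Ind_z},
    {Ind_v, Ind_x, Ind_z}, {Ind_w, Ind_x, Ind_z}, {Ind_u, Ind_y, Ind_z}, {Ind_v, Ind_y, Ind_z}, {Ind_w, Ind_y, Ind_z}}"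

text \<open>A set of three elements that contains one of the nine triples equals it, so all
  coefficients vanish.\<close>

lemma not_nine:
  assumes "card A = 3" "A \<notin> nine"
  shows "etaL t A = 0"
proof -
  have sub: "\<not> B \<subseteq> A" if "B \<in> nine" for B
  proof
    assume "B \<subseteq> A"
    moreover have "card B = 3"
      using that by (auto simp: nine_def)
    ultimately have "B = A"
      using assms(1) by (intro card_subset_eq) auto
    then show False
      using assms(2) that by simp
  qed
  have "cf1 A = 0" "cf2 A = 0" "cf3 A = 0"
    using sub unfolding nine_def cf1_def cf2_def cf3_def by auto
  then show ?thesis
    by (simp add: etaL_def)
qed

lemma taylor_cochain_lfc: "taylor_cochain (mJ t) t = lfc t 3 (etaL t :: indet set \<Rightarrow> 'k::field_char_0 laur)"
  unfolding taylor_cochain_def lfc_def Let_def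
proof (rule restrict_ext, goal_cases)
  case (1 A)
  then have A: "card A = 3"
    by (simp add: faces_iff)
  have T: "gd1 A \<Longrightarrow> taylor_trunc (cech_loc (mJ t) A) t (cech_quot (mJ t) A
      (pvar Ind_v * pvar Ind_z - pvar Ind_w * pvar Ind_y) (pvar Ind_v * pvar Ind_z)) = lf t A (tay1 t A :: 'k laur)"
    "gd2 A \<Longrightarrow> taylor_trunc (cech_loc (mJ t) A) t (cech_quot (mJ t) A
      (pvar Ind_w * pvar Ind_x - pvar Ind_u * pvar Ind_z) (pvar Ind_w * pvar Ind_x)) = lf t A (tay2 t A :: 'k laur)"
    "gd3 A \<Longrightarrow> taylor_trunc (cech_loc (mJ t) A) t (cech_quot (mJ t) A
      (pvar Ind_u * pvar Ind_y - pvar Ind_v * pvar Ind_x) (pvar Ind_u * pvar Ind_y)) = lf t A (tay3 t A :: 'k laur)"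
    unfolding tay1_def tay2_def tay3_def by (rule taylor_quot D_IP_quad; assumption?)+
  show ?case
  proof (cases "A \<in> nine")
    case True
    then show ?thesis
      unfolding nine_def insert_iff empty_iff
      by (elim disjE FalseE; simp add: T gd_def indet_set_eq_iff etaL_def cf1_def cf2_def cf3_def algebra_simps lf_uminus lf_add tay_FTs FT_uminus)
  next
    case False
    then show ?thesis
      using not_nine[OF A False, of t, where 'a = 'k] by (simp add: nine_def lf_zero)
  qed
qed

lemma eta_lfc:
  assumes t: "1 \<le> t"
  shows "eta (mJ t) t = lfc t 3 (etaL t :: indet set \<Rightarrow> 'k::field_char_0 laur)"
  unfolding eta_def lfc_def Let_def
proof (rule restrict_ext, goal_cases)
  case (1 A)
  then have A: "card A = 3"
    by (simp add: faces_iff)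
  let ?L = "\<lambda>p q. ln_trunc (cech_loc (mJ t) A) t (cech_quot (mJ t) A p q)"
  have L: "gd3 A \<Longrightarrow> ?L (pvar Ind_u * pvar Ind_y) (pvar Ind_v * pvar Ind_x) = lf t A (tay3 t A :: 'k laur)"
    "gd1 A \<Longrightarrow> ?L (pvar Ind_v * pvar Ind_z) (pvar Ind_w * pvar Ind_y) = lf t A (tay1 t A :: 'k laur)"
    unfolding tay1_def tay3_def by (rule ln_quot_swap D_IP_quad t; assumption?)+
  have L': "gd2 A \<Longrightarrow> ?L (pvar Ind_u * pvar Ind_z) (pvar Ind_w * pvar Ind_x) = lf t A (- tay2 t A :: 'k laur)"
    "gd1 A \<Longrightarrow> ?L (pvar Ind_w * pvar Ind_y) (pvar Ind_v * pvar Ind_z) = lf t A (- tay1 t A :: 'k laur)"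
    "gd3 A \<Longrightarrow> ?L (pvar Ind_v * pvar Ind_x) (pvar Ind_u * pvar Ind_y) = lf t A (- tay3 t A :: 'k laur)"
    unfolding tay1_def tay2_def tay3_def by (rule ln_quot D_IP_quad; assumption?)+
  show ?case
  proof (cases "A \<in> nine")
    case True
    then show ?thesis
      unfolding nine_def insert_iff empty_iff
      by (elim disjE FalseE; simp add: L L' gd_def indet_set_eq_iff etaL_def cf1_def cf2_def cf3_def algebra_simps lf_add tay_FTs FT_uminus)
  next
    case False
    then show ?thesis
      using not_nine[OF A False, of t, where 'a = 'k] by (simp add: nine_def lf_zero)
  qed
qed

subsection \<open>The generator\<close>

lemma etaL_LC: "etaL t \<in> LC k"
  by (simp add: LC_def etaL_FT)

text \<open>Nonvanishing of the class of \<open>eta\<close> plays two roles: it is itself a claim,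
  and it makes the coefficient of the image of \<open>eta\<close> at \<open>e0\<close> nonzero, so
  that every cocycle can be compared with \<open>eta\<close>.\<close>

theorem local_cohomology_generator:
  fixes t :: nat
  assumes t: "2 \<le> t"
  defines "J \<equiv> (mJ t :: 'k::field_char_0 poly6 set)"
  defines "H \<equiv> local_cohomology J 3 0"
  defines "h \<equiv> cech_class J 3 (eta J t)"
  shows "eta J t = taylor_cochain J t" "eta J t \<in> cech_cocycles J 3 \<inter> cech_degree J 3 0"
    "h \<noteq> \<zero>\<^bsub>H\<^esub>" "carrier H = {c \<odot>\<^bsub>H\<^esub> h | c :: 'k. True}"
proof -
  let ?e = "etaL t :: indet set \<Rightarrow> 'k laur"
  have t1: "1 \<le> t"
    using t by simp
  have eta: "eta J t = lfc t 3 ?e"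
    unfolding J_def by (rule eta_lfc[OF t1])
  show "eta J t = taylor_cochain J t"
    unfolding eta unfolding J_def by (rule taylor_cochain_lfc[symmetric])
  have deg: "lfc t 3 x \<in> cech_degree J 3 0" if "x \<in> LC 3" "\<And>A. card A = 3 \<Longrightarrow> homog 0 (x A)" for x :: "indet set \<Rightarrow> 'k laur"
    using that by (auto simp: cech_degree_def lfc_def J_def lf_degree faces_iff LC_def)
  have coc: "lfc t 3 (\<lambda>A. sc c * ?e A) \<in> cech_cocycles J 3 \<inter> cech_degree J 3 0" for c :: 'k
    using etaL_cocycle[OF t1, where 'a = 'k] unfolding J_def
    by (intro IntI deg[unfolded J_def] homog_sc_mult homog_etaL LC_sc etaL_LC)
      (simp add: lfc_cocycle LC_sc etaL_LC cd_mult IP_sc)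
  from coc[of 1] show "eta J t \<in> cech_cocycles J 3 \<inter> cech_degree J 3 0"
    unfolding eta by simp
  have cdb: "cd b \<in> LC 3" if "b \<in> (LC 2 :: (indet set \<Rightarrow> 'k laur) set)" for b
    using LC_cd[OF that] by (simp add: numeral_3_eq_3 numeral_2_eq_2)
  have h: "h = {lfc t 3 (\<lambda>A. cd b A + ?e A) | b. b \<in> LC 2}"
    unfolding h_def eta unfolding J_def by (rule class_lfc[OF etaL_LC])
  have cd0: "cd (\<lambda>A. 0 :: 'k laur) = (\<lambda>A. 0)"
    by (simp add: cd_def fun_eq_iff)
  show "h \<noteq> \<zero>\<^bsub>H\<^esub>"
  proof
    assume "h = \<zero>\<^bsub>H\<^esub>"
    then have "h = {lfc t 3 (cd b) | b. b \<in> (LC 2 :: (indet set \<Rightarrow> 'k laur) set)}"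
      by (simp add: H_def local_cohomology_def J_def boundaries_lfc)
    moreover have "lfc t 3 ?e \<in> h"
      unfolding h using LC_0[of 2] cd0 by (intro CollectI exI[of _ "\<lambda>A. 0"]) simp
    ultimately obtain b :: "indet set \<Rightarrow> 'k laur" where b: "b \<in> LC 2" "lfc t 3 ?e = lfc t 3 (cd b)"
      by blast
    then have "\<forall>A. card A = 3 \<longrightarrow> ?e A - cd b A \<in> IP A (int t)"
      using lfc_eq_iff[OF etaL_LC cdb[OF b(1)]] by (simp add: eqm_def)
    then show False
      using etaL_not_boundary[OF t, where 'a = 'k] b(1) unfolding LC_def by blast
  qed
  \<comment> \<open>The scalar multiple of a class is a union over its coset; scaling maps
    coboundaries to coboundaries, so all members yield one class.\<close>
  have smult: "c \<odot>\<^bsub>H\<^esub> h = cech_class J 3 (lfc t 3 (\<lambda>A. sc c * ?e A))" for c :: 'k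
  proof -
    have "cech_class J 3 (c \<odot>\<^bsub>cech J 3\<^esub> f) = cech_class J 3 (lfc t 3 (\<lambda>A. sc c * ?e A))" if f: "f \<in> h" for f
    proof -
      obtain b where b: "b \<in> LC 2" "f = lfc t 3 (\<lambda>A. cd b A + ?e A)"
        using f unfolding h by blast
      have m: "(\<lambda>A. cd b A + ?e A) \<in> LC 3"
        by (rule LC_add[OF cdb[OF b(1)] etaL_LC])
      have "c \<odot>\<^bsub>cech J 3\<^esub> f = lfc t 3 (\<lambda>A. sc c * (cd b A + ?e A))"
        unfolding b(2) J_def by (rule lfc_smult[OF m])
      moreover have "cech_class J 3 (lfc t 3 (\<lambda>A. sc c * (cd b A + ?e A))) = cech_class J 3 (lfc t 3 (\<lambda>A. sc c * ?e A))"
        unfolding J_def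
      proof (rule class_lfc_cong[OF LC_sc[OF m] LC_sc[OF etaL_LC] LC_sc[OF b(1)]])
        fix A :: "indet set" assume "card A = 3"
        then show "eqm t A (sc c * (cd b A + ?e A)) (cd (\<lambda>A. sc c * b A) A + sc c * ?e A)"
          using LC_D[OF LC_sc[OF m]] by (simp add: cd_mult ring_distribs eqm_refl)
      qed
      ultimately show ?thesis
        by simp
    qed
    moreover have "lfc t 3 ?e \<in> h"
      unfolding h using LC_0[of 2] cd0 by (intro CollectI exI[of _ "\<lambda>A. 0"]) simp
    ultimately have "(\<Union>f\<in>h. cech_class J 3 (c \<odot>\<^bsub>cech J 3\<^esub> f)) = cech_class J 3 (lfc t 3 (\<lambda>A. sc c * ?e A))"
      by blast
    then show ?thesis
      by (simp add: H_def local_cohomology_def)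
  qed
  show "carrier H = {c \<odot>\<^bsub>H\<^esub> h | c :: 'k. True}"
  proof (intro equalityI subsetI)
    fix C assume "C \<in> carrier H"
    then obtain f where f: "f \<in> cech_cocycles J 3" "f \<in> cech_degree J 3 0" "C = cech_class J 3 f"
      by (auto simp: H_def local_cohomology_def)
    have "\<forall>A. \<exists>x. card A = 3 \<longrightarrow> x \<in> FT A 0 \<and> homog 0 x \<and> f A = lf t A (x :: 'k laur)"
      using f(2) by (auto simp: cech_degree_def PiE_def Pi_def faces_iff J_def lf_degree)
    then obtain a where a: "\<And>A. card A = 3 \<Longrightarrow> a A \<in> FT A 0 \<and> homog 0 (a A) \<and> f A = lf t A (a A :: 'k laur)"
      by metis
    have aL: "a \<in> LC 3"
      using a by (simp add: LC_def)
    have fa: "f = lfc t 3 a"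
    proof
      fix A show "f A = lfc t 3 a A"
        using f(2) a[of A] by (auto simp: cech_degree_def lfc_def faces_iff PiE_def extensional_def)
    qed
    have cyc: "cd a B \<in> IP B (int t)" if "card B = 4" for B
      using f(1) that unfolding fa J_def by (simp add: lfc_cocycle[OF aL])
    obtain c b where b: "\<And>A. card A = 2 \<Longrightarrow> b A \<in> FT A 0"
      "\<And>A. card A = 3 \<Longrightarrow> a A - sc c * ?e A - cd b A \<in> IP A (int t)"
    proof (rule cocycle_multiple[of a "int t" ?e])
      show "\<not> (\<exists>b. (\<forall>A. card A = 2 \<longrightarrow> b A \<in> FT A 0) \<and> (\<forall>A. card A = 3 \<longrightarrow> ?e A - cd b A \<in> IP A (int t)))"
        by (rule etaL_not_boundary[OF t])
    qed (use a cyc etaL_FT homog_etaL etaL_cocycle[OF t1] in \<open>(blast | assumption | rule that)+\<close>)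
    have bL: "b \<in> LC 2"
      using b(1) by (simp add: LC_def)
    have "cech_class J 3 (lfc t 3 a) = cech_class J 3 (lfc t 3 (\<lambda>A. sc c * ?e A))"
      unfolding J_def
    proof (rule class_lfc_cong[OF aL LC_sc[OF etaL_LC] bL])
      fix A :: "indet set" assume A: "card A = 3"
      then show "eqm t A (a A) (cd b A + sc c * ?e A)"
        using b(2)[OF A] a[OF A] LC_D[OF cdb[OF bL] A] FT_sc_mult[OF etaL_FT, of c t A]
        by (simp add: eqm_def FT_add algebra_simps)
    qed
    then show "C \<in> {c \<odot>\<^bsub>H\<^esub> h | c :: 'k. True}"
      using f(3) fa smult[of c] by blast
  next
    fix C assume "C \<in> {c \<odot>\<^bsub>H\<^esub> h | c :: 'k. True}"
    then obtain c where "C = cech_class J 3 (lfc t 3 (\<lambda>A. sc c * ?e A))"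
      using smult by blast
    then show "C \<in> carrier H"
      using coc[of c] by (simp add: H_def local_cohomology_def)
  qed
qed

section \<open>The order function of the powers of \<open>I\<close>\<close>

lemma sc_uminus: "sc (- c) = - sc c"
  by (simp add: sc_def single_uminus)

definition yz_deg :: "exps \<Rightarrow> int"
  where "yz_deg e = lk e (V Ind_y) + lk e (V Ind_z)"

definition shear_rest :: "exps \<Rightarrow> exps"
  where "shear_rest e = e - Poly_Mapping.single (V Ind_y) (lk e (V Ind_y)) - Poly_Mapping.single (V Ind_z) (lk e (V Ind_z))"

text \<open>\<open>yshift\<close> and \<open>zshift\<close> are the exponents of vx/u and
  wx/u.\<close>

definition yshift :: "exps" where "yshift = ex (V Ind_v) + ex (V Ind_x) - ex (V Ind_u)"
definition zshift :: "exps" where "zshift = ex (V Ind_w) + ex (V Ind_x) - ex (V Ind_u)"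

definition shear_mono :: "'k \<Rightarrow> exps \<Rightarrow> 'k::field_char_0 laur"
  where "shear_mono c e = mn (shear_rest e) * (mv Ind_y + sc c * mn yshift) ^ nat (lk e (V Ind_y))
    * (mv Ind_z + sc c * mn zshift) ^ nat (lk e (V Ind_z))"

text \<open>The substitution \<open>y \<mapsto> y + cvx/u, z \<mapsto> z + cwx/u\<close>. For \<open>c = 1\<close> it maps \<open>\<Delta>\<^sub>1, \<Delta>\<^sub>2, \<Delta>\<^sub>3\<close> to
  \<open>vz - wy, -uz, uy\<close>, so that \<open>I\<close> becomes the ideal \<open>(y, z)\<close> once \<open>u\<close> is inverted.\<close>

definition shear :: "'k \<Rightarrow> 'k laur \<Rightarrow> 'k::field_char_0 laur"
  where "shear c = lin (shear_mono c)"

lemma shear_add: "shear c (p + q) = shear c p + shear c q" and shear_diff: "shear c (p - q) = shear c p - shear c q"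
  and shear_0 [simp]: "shear c 0 = 0"
  by (simp_all add: shear_def lin_add lin_diff)

lemma shear_rest_add: "shear_rest (a + b) = shear_rest a + shear_rest b"
  by (rule exps_eqI) (simp_all add: shear_rest_def lk_simps lookup_single when_def)

lemma shear_mono_add:
  assumes "a \<in> EA {Ind_u} 0" "b \<in> EA {Ind_u} 0"
  shows "shear_mono c (a + b) = shear_mono c a * shear_mono c b"
proof -
  have "0 \<le> lk a (V Ind_y)" "0 \<le> lk b (V Ind_y)" "0 \<le> lk a (V Ind_z)" "0 \<le> lk b (V Ind_z)"
    using assms by (simp_all add: EA_def)
  then show ?thesis
    by (simp add: shear_mono_def shear_rest_add mn_add lookup_add nat_add_distrib power_add mult_ac)
qed

lemma shear_mult: "p \<in> FT {Ind_u} 0 \<Longrightarrow> q \<in> FT {Ind_u} 0 \<Longrightarrow> shear c (p * q) = shear c p * shear c q"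
  unfolding shear_def by (rule lin_mult) (auto simp: FT_def key_space_def intro: shear_mono_add)

lemma shear_rest_EA: "e \<in> EA {Ind_u} 0 \<Longrightarrow> shear_rest e \<in> EA {Ind_u} 0"
  by (auto simp: EA_def shear_rest_def tdeg_def lk_simps lookup_single when_def)

lemma shift_EA: "yshift \<in> EA {Ind_u} 0" "zshift \<in> EA {Ind_u} 0"
  by (auto simp: EA_def yshift_def zshift_def tdeg_def lk_simps)

lemma shift_FT: "(mv Ind_y + sc c * mn yshift :: 'k::field_char_0 laur) \<in> FT {Ind_u} 0"
  "(mv Ind_z + sc c * mn zshift :: 'k laur) \<in> FT {Ind_u} 0"
  by (intro FT_add mv_FT FT_sc_mult FT_mn shift_EA)+

lemma shear_mono_FT: "e \<in> EA {Ind_u} 0 \<Longrightarrow> (shear_mono c e :: 'k::field_char_0 laur) \<in> FT {Ind_u} 0"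
  unfolding shear_mono_def by (intro FT_mult0 FT_power shift_FT FT_mn shear_rest_EA)

lemma shear_sc_mn: "shear c (sc d * mn e) = sc d * shear_mono c e"
  by (simp add: shear_def flip: single_eq_sc_mn)

lemma shear_mn: "shear c (mn e) = shear_mono c e"
  by (simp add: shear_def)

lemma shear_FT: "p \<in> FT {Ind_u} 0 \<Longrightarrow> shear c (p :: 'k::field_char_0 laur) \<in> FT {Ind_u} 0"
  by (erule FT_induct) (simp_all add: shear_add FT_add shear_sc_mn FT_sc_mult shear_mono_FT)

lemma shear_power: "p \<in> FT {Ind_u} 0 \<Longrightarrow> shear c (p ^ n) = shear c (p :: 'k::field_char_0 laur) ^ n"
proof (induction n)
  case 0
  have "shear_rest 0 = 0"
    by (simp add: shear_rest_def)
  then show ?case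
    using shear_mn[of c 0] by (simp add: shear_mono_def)
qed (simp add: shear_mult FT_power)

lemma shear_sc: "p \<in> FT {Ind_u} 0 \<Longrightarrow> shear c (sc d * p) = sc d * shear c (p :: 'k::field_char_0 laur)"
  using shear_power[of 0 c 0] shear_sc_mn[of c d 0] shear_mn[of c 0] by (simp add: shear_mult sc_FT)

lemma shear_fixed:
  assumes "lk e (V Ind_y) = 0" "lk e (V Ind_z) = 0"
  shows "shear c (mn e) = (mn e :: 'k::field_char_0 laur)"
  using assms by (simp add: shear_mn shear_mono_def shear_rest_def)

lemma shear_mv [simp]:
  "i \<noteq> Ind_y \<Longrightarrow> i \<noteq> Ind_z \<Longrightarrow> shear c (mv i) = (mv i :: 'k::field_char_0 laur)"
  "shear c (mv Ind_y) = mv Ind_y + sc c * (mn yshift :: 'k laur)"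
  "shear c (mv Ind_z) = mv Ind_z + sc c * (mn zshift :: 'k laur)"
proof -
  have "shear_rest (ex (V Ind_y)) = 0" "shear_rest (ex (V Ind_z)) = 0"
    by (rule exps_eqI; simp add: shear_rest_def lk_simps lookup_single when_def)+
  then show "shear c (mv Ind_y) = mv Ind_y + sc c * (mn yshift :: 'k laur)"
    "shear c (mv Ind_z) = mv Ind_z + sc c * (mn zshift :: 'k laur)"
    by (simp_all add: shear_mn shear_mono_def lk_ex)
qed (simp add: shear_fixed lk_ex)

lemma shear_shift [simp]: "shear c (mn yshift) = (mn yshift :: 'k::field_char_0 laur)"
  "shear c (mn zshift) = (mn zshift :: 'k laur)"
  by (rule shear_fixed; simp add: yshift_def zshift_def lk_simps)+

lemma shear_inverse:
  assumes "p \<in> FT {Ind_u} 0"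
  shows "shear (- 1) (shear 1 p) = (p :: 'k::field_char_0 laur)"
  using assms
proof (rule FT_induct)
  fix e and d :: 'k
  assume e: "e \<in> EA {Ind_u} 0"
  have y: "shear (- 1) (mv Ind_y + sc 1 * mn yshift) = (mv Ind_y :: 'k laur)"
    and z: "shear (- 1) (mv Ind_z + sc 1 * mn zshift) = (mv Ind_z :: 'k laur)"
    by (simp_all add: shear_add shear_sc_mn sc_uminus flip: shear_mn)
  have r: "shear (- 1) (mn (shear_rest e)) = (mn (shear_rest e) :: 'k laur)"
    by (rule shear_fixed) (simp_all add: shear_rest_def lk_simps lookup_single when_def)
  have pw: "mv i ^ n = (mn (Poly_Mapping.single (V i) (int n)) :: 'k laur)" for i n
    by (induction n) (simp_all add: ex_def flip: mn_add single_add)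
  have "0 \<le> lk e (V Ind_y)" "0 \<le> lk e (V Ind_z)"
    using e by (simp_all add: EA_def)
  then have "e = shear_rest e + Poly_Mapping.single (V Ind_y) (int (nat (lk e (V Ind_y))))
      + Poly_Mapping.single (V Ind_z) (int (nat (lk e (V Ind_z))))"
    by (simp add: shear_rest_def)
  then have me: "mn e = mn (shear_rest e) * mv Ind_y ^ nat (lk e (V Ind_y)) * (mv Ind_z ^ nat (lk e (V Ind_z)) :: 'k laur)"
    by (metis pw mn_add)
  have "shear (- 1) (shear_mono 1 e) = (mn e :: 'k laur)"
    unfolding shear_mono_def me
    by (simp only: shear_mult FT_mult0 FT_power shift_FT FT_mn shear_rest_EA e shear_power y z r)
  then show "shear (- 1) (shear 1 (sc d * mn e)) = (sc d * mn e :: 'k laur)"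
    by (simp add: shear_sc_mn shear_sc shear_mono_FT e)
qed (simp_all add: shear_add)

text \<open>The n-th power of (y, z) in the localization of R at u. It is a monomial ideal, so the
  order of an element is read off its exponents.\<close>

definition yz_ge :: "int \<Rightarrow> 'k::field_char_0 laur set"
  where "yz_ge n = key_space {e \<in> EA {Ind_u} 0. n \<le> yz_deg e}"

lemma yz_deg_add: "yz_deg (a + b) = yz_deg a + yz_deg b"
  by (simp add: yz_deg_def lookup_add)

lemma yz_ge_mult: "p \<in> yz_ge n \<Longrightarrow> q \<in> yz_ge m \<Longrightarrow> p * q \<in> yz_ge (n + m)"
  unfolding yz_ge_def
  by (erule (1) key_space_mult) (use EA_add[of _ "{Ind_u}" 0 _ 0] in \<open>auto simp: yz_deg_add\<close>)

lemma yz_ge_0: "yz_ge 0 = FT {Ind_u} 0"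
proof -
  have "{e \<in> EA {Ind_u} 0. 0 \<le> yz_deg e} = EA {Ind_u} 0"
    by (auto simp: EA_def yz_deg_def)
  then show ?thesis
    by (simp add: yz_ge_def FT_def)
qed

lemma yz_ge_power: "p \<in> yz_ge 1 \<Longrightarrow> p ^ n \<in> yz_ge (int n)"
proof (induction n)
  case (Suc n)
  then show ?case
    using yz_ge_mult[of p 1 "p ^ n" "int n"] by simp
qed (simp add: yz_ge_0)

lemma mn_yz_ge: "e \<in> EA {Ind_u} 0 \<Longrightarrow> n \<le> yz_deg e \<Longrightarrow> mn e \<in> yz_ge n"
  by (simp add: yz_ge_def key_space_def)

lemma shear_D: "shear 1 D3 = (mv Ind_u * mv Ind_y :: 'k::field_char_0 laur)"
  "shear 1 D2 = (- (mv Ind_u * mv Ind_z) :: 'k laur)"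
  "shear 1 D1 = (mv Ind_v * mv Ind_z - mv Ind_w * mv Ind_y :: 'k laur)"
proof -
  have 1: "mv Ind_u * mn yshift = (mv Ind_v * mv Ind_x :: 'k laur)"
    "mv Ind_u * mn zshift = (mv Ind_w * mv Ind_x :: 'k laur)"
    "mv Ind_v * mn zshift = (mv Ind_w * mn yshift :: 'k laur)"
    by (simp_all add: yshift_def zshift_def algebra_simps flip: mn_add)
  show "shear 1 D3 = (mv Ind_u * mv Ind_y :: 'k laur)" "shear 1 D2 = (- (mv Ind_u * mv Ind_z) :: 'k laur)"
    "shear 1 D1 = (mv Ind_v * mv Ind_z - mv Ind_w * mv Ind_y :: 'k laur)"
    by (simp_all add: D1_def D2_def D3_def shear_diff shear_mult mv_FT distrib_left 1)
qed

lemma shear_D_yz_ge: "shear 1 D1 \<in> (yz_ge 1 :: 'k::field_char_0 laur set)" "shear 1 D2 \<in> (yz_ge 1 :: 'k laur set)"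
  "shear 1 D3 \<in> (yz_ge 1 :: 'k laur set)"
proof -
  have y: "mv Ind_y \<in> (yz_ge 1 :: 'k laur set)" "mv Ind_z \<in> (yz_ge 1 :: 'k laur set)"
    by (rule mn_yz_ge; simp add: mn_EA_simps yz_deg_def lk_ex)+
  have m: "mv i * q \<in> (yz_ge 1 :: 'k laur set)" if "q \<in> yz_ge 1" for i q
    using yz_ge_mult[of "mv i" 0 q 1] that by (simp add: yz_ge_0 mv_FT)
  show "shear 1 D1 \<in> (yz_ge 1 :: 'k laur set)" "shear 1 D2 \<in> (yz_ge 1 :: 'k laur set)" "shear 1 D3 \<in> (yz_ge 1 :: 'k laur set)"
    unfolding shear_D using m y unfolding yz_ge_def by (auto intro!: key_space_diff key_space_uminus)
qed

lemma shear_IP: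
  assumes "f \<in> IP {} n"
  shows "shear 1 f \<in> (yz_ge n :: 'k::field_char_0 laur set)"
proof -
  obtain F where F: "F \<in> FT {} n" "f = psi F"
    using assms by (auto simp: IP_def)
  from F(1) have "shear 1 (psi F) \<in> yz_ge n"
  proof (rule FT_induct)
    show "shear 1 (psi (a + b)) \<in> yz_ge n" if "shear 1 (psi a) \<in> yz_ge n" "shear 1 (psi b) \<in> yz_ge n" for a b :: "'k laur"
      using that unfolding yz_ge_def by (simp add: psi_add shear_add key_space_add)
    fix e and c :: 'k
    assume e: "e \<in> EA {} n"
    have v: "(mn (vpart e) :: 'k laur) \<in> FT {Ind_u} 0"
      using e by (intro FT_mn) (auto simp: EA_def tdeg_def)
    have "psim e \<in> (FT {Ind_u} 0 :: 'k laur set)"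
      using e by (auto intro: psim_FT FT_mono)
    then have "shear 1 (psi (sc c * mn e)) = sc c * shear 1 (psim e)"
      by (simp add: psi_sc_mn shear_sc)
    moreover have "shear 1 (psim e) = (shear 1 (mn (vpart e)) * shear 1 D1 ^ nat (lk e TA)
        * shear 1 D2 ^ nat (lk e TB) * shear 1 D3 ^ nat (lk e TC) :: 'k laur)"
      unfolding psim_def by (simp only: shear_mult shear_power FT_mult0 FT_power D_FT v)
    moreover have "\<dots> \<in> yz_ge (0 + int (nat (lk e TA)) + int (nat (lk e TB)) + int (nat (lk e TC)))"
      by (intro yz_ge_mult yz_ge_power shear_D_yz_ge) (simp add: yz_ge_0 shear_FT v)
    moreover have "0 + int (nat (lk e TA)) + int (nat (lk e TB)) + int (nat (lk e TC)) = n"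
      using e by (simp add: EA_def tdeg_def)
    ultimately show "shear 1 (psi (sc c * mn e)) \<in> yz_ge n"
      unfolding yz_ge_def by (auto intro: key_space_sc_mult)
  qed (simp add: yz_ge_def)
  then show ?thesis
    by (simp add: F(2))
qed

text \<open>The inverse shear maps y to \<open>\<Delta>\<^sub>3\<close>/u and z to
  -\<open>\<Delta>\<^sub>2\<close>/u, which lie in I once u is inverted.\<close>

lemma shear_yz_ge:
  assumes "p \<in> yz_ge n" "0 \<le> n"
  shows "shear (- 1) p \<in> (IP {Ind_u} n :: 'k::field_char_0 laur set)"
proof -
  have u: "(mn (- ex (V Ind_u)) :: 'k laur) \<in> FT {Ind_u} 0"
    by (intro FT_mn) (auto simp: EA_def tdeg_def lk_simps)
  have "mn yshift = (mn (- ex (V Ind_u)) * (mv Ind_v * mv Ind_x) :: 'k laur)"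
    "mn zshift = (mn (- ex (V Ind_u)) * (mv Ind_w * mv Ind_x) :: 'k laur)"
    by (simp_all add: yshift_def zshift_def algebra_simps flip: mn_add)
  then have "mv Ind_y + sc (- 1) * mn yshift = (mn (- ex (V Ind_u)) * D3 :: 'k laur)"
    "mv Ind_z + sc (- 1) * mn zshift = (- (mn (- ex (V Ind_u)) * D2) :: 'k laur)"
    by (simp_all add: sc_uminus D2_def D3_def right_diff_distrib)
  then have D: "mv Ind_y + sc (- 1) * mn yshift \<in> (IP {Ind_u} 1 :: 'k laur set)"
    "mv Ind_z + sc (- 1) * mn zshift \<in> (IP {Ind_u} 1 :: 'k laur set)"
    using u by (simp_all add: IP_uminus IP_mult_FT D_IP)
  have mono: "shear_mono (- 1) e \<in> (IP {Ind_u} n :: 'k laur set)" if e: "e \<in> EA {Ind_u} 0" "n \<le> yz_deg e" for e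
  proof -
    have "shear_mono (- 1) e \<in> (IP {Ind_u} (0 + int (nat (lk e (V Ind_y))) + int (nat (lk e (V Ind_z)))) :: 'k laur set)"
      unfolding shear_mono_def by (intro IP_mult IP_power D) (simp add: IP_zero FT_mn shear_rest_EA e)
    then show ?thesis
      by (rule IP_antimono) (use assms(2) e in \<open>auto simp: EA_def yz_deg_def\<close>)
  qed
  show ?thesis
    unfolding shear_def lin_def
    by (intro IP_sum IP_sc mono) (use assms(1) in \<open>auto simp: yz_ge_def key_space_def\<close>)
qed

text \<open>The denominator is a power of u, and \<open>u_saturated\<close> removes its factors one
  at a time.\<close>

lemma IP_u:
  assumes "f \<in> FT {} 0" "f \<in> IP {Ind_u} n"
  shows "f \<in> (IP {} n :: 'k::field_char_0 laur set)"
proof -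
  have f: "f \<in> FT {Ind_u} 0"
    using assms(1) by (rule FT_mono) simp
  obtain d where d: "d \<in> MA {Ind_u}" "mn d * f \<in> IP {} n"
    using assms(2) IP_clear[OF f, of n] by blast
  have dE: "d \<in> EA {} 0" "- d \<in> EA {Ind_u} 0"
    using d(1) by (simp_all add: MA_def)
  have 0: "lk d (V i) = 0" if "i \<noteq> Ind_u" for i
  proof -
    have "0 \<le> lk d (V i)" "0 \<le> lk (- d) (V i)"
      using dE that by (simp_all add: EA_def)
    then show ?thesis
      by simp
  qed
  have "0 \<le> lk d (V Ind_u)"
    using dE(1) by (simp add: EA_def)
  then have "d = Poly_Mapping.single (V Ind_u) (int (nat (lk d (V Ind_u))))"
    using EA_0_T[OF dE(1)] 0 by (intro exps_eqI) (simp_all add: lookup_single when_def)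
  then obtain m where m: "d = Poly_Mapping.single (V Ind_u) (int m)"
    by blast
  have "mn (Poly_Mapping.single (V Ind_u) (int m)) * f \<in> IP {} n \<Longrightarrow> f \<in> IP {} n"
  proof (induction m)
    case (Suc m)
    have s: "mn (Poly_Mapping.single (V Ind_u) (int (Suc m))) * f
        = mv Ind_u * (mn (Poly_Mapping.single (V Ind_u) (int m)) * f)"
      by (simp add: ex_def flip: mn_add mult.assoc single_add)
    have "mn (Poly_Mapping.single (V Ind_u) (int m)) * f \<in> FT {} 0"
      by (intro FT_mult0 FT_mn assms) (auto simp: EA_def tdeg_def lookup_single when_def)
    from u_saturated[OF this, of n] show ?case
      using Suc.IH Suc.prems[unfolded s] unfolding IP_def by blast
  qed simp
  then show ?thesis
    using d(2) m by simp
qed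

lemma IP_iff_yz_ge:
  assumes "f \<in> FT {} 0" "0 \<le> n"
  shows "f \<in> IP {} n \<longleftrightarrow> shear 1 f \<in> (yz_ge n :: 'k::field_char_0 laur set)"
proof
  assume "shear 1 f \<in> yz_ge n"
  from shear_yz_ge[OF this assms(2)] have "shear (- 1) (shear 1 f) \<in> IP {Ind_u} n" .
  moreover have "f \<in> FT {Ind_u} 0"
    using assms(1) by (rule FT_mono) simp
  ultimately show "f \<in> IP {} n"
    using assms(1) by (simp add: shear_inverse IP_u)
qed (rule shear_IP)

lemma not_yz_ge_SucE:
  assumes "p \<in> FT {Ind_u} 0" "p \<notin> yz_ge (n + 1)"
  obtains a where "a \<le> n" "\<And>e. e \<in> Poly_Mapping.keys p \<Longrightarrow> a \<le> yz_deg e" "graded_part yz_deg a p \<noteq> (0 :: 'k::field_char_0 laur)"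
proof -
  obtain e0 where e0: "e0 \<in> Poly_Mapping.keys p" "yz_deg e0 \<le> n"
    using assms by (force simp: yz_ge_def FT_def key_space_def)
  define a where "a = Min (yz_deg ` Poly_Mapping.keys p)"
  have "a \<in> yz_deg ` Poly_Mapping.keys p"
    unfolding a_def using e0 by (intro Min_in) auto
  then obtain e1 where e1: "e1 \<in> Poly_Mapping.keys p" "a = yz_deg e1"
    by blast
  have min: "a \<le> yz_deg e" if "e \<in> Poly_Mapping.keys p" for e
    unfolding a_def using that by (intro Min_le) auto
  have "e1 \<in> Poly_Mapping.keys (graded_part yz_deg a p)"
    using e1 by (simp add: graded_part_def keys_filter_keys)
  then have "graded_part yz_deg a p \<noteq> 0"
    by auto
  then show thesis
    using that[of a] min min[OF e0(1)] e0(2) by fastforce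
qed

text \<open>The associated graded ring of the powers of \<open>I\<close> is a domain.\<close>

lemma mJ_mult_notin:
  assumes "p \<notin> mJ (Suc n)" "q \<notin> mJ (Suc m)"
  shows "p * q \<notin> (mJ (Suc (n + m)) :: 'k::field_char_0 poly6 set)"
proof
  assume pq: "p * q \<in> mJ (Suc (n + m))"
  define P Q where "P = shear 1 (emb p)" and "Q = shear 1 (emb q)"
  have FT: "emb r \<in> FT {Ind_u} 0" for r :: "'k poly6"
    using emb_FT by (rule FT_mono) simp
  have iff: "r \<in> mJ k \<longleftrightarrow> shear 1 (emb r) \<in> yz_ge (int k)" for r :: "'k poly6" and k
    by (simp add: mJ_iff IP_iff_yz_ge emb_FT)
  have "P \<notin> yz_ge (int n + 1)" "Q \<notin> yz_ge (int m + 1)"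
    using assms by (simp_all add: iff P_def Q_def add.commute)
  then obtain a b where a: "a \<le> int n" "\<And>e. e \<in> Poly_Mapping.keys P \<Longrightarrow> a \<le> yz_deg e" "graded_part yz_deg a P \<noteq> 0"
    and b: "b \<le> int m" "\<And>e. e \<in> Poly_Mapping.keys Q \<Longrightarrow> b \<le> yz_deg e" "graded_part yz_deg b Q \<noteq> 0"
    using not_yz_ge_SucE[of P "int n"] not_yz_ge_SucE[of Q "int m"] shear_FT[OF FT] unfolding P_def Q_def by metis
  have "graded_part yz_deg (a + b) (P * Q) = graded_part yz_deg a P * graded_part yz_deg b Q"
    by (rule graded_part_mult_low) (use a b in \<open>auto simp: yz_deg_add\<close>)
  also have "\<dots> \<noteq> 0"
    using a(3) b(3) by simp
  finally have "Poly_Mapping.keys (P * Q) \<inter> {e. yz_deg e = a + b} \<noteq> {}"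
    by (metis graded_part_def keys_filter_keys keys_empty_iff)
  then obtain e where e: "e \<in> Poly_Mapping.keys (P * Q)" "yz_deg e = a + b"
    by blast
  have "P * Q \<in> yz_ge (int (Suc (n + m)))"
    using pq by (simp add: iff P_def Q_def emb_mult shear_mult FT)
  then have "int (Suc (n + m)) \<le> yz_deg e"
    using e(1) by (auto simp: yz_ge_def key_space_def)
  then show False
    using a(1) b(1) e(2) by simp
qed

text \<open>Setting all indeterminates to 1 kills the minors but no monomial, which keeps the
  monomials outside I.\<close>

lemma ev_IP:
  assumes "f \<in> IP {} n" "1 \<le> n"
  shows "lin (\<lambda>_. 1) f = (0 :: 'k::field_char_0 laur)"
proof -
  obtain F where F: "F \<in> FT {} n" "f = psi F"
    using assms(1) by (auto simp: IP_def)
  have m: "lin (\<lambda>_. 1) (p * q) = lin (\<lambda>_. 1) p * (lin (\<lambda>_. 1) q :: 'k laur)" for p q :: "'k laur"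
    by (rule lin_mult) simp
  from F(1) have "lin (\<lambda>_. 1) (psi F) = (0 :: 'k laur)"
  proof (rule FT_induct)
    fix e and c :: 'k
    assume e: "e \<in> EA {} n"
    have "e \<in> EA {} ((n - 1) + 1)" "0 \<le> n - 1"
      using e assms(2) by simp_all
    then obtain g where g: "g \<in> {TA, TB, TC}" "e - ex g \<in> EA {} (n - 1)"
      by (rule EA_Suc_cases)
    have "lin (\<lambda>_. 1) (psim (ex g)) = (0 :: 'k laur)"
      using g(1) by (auto simp: psim_ex D1_def D2_def D3_def lin_diff m)
    then show "lin (\<lambda>_. 1) (psi (sc c * mn e)) = (0 :: 'k laur)"
      by (simp add: psi_sc_mn psim_split[OF g] m)
  qed (simp_all add: psi_add lin_add)
  then show ?thesis
    by (simp add: F(2))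
qed

lemma monomials_notin_mJ:
  assumes "s \<in> monomials A" "1 \<le> n"
  shows "s \<notin> (mJ n :: 'k::field_char_0 poly6 set)"
proof
  assume "s \<in> mJ n"
  then have "lin (\<lambda>_. 1) (emb s) = (0 :: 'k laur)"
    using assms(2) by (intro ev_IP) (auto simp: mJ_iff)
  moreover obtain d where "emb s = (mn d :: 'k laur)"
    using emb_monomials[of A, where 'k = 'k] assms(1) by blast
  ultimately show False
    by simp
qed

section \<open>The adic completion\<close>

lemma mJ_antimono:
  assumes "m \<le> n" "p \<in> mJ n"
  shows "p \<in> (mJ m :: 'k::field_char_0 poly6 set)"
  using assms unfolding mJ_iff by (elim IP_antimono) simp_all

lemma mJ_mult: "p \<in> mJ m \<Longrightarrow> q \<in> mJ n \<Longrightarrow> p * q \<in> (mJ (m + n) :: 'k::field_char_0 poly6 set)"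
  using IP_mult[of "emb p" "{}" "int m" "emb q" "int n"] by (simp add: mJ_iff emb_mult)

lemma mJ_0: "mJ 0 = (UNIV :: 'k::field_char_0 poly6 set)"
  by (auto simp: mJ_iff IP_zero emb_FT)

lemmas mJ_add = ideal_add[OF mJ_ideal] and mJ_lmult = ideal_mult[OF mJ_ideal] and zero_mJ = ideal_0[OF mJ_ideal]

lemma mJ_uminus: "p \<in> mJ n \<Longrightarrow> - p \<in> (mJ n :: 'k::field_char_0 poly6 set)"
  by (simp add: mJ_iff emb_uminus IP_uminus)

lemma mJ_diff: "p \<in> mJ n \<Longrightarrow> q \<in> mJ n \<Longrightarrow> p - q \<in> (mJ n :: 'k::field_char_0 poly6 set)"
  by (simp add: mJ_iff emb_diff IP_diff)

section \<open>The completion through coherent sequences of representatives, and its fraction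
  field\<close>

definition coh :: "(nat \<Rightarrow> 'k::field_char_0 poly6) \<Rightarrow> bool"
  where "coh p \<longleftrightarrow> (\<forall>n. p (Suc n) - p n \<in> mJ n)"

definition cmp :: "(nat \<Rightarrow> 'k::field_char_0 poly6) \<Rightarrow> nat \<Rightarrow> 'k poly6 set"
  where "cmp p n = residue (mJ n) (p n)"

abbreviation Dc :: "(nat \<Rightarrow> 'k::field_char_0 poly6 set) ring"
  where "Dc \<equiv> adic_completion poly6_ring mI"

lemma coh_const: "coh (\<lambda>_. p)"
  by (simp add: coh_def zero_mJ)

lemma coh_add: "coh p \<Longrightarrow> coh q \<Longrightarrow> coh (\<lambda>n. p n + q n)"
  unfolding coh_def by (metis add_diff_add mJ_add)

lemma coh_uminus: "coh p \<Longrightarrow> coh (\<lambda>n. - p n)"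
  unfolding coh_def by (metis minus_diff_minus mJ_uminus)

lemma coh_mult:
  assumes "coh p" "coh q"
  shows "coh (\<lambda>n. p n * q n)"
  unfolding coh_def
proof
  fix n
  have "q (Suc n) * (p (Suc n) - p n) + p n * (q (Suc n) - q n) \<in> mJ n"
    using assms by (intro mJ_add mJ_lmult) (simp_all add: coh_def)
  then show "p (Suc n) * q (Suc n) - p n * q n \<in> mJ n"
    by (simp add: algebra_simps)
qed

text \<open>Later terms of a coherent sequence agree with \<open>p n\<close> modulo I^n, so orders
  may be tested at any larger index.\<close>

lemma coh_mJ:
  assumes "coh p" "n \<le> m"
  shows "p m \<in> mJ n \<longleftrightarrow> p n \<in> mJ n"
proof -
  have "p m - p n \<in> mJ n"
    using assms(2)
  proof (induction m rule: dec_induct)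
    case (step m)
    have "p (Suc m) - p m \<in> mJ n"
      using assms(1) step(1) mJ_antimono unfolding coh_def by blast
    from mJ_add[OF this step.IH] show ?case
      by simp
  qed (simp add: zero_mJ)
  then show ?thesis
    using mJ_add[of "p m - p n" n "p n"] mJ_diff[of "p m" n "p m - p n"] by auto
qed

lemma cmp_eq: "cmp p = cmp q \<longleftrightarrow> (\<forall>n. p n - q n \<in> mJ n)"
  by (simp add: fun_eq_iff cmp_def residue_eq[OF mJ_ideal])

lemma Dc_carrier: "carrier Dc = cmp ` Collect (coh :: (nat \<Rightarrow> 'k::field_char_0 poly6) \<Rightarrow> bool)"
proof -
  \<comment> \<open>Transition maps are encoded as inclusions of cosets; such an inclusion is a
    congruence modulo the larger ideal.\<close>
  have sub: "residue (mJ (Suc n)) q \<subseteq> residue (mJ n) p \<longleftrightarrow> q - p \<in> mJ n" for n and p q :: "'k poly6"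
  proof
    assume "residue (mJ (Suc n)) q \<subseteq> residue (mJ n) p"
    moreover have "q \<in> residue (mJ (Suc n)) q"
      by (simp add: mem_residue zero_mJ)
    ultimately have "q \<in> residue (mJ n) p"
      by blast
    then show "q - p \<in> mJ n"
      by (simp add: mem_residue)
  next
    assume qp: "q - p \<in> mJ n"
    show "residue (mJ (Suc n)) q \<subseteq> residue (mJ n) p"
    proof
      fix r assume "r \<in> residue (mJ (Suc n)) q"
      then have "r - q \<in> mJ n"
        using mJ_antimono[of n "Suc n"] by (auto simp: mem_residue)
      from mJ_add[OF this qp] show "r \<in> residue (mJ n) p"
        by (simp add: mem_residue)
    qed
  qed
  show ?thesis
  proof
    show "carrier Dc \<subseteq> cmp ` Collect (coh :: (nat \<Rightarrow> 'k poly6) \<Rightarrow> bool)"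
    proof
      fix f :: "nat \<Rightarrow> 'k poly6 set" assume "f \<in> carrier Dc"
      then have f: "f n \<in> range (residue (mJ n))" "f (Suc n) \<subseteq> f n" for n
        by (simp_all add: adic_completion_def quot_carrier flip: mJ_def)
      from f(1) have "\<exists>p. f n = residue (mJ n) p" for n
        by blast
      then obtain p where p: "\<And>n. f n = residue (mJ n) (p n)"
        by metis
      then have "f = cmp p" "coh p"
        using f(2) by (simp_all add: fun_eq_iff cmp_def coh_def sub)
      then show "f \<in> cmp ` Collect coh"
        by blast
    qed
    show "cmp ` Collect (coh :: (nat \<Rightarrow> 'k poly6) \<Rightarrow> bool) \<subseteq> carrier Dc"
      by (simp add: image_subset_iff adic_completion_def cmp_def quot_carrier coh_def sub flip: mJ_def)
  qed
qed

lemma cmp_carrier: "coh p \<Longrightarrow> cmp p \<in> carrier Dc"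
  by (simp add: Dc_carrier)

lemma Dc_ops:
  "cmp p \<otimes>\<^bsub>Dc\<^esub> cmp q = cmp (\<lambda>n. p n * (q n :: 'k::field_char_0 poly6))"
  "cmp p \<oplus>\<^bsub>Dc\<^esub> cmp q = cmp (\<lambda>n. p n + (q n :: 'k poly6))"
  "\<one>\<^bsub>Dc\<^esub> = cmp (\<lambda>_. 1 :: 'k poly6)" "\<zero>\<^bsub>Dc\<^esub> = cmp (\<lambda>_. 0 :: 'k poly6)"
  by (simp_all add: fun_eq_iff adic_completion_def cmp_def quot_mult quot_add quot_one quot_zero mJ_ideal
      flip: mJ_def)

lemma Dc_cring: "cring (Dc :: (nat \<Rightarrow> 'k::field_char_0 poly6 set) ring)"
proof (rule cringI)
  show "abelian_group (Dc :: (nat \<Rightarrow> 'k poly6 set) ring)"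
  proof (rule abelian_groupI)
    fix f :: "nat \<Rightarrow> 'k poly6 set" assume "f \<in> carrier Dc"
    then obtain p where p: "coh p" "f = cmp p"
      by (auto simp: Dc_carrier)
    then have "cmp (\<lambda>n. - p n) \<oplus>\<^bsub>Dc\<^esub> f = \<zero>\<^bsub>Dc\<^esub>"
      by (simp add: Dc_ops)
    then show "\<exists>g\<in>carrier Dc. g \<oplus>\<^bsub>Dc\<^esub> f = \<zero>\<^bsub>Dc\<^esub>"
      using p(1) by (blast intro: cmp_carrier coh_uminus)
  qed (auto simp: Dc_carrier Dc_ops coh_add coh_const add_ac)
  show "comm_monoid (Dc :: (nat \<Rightarrow> 'k poly6 set) ring)"
    by (rule comm_monoidI) (auto simp: Dc_carrier Dc_ops coh_mult coh_const mult_ac)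
qed (auto simp: Dc_carrier Dc_ops distrib_right)

lemma cmp_zero_iff: "cmp p n = \<zero>\<^bsub>poly6_ring Quot ideal_power poly6_ring mI n\<^esub> \<longleftrightarrow> p n \<in> mJ n"
  by (simp add: cmp_def quot_zero[OF mJ_ideal] residue_eq[OF mJ_ideal] flip: mJ_def)

text \<open>Since I^0 is the whole ring, the least failing index is a successor, and its predecessor
  is the order.\<close>

lemma coh_exact_order:
  assumes "p (Suc n) \<notin> (mJ (Suc n) :: 'k::field_char_0 poly6 set)"
  obtains k where "k \<le> n" "p k \<in> mJ k" "p (Suc k) \<notin> mJ (Suc k)"
proof -
  define m where "m = (LEAST m. p m \<notin> mJ m)"
  have m: "p m \<notin> mJ m" "m \<le> Suc n"
    unfolding m_def using assms by (rule LeastI, rule Least_le)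
  then obtain k where k: "m = Suc k"
    by (cases m) (auto simp: mJ_0)
  have "p k \<in> mJ k"
    using not_less_Least[of k "\<lambda>m. p m \<notin> mJ m"] k unfolding m_def by auto
  then show thesis
    using that[of k] m k by simp
qed

lemma coh_mult_notin:
  assumes "coh p" "coh q" "p (Suc k) \<notin> mJ (Suc k)" "q (Suc l) \<notin> mJ (Suc l)"
  shows "p (Suc (k + l)) * q (Suc (k + l)) \<notin> (mJ (Suc (k + l)) :: 'k::field_char_0 poly6 set)"
  using assms coh_mJ[OF assms(1), of "Suc k" "Suc (k + l)"] coh_mJ[OF assms(2), of "Suc l" "Suc (k + l)"]
  by (intro mJ_mult_notin) simp_all

lemma nonzeros_Dc:
  "f \<in> nonzeros Dc \<longleftrightarrow> (\<exists>p n. coh p \<and> f = cmp p \<and> p (Suc n) \<notin> (mJ (Suc n) :: 'k::field_char_0 poly6 set))"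
proof -
  have "cmp p \<noteq> \<zero>\<^bsub>Dc\<^esub> \<longleftrightarrow> (\<exists>n. p (Suc n) \<notin> mJ (Suc n))" for p :: "nat \<Rightarrow> 'k poly6"
    unfolding Dc_ops cmp_eq by simp (metis mJ_0 UNIV_I not0_implies_Suc)
  then show ?thesis
    by (auto simp: nonzeros_def Dc_carrier)
qed

text \<open>Closure of the nonzero elements under products rests on the additivity of orders: the
  completion is a domain.\<close>

lemma Dc_frac_ring: "frac_ring (Dc :: (nat \<Rightarrow> 'k::field_char_0 poly6 set) ring) (nonzeros Dc)"
proof -
  interpret cring "Dc :: (nat \<Rightarrow> 'k poly6 set) ring"
    by (rule Dc_cring)
  show ?thesis
  proof unfold_locales
    have "1 \<notin> (mJ (Suc 0) :: 'k poly6 set)"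
      by (rule monomials_notin_mJ[OF monomials_one]) simp
    then show "\<one>\<^bsub>Dc\<^esub> \<in> nonzeros (Dc :: (nat \<Rightarrow> 'k poly6 set) ring)"
      unfolding nonzeros_Dc Dc_ops using coh_const by blast
    fix f g :: "nat \<Rightarrow> 'k poly6 set"
    assume "f \<in> nonzeros Dc" "g \<in> nonzeros Dc"
    then obtain p n q m where pq: "coh p" "f = cmp p" "p (Suc n) \<notin> mJ (Suc n)"
      "coh q" "g = cmp q" "q (Suc m) \<notin> mJ (Suc m)"
      unfolding nonzeros_Dc by blast
    have "cmp (\<lambda>n. p n * q n) \<in> nonzeros Dc"
      unfolding nonzeros_Dc using coh_mult_notin[OF pq(1,4,3,6)] coh_mult[OF pq(1,4)] by blast
    then show "f \<otimes>\<^bsub>Dc\<^esub> g \<in> nonzeros Dc"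
      by (simp add: Dc_ops pq(2,5))
  qed (auto simp: nonzeros_def)
qed

abbreviation Kc :: "((nat \<Rightarrow> 'k::field_char_0 poly6 set) \<times> (nat \<Rightarrow> 'k poly6 set)) set ring"
  where "Kc \<equiv> fraction_field Dc"

abbreviation fc :: "(nat \<Rightarrow> 'k::field_char_0 poly6) \<Rightarrow> (nat \<Rightarrow> 'k poly6) \<Rightarrow>
    ((nat \<Rightarrow> 'k poly6 set) \<times> (nat \<Rightarrow> 'k poly6 set)) set"
  where "fc p q \<equiv> frac Dc (nonzeros Dc) (cmp p) (cmp q)"

lemma Kc_cring: "cring (Kc :: ((nat \<Rightarrow> 'k::field_char_0 poly6 set) \<times> (nat \<Rightarrow> 'k poly6 set)) set ring)"
  unfolding fraction_field_def by (rule frac_ring.localization_cring[OF Dc_frac_ring])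

lemma cmp_nonzero: "coh q \<Longrightarrow> q (Suc n) \<notin> mJ (Suc n) \<Longrightarrow> cmp q \<in> nonzeros Dc"
  unfolding nonzeros_Dc by blast

lemma Kc_ops:
  assumes "coh p" "cmp q \<in> nonzeros Dc" "coh p'" "cmp q' \<in> nonzeros Dc"
  shows "fc p q \<in> carrier Kc"
    "fc p q \<otimes>\<^bsub>Kc\<^esub> fc p' q' = fc (\<lambda>n. p n * p' n) (\<lambda>n. q n * (q' n :: 'k::field_char_0 poly6))"
    "fc p q \<oplus>\<^bsub>Kc\<^esub> fc p' q' = fc (\<lambda>n. p n * q' n + p' n * q n) (\<lambda>n. q n * q' n)"
    "\<one>\<^bsub>Kc\<^esub> = (fc (\<lambda>_. 1) (\<lambda>_. 1) :: ((nat \<Rightarrow> 'k poly6 set) \<times> (nat \<Rightarrow> 'k poly6 set)) set)"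
    "\<zero>\<^bsub>Kc\<^esub> = (fc (\<lambda>_. 0) (\<lambda>_. 1) :: ((nat \<Rightarrow> 'k poly6 set) \<times> (nat \<Rightarrow> 'k poly6 set)) set)"
proof -
  interpret frac_ring "Dc :: (nat \<Rightarrow> 'k poly6 set) ring" "nonzeros Dc"
    by (rule Dc_frac_ring)
  note c = assms(2,4) cmp_carrier[OF assms(1)] cmp_carrier[OF assms(3)]
  show "fc p q \<in> carrier Kc"
    "fc p q \<otimes>\<^bsub>Kc\<^esub> fc p' q' = fc (\<lambda>n. p n * p' n) (\<lambda>n. q n * q' n)"
    "fc p q \<oplus>\<^bsub>Kc\<^esub> fc p' q' = fc (\<lambda>n. p n * q' n + p' n * q n) (\<lambda>n. q n * q' n)"
    "\<one>\<^bsub>Kc\<^esub> = (fc (\<lambda>_. 1) (\<lambda>_. 1) :: ((nat \<Rightarrow> 'k poly6 set) \<times> (nat \<Rightarrow> 'k poly6 set)) set)"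
    "\<zero>\<^bsub>Kc\<^esub> = (fc (\<lambda>_. 0) (\<lambda>_. 1) :: ((nat \<Rightarrow> 'k poly6 set) \<times> (nat \<Rightarrow> 'k poly6 set)) set)"
    unfolding fraction_field_def
    by (simp_all only: localization_mult localization_add frac_carrier c Dc_ops localization_one localization_zero)
qed

subsection \<open>Neighbourhoods of zero\<close>

abbreviation Uc :: "nat \<Rightarrow> ((nat \<Rightarrow> 'k::field_char_0 poly6 set) \<times> (nat \<Rightarrow> 'k poly6 set)) set set"
  where "Uc \<equiv> adic_nhd poly6_ring mI"

text \<open>In \<open>adic_nhd\<close> the number \<open>n\<close> bounds the order of the
  denominator only from above. Lowering it to the exact order preserves the condition on the
  numerator and provides the lower bound that sums require.\<close>

lemma UcE:
  assumes "x \<in> (Uc k :: ((nat \<Rightarrow> 'k::field_char_0 poly6 set) \<times> (nat \<Rightarrow> 'k poly6 set)) set set)"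
  obtains p q n where "coh p" "coh q" "x = fc p q" "p (n + k) \<in> mJ (n + k)" "q n \<in> mJ n" "q (Suc n) \<notin> mJ (Suc n)"
proof -
  obtain p q n where x: "coh p" "coh q" "x = fc p q" "p (n + k) \<in> mJ (n + k)" "q (Suc n) \<notin> mJ (Suc n)"
  proof -
    obtain a b n where x: "x = frac Dc (nonzeros Dc) a b" "a \<in> carrier Dc" "b \<in> carrier Dc"
      "a (n + k) = \<zero>\<^bsub>poly6_ring Quot ideal_power poly6_ring mI (n + k)\<^esub>"
      "b (Suc n) \<noteq> \<zero>\<^bsub>poly6_ring Quot ideal_power poly6_ring mI (Suc n)\<^esub>"
      using assms unfolding adic_nhd_def by blast
    obtain p q where "coh p" "a = cmp p" "coh q" "b = cmp q"
      using x(2,3) unfolding Dc_carrier by blast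
    then show ?thesis
      using that x(1,4,5) by (simp only: cmp_zero_iff) blast
  qed
  obtain m where m: "m \<le> n" "q m \<in> mJ m" "q (Suc m) \<notin> mJ (Suc m)"
    using coh_exact_order[of q, OF x(5)] .
  have "p (n + k) \<in> mJ (m + k)"
    using m(1) by (intro mJ_antimono[OF _ x(4)]) simp
  then have "p (m + k) \<in> mJ (m + k)"
    using coh_mJ[OF x(1), of "m + k" "n + k"] m(1) by simp
  then show thesis
    using that x(1-3) m(2,3) by blast
qed

lemma UcI:
  assumes "coh p" "coh q" "p (n + k) \<in> mJ (n + k)" "q (Suc n) \<notin> mJ (Suc n)"
  shows "fc p q \<in> (Uc k :: ((nat \<Rightarrow> 'k::field_char_0 poly6 set) \<times> (nat \<Rightarrow> 'k poly6 set)) set set)"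
proof -
  have "cmp p (n + k) = \<zero>\<^bsub>poly6_ring Quot ideal_power poly6_ring mI (n + k)\<^esub>"
    "cmp q (Suc n) \<noteq> \<zero>\<^bsub>poly6_ring Quot ideal_power poly6_ring mI (Suc n)\<^esub>"
    using assms(3,4) by (simp_all only: cmp_zero_iff not_False_eq_True)
  then show ?thesis
    unfolding adic_nhd_def using cmp_carrier[OF assms(1)] cmp_carrier[OF assms(2)] by blast
qed

lemma Uc_carrier: "x \<in> Uc k \<Longrightarrow> x \<in> carrier (Kc :: ((nat \<Rightarrow> 'k::field_char_0 poly6 set) \<times> (nat \<Rightarrow> 'k poly6 set)) set ring)"
  by (erule UcE) (metis Kc_ops(1) cmp_nonzero coh_const)

text \<open>Over the common denominator both numerator terms have order at least n + n' + k, while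
  the denominator has order exactly n + n' because orders add.\<close>

lemma Uc_add:
  assumes "x \<in> Uc k" "y \<in> (Uc k :: ((nat \<Rightarrow> 'k::field_char_0 poly6 set) \<times> (nat \<Rightarrow> 'k poly6 set)) set set)"
  shows "x \<oplus>\<^bsub>Kc\<^esub> y \<in> Uc k"
proof -
  obtain p q n where x: "coh p" "coh q" "x = fc p q" "p (n + k) \<in> mJ (n + k)" "q n \<in> mJ n" "q (Suc n) \<notin> mJ (Suc n)"
    using assms(1) by (rule UcE)
  obtain p' q' n' where y: "coh p'" "coh q'" "y = fc p' q'" "p' (n' + k) \<in> mJ (n' + k)" "q' n' \<in> mJ n'" "q' (Suc n') \<notin> mJ (Suc n')"
    using assms(2) by (rule UcE)
  \<comment> \<open>One index at which all four sequences can be tested.\<close>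
  define N where "N = n + n' + k"
  have N: "p N \<in> mJ (n + k)" "q N \<in> mJ n" "p' N \<in> mJ (n' + k)" "q' N \<in> mJ n'"
    using x y coh_mJ[of p "n + k" N] coh_mJ[of q n N] coh_mJ[of p' "n' + k" N] coh_mJ[of q' n' N]
    by (simp_all add: N_def)
  have "p N * q' N \<in> mJ N" "p' N * q N \<in> mJ N"
    using mJ_mult[OF N(1,4)] mJ_mult[OF N(3,2)] by (simp_all add: N_def ac_simps)
  then have "p (n + n' + k) * q' (n + n' + k) + p' (n + n' + k) * q (n + n' + k) \<in> mJ (n + n' + k)"
    unfolding N_def by (rule mJ_add)
  then have "fc (\<lambda>n. p n * q' n + p' n * q n) (\<lambda>n. q n * q' n) \<in> Uc k"
    using coh_mult_notin[OF x(2) y(2) x(6) y(6)]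
    by (intro UcI[where n = "n + n'"] coh_add coh_mult x(1,2) y(1,2))
  then show ?thesis
    unfolding x(3) y(3) using x y by (simp add: Kc_ops cmp_nonzero)
qed

lemma Uc_zero: "\<zero>\<^bsub>Kc\<^esub> \<in> (Uc k :: ((nat \<Rightarrow> 'k::field_char_0 poly6 set) \<times> (nat \<Rightarrow> 'k poly6 set)) set set)"
proof -
  have 1: "1 \<notin> (mJ (Suc 0) :: 'k poly6 set)"
    by (rule monomials_notin_mJ[OF monomials_one]) simp
  then have "fc (\<lambda>_. 0) (\<lambda>_. 1) \<in> (Uc k :: ((nat \<Rightarrow> 'k poly6 set) \<times> (nat \<Rightarrow> 'k poly6 set)) set set)"
    by (intro UcI[where n = 0] coh_const zero_mJ)
  then show ?thesis
    by (simp add: fraction_field_def frac_ring.localization_zero[OF Dc_frac_ring] Dc_ops)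
qed

lemma Uc_uminus:
  assumes "x \<in> (Uc k :: ((nat \<Rightarrow> 'k::field_char_0 poly6 set) \<times> (nat \<Rightarrow> 'k poly6 set)) set set)"
  shows "\<ominus>\<^bsub>Kc\<^esub> x \<in> Uc k"
proof -
  interpret frac_ring "Dc :: (nat \<Rightarrow> 'k poly6 set) ring" "nonzeros Dc"
    by (rule Dc_frac_ring)
  interpret K: cring "Kc :: ((nat \<Rightarrow> 'k poly6 set) \<times> (nat \<Rightarrow> 'k poly6 set)) set ring"
    by (rule Kc_cring)
  obtain p q n where x: "coh p" "coh q" "x = fc p q" "p (n + k) \<in> mJ (n + k)" "q n \<in> mJ n" "q (Suc n) \<notin> mJ (Suc n)"
    using assms by (rule UcE)
  have q: "cmp q \<in> nonzeros Dc"
    using x by (intro cmp_nonzero)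
  have "fc (\<lambda>n. - p n) q \<oplus>\<^bsub>Kc\<^esub> x = fc (\<lambda>_. 0) (\<lambda>n. q n * q n)"
    unfolding x(3) using x(1) q by (simp add: Kc_ops coh_uminus)
  also have "\<dots> = \<zero>\<^bsub>Kc\<^esub>"
    using frac_zero[OF S_mult[OF q q]] by (simp add: fraction_field_def localization_zero Dc_ops)
  finally have "\<ominus>\<^bsub>Kc\<^esub> x = fc (\<lambda>n. - p n) q"
    using x q by (intro K.minus_equality) (simp_all add: Kc_ops coh_uminus)
  also have "\<dots> \<in> Uc k"
    using x by (intro UcI coh_uminus mJ_uminus)
  finally show ?thesis .
qed

subsection \<open>Laurent polynomials in the fraction field\<close>

text \<open>The counterpart of \<open>lf\<close> without reduction modulo I^t. All six
  indeterminates may be inverted, as no monomial lies in I.\<close>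

definition laur_frac :: "'k::field_char_0 laur \<Rightarrow> ((nat \<Rightarrow> 'k poly6 set) \<times> (nat \<Rightarrow> 'k poly6 set)) set"
  where "laur_frac a = (SOME c. \<exists>p s. s \<in> monomials UNIV \<and> emb p = a * emb s \<and> c = fc (\<lambda>_. p) (\<lambda>_. s))"

lemma monomial_nonzero: "s \<in> monomials A \<Longrightarrow> cmp (\<lambda>_. s) \<in> nonzeros (Dc :: (nat \<Rightarrow> 'k::field_char_0 poly6 set) ring)"
  using monomials_notin_mJ[of s A "Suc 0"] by (intro cmp_nonzero[where n = 0] coh_const) simp

lemma laur_frac_eq:
  assumes "s \<in> monomials UNIV" "emb p = a * emb s"
  shows "laur_frac a = fc (\<lambda>_. p) (\<lambda>_. (s :: 'k::field_char_0 poly6))"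
proof -
  interpret frac_ring "Dc :: (nat \<Rightarrow> 'k poly6 set) ring" "nonzeros Dc"
    by (rule Dc_frac_ring)
  let ?P = "\<lambda>c. \<exists>p s. s \<in> monomials UNIV \<and> emb p = a * emb s \<and> c = fc (\<lambda>_. p) (\<lambda>_. s)"
  have "?P (laur_frac a)"
    unfolding laur_frac_def by (rule someI[of ?P "fc (\<lambda>_. p) (\<lambda>_. s)"]) (use assms in blast)
  then obtain p' s' where p': "s' \<in> monomials UNIV" "emb p' = a * emb s'" "laur_frac a = fc (\<lambda>_. p') (\<lambda>_. s')"
    by blast
  have "emb (p' * s) = emb (p * s')"
    by (simp add: emb_mult p'(2) assms(2))
  then have "p' * s = p * s'"
    by (simp only: emb_inj)
  then show ?thesis
    unfolding p'(3)
    by (intro frac_eqI cmp_carrier coh_const monomial_nonzero[OF assms(1)] monomial_nonzero[OF p'(1)])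
      (simp add: Dc_ops)
qed

lemma laur_fracE:
  fixes a :: "'k::field_char_0 laur"
  assumes "a \<in> FT UNIV 0"
  obtains p s where "s \<in> monomials UNIV" "emb p = a * emb s" "laur_frac a = fc (\<lambda>_. p) (\<lambda>_. s)"
proof -
  obtain p s where "s \<in> monomials UNIV" "emb p = a * (emb s :: 'k laur)"
    using laur_fraction[OF assms] .
  then show thesis
    using laur_frac_eq by (intro that)
qed

lemma laur_frac_hom: "laur_hom Kc UNIV (laur_frac :: 'k::field_char_0 laur \<Rightarrow> _)"
proof (intro laur_hom.intro laur_hom_axioms.intro Kc_cring)
  fix a :: "'k laur" assume a: "a \<in> FT UNIV 0"
  obtain p s where p: "s \<in> monomials UNIV" "emb p = a * emb s" "laur_frac a = fc (\<lambda>_. p) (\<lambda>_. s)"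
    using a by (rule laur_fracE)
  show "laur_frac a \<in> carrier Kc"
    unfolding p(3) by (rule Kc_ops(1)[OF coh_const _ coh_const]) (rule monomial_nonzero[OF p(1)])+
  fix b :: "'k laur" assume b: "b \<in> FT UNIV 0"
  obtain q r where q: "r \<in> monomials UNIV" "emb q = b * emb r" "laur_frac b = fc (\<lambda>_. q) (\<lambda>_. r)"
    using b by (rule laur_fracE)
  have sr: "s * r \<in> monomials UNIV"
    using p(1) q(1) by (rule monomials_mult)
  note ops = Kc_ops[OF coh_const monomial_nonzero[OF p(1)] coh_const monomial_nonzero[OF q(1)]]
  show "laur_frac a \<oplus>\<^bsub>Kc\<^esub> laur_frac b = laur_frac (a + b)" "laur_frac a \<otimes>\<^bsub>Kc\<^esub> laur_frac b = laur_frac (a * b)"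
    unfolding p(3) q(3) ops
    by (rule laur_frac_eq[OF sr, symmetric], simp add: emb_add emb_mult p(2) q(2) algebra_simps)+
next
  show "\<one>\<^bsub>Kc\<^esub> = laur_frac (1 :: 'k laur)"
    unfolding Kc_ops(4)[OF coh_const monomial_nonzero[OF monomials_one] coh_const monomial_nonzero[OF monomials_one]]
    by (rule laur_frac_eq[OF monomials_one, symmetric]) simp
qed

text \<open>A monomial denominator has order 0, so the order of the fraction is that of its
  numerator.\<close>

lemma laur_frac_Uc:
  fixes a :: "'k::field_char_0 laur"
  assumes "a \<in> IP UNIV (int k)"
  shows "laur_frac a \<in> Uc k"
proof -
  obtain d where d: "d \<in> MA UNIV" "mn d * a \<in> IP {} (int k)"
    using assms IP_clear[OF IP_subset[OF assms]] by blast
  obtain s where s: "s \<in> monomials UNIV" "emb s = (mn d :: 'k laur)"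
    using MA_monomial[OF d(1), where 'k = 'k] by blast
  obtain p :: "'k poly6" where p: "mn d * a = emb p"
    using emb_surj[OF IP_subset[OF d(2)]] by blast
  have "laur_frac a = fc (\<lambda>_. p) (\<lambda>_. s)"
    by (rule laur_frac_eq[OF s(1)]) (simp add: p[symmetric] s(2) mult.commute)
  also have "\<dots> \<in> Uc k"
    using d(2) p s(1) monomials_notin_mJ[of s UNIV "Suc 0"] by (intro UcI[where n = 0] coh_const) (simp_all add: mJ_iff)
  finally show ?thesis .
qed

lemma completion_frac_laur:
  assumes "s \<in> monomials UNIV" "emb p = a * emb s"
  shows "completion_frac poly6_ring mI p s = laur_frac (a :: 'k::field_char_0 laur)"
proof -
  have "to_completion poly6_ring mI r = cmp (\<lambda>_. r)" for r :: "'k poly6"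
    by (simp add: fun_eq_iff to_completion_def cmp_def residue_def mJ_def)
  then show ?thesis
    by (simp add: completion_frac_def laur_frac_eq[OF assms])
qed

section \<open>Limits in a filtered ring\<close>

text \<open>The neighbourhoods are additive subgroups, which makes limits of sums independent of the
  chosen sequences.\<close>

locale filtered_ring = cring K for K (structure) +
  fixes U :: "nat \<Rightarrow> 'a set"
  assumes U_carrier: "x \<in> U k \<Longrightarrow> x \<in> carrier K"
    and U_add: "x \<in> U k \<Longrightarrow> y \<in> U k \<Longrightarrow> x \<oplus> y \<in> U k"
    and U_uminus: "x \<in> U k \<Longrightarrow> \<ominus> x \<in> U k"
    and U_zero: "\<zero> \<in> U k"
begin

lemma null_seq_add:
  assumes "null_seq U f" "null_seq U g"
  shows "null_seq U (\<lambda>n. f n \<oplus> g n)"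
  unfolding null_seq_def
proof
  fix k
  obtain N M where "\<forall>n\<ge>N. f n \<in> U k" "\<forall>n\<ge>M. g n \<in> U k"
    using assms unfolding null_seq_def by blast
  then show "\<exists>N. \<forall>n\<ge>N. f n \<oplus> g n \<in> U k"
    by (intro exI[of _ "max N M"]) (simp add: U_add)
qed

lemma null_seq_uminus: "null_seq U f \<Longrightarrow> null_seq U (\<lambda>n. \<ominus> f n)"
  unfolding null_seq_def by (blast intro: U_uminus)

lemma null_seq_minus_sym:
  assumes "null_seq U (\<lambda>n. f n \<ominus> g n)" "\<And>n. f n \<in> carrier K" "\<And>n. g n \<in> carrier K"
  shows "null_seq U (\<lambda>n. g n \<ominus> f n)"
  using null_seq_uminus[OF assms(1)] assms(2,3) by (simp add: a_minus_def minus_add a_comm)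

lemma null_seq_minus_trans:
  assumes "null_seq U (\<lambda>n. f n \<ominus> g n)" "null_seq U (\<lambda>n. g n \<ominus> h n)"
    "\<And>n. f n \<in> carrier K" "\<And>n. g n \<in> carrier K" "\<And>n. h n \<in> carrier K"
  shows "null_seq U (\<lambda>n. f n \<ominus> h n)"
proof -
  have "(f n \<ominus> g n) \<oplus> (g n \<ominus> h n) = f n \<ominus> h n" for n
    using assms(3-5) by (simp add: a_minus_def a_assoc r_neg1)
  then show ?thesis
    using null_seq_add[OF assms(1,2)] by simp
qed

lemma cauchy_seq_carrier: "cauchy_seq K U f \<Longrightarrow> f n \<in> carrier K"
  by (simp add: cauchy_seq_def)

lemma add_minus_add:
  "a \<in> carrier K \<Longrightarrow> b \<in> carrier K \<Longrightarrow> c \<in> carrier K \<Longrightarrow> d \<in> carrier K \<Longrightarrow>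
    (a \<oplus> b) \<ominus> (c \<oplus> d) = (a \<ominus> c) \<oplus> (b \<ominus> d)"
  by (simp add: a_minus_def minus_add a_ac)

lemma cauchy_seq_add:
  assumes "cauchy_seq K U f" "cauchy_seq K U g"
  shows "cauchy_seq K U (\<lambda>n. f n \<oplus> g n)"
  unfolding cauchy_seq_def
proof (intro conjI allI)
  show "f n \<oplus> g n \<in> carrier K" for n
    using assms by (simp add: cauchy_seq_carrier)
  fix k
  obtain N M where "\<forall>m\<ge>N. \<forall>n\<ge>N. f m \<ominus> f n \<in> U k" "\<forall>m\<ge>M. \<forall>n\<ge>M. g m \<ominus> g n \<in> U k"
    using assms unfolding cauchy_seq_def by blast
  then show "\<exists>N. \<forall>m\<ge>N. \<forall>n\<ge>N. (f m \<oplus> g m) \<ominus> (f n \<oplus> g n) \<in> U k"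
    using assms
    by (intro exI[of _ "max N M"]) (simp add: add_minus_add cauchy_seq_carrier U_add)
qed

lemma seq_lim_self:
  assumes "cauchy_seq K U f"
  shows "f \<in> seq_lim K U f"
proof -
  have "f n \<ominus> f n = \<zero>" for n
    using cauchy_seq_carrier[OF assms] by (simp add: r_right_minus_eq)
  then show ?thesis
    using assms by (simp add: seq_lim_def null_seq_def U_zero)
qed

lemma seq_lim_eqI:
  assumes f: "cauchy_seq K U f" and g: "cauchy_seq K U g" and null: "null_seq U (\<lambda>n. f n \<ominus> g n)"
  shows "seq_lim K U f = seq_lim K U g"
proof -
  have sub: "seq_lim K U g \<subseteq> seq_lim K U f"
    if f: "cauchy_seq K U f" and g: "cauchy_seq K U g" and null: "null_seq U (\<lambda>n. f n \<ominus> g n)" for f g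
  proof
    fix h assume h: "h \<in> seq_lim K U g"
    then have hc: "cauchy_seq K U h" and gh: "null_seq U (\<lambda>n. g n \<ominus> h n)"
      by (simp_all add: seq_lim_def)
    have "null_seq U (\<lambda>n. f n \<ominus> h n)"
      by (rule null_seq_minus_trans[OF null gh]) (rule cauchy_seq_carrier[OF f] cauchy_seq_carrier[OF g] cauchy_seq_carrier[OF hc])+
    then show "h \<in> seq_lim K U f"
      using hc f by (simp add: seq_lim_def)
  qed
  have "null_seq U (\<lambda>n. g n \<ominus> f n)"
    by (rule null_seq_minus_sym[OF null]) (rule cauchy_seq_carrier[OF f] cauchy_seq_carrier[OF g])+
  from sub[OF g f this] sub[OF f g null] show ?thesis
    by (rule subset_antisym)
qed

lemma seq_completion_add:
  assumes f: "cauchy_seq K U f" and g: "cauchy_seq K U g"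
  shows "seq_lim K U f \<oplus>\<^bsub>seq_completion K U\<^esub> seq_lim K U g = seq_lim K U (\<lambda>n. f n \<oplus> g n)"
proof -
  have eq: "seq_lim K U (\<lambda>n. f' n \<oplus> g' n) = seq_lim K U (\<lambda>n. f n \<oplus> g n)"
    if m: "f' \<in> seq_lim K U f" "g' \<in> seq_lim K U g" for f' g'
  proof -
    have c: "cauchy_seq K U f'" "cauchy_seq K U g'"
      and n: "null_seq U (\<lambda>n. f n \<ominus> f' n)" "null_seq U (\<lambda>n. g n \<ominus> g' n)"
      using m by (simp_all add: seq_lim_def)
    have "null_seq U (\<lambda>n. (f n \<oplus> g n) \<ominus> (f' n \<oplus> g' n))"
      using null_seq_add[OF n] by (simp add: add_minus_add cauchy_seq_carrier f g c)
    then show ?thesis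
      by (intro seq_lim_eqI[symmetric] cauchy_seq_add f g c)
  qed
  have "seq_lim K U f \<oplus>\<^bsub>seq_completion K U\<^esub> seq_lim K U g
      = (\<Union>f'\<in>seq_lim K U f. \<Union>g'\<in>seq_lim K U g. seq_lim K U (\<lambda>n. f n \<oplus> g n))"
    unfolding seq_completion_def ring_record_simps by (intro SUP_cong refl eq)
  also have "\<dots> = seq_lim K U (\<lambda>n. f n \<oplus> g n)"
    using seq_lim_self[OF f] seq_lim_self[OF g] by auto
  finally show ?thesis .
qed

end

section \<open>The identity of the Taylor series\<close>

text \<open>Both truncations differ from the one at \<open>k\<close> by powers of an element of I
  with exponents at least \<open>k\<close>.\<close>

lemma tlog_diff_IP:
  assumes "a \<in> IP A 1" "1 \<le> k" "k \<le> m" "k \<le> n"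
  shows "tlog m a - tlog n a \<in> (IP A (int k) :: 'k::field_char_0 laur set)"
proof -
  have "tlog m a - tlog k a \<in> IP A (int k)" if "k \<le> m" for m
  proof -
    have "{1..<m} = {1..<k} \<union> {k..<m}" "{1..<k} \<inter> {k..<m} = {}"
      using that assms(2) by auto
    then have "tlog m a - tlog k a = (\<Sum>i\<in>{k..<m}. sc (1 / of_nat i) * a ^ i)"
      by (simp add: tlog_def sum.union_disjoint)
    also have "\<dots> \<in> IP A (int k)"
      by (intro IP_sum IP_sc IP_power_ge assms(1)) simp
    finally show ?thesis .
  qed
  from IP_diff[OF this[OF assms(3)] this[OF assms(4)]] show ?thesis
    by simp
qed

lemma Kc_filtered: "filtered_ring (Kc :: ((nat \<Rightarrow> 'k::field_char_0 poly6 set) \<times> (nat \<Rightarrow> 'k poly6 set)) set ring) Uc"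
  by (intro filtered_ring.intro filtered_ring_axioms.intro Kc_cring Uc_carrier Uc_add Uc_uminus Uc_zero)

lemma cauchy_laur_frac:
  assumes a: "\<And>n. a n \<in> FT UNIV 0"
    and d: "\<And>k m n. 1 \<le> k \<Longrightarrow> k \<le> m \<Longrightarrow> k \<le> n \<Longrightarrow> a m - a n \<in> (IP UNIV (int k) :: 'k::field_char_0 laur set)"
  shows "cauchy_seq Kc Uc (\<lambda>n. laur_frac (a n))"
  unfolding cauchy_seq_def
proof (intro conjI allI)
  interpret laur_hom Kc UNIV "laur_frac :: 'k laur \<Rightarrow> _"
    by (rule laur_frac_hom)
  show "laur_frac (a n) \<in> carrier Kc" for n
    by (rule hom_carrier[OF a])
  fix k
  \<comment> \<open>The bound \<open>Suc k\<close> instead of \<open>k\<close> covers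
    \<open>k = 0\<close>, where assumption \<open>d\<close> says nothing.\<close>
  have "laur_frac (a m) \<ominus>\<^bsub>Kc\<^esub> laur_frac (a n) \<in> Uc k" if "m \<ge> Suc k" "n \<ge> Suc k" for m n
  proof -
    have "a m - a n \<in> IP UNIV (int k)"
      using that by (intro IP_antimono[OF d[of "Suc k" m n]]) simp_all
    then show ?thesis
      by (simp add: hom_minus a laur_frac_Uc)
  qed
  then show "\<exists>N. \<forall>m\<ge>N. \<forall>n\<ge>N. laur_frac (a m) \<ominus>\<^bsub>Kc\<^esub> laur_frac (a n) \<in> Uc k"
    by blast
qed

lemma completion_frac_pvar:
  "completion_frac poly6_ring mI p (pvar i * pvar j) = laur_frac (emb p * mn (- (ex (V i) + ex (V j))) :: 'k::field_char_0 laur)"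
proof (rule completion_frac_laur)
  have "pvar a \<in> (monomials UNIV :: 'k poly6 set)" for a
  proof -
    have "(\<Prod>b\<in>UNIV. pvar b ^ (if b = a then 1 else 0)) = (pvar a :: 'k poly6)"
      by (simp add: if_distrib[of "\<lambda>n. pvar _ ^ n"] cong: if_cong)
    then show ?thesis
      unfolding monomials_def by (intro CollectI exI[of _ "\<lambda>b. if b = a then 1 else 0"]) (simp only:)
  qed
  then show "pvar i * pvar j \<in> (monomials UNIV :: 'k poly6 set)"
    by (intro monomials_mult)
  have e: "emb (pvar i * pvar j) = (mn (ex (V i) + ex (V j)) :: 'k laur)"
    by (simp only: emb_mult emb_pvar mn_add)
  show "emb p = emb p * mn (- (ex (V i) + ex (V j))) * emb (pvar i * pvar j :: 'k poly6)"
    by (simp only: e mult.assoc mn_uminus mult_1_right)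
qed

lemma series_identity:
  defines "q \<equiv> completion_frac poly6_ring (mI :: 'k::field_char_0 poly6 set)"
    and "K' \<equiv> seq_completion Kc (Uc :: nat \<Rightarrow> ((nat \<Rightarrow> 'k poly6 set) \<times> (nat \<Rightarrow> 'k poly6 set)) set set)"
    and "x1 \<equiv> taylor_series Kc Uc (completion_frac poly6_ring (mI :: 'k poly6 set)
      (pvar Ind_v * pvar Ind_z - pvar Ind_w * pvar Ind_y) (pvar Ind_v * pvar Ind_z))"
    and "x2 \<equiv> taylor_series Kc Uc (completion_frac poly6_ring (mI :: 'k poly6 set)
      (pvar Ind_w * pvar Ind_x - pvar Ind_u * pvar Ind_z) (pvar Ind_w * pvar Ind_x))"
    and "x3 \<equiv> taylor_series Kc Uc (completion_frac poly6_ring (mI :: 'k poly6 set)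
      (pvar Ind_u * pvar Ind_y - pvar Ind_v * pvar Ind_x) (pvar Ind_u * pvar Ind_y))"
  shows "x1 \<in> carrier K'" "x2 \<in> carrier K'" "x3 \<in> carrier K'" "x1 \<oplus>\<^bsub>K'\<^esub> x2 \<oplus>\<^bsub>K'\<^esub> x3 = \<zero>\<^bsub>K'\<^esub>"
    "q (pvar Ind_w * pvar Ind_y) (pvar Ind_v * pvar Ind_z) \<otimes>\<^bsub>Kc\<^esub> q (pvar Ind_u * pvar Ind_z) (pvar Ind_w * pvar Ind_x)
      \<otimes>\<^bsub>Kc\<^esub> q (pvar Ind_v * pvar Ind_x) (pvar Ind_u * pvar Ind_y) = \<one>\<^bsub>Kc\<^esub>" (is ?prod)
    "adic_ln Kc Uc \<one>\<^bsub>Kc\<^esub> = \<zero>\<^bsub>K'\<^esub>" (is ?ln)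
proof -
  interpret filtered_ring Kc "Uc :: nat \<Rightarrow> ((nat \<Rightarrow> 'k poly6 set) \<times> (nat \<Rightarrow> 'k poly6 set)) set set"
    by (rule Kc_filtered)
  interpret laur_hom Kc UNIV "laur_frac :: 'k laur \<Rightarrow> _"
    by (rule laur_frac_hom)
  have inv_FT: "(mn (- (ex (V i) + ex (V j))) :: 'k laur) \<in> FT UNIV 0" for i j
    by (intro mn_neg_FT) simp_all
  define a1 :: "'k laur" where "a1 = D1 * mn (- (ex (V Ind_v) + ex (V Ind_z)))"
  define a2 :: "'k laur" where "a2 = D2 * mn (- (ex (V Ind_w) + ex (V Ind_x)))"
  define a3 :: "'k laur" where "a3 = D3 * mn (- (ex (V Ind_u) + ex (V Ind_y)))"
  have IP: "a1 \<in> IP UNIV 1" "a2 \<in> IP UNIV 1" "a3 \<in> IP UNIV 1"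
    unfolding a1_def a2_def a3_def by (intro IP_mult_FT2 D_IP inv_FT)+
  have FT: "a1 \<in> FT UNIV 0" "a2 \<in> FT UNIV 0" "a3 \<in> FT UNIV 0"
    using IP by (simp_all add: IP_subset)
  have ts: "taylor_series Kc Uc (laur_frac a) = seq_lim Kc Uc (\<lambda>n. laur_frac (tlog n a))" if "a \<in> FT UNIV 0" for a :: "'k laur"
    by (simp add: taylor_series_def taylor_trunc_hom that)
  have x: "x1 = seq_lim Kc Uc (\<lambda>n. laur_frac (tlog n a1))" "x2 = seq_lim Kc Uc (\<lambda>n. laur_frac (tlog n a2))"
    "x3 = seq_lim Kc Uc (\<lambda>n. laur_frac (tlog n a3))"
    by (simp_all only: x1_def x2_def x3_def completion_frac_pvar emb_minors ts FT flip: a1_def a2_def a3_def)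
  have cauchy: "cauchy_seq Kc Uc (\<lambda>n. laur_frac (tlog n a))" if "a \<in> IP UNIV 1" for a :: "'k laur"
    by (rule cauchy_laur_frac) (simp_all add: tlog_FT[OF IP_subset[OF that]] tlog_diff_IP[OF that])
  then have cr: "seq_lim Kc Uc (\<lambda>n. laur_frac (tlog n a)) \<in> carrier K'" if "a \<in> IP UNIV 1" for a :: "'k laur"
    using that by (auto simp: K'_def seq_completion_def)
  show "x1 \<in> carrier K'" "x2 \<in> carrier K'" "x3 \<in> carrier K'"
    unfolding x by (intro cr IP)+
  define s where "s n = tlog n a1 + tlog n a2 + tlog n a3" for n
  have s: "laur_frac (tlog n a1) \<oplus>\<^bsub>Kc\<^esub> laur_frac (tlog n a2) \<oplus>\<^bsub>Kc\<^esub> laur_frac (tlog n a3) = laur_frac (s n)" for n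
    by (simp add: s_def hom_add tlog_FT FT FT_add)
  \<comment> \<open>Over \<open>UNIV\<close> the inverses in \<open>qinv\<close> are exact, so the
    partial sums are the truncated logarithms of \<open>tay_sum\<close> for three quotients with
    product 1.\<close>
  have s_IP: "s n \<in> IP UNIV (int n)" if "1 \<le> n" for n
  proof -
    have "tay n UNIV i j k l = tlog n ((quad i j - quad k l) * mn (- (ex (V i) + ex (V j))) :: 'k laur)"
      for i j k l
      by (simp add: tay_def qinv_def)
    then have "s n = tay n UNIV Ind_v Ind_z Ind_w Ind_y + tay n UNIV Ind_w Ind_x Ind_u Ind_z
        + tay n UNIV Ind_u Ind_y Ind_v Ind_x"
      by (simp only: s_def a1_def a2_def a3_def D1_def D2_def D3_def quad_def)
    moreover have "eqm n UNIV \<dots> 0"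
      using D_IP[of UNIV, where 'k = 'k] that
      by (intro tay_sum) (simp_all add: quad_def D1_def D2_def D3_def gd_def mult_ac)
    ultimately show ?thesis
      by (simp add: eqm_def)
  qed
  have "x1 \<oplus>\<^bsub>K'\<^esub> x2 \<oplus>\<^bsub>K'\<^esub> x3 = seq_lim Kc Uc (\<lambda>n. laur_frac (s n))"
    unfolding x K'_def by (simp only: seq_completion_add cauchy_seq_add cauchy IP s)
  also have "\<dots> = seq_lim Kc Uc (\<lambda>n. laur_frac (0 :: 'k laur))"
  proof (rule seq_lim_eqI)
    show "cauchy_seq Kc Uc (\<lambda>n. laur_frac (s n))"
      unfolding s[symmetric] by (intro cauchy_seq_add cauchy IP)
    show "cauchy_seq Kc Uc (\<lambda>n. laur_frac (0 :: 'k laur))"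
      by (rule cauchy_laur_frac) simp_all
    have "laur_frac (s n) \<in> Uc k" if "n \<ge> Suc k" for n k
      using that by (intro laur_frac_Uc IP_antimono[OF s_IP]) simp_all
    moreover have "s n \<in> FT UNIV 0" for n
      by (simp add: s_def tlog_FT FT FT_add)
    ultimately show "null_seq Uc (\<lambda>n. laur_frac (s n) \<ominus>\<^bsub>Kc\<^esub> laur_frac 0)"
      unfolding null_seq_def by (simp add: hom_minus) blast
  qed
  finally show "x1 \<oplus>\<^bsub>K'\<^esub> x2 \<oplus>\<^bsub>K'\<^esub> x3 = \<zero>\<^bsub>K'\<^esub>"
    by (simp add: K'_def seq_completion_def hom_zero)
  have F: "(mv i * mv j * mn (- (ex (V k) + ex (V l))) :: 'k laur) \<in> FT UNIV 0" for i j k l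
    by (intro FT_mult0 mv_FT inv_FT)
  have "mv Ind_w * mv Ind_y * mn (- (ex (V Ind_v) + ex (V Ind_z)))
    * (mv Ind_u * mv Ind_z * mn (- (ex (V Ind_w) + ex (V Ind_x))))
    * (mv Ind_v * mv Ind_x * mn (- (ex (V Ind_u) + ex (V Ind_y)))) = (1 :: 'k laur)"
    by (simp flip: mn_add)
  then show ?prod
    unfolding q_def completion_frac_pvar emb_mult emb_pvar
    by (simp only: hom_mult hom_one F FT_mult0)
  have "ln_trunc Kc t (laur_frac (1 :: 'k laur)) = \<zero>\<^bsub>Kc\<^esub>" for t
    by (simp add: ln_trunc_hom hom_zero)
  then show ?ln
    by (simp add: adic_ln_def K'_def seq_completion_def hom_one)
qed

theorem theorem4p1:
  fixes u v w x y z \<Delta>\<^sub>1 \<Delta>\<^sub>2 \<Delta>\<^sub>3 :: "'k::field_char_0 poly6"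
    and I :: "'k poly6 set"
  assumes "u = pvar Ind_u" and "v = pvar Ind_v" and "w = pvar Ind_w"
    and "x = pvar Ind_x" and "y = pvar Ind_y" and "z = pvar Ind_z"
    and "\<Delta>\<^sub>1 = v * z - w * y" and "\<Delta>\<^sub>2 = w * x - u * z" and "\<Delta>\<^sub>3 = u * y - v * x"
    and "I = Idl\<^bsub>poly6_ring\<^esub> {\<Delta>\<^sub>1, \<Delta>\<^sub>2, \<Delta>\<^sub>3}"
  shows
    "(let K = fraction_field (adic_completion poly6_ring I);
         U = adic_nhd poly6_ring I;
         K' = seq_completion K U;
         q = completion_frac poly6_ring I
     in q (w * y) (v * z) \<otimes>\<^bsub>K\<^esub> q (u * z) (w * x) \<otimes>\<^bsub>K\<^esub> q (v * x) (u * y) = \<one>\<^bsub>K\<^esub> \<and>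
        adic_ln K U (q (w * y) (v * z) \<otimes>\<^bsub>K\<^esub> q (u * z) (w * x) \<otimes>\<^bsub>K\<^esub> q (v * x) (u * y))
          = adic_ln K U \<one>\<^bsub>K\<^esub> \<and>
        adic_ln K U \<one>\<^bsub>K\<^esub> = \<zero>\<^bsub>K'\<^esub> \<and>
        taylor_series K U (q \<Delta>\<^sub>1 (v * z)) \<in> carrier K' \<and>
        taylor_series K U (q \<Delta>\<^sub>2 (w * x)) \<in> carrier K' \<and>
        taylor_series K U (q \<Delta>\<^sub>3 (u * y)) \<in> carrier K' \<and>
        taylor_series K U (q \<Delta>\<^sub>1 (v * z)) \<oplus>\<^bsub>K'\<^esub> taylor_series K U (q \<Delta>\<^sub>2 (w * x))
          \<oplus>\<^bsub>K'\<^esub> taylor_series K U (q \<Delta>\<^sub>3 (u * y)) = \<zero>\<^bsub>K'\<^esub>) \<and>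
     (\<forall>t\<ge>2.
       let J = ideal_power poly6_ring I t;
           H = local_cohomology J 3 0;
           h = cech_class J 3 (eta J t)
       in eta J t = taylor_cochain J t \<and>
          eta J t \<in> cech_cocycles J 3 \<inter> cech_degree J 3 0 \<and>
          h \<noteq> \<zero>\<^bsub>H\<^esub> \<and>
          carrier H = {c \<odot>\<^bsub>H\<^esub> h | c :: 'k. True})"
proof -
  have I: "I = mI"
    using assms by (simp add: mI_def)
  show ?thesis
    unfolding I Let_def assms(1-9) mJ_def[symmetric]
    by (intro conjI allI impI;
        (rule series_identity local_cohomology_generator, assumption?)?; simp only: series_identity)
qed

end
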